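(* Let $\nu\in[0,1)$, let $A_{\nu,\infty}$ be the minimal operator generated by $\tau_\nu=-\frac{d^2}{dx^2}+\frac{\nu^2-1/4}{x^2}$ in $L^2(\mathbb R_+)$, and let $(A_{\nu,\infty})_F$ be its Friedrichs extension. Let $\xi\in C_0^1(\mathbb R_+)$ satisfy $\xi(x)=1$ for $x\in(0,1/2)$ and $\xi(x)=0$ for $x\ge3/4$. Then: (i) For $\nu\in(0,1)$ the quadratic form $\mathfrak a_{\nu,\infty}$ associated with $(A_{\nu,\infty})_F$ is $$\mathfrak a_{\nu,\infty}[u]=\int_0^\infty|u'(x)|^2dx+\left(\nu^2-\tfrac14\right)\int_0^\infty\frac{|u(x)|^2}{x^2}dx,\qquad \operatorname{dom}(\mathfrak a_{\nu,\infty})=H_0^1(\mathbb R_+).$$ (ii) For $\nu=0$ the quadratic form $\mathfrak a_{0,\infty}$ associated with $(A_{0,\infty})_F$ is $$\mathfrak a_{0,\infty}[u]=\int_0^\infty\left|u'(x)-\frac{u(x)}{2x}\right|^2dx,$$ $$\operatorname{dom}(\mathfrak a_{0,\infty})\supset H_0^1(\mathbb R_+)\dotplus\operatorname{span}\left\{x^{1/2}|\log(x)|^{-\alpha}\xi(x): 0<\alpha\le\tfrac12\right\},$$ and $\dim\left(\operatorname{dom}(\mathfrak a_{0,\infty})/H_0^1(\mathbb R_+)\right)=\infty$. (iii) For $\nu\in[0,1)$ the Friedrichs extension $(A_{\nu,\infty})_F$ is given by $$(A_{\nu,\infty})_F=A_{\nu,\infty}^*\upharpoonright\operatorname{dom}((A_{\nu,\infty})_F),\qquad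 \operatorname{dom}((A_{\nu,\infty})_F)=H_0^2(\mathbb R_+)\dotplus\operatorname{span}\{x^{1/2+\nu}\xi(x)\}.$$ (iv) For $\nu\in(0,1)$, the quadratic form $(\mathfrak a_{\nu,\infty})_h$ associated with the self-adjoint extension $(A_{\nu,\infty})_h$ of $A_{\nu,\infty}$, $h\in\mathbb R\cup\{\infty\}$, satisfies $$\operatorname{dom}((\mathfrak a_{\nu,\infty})_h)=H_0^1(\mathbb R_+)\dotplus\operatorname{span}\{x^{1/2-\nu}\xi(x)\}.$$
   Context: $\mathbb R_+$ denotes the half-line with endpoints $0$ and $\infty$. $C_0^1(\mathbb R_+)$ denotes the continuously differentiable functions on the half-line (up to and including the endpoint $0$, where they need not vanish) with compact support in $[0,\infty)$. The maximal operator generated by $\tau_\nu$ in $L^2(\mathbb R_+)$ acts as $\tau_\nu$ on all $f\in L^2(\mathbb R_+)$ with $f,f'$ locally absolutely continuous on $(0,\infty)$ and $\tau_\nu f\in L^2(\mathbb R_+)$; the minimal operator $A_{\nu,\infty}$ is the closure of its restriction to functions with compact support in $(0,\infty)$, and $A_{\nu,\infty}^*$ is the maximal operator. $H_0^2(\mathbb R_+)=\{f\in H^2(\mathbb R_+): f(0)=f'(0)=0\}$ and $H_0^1(\mathbb R_+)=\{f\in H^1(\mathbb R_+): f(0)=0\}$. The quadratic form associated with a lower semibounded self-adjoint operator is its closed form; for the Friedrichs extension of $A$ it is the closure of $u\mapsto(Au,u)$, $u\in\operatorname{dom}(A)$. The symbol $\dotplus$ denotes a direct sum of linear spaces. With $[f,g]_x=f(x)\overline{g'(x)}-f'(x)\overline{g(x)}$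 and $[f,g]_0=\lim_{x\to0^+}[f,g]_x$, for $\nu\in(0,1)$ all self-adjoint extensions of $A_{\nu,\infty}$ are the operators $(A_{\nu,\infty})_h$, $h\in\mathbb R\cup\{\infty\}$, where $(A_{\nu,\infty})_h$ is the restriction of $A_{\nu,\infty}^*$ to $\{f\in\operatorname{dom}(A_{\nu,\infty}^* ): [f,x^{1/2-\nu}+2\nu h\,x^{1/2+\nu}]_0=0\}$ (for $h=\infty$ the condition is read as $[f,x^{1/2+\nu}]_0=0$).
   Formalization: In (iii) the domain formula is proved for ξ also in H², since otherwise x^{1/2+ν}ξ is not in dom(A* ); in (iv) the formula is proved for real h, while for h=∞ (the Friedrichs extension) the form domain is shown to be H_0^1, as the printed formula contradicts (i). *)

theory Defs
  imports "HOL-Analysis.Analysis" "HOL-Library.Extended_Nat"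
begin

section \<open>The complex Hilbert space of square integrable functions on the half-line\<close>

abbreviation half_line :: "real measure"
  where "half_line \<equiv> lebesgue_on {0<..}"

definition sq_integrable :: "(real \<Rightarrow> complex) \<Rightarrow> bool"
  where "sq_integrable f \<longleftrightarrow>
    f \<in> borel_measurable half_line \<and> integrable half_line (\<lambda>x. (cmod (f x))\<^sup>2)"

definition l2_rel :: "(real \<Rightarrow> complex) \<Rightarrow> (real \<Rightarrow> complex) \<Rightarrow> bool"
  where "l2_rel f g \<longleftrightarrow> sq_integrable f \<and> sq_integrable g \<and> (AE x in half_line. f x = g x)"

lemma l2_rel_eqI: "sq_integrable f \<Longrightarrow> f = g \<Longrightarrow> l2_rel f g"
  by (simp add: l2_rel_def)

lemma l2_rel_reflD: "l2_rel f f \<Longrightarrow> sq_integrable f"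
  by (simp add: l2_rel_def)

lemma sq_integrable_zero: "sq_integrable (\<lambda>x. 0)"
  by (simp add: sq_integrable_def)

lemma sq_integrable_add:
  assumes "sq_integrable f" "sq_integrable g"
  shows "sq_integrable (\<lambda>x. f x + g x)"
proof -
  have [measurable]: "f \<in> borel_measurable half_line" "g \<in> borel_measurable half_line"
    using assms by (auto simp: sq_integrable_def)
  have le: "(cmod (a + b))\<^sup>2 \<le> 2 * (cmod a)\<^sup>2 + 2 * (cmod b)\<^sup>2" for a b
  proof -
    have "(cmod (a + b))\<^sup>2 \<le> (cmod a + cmod b)\<^sup>2"
      by (simp add: norm_triangle_ineq power_mono)
    also have "\<dots> \<le> 2 * (cmod a)\<^sup>2 + 2 * (cmod b)\<^sup>2"
      using sum_squares_bound[of "cmod a" "cmod b"] by (simp add: power2_sum)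
    finally show ?thesis .
  qed
  have "integrable half_line (\<lambda>x. (cmod (f x + g x))\<^sup>2)"
  proof (rule Bochner_Integration.integrable_bound)
    show "integrable half_line (\<lambda>x. 2 * (cmod (f x))\<^sup>2 + 2 * (cmod (g x))\<^sup>2)"
      using assms by (auto simp: sq_integrable_def)
    show "(\<lambda>x. (cmod (f x + g x))\<^sup>2) \<in> borel_measurable half_line"
      by measurable
    show "AE x in half_line. norm ((cmod (f x + g x))\<^sup>2)
        \<le> norm (2 * (cmod (f x))\<^sup>2 + 2 * (cmod (g x))\<^sup>2)"
      using le by auto
  qed
  then show ?thesis by (simp add: sq_integrable_def)
qed

lemma sq_integrable_scale:
  assumes "sq_integrable f"
  shows "sq_integrable (\<lambda>x. c * f x)"
  using assms by (auto simp: sq_integrable_def norm_mult power_mult_distrib)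

lemma sq_integrable_uminus:
  assumes "sq_integrable f"
  shows "sq_integrable (\<lambda>x. - f x)"
  using assms by (simp add: sq_integrable_def)

lemma sq_integrable_mult_cnj:
  assumes "sq_integrable f" "sq_integrable g"
  shows "integrable half_line (\<lambda>x. f x * cnj (g x))"
proof (rule Bochner_Integration.integrable_bound)
  have [measurable]: "f \<in> borel_measurable half_line" "g \<in> borel_measurable half_line"
    using assms by (auto simp: sq_integrable_def)
  show "integrable half_line (\<lambda>x. (cmod (f x))\<^sup>2 + (cmod (g x))\<^sup>2)"
    using assms by (auto simp: sq_integrable_def)
  have [measurable]: "cnj \<in> borel_measurable borel"
    by (intro borel_measurable_continuous_onI continuous_intros)
  show "(\<lambda>x. f x * cnj (g x)) \<in> borel_measurable half_line"
    by measurable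
  have "norm (a * cnj b) \<le> norm ((cmod a)\<^sup>2 + (cmod b)\<^sup>2)" for a b
  proof -
    have "0 \<le> cmod a * cmod b" by simp
    then show ?thesis
      using sum_squares_bound[of "cmod a" "cmod b"] unfolding norm_mult complex_mod_cnj real_norm_def by linarith
  qed
  then show "AE x in half_line. norm (f x * cnj (g x)) \<le> norm ((cmod (f x))\<^sup>2 + (cmod (g x))\<^sup>2)"
    by auto
qed

quotient_type l2 = "real \<Rightarrow> complex" / partial: l2_rel
  morphisms rep_l2 L2
proof (rule part_equivpI)
  show "\<exists>f. l2_rel f f"
    using sq_integrable_zero by (auto simp: l2_rel_def)
  show "symp l2_rel"
    by (auto intro!: sympI simp: l2_rel_def)
  show "transp l2_rel"
  proof (rule transpI)
    fix f g h assume fg: "l2_rel f g" and gh: "l2_rel g h"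
    then have "AE x in half_line. f x = g x" "AE x in half_line. g x = h x"
      by (auto simp: l2_rel_def)
    then have "AE x in half_line. f x = h x"
      by eventually_elim simp
    with fg gh show "l2_rel f h" by (auto simp: l2_rel_def)
  qed
qed

lift_definition l2_scale :: "complex \<Rightarrow> l2 \<Rightarrow> l2"  (infixr \<open>*\<^sub>C\<close> 75)
  is "\<lambda>c f x. c * f x"
  by (auto simp: l2_rel_def sq_integrable_scale)

lift_definition l2_inner :: "l2 \<Rightarrow> l2 \<Rightarrow> complex"
  is "\<lambda>f g. LINT x|half_line. f x * cnj (g x)"
proof -
  fix f1 f2 g1 g2 assume f: "l2_rel f1 f2" and g: "l2_rel g1 g2"
  have "AE x in half_line. f1 x = f2 x" "AE x in half_line. g1 x = g2 x"
    using f g by (auto simp: l2_rel_def)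
  then have "AE x in half_line. f1 x * cnj (g1 x) = f2 x * cnj (g2 x)"
    by eventually_elim simp
  then show "(LINT x|half_line. f1 x * cnj (g1 x)) = (LINT x|half_line. f2 x * cnj (g2 x))"
    using f g by (intro integral_cong_AE)
      (auto simp: l2_rel_def intro!: borel_measurable_integrable sq_integrable_mult_cnj)
qed

instantiation l2 :: real_vector
begin

definition zero_l2 :: l2 where "zero_l2 = L2 (\<lambda>x. 0)"

lemma zero_l2_transfer [transfer_rule]: "pcr_l2 (\<lambda>x. 0) 0"
  by (simp add: l2.pcr_cr_eq cr_l2_def zero_l2_def l2_rel_def sq_integrable_zero)

lift_definition plus_l2 :: "l2 \<Rightarrow> l2 \<Rightarrow> l2" is "\<lambda>f g x. f x + g x"
proof -
  fix f1 f2 g1 g2 assume fg: "l2_rel f1 f2" "l2_rel g1 g2"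
  then have "AE x in half_line. f1 x = f2 x" "AE x in half_line. g1 x = g2 x"
    by (auto simp: l2_rel_def)
  then have "AE x in half_line. f1 x + g1 x = f2 x + g2 x"
    by eventually_elim simp
  with fg show "l2_rel (\<lambda>x. f1 x + g1 x) (\<lambda>x. f2 x + g2 x)"
    by (simp add: l2_rel_def sq_integrable_add)
qed

lift_definition uminus_l2 :: "l2 \<Rightarrow> l2" is "\<lambda>f x. - f x"
  by (auto simp: l2_rel_def sq_integrable_uminus)

definition minus_l2 :: "l2 \<Rightarrow> l2 \<Rightarrow> l2" where "u - v = u + (- v)" for u v :: l2

definition scaleR_l2 :: "real \<Rightarrow> l2 \<Rightarrow> l2" where "r *\<^sub>R u = complex_of_real r *\<^sub>C u" for u :: l2

instance
proof
  fix a b c :: l2 and r s :: real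
  show "a + b + c = a + (b + c)" "a + b = b + a" "0 + a = a" "- a + a = 0"
    by (transfer, rule l2_rel_eqI;
        ((intro sq_integrable_add sq_integrable_uminus sq_integrable_zero l2_rel_reflD; assumption)
          | simp add: fun_eq_iff))+
  show "a - b = a + - b" by (simp add: minus_l2_def)
  show "r *\<^sub>R (a + b) = r *\<^sub>R a + r *\<^sub>R b" "(r + s) *\<^sub>R a = r *\<^sub>R a + s *\<^sub>R a"
    "r *\<^sub>R s *\<^sub>R a = (r * s) *\<^sub>R a" "1 *\<^sub>R a = a"
    unfolding scaleR_l2_def
    by (transfer, rule l2_rel_eqI;
        ((intro sq_integrable_add sq_integrable_scale l2_rel_reflD; assumption)
          | simp add: fun_eq_iff algebra_simps))+
qed

end

global_interpretation l2: vector_space "(*\<^sub>C) :: complex \<Rightarrow> l2 \<Rightarrow> l2"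
  by unfold_locales
    (transfer, rule l2_rel_eqI;
        ((intro sq_integrable_add sq_integrable_scale l2_rel_reflD; assumption)
          | simp add: fun_eq_iff algebra_simps))+

lemma l2_inner_add_left: "l2_inner (u + v) w = l2_inner u w + l2_inner v w"
proof transfer
  fix u v w assume "l2_rel u u" "l2_rel v v" "l2_rel w w"
  then have "integrable half_line (\<lambda>x. u x * cnj (w x))" "integrable half_line (\<lambda>x. v x * cnj (w x))"
    by (simp_all add: l2_rel_def sq_integrable_mult_cnj)
  from Bochner_Integration.integral_add[OF this]
  show "(LINT x|half_line. (u x + v x) * cnj (w x)) =
      (LINT x|half_line. u x * cnj (w x)) + (LINT x|half_line. v x * cnj (w x))"
    by (simp only: distrib_right)
qed

lemma l2_inner_scale_left: "l2_inner (c *\<^sub>C u) v = c * l2_inner u v"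
  by transfer (simp add: mult.assoc)

lemma l2_inner_commute: "l2_inner v u = cnj (l2_inner u v)"
proof transfer
  fix v u assume "l2_rel v v" "l2_rel u u"
  then have "integrable half_line (\<lambda>x. u x * cnj (v x))"
    by (simp add: l2_rel_def sq_integrable_mult_cnj)
  from integral_bounded_linear[OF bounded_linear_cnj this]
  show "(LINT x|half_line. v x * cnj (u x)) = cnj (LINT x|half_line. u x * cnj (v x))"
    by (simp add: mult.commute)
qed

lemma Re_l2_inner_L2_self:
  assumes "sq_integrable f"
  shows "Re (l2_inner (L2 f) (L2 f)) = (LINT x|half_line. (cmod (f x))\<^sup>2)"
proof -
  have "l2_inner (L2 f) (L2 f) = (LINT x|half_line. f x * cnj (f x))"
    using assms by (intro l2_inner.abs_eq) (auto simp: l2_rel_def eq_onp_def)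
  also have "\<dots> = (LINT x|half_line. complex_of_real ((cmod (f x))\<^sup>2))"
    by (simp add: complex_norm_square[symmetric])
  also have "\<dots> = complex_of_real (LINT x|half_line. (cmod (f x))\<^sup>2)"
    by (rule integral_complex_of_real)
  finally show ?thesis by (simp only: Re_complex_of_real)
qed

instantiation l2 :: real_inner
begin

definition inner_l2 :: "l2 \<Rightarrow> l2 \<Rightarrow> real" where "inner_l2 u v = Re (l2_inner u v)"
definition norm_l2 :: "l2 \<Rightarrow> real" where "norm_l2 u = sqrt (Re (l2_inner u u))"
definition sgn_l2 :: "l2 \<Rightarrow> l2" where "sgn_l2 u = u /\<^sub>R norm u"
definition dist_l2 :: "l2 \<Rightarrow> l2 \<Rightarrow> real" where "dist_l2 u v = norm (u - v)"
definition uniformity_l2 :: "(l2 \<times> l2) filter"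
  where "uniformity_l2 = (INF e\<in>{0<..}. principal {(u, v). dist u v < e})"
definition open_l2 :: "l2 set \<Rightarrow> bool"
  where "open_l2 U \<longleftrightarrow> (\<forall>u\<in>U. \<forall>\<^sub>F (u', v) in uniformity. u' = u \<longrightarrow> v \<in> U)"

instance
proof
  fix u v w :: l2 and r :: real
  show "dist u v = norm (u - v)" by (rule dist_l2_def)
  show "sgn u = u /\<^sub>R norm u" by (rule sgn_l2_def)
  show "uniformity = (INF e\<in>{0<..}. principal {(u, v). dist u (v::l2) < e})"
    by (rule uniformity_l2_def)
  show "open U \<longleftrightarrow> (\<forall>u\<in>U. \<forall>\<^sub>F (u', v) in uniformity. u' = u \<longrightarrow> v \<in> U)" for U :: "l2 set"
    by (rule open_l2_def)
  show "inner u v = inner v u"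
    unfolding inner_l2_def by (subst l2_inner_commute) simp
  show "inner (u + v) w = inner u w + inner v w"
    by (simp add: inner_l2_def l2_inner_add_left)
  show "inner (r *\<^sub>R u) v = r * inner u v"
    by (simp add: inner_l2_def scaleR_l2_def l2_inner_scale_left)
  show "norm u = sqrt (inner u u)" by (simp add: norm_l2_def inner_l2_def)
  obtain f where f: "sq_integrable f" "u = L2 f"
    by (induct u rule: l2.abs_induct) (auto simp: l2_rel_def)
  show "0 \<le> inner u u"
    using f by (simp add: inner_l2_def Re_l2_inner_L2_self)
  show "inner u u = 0 \<longleftrightarrow> u = 0"
  proof
    assume "inner u u = 0"
    then have "(LINT x|half_line. (cmod (f x))\<^sup>2) = 0"
      using f by (simp add: inner_l2_def Re_l2_inner_L2_self)
    then have "AE x in half_line. (cmod (f x))\<^sup>2 = 0"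
      using f by (subst (asm) integral_nonneg_eq_0_iff_AE) (auto simp: sq_integrable_def)
    then have "l2_rel f (\<lambda>x. 0)"
      using f by (auto simp: l2_rel_def sq_integrable_zero)
    then show "u = 0"
      using f by (simp add: zero_l2_def Quotient_rel_abs[OF Quotient_l2])
  next
    assume "u = 0"
    then have "l2_inner u u = 0"
      using l2_inner_scale_left[of 0 u u] by simp
    then show "inner u u = 0" by (simp add: inner_l2_def)
  qed
qed

end


section \<open>Linear subspaces\<close>

definition sum_space :: "l2 set \<Rightarrow> l2 set \<Rightarrow> l2 set"
  where "sum_space U W = {u + w | u w. u \<in> U \<and> w \<in> W}"

definition is_direct_sum :: "l2 set \<Rightarrow> l2 set \<Rightarrow> l2 set \<Rightarrow> bool"
  where "is_direct_sum V U W \<longleftrightarrow> U \<inter> W = {0} \<and> V = sum_space U W"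

text \<open>
  The dimension of the quotient space \<open>V / W\<close>: the largest number of vectors of \<open>V\<close> whose
  cosets modulo \<open>W\<close> are linearly independent.
\<close>

definition independent_mod :: "l2 set \<Rightarrow> l2 set \<Rightarrow> bool"
  where "independent_mod W B \<longleftrightarrow> (\<forall>c. (\<Sum>b\<in>B. c b *\<^sub>C b) \<in> W \<longrightarrow> (\<forall>b\<in>B. c b = 0))"

definition quotient_dim :: "l2 set \<Rightarrow> l2 set \<Rightarrow> enat"
  where "quotient_dim V W = (SUP B\<in>{B. finite B \<and> B \<subseteq> V \<and> independent_mod W B}. enat (card B))"


section \<open>Linear operators, given by their graphs, and quadratic forms\<close>

type_synonym l2_op = "(l2 \<times> l2) set"

definition op_apply :: "l2_op \<Rightarrow> l2 \<Rightarrow> l2"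
  where "op_apply T u = (THE w. (u, w) \<in> T)"

definition op_restrict :: "l2_op \<Rightarrow> l2 set \<Rightarrow> l2_op"
  where "op_restrict T V = {(u, w) \<in> T. u \<in> V}"

definition op_adjoint :: "l2_op \<Rightarrow> l2_op"
  where "op_adjoint T = {(v, w). \<forall>(x, y)\<in>T. l2_inner y v = l2_inner x w}"

text \<open>
  The closure of the form \<open>u \<mapsto> (T u, u)\<close> on \<open>dom T\<close>, for a densely defined, symmetric, lower
  semibounded operator \<open>T\<close>: its domain consists of the limits of sequences in \<open>dom T\<close> that are
  Cauchy with respect to the form, and its values are the limits of the values along such
  sequences. For self-adjoint \<open>T\<close> this is the closed form associated with \<open>T\<close>. The form is given
  as a sesquilinear form, linear in the first argument; its quadratic form is \<open>op_form T u u\<close>.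
\<close>

definition form_convergent :: "l2_op \<Rightarrow> (nat \<Rightarrow> l2) \<Rightarrow> l2 \<Rightarrow> bool"
  where "form_convergent T X u \<longleftrightarrow>
    (\<forall>n. X n \<in> Domain T) \<and> X \<longlonglongrightarrow> u \<and>
    (\<forall>e>0. \<exists>N. \<forall>m\<ge>N. \<forall>n\<ge>N. cmod (l2_inner (op_apply T (X m - X n)) (X m - X n)) < e)"

definition form_dom :: "l2_op \<Rightarrow> l2 set"
  where "form_dom T = {u. \<exists>X. form_convergent T X u}"

definition op_form :: "l2_op \<Rightarrow> l2 \<Rightarrow> l2 \<Rightarrow> complex"
  where "op_form T u v = (THE c. \<forall>X Y. form_convergent T X u \<longrightarrow> form_convergent T Y v \<longrightarrow>
    (\<lambda>n. l2_inner (op_apply T (X n)) (Y n)) \<longlonglongrightarrow> c)"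

text \<open>
  The operator that the first representation theorem assigns to the closure of \<open>u \<mapsto> (T u, u)\<close>.
\<close>

definition friedrichs :: "l2_op \<Rightarrow> l2_op"
  where "friedrichs T =
    {(u, w). u \<in> form_dom T \<and> (\<forall>v\<in>form_dom T. op_form T u v = l2_inner w v)}"


section \<open>Locally absolutely continuous functions\<close>

definition abs_continuous_on :: "real \<Rightarrow> real \<Rightarrow> (real \<Rightarrow> complex) \<Rightarrow> bool"
  where "abs_continuous_on a b f \<longleftrightarrow>
    (\<forall>e>0. \<exists>d>0. \<forall>\<D> T. \<D> division_of T \<and> T \<subseteq> {a..b} \<and> (\<Sum>K\<in>\<D>. Sup K - Inf K) < d \<longrightarrow>
      (\<Sum>K\<in>\<D>. cmod (f (Sup K) - f (Inf K))) < e)"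

definition loc_abs_continuous_on :: "real set \<Rightarrow> (real \<Rightarrow> complex) \<Rightarrow> bool"
  where "loc_abs_continuous_on S f \<longleftrightarrow>
    (\<forall>a b. a \<le> b \<longrightarrow> {a..b} \<subseteq> S \<longrightarrow> abs_continuous_on a b f)"

definition deriv_on :: "real set \<Rightarrow> (real \<Rightarrow> complex) \<Rightarrow> real \<Rightarrow> complex"
  where "deriv_on S f x = vector_derivative f (at x within S)"

definition compact_support_in :: "real set \<Rightarrow> (real \<Rightarrow> complex) \<Rightarrow> bool"
  where "compact_support_in S f \<longleftrightarrow> (\<exists>K. compact K \<and> K \<subseteq> S \<and> (\<forall>x\<in>S - K. f x = 0))"

definition C1_0 :: "(real \<Rightarrow> complex) set"
  where "C1_0 = {f. f differentiable_on {0..} \<and> continuous_on {0..} (deriv_on {0..} f) \<and>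
    compact_support_in {0..} f}"


section \<open>Sobolev spaces on the half-line\<close>

text \<open>
  The functions below are the representatives that are absolutely continuous up to \<open>0\<close>, for which
  the boundary values at \<open>0\<close> make sense.
\<close>

definition H1_fun :: "(real \<Rightarrow> complex) set"
  where "H1_fun = {f. sq_integrable f \<and> loc_abs_continuous_on {0..} f \<and>
    sq_integrable (deriv_on {0..} f)}"

definition H2_fun :: "(real \<Rightarrow> complex) set"
  where "H2_fun = {f \<in> H1_fun. f differentiable_on {0..} \<and> deriv_on {0..} f \<in> H1_fun}"

definition H10_fun :: "(real \<Rightarrow> complex) set"
  where "H10_fun = {f \<in> H1_fun. f 0 = 0}"

definition H20_fun :: "(real \<Rightarrow> complex) set"
  where "H20_fun = {f \<in> H2_fun. f 0 = 0 \<and> deriv_on {0..} f 0 = 0}"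

definition H10 :: "l2 set" where "H10 = L2 ` H10_fun"

definition H20 :: "l2 set" where "H20 = L2 ` H20_fun"


section \<open>The Bessel operators\<close>

definition bessel_expr :: "real \<Rightarrow> (real \<Rightarrow> complex) \<Rightarrow> real \<Rightarrow> complex"
  where "bessel_expr \<nu> f x =
    - deriv_on {0<..} (deriv_on {0<..} f) x + complex_of_real ((\<nu>\<^sup>2 - 1/4) / x\<^sup>2) * f x"

definition bessel_max_fun :: "real \<Rightarrow> (real \<Rightarrow> complex) set"
  where "bessel_max_fun \<nu> = {f. sq_integrable f \<and>
    f differentiable_on {0<..} \<and> loc_abs_continuous_on {0<..} f \<and>
    loc_abs_continuous_on {0<..} (deriv_on {0<..} f) \<and> sq_integrable (bessel_expr \<nu> f)}"

definition bessel_min :: "real \<Rightarrow> l2_op"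
  where "bessel_min \<nu> = closure
    {(L2 f, L2 (bessel_expr \<nu> f)) | f. f \<in> bessel_max_fun \<nu> \<and> compact_support_in {0<..} f}"

definition lagrange_bracket :: "(real \<Rightarrow> complex) \<Rightarrow> (real \<Rightarrow> complex) \<Rightarrow> real \<Rightarrow> complex"
  where "lagrange_bracket f g x =
    f x * cnj (deriv_on {0<..} g x) - deriv_on {0<..} f x * cnj (g x)"

text \<open>The parameter \<open>h\<close> ranges over the real line (\<open>Some\<close>) and the point at infinity (\<open>None\<close>).\<close>

definition boundary_fun :: "real \<Rightarrow> real option \<Rightarrow> real \<Rightarrow> complex"
  where "boundary_fun \<nu> h x = (case h of
      Some r \<Rightarrow> complex_of_real (x powr (1/2 - \<nu>) + 2 * \<nu> * r * x powr (1/2 + \<nu>))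
    | None \<Rightarrow> complex_of_real (x powr (1/2 + \<nu>)))"

text \<open>
  Boundary values are computed from the continuously differentiable representative of an
  element of the domain of the adjoint.
\<close>

definition bessel_ext :: "real \<Rightarrow> real option \<Rightarrow> l2_op"
  where "bessel_ext \<nu> h = op_restrict (op_adjoint (bessel_min \<nu>))
    {L2 f | f. f \<in> bessel_max_fun \<nu> \<and>
      ((\<lambda>x. lagrange_bracket f (boundary_fun \<nu> h) x) \<longlongrightarrow> 0) (at_right 0)}"

end

theory Submission
  imports Defs
begin

text \<open>
  Put \<open>s = 1/2 + \<nu>\<close> and \<open>s' = 1/2 - \<nu>\<close>, the two roots of \<open>\<sigma>\<^sup>2 - \<sigma> = \<nu>\<^sup>2 - 1/4\<close>. For either root the
  differential expression factors into first order expressions,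
  \<open>\<tau> = (- d/dx - \<sigma>/x) (d/dx - \<sigma>/x)\<close>, and the second factor, called \<open>grad \<sigma>\<close> below, controls
  every form in the theorem.

  For the larger root \<open>s\<close> the graph of \<open>grad s\<close> is closed and has the compactly supported functions
  of the maximal domain as a core; on these Green's formula reads
  \<open>(\<tau> u, v) = (grad s u, grad s v)\<close>. Hence the closure of \<open>u \<mapsto> (\<tau> u, u)\<close> is \<open>\<parallel>grad s u\<parallel>\<^sup>2\<close> on the whole
  domain of \<open>grad s\<close> (\<open>factored_by_core\<close>), and the Friedrichs extension is \<open>\<tau>\<close> on those \<open>u\<close> in the
  maximal domain for which \<open>grad s u\<close> is square integrable (\<open>friedrichs_eq\<close>).

  (i) If \<open>s > 1/2\<close>, Hardy's inequality puts \<open>u/x\<close> into \<open>L\<^sup>2\<close> for all \<open>u\<close> in the domain of \<open>grad s\<close>, so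
  that this domain is \<open>H\<^sub>0\<^sup>1\<close>; integrating the cross term of \<open>\<bar>u' - s u/x\<bar>\<^sup>2\<close> gives the stated form
  (\<open>hardy_dom_energy\<close>). (ii) If \<open>s = 1/2\<close>, Hardy's inequality fails: the functions
  \<open>x powr (1/2) \<bar>ln x\<bar> powr (- \<alpha>)\<close> with cutoff lie in the form domain, but in a linear combination of them
  divided by \<open>x\<close> the term with the smallest exponent dominates, and it is not square integrable near \<open>0\<close>.
  (iii) For \<open>u\<close> in the domain of the Friedrichs extension, integrating the two first order equations
  from \<open>0\<close> gives \<open>grad s u = O(x powr (1/2))\<close> and then \<open>u = \<beta> x powr s + O(x powr (3/2))\<close>; the remainder
  is in \<open>H\<^sub>0\<^sup>2\<close> because \<open>u/x\<^sup>2\<close> is square integrable for it.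

  (iv) With the smaller root \<open>s' < 1/2\<close> every \<open>u\<close> in the maximal domain satisfies
  \<open>grad s' u \<in> L\<^sup>2\<close>, at the price of a boundary term in Green's formula. With \<open>a\<close> the limit of
  \<open>x powr (- s') u\<close> at \<open>0\<close>, the boundary condition with parameter \<open>h\<close> turns this term into
  \<open>4 \<nu>\<^sup>2 h \<bar>a\<bar>\<^sup>2\<close>, and \<open>\<bar>a\<bar>\<^sup>2 \<le> \<epsilon> \<parallel>grad s' u\<parallel>\<^sup>2 + C \<parallel>u\<parallel>\<^sup>2\<close> with arbitrarily small \<open>\<epsilon>\<close> (\<open>trace_le_energy\<close>). So
  the form domain is contained in the domain of \<open>grad s'\<close>, which is \<open>H\<^sub>0\<^sup>1\<close> plus a multiple of the cut off
  power \<open>x powr s'\<close>, since \<open>u\<close> belongs to \<open>H\<^sub>0\<^sup>1\<close> exactly when \<open>a = 0\<close>. Conversely the form domain contains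
  \<open>H\<^sub>0\<^sup>1\<close>, the form domain of the minimal operator, and one element with \<open>a = 1\<close>. For \<open>h = \<infinity>\<close> the
  boundary condition says \<open>grad s u \<in> L\<^sup>2\<close>, which gives the Friedrichs extension and the form domain \<open>H\<^sub>0\<^sup>1\<close>.

  Underneath lies the description of locally absolutely continuous functions as integrals of their
  derivatives (\<open>primitive\<close>), in which all computations with weak derivatives are done.
\<close>

abbreviation (input) cpx :: "real \<Rightarrow> complex"
  where "cpx \<equiv> complex_of_real"

abbreviation (input) pw :: "real \<Rightarrow> real \<Rightarrow> complex"
  where "pw p x \<equiv> cpx (x powr p)"

abbreviation (input) pot :: "real \<Rightarrow> real \<Rightarrow> complex"
  where "pot \<nu> x \<equiv> cpx ((\<nu>\<^sup>2 - 1/4) / x\<^sup>2)"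

abbreviation lim0 :: "(real \<Rightarrow> 'a::topological_space) \<Rightarrow> 'a \<Rightarrow> bool"
  where "lim0 f l \<equiv> (f \<longlongrightarrow> l) (at_right 0)"

abbreviation nonoverlapping :: "('i \<Rightarrow> real) \<Rightarrow> ('i \<Rightarrow> real) \<Rightarrow> 'i set \<Rightarrow> bool"
  where "nonoverlapping u v J \<equiv> pairwise (\<lambda>i j. {u i<..<v i} \<inter> {u j<..<v j} = {}) J"

section \<open>Differentiability almost everywhere of integrals\<close>

text \<open>
	Lebesgue's differentiation theorem. If the derivative fails at \<open>x\<close>, then on arbitrarily short
	intervals between \<open>x\<close> and some \<open>y\<close> the increment of \<open>F\<close> misses \<open>(y - x) f x\<close> by a fixed fraction of
	\<open>\<bar>y - x\<bar>\<close>. Vitali's lemma selects disjoint intervals of this kind whose fivefold enlargements cover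
	all such points, and Henstock's lemma makes the sum of the misses small.
\<close>

lemma negligible_not_has_vector_derivative_integral:
	fixes f :: "real \<Rightarrow> 'a::euclidean_space"
	assumes f: "f integrable_on {a..b}"
		and F: "\<And>x y. a \<le> x \<Longrightarrow> x \<le> y \<Longrightarrow> y \<le> b \<Longrightarrow> F y - F x = integral {x..y} f"
	shows "negligible {x \<in> {a<..<b}. \<not> (F has_vector_derivative f x) (at x)}"
proof -
	define r where "r = (\<lambda>x y. norm (F y - F x - (y - x) *\<^sub>R f x))"
	\<comment> \<open>The points at which the increments miss by the fraction \<open>1 / (k + 1)\<close> at arbitrarily small scale.\<close>
	define E where "E = (\<lambda>k::nat. {x \<in> {a<..<b}. \<forall>d>0. \<exists>y\<in>{a..b}. 0 < \<bar>y - x\<bar> \<and> \<bar>y - x\<bar> < d \<and>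
			\<bar>y - x\<bar> < real (Suc k) * r x y})"
	have sub: "{x \<in> {a<..<b}. \<not> (F has_vector_derivative f x) (at x)} \<subseteq> (\<Union>k. E k)"
	proof safe
		fix x assume x: "x \<in> {a<..<b}" and nd: "\<not> (F has_vector_derivative f x) (at x)"
		from nd obtain e where e: "e > 0"
			and ne: "\<And>d. d > 0 \<Longrightarrow> \<exists>y. norm (y - x) < d \<and> \<not> norm (F y - F x - (y - x) *\<^sub>R f x) \<le> e * norm (y - x)"
			unfolding has_vector_derivative_def has_derivative_at_alt
			by (auto simp: bounded_linear_scaleR_left)
		obtain k where k: "1 / e < real (Suc k)" using reals_Archimedean2[of "1/e"]
			by (metis less_Suc_eq of_nat_less_iff order_less_trans)
		have "x \<in> E k"
			unfolding E_def
		proof (intro CollectI conjI x allI impI)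
			fix d :: real assume d: "d > 0"
			define d' where "d' = min d (min (x - a) (b - x))"
			have "d' > 0" using d x by (auto simp: d'_def)
			from ne[OF this] obtain y where y: "norm (y - x) < d'"
				"\<not> norm (F y - F x - (y - x) *\<^sub>R f x) \<le> e * norm (y - x)" by blast
			have "y \<in> {a..b}" using y(1) by (auto simp: d'_def abs_if split: if_splits)
			moreover have "y \<noteq> x" using y(2) by auto
			moreover have "\<bar>y - x\<bar> < d" using y(1) by (auto simp: d'_def)
			moreover have "\<bar>y - x\<bar> < real (Suc k) * r x y"
			proof -
				have "e * \<bar>y - x\<bar> < r x y" using y(2) by (simp add: r_def)
				then have "\<bar>y - x\<bar> < (1/e) * r x y" using e by (simp add: field_simps)
				also have "\<dots> \<le> real (Suc k) * r x y"
					by (rule mult_right_mono) (use k in \<open>auto simp: r_def\<close>)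
				finally show ?thesis .
			qed
			ultimately show "\<exists>y\<in>{a..b}. 0 < \<bar>y - x\<bar> \<and> \<bar>y - x\<bar> < d \<and> \<bar>y - x\<bar> < real (Suc k) * r x y"
				by (intro bexI[of _ y]) auto
		qed
		then show "x \<in> (\<Union>k. E k)" by blast
	qed
	have "negligible (E k)" for k
		unfolding negligible_outer_le
	proof (intro allI impI)
		fix e :: real assume e: "e > 0"
		\<comment> \<open>The factor \<open>10\<close>: the fivefold enlargement of a ball of radius \<open>\<rho>\<close> has length \<open>10 \<rho>\<close>.\<close>
		define e' where "e' = e / (10 * real (Suc k))"
		have e': "e' > 0" using e by (simp add: e'_def)
		from f have "f integrable_on cbox a b" by simp
		from Henstock_lemma[OF this e'] obtain \<gamma> where g: "gauge \<gamma>"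
			and Hen: "\<And>p. p tagged_partial_division_of cbox a b \<Longrightarrow> \<gamma> fine p \<Longrightarrow>
				 (\<Sum>(x,K)\<in>p. norm (measure lborel K *\<^sub>R f x - integral K f)) < e'" by blast
		have "\<exists>y. y \<in> {a..b} \<and> 0 < \<bar>y - x\<bar> \<and> \<bar>y - x\<bar> < 1 \<and> cball x \<bar>y - x\<bar> \<subseteq> \<gamma> x \<and> \<bar>y - x\<bar> < real (Suc k) * r x y"
			if x: "x \<in> E k" for x
		proof -
			have "x \<in> \<gamma> x" "open (\<gamma> x)" using g by (auto simp: gauge_def)
			then obtain d where d: "d > 0" "cball x d \<subseteq> \<gamma> x" using open_contains_cball by blast
			have "min 1 d > 0" using d by auto
			with x obtain y where "y \<in> {a..b}" "0 < \<bar>y - x\<bar>" "\<bar>y - x\<bar> < min 1 d" "\<bar>y - x\<bar> < real (Suc k) * r x y"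
				unfolding E_def by blast
			moreover have "cball x \<bar>y - x\<bar> \<subseteq> cball x d" using \<open>\<bar>y - x\<bar> < min 1 d\<close> by (intro subset_cball) auto
			ultimately show ?thesis using d by (intro exI[of _ y]) auto
		qed
		then obtain y where y: "\<And>x. x \<in> E k \<Longrightarrow> y x \<in> {a..b} \<and> 0 < \<bar>y x - x\<bar> \<and> \<bar>y x - x\<bar> < 1
				\<and> cball x \<bar>y x - x\<bar> \<subseteq> \<gamma> x \<and> \<bar>y x - x\<bar> < real (Suc k) * r x (y x)" by metis
		define \<rho> where "\<rho> x = \<bar>y x - x\<bar>" for x
		have Esub: "E k \<subseteq> (\<Union>x\<in>E k. cball x (\<rho> x))" by (auto simp: \<rho>_def)
		obtain C where C: "countable C" "C \<subseteq> E k"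
			and pw: "pairwise (\<lambda>i j. disjnt (cball i (\<rho> i)) (cball j (\<rho> j))) C"
			and cov: "E k \<subseteq> (\<Union>i\<in>C. cball i (5 * \<rho> i))"
			by (rule Vitali_covering_lemma_cballs[OF Esub, where B=1])
				 (use y in \<open>force simp: \<rho>_def\<close>)+
		have sumr: "(\<Sum>x\<in>C'. \<rho> x) \<le> e / 10" if C': "C' \<subseteq> C" "finite C'" for C'
		proof -
			define p where "p = (\<lambda>x. (x, {min x (y x)..max x (y x)})) ` C'"
			have inj: "inj_on (\<lambda>x. (x, {min x (y x)..max x (y x)})) C'" by (auto intro: inj_onI)
			have yE: "y x \<in> {a..b} \<and> 0 < \<bar>y x - x\<bar> \<and> cball x (\<rho> x) \<subseteq> \<gamma> x \<and> \<rho> x < real (Suc k) * r x (y x)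
					\<and> x \<in> {a<..<b}" if "x \<in> C'" for x
				using y[of x] that C' C by (auto simp: \<rho>_def E_def)
			have Kc: "{min x (y x)..max x (y x)} \<subseteq> cball x (\<rho> x)" for x
				by (auto simp: \<rho>_def dist_real_def)
			have "p tagged_partial_division_of cbox a b"
				unfolding tagged_partial_division_of_def
			proof (intro conjI allI impI)
				show "finite p" using C' by (simp add: p_def)
				fix x K assume "(x, K) \<in> p"
				then have xK: "x \<in> C'" "K = {min x (y x)..max x (y x)}" by (auto simp: p_def)
				show "x \<in> K" using xK by auto
				show "K \<subseteq> cbox a b" using xK yE[of x] by auto
				show "\<exists>a b. K = cbox a b" using xK by (metis cbox_interval)
			next
				fix x K x' K' assume p': "(x, K) \<in> p \<and> (x', K') \<in> p \<and> (x, K) \<noteq> (x', K')"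
				then have xK: "x \<in> C'" "K = {min x (y x)..max x (y x)}" by (auto simp: p_def)
				from p' have xK': "x' \<in> C'" "K' = {min x' (y x')..max x' (y x')}" by (auto simp: p_def)
				with p' xK have "x \<noteq> x'" by auto
				then have "disjnt (cball x (\<rho> x)) (cball x' (\<rho> x'))" using pw xK xK' C' by (auto simp: pairwise_def)
				then have "K \<inter> K' = {}" using Kc[of x] Kc[of x'] xK(2) xK'(2)
						unfolding disjnt_def by blast
				then show "interior K \<inter> interior K' = {}" using interior_subset by blast
			qed
			moreover have "\<gamma> fine p"
				unfolding fine_def p_def using yE Kc by fastforce
			ultimately have "(\<Sum>(x,K)\<in>p. norm (measure lborel K *\<^sub>R f x - integral K f)) < e'" by (rule Hen)
			also have "(\<Sum>(x,K)\<in>p. norm (measure lborel K *\<^sub>R f x - integral K f)) = (\<Sum>x\<in>C'. r x (y x))"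
			proof -
				have *: "norm (measure lborel {min x (y x)..max x (y x)} *\<^sub>R f x - integral {min x (y x)..max x (y x)} f) = r x (y x)" if x: "x \<in> C'" for x
				proof (cases "x \<le> y x")
					case True
					then show ?thesis using F[of x "y x"] yE[OF x] by (simp add: r_def norm_minus_commute)
				next
					case False
					then have m: "min x (y x) = y x" "max x (y x) = x" by auto
					have "integral {y x..x} f = F x - F (y x)" using F[of "y x" x] yE[OF x] False by auto
					then have "measure lborel {y x..x} *\<^sub>R f x - integral {y x..x} f = F (y x) - F x - (y x - x) *\<^sub>R f x"
						using False by (simp add: algebra_simps)
					then show ?thesis unfolding m r_def by simp
				qed
				show ?thesis
					unfolding p_def by (subst sum.reindex[OF inj]) (use * in \<open>auto intro!: sum.cong simp del: measure_lborel_Icc\<close>)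
			qed
			finally have s: "(\<Sum>x\<in>C'. r x (y x)) < e'" .
			have "(\<Sum>x\<in>C'. \<rho> x) \<le> (\<Sum>x\<in>C'. real (Suc k) * r x (y x))"
				by (rule sum_mono) (use yE less_imp_le in blast)
			also have "\<dots> \<le> real (Suc k) * e'" unfolding sum_distrib_left[symmetric]
				by (rule mult_left_mono) (use s in auto)
			also have "\<dots> = e / 10" by (simp add: e'_def del: of_nat_Suc)
			finally show ?thesis .
		qed
		have mU: "measure lebesgue (\<Union>i\<in>C'. cball i (5 * \<rho> i)) \<le> e" if C': "C' \<subseteq> C" "finite C'" for C'
		proof -
			have "measure lebesgue (\<Union>i\<in>C'. cball i (5 * \<rho> i)) \<le> (\<Sum>i\<in>C'. measure lebesgue (cball i (5 * \<rho> i)))"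
				by (rule measure_UNION_le) (use C' in auto)
			also have "\<dots> = (\<Sum>i\<in>C'. 10 * \<rho> i)"
				by (rule sum.cong) (auto simp: cball_eq_atLeastAtMost \<rho>_def)
			also have "\<dots> \<le> e" using sumr[OF C'] by (simp add: sum_distrib_left[symmetric])
			finally show ?thesis .
		qed
		show "\<exists>T. E k \<subseteq> T \<and> T \<in> lmeasurable \<and> measure lebesgue T \<le> e"
		proof (intro exI conjI)
			show "E k \<subseteq> (\<Union>i\<in>C. cball i (5 * \<rho> i))" by (rule cov)
			show "(\<Union>i\<in>C. cball i (5 * \<rho> i)) \<in> lmeasurable"
				by (rule fmeasurable_UN_bound[OF C(1), where B=e]) (use mU in auto)
			show "measure lebesgue (\<Union>i\<in>C. cball i (5 * \<rho> i)) \<le> e"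
				by (rule measure_UN_bound[OF C(1), where B=e]) (use mU in auto)
		qed
	qed
	then have "negligible (\<Union>k. E k)" by (intro negligible_countable_Union) auto
	then show ?thesis by (rule negligible_subset[OF _ sub])
qed

section \<open>The total variation of an absolutely continuous function\<close>

text \<open>
	The definition uses divisions, that is sets of intervals. Indexed families may repeat intervals and
	contain degenerate ones, so they survive clamping and refinement.
\<close>

lemma abs_continuous_onD:
	assumes f: "abs_continuous_on a b f" and e: "e > 0"
	obtains d where "d > 0"
		"\<And>(J :: 'i set) u v. finite J \<Longrightarrow> (\<And>j. j \<in> J \<Longrightarrow> a \<le> u j \<and> u j \<le> v j \<and> v j \<le> b) \<Longrightarrow>
			nonoverlapping u v J \<Longrightarrow> (\<Sum>j\<in>J. v j - u j) < d \<Longrightarrow>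
			(\<Sum>j\<in>J. cmod (f (v j) - f (u j))) < e"
proof -
	obtain d where d: "d > 0" and D: "\<And>\<D> T. \<D> division_of T \<Longrightarrow> T \<subseteq> {a..b} \<Longrightarrow>
			(\<Sum>K\<in>\<D>. Sup K - Inf K) < d \<Longrightarrow> (\<Sum>K\<in>\<D>. cmod (f (Sup K) - f (Inf K))) < e"
		using f e unfolding abs_continuous_on_def by meson
	have "(\<Sum>j\<in>J. cmod (f (v j) - f (u j))) < e"
		if J: "finite J" "\<And>j. j \<in> J \<Longrightarrow> a \<le> u j \<and> u j \<le> v j \<and> v j \<le> b"
			"nonoverlapping u v J" "(\<Sum>j\<in>J. v j - u j) < d"
		for J :: "'i set" and u v
	proof -
		define J' where "J' = {j \<in> J. u j < v j}"
		define \<D> where "\<D> = (\<lambda>j. {u j..v j}) ` J'"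
		have fin: "finite J'" using J by (auto simp: J'_def)
		have inj: "inj_on (\<lambda>j. {u j..v j}) J'"
		proof (rule inj_onI, rule ccontr)
			fix i j assume ij: "i \<in> J'" "j \<in> J'" "{u i..v i} = {u j..v j}" "i \<noteq> j"
			then have "u i = u j" "v i = v j" by (auto simp: J'_def Icc_eq_Icc)
			then have "{u i<..<v i} = {}" using J(3) ij by (fastforce simp: pairwise_def J'_def)
			then show False using ij(1) by (auto simp: J'_def)
		qed
		have div: "\<D> division_of \<Union>\<D>"
			unfolding division_of_def
		proof (intro conjI ballI)
			show "finite \<D>" using fin by (simp add: \<D>_def)
			fix K assume K: "K \<in> \<D>"
			then obtain j where j: "j \<in> J'" "K = {u j..v j}" by (auto simp: \<D>_def)
			show "K \<subseteq> \<Union>\<D>" using K by auto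
			show "K \<noteq> {}" using j by (auto simp: J'_def)
			show "\<exists>a b. K = cbox a b" using j by (metis cbox_interval)
			show "K \<noteq> K' \<longrightarrow> interior K \<inter> interior K' = {}" if K': "K' \<in> \<D>" for K'
			proof
				assume ne: "K \<noteq> K'"
				obtain i where i: "i \<in> J'" "K' = {u i..v i}" using K' by (auto simp: \<D>_def)
				with j ne have "i \<noteq> j" by auto
				then show "interior K \<inter> interior K' = {}"
					using J(3) i j by (auto simp: pairwise_def J'_def)
			qed
		qed auto
		have re: "(\<Sum>K\<in>\<D>. h (Inf K) (Sup K)) = (\<Sum>j\<in>J. h (u j) (v j))" if "\<And>x. h x x = 0" for h :: "real \<Rightarrow> real \<Rightarrow> real"
		proof -
			have "(\<Sum>K\<in>\<D>. h (Inf K) (Sup K)) = (\<Sum>j\<in>J'. h (u j) (v j))"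
				unfolding \<D>_def by (subst sum.reindex[OF inj]) (auto intro!: sum.cong simp: J'_def)
			also have "\<dots> = (\<Sum>j\<in>J. h (u j) (v j))"
			proof (rule sum.mono_neutral_left)
				show "\<forall>i\<in>J - J'. h (u i) (v i) = 0"
				proof
					fix i assume "i \<in> J - J'"
					then have "u i = v i" using J(2)[of i] by (auto simp: J'_def)
					then show "h (u i) (v i) = 0" using that by simp
				qed
			qed (use J in \<open>auto simp: J'_def\<close>)
			finally show ?thesis .
		qed
		have "(\<Sum>K\<in>\<D>. cmod (f (Sup K) - f (Inf K))) < e"
		proof (rule D[OF div])
			show "\<Union>\<D> \<subseteq> {a..b}"
			proof
				fix x assume "x \<in> \<Union>\<D>"
				then obtain j where "j \<in> J" "x \<in> {u j..v j}" by (auto simp: \<D>_def J'_def)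
				then show "x \<in> {a..b}" using J(2)[of j] by auto
			qed
			show "(\<Sum>K\<in>\<D>. Sup K - Inf K) < d" using J(4) re[of "\<lambda>x y. y - x"] by simp
		qed
		then show ?thesis using re[of "\<lambda>x y. cmod (f y - f x)"] by simp
	qed
	then show ?thesis using d that by blast
qed

text \<open>
	Partitions are monotone sequences: splitting a partition at an intermediate point amounts to taking
	\<open>min\<close> and \<open>max\<close> with that point.
\<close>

definition variation_sums :: "(real \<Rightarrow> complex) \<Rightarrow> real \<Rightarrow> real \<Rightarrow> real set"
	where "variation_sums f u v = {\<Sum>i<n. cmod (f (p (Suc i)) - f (p i)) | p n. mono p \<and> p 0 = u \<and> p n = v}"

lemma variation_sums_split:
	assumes S: "S \<in> variation_sums f u w" and uvw: "u \<le> v" "v \<le> w"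
	obtains S1 S2 where "S1 \<in> variation_sums f u v" "S2 \<in> variation_sums f v w" "S \<le> S1 + S2"
proof -
	obtain p n where p: "mono p" "p 0 = u" "p n = w" "S = (\<Sum>i<n. cmod (f (p (Suc i)) - f (p i)))"
		using S by (auto simp: variation_sums_def)
	define p1 p2 where "p1 i = min (p i) v" and "p2 i = max (p i) v" for i :: nat
	have mono: "mono p1" "mono p2"
		using p(1) by (auto simp: mono_def p1_def p2_def min_def max_def intro: order_trans)
	have "(\<Sum>i<n. cmod (f (p1 (Suc i)) - f (p1 i))) \<in> variation_sums f u v"
		unfolding variation_sums_def using mono p uvw
		by (intro CollectI exI[of _ p1] exI[of _ n]) (auto simp: p1_def)
	moreover have "(\<Sum>i<n. cmod (f (p2 (Suc i)) - f (p2 i))) \<in> variation_sums f v w"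
		unfolding variation_sums_def using mono p uvw
		by (intro CollectI exI[of _ p2] exI[of _ n]) (auto simp: p2_def)
	moreover have "S \<le> (\<Sum>i<n. cmod (f (p1 (Suc i)) - f (p1 i))) + (\<Sum>i<n. cmod (f (p2 (Suc i)) - f (p2 i)))"
		unfolding p(4) sum.distrib[symmetric]
	proof (rule sum_mono)
		fix i
		have e: "f (p1 j) + f (p2 j) = f (p j) + f v" for j by (auto simp: p1_def p2_def min_def max_def)
		have "f (p (Suc i)) - f (p i) = (f (p1 (Suc i)) - f (p1 i)) + (f (p2 (Suc i)) - f (p2 i))"
			using e[of i] e[of "Suc i"] by (simp add: algebra_simps)
		then show "cmod (f (p (Suc i)) - f (p i)) \<le> cmod (f (p1 (Suc i)) - f (p1 i)) + cmod (f (p2 (Suc i)) - f (p2 i))"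
			by (simp add: norm_triangle_ineq)
	qed
	ultimately show ?thesis using that by blast
qed

lemma variation_sums_append:
	assumes S: "S \<in> variation_sums f u v" and vw: "v \<le> w"
	shows "S + cmod (f w - f v) \<in> variation_sums f u w"
proof -
	obtain p n where p: "mono p" "p 0 = u" "p n = v" "S = (\<Sum>i<n. cmod (f (p (Suc i)) - f (p i)))"
		using S by (auto simp: variation_sums_def)
	define q where "q i = (if i \<le> n then p i else w)" for i
	have "mono q"
	proof (rule monoI)
		fix i j :: nat assume "i \<le> j"
		then show "q i \<le> q j"
			using monoD[OF p(1), of i j] monoD[OF p(1), of i n] p(3) vw by (auto simp: q_def)
	qed
	moreover have "(\<Sum>i<Suc n. cmod (f (q (Suc i)) - f (q i))) = S + cmod (f w - f v)"
		unfolding p(4) by (auto simp: q_def p(3) intro!: sum.cong)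
	ultimately show ?thesis
		unfolding variation_sums_def
		by (intro CollectI exI[of _ q] exI[of _ "Suc n"]) (auto simp: q_def p)
qed

lemma variation_sums_single: "u \<le> v \<Longrightarrow> cmod (f v - f u) \<in> variation_sums f u v"
proof -
	assume uv: "u \<le> v"
	have "0 \<in> variation_sums f u u"
		unfolding variation_sums_def
		by (intro CollectI exI[of _ "\<lambda>_. u"] exI[of _ "0::nat"]) (auto intro: monoI)
	from variation_sums_append[OF this uv] show ?thesis by simp
qed

lemma monotone_points_disjoint:
	fixes p :: "nat \<Rightarrow> real"
	assumes "mono p"
	shows "pairwise (\<lambda>i j. {p i<..<p (Suc i)} \<inter> {p j<..<p (Suc j)} = {}) J"
proof (rule pairwiseI)
	fix i j :: nat assume "i \<noteq> j"
	then consider "Suc i \<le> j" | "Suc j \<le> i" by linarith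
	then show "{p i<..<p (Suc i)} \<inter> {p j<..<p (Suc j)} = {}"
		by cases (use monoD[OF assms] in fastforce)+
qed

text \<open>
	All variation sums over an interval shorter than the \<open>d\<close> that belongs to \<open>e = 1\<close> are at most \<open>1\<close>, and
	\<open>[a, b]\<close> is covered by finitely many intervals of length \<open>d/2\<close>.
\<close>

lemma abs_continuous_on_bounded_variation:
	assumes f: "abs_continuous_on a b f" and ab: "a \<le> b"
	obtains B where "\<And>u v S. a \<le> u \<Longrightarrow> u \<le> v \<Longrightarrow> v \<le> b \<Longrightarrow> S \<in> variation_sums f u v \<Longrightarrow> S \<le> B"
proof -
	obtain d where d: "d > 0" and D: "\<And>(J :: nat set) u v. finite J \<Longrightarrow>
			(\<And>j. j \<in> J \<Longrightarrow> a \<le> u j \<and> u j \<le> v j \<and> v j \<le> b) \<Longrightarrow>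
			nonoverlapping u v J \<Longrightarrow> (\<Sum>j\<in>J. v j - u j) < d \<Longrightarrow>
			(\<Sum>j\<in>J. cmod (f (v j) - f (u j))) < 1"
		by (rule abs_continuous_onD[OF f zero_less_one]) blast
	have small: "S \<le> 1" if "a \<le> u" "u \<le> v" "v \<le> b" "v - u < d" and S: "S \<in> variation_sums f u v" for u v S
	proof -
		obtain p n where p: "mono p" "p 0 = u" "p n = v" "S = (\<Sum>i<n. cmod (f (p (Suc i)) - f (p i)))"
			using S by (auto simp: variation_sums_def)
		have "S < 1"
			unfolding p(4)
		proof (rule D)
			show "pairwise (\<lambda>i j. {p i<..<p (Suc i)} \<inter> {p j<..<p (Suc j)} = {}) {..<n}"
				by (rule monotone_points_disjoint[OF p(1)])
			show "(\<Sum>j<n. p (Suc j) - p j) < d" using that p by (simp add: sum_lessThan_telescope)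
			fix j assume "j \<in> {..<n}"
			then show "a \<le> p j \<and> p j \<le> p (Suc j) \<and> p (Suc j) \<le> b"
				using monoD[OF p(1), of 0 j] monoD[OF p(1), of j "Suc j"] monoD[OF p(1), of "Suc j" n] p that
				by auto
		qed auto
		then show ?thesis by simp
	qed
	have ind: "S \<le> real k" if "a \<le> u" "u \<le> v" "v \<le> b" "v - u < real k * (d/2)" "S \<in> variation_sums f u v" for k u v S
		using that
	proof (induction k arbitrary: v S)
		case 0
		then show ?case by simp
	next
		case (Suc k)
		show ?case
		proof (cases "v - u < d")
			case True
			then show ?thesis using small[of u v S] Suc.prems by simp
		next
			case False
			then have uv: "u \<le> v - d/2" "v - d/2 \<le> v" "v - d/2 - u < real k * (d/2)"
				using d Suc.prems by (auto simp: algebra_simps)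
			obtain S1 S2 where S: "S1 \<in> variation_sums f u (v - d/2)" "S2 \<in> variation_sums f (v - d/2) v" "S \<le> S1 + S2"
				using variation_sums_split[OF Suc.prems(5) uv(1,2)] by blast
			have "S1 \<le> real k" by (rule Suc.IH[OF _ uv(1) _ uv(3) S(1)]) (use Suc.prems d in auto)
			moreover have "S2 \<le> 1" by (rule small[OF _ uv(2) _ _ S(2)]) (use Suc.prems d uv in auto)
			ultimately show ?thesis using S by simp
		qed
	qed
	obtain k where k: "(b - a) / (d/2) < real k" using reals_Archimedean2 by blast
	then have k': "b - a < real k * (d/2)" using d by (simp add: field_simps)
	show ?thesis
		by (rule that[of "real k"], rule ind) (use k' in auto)
qed

definition AC_monotone :: "real \<Rightarrow> real \<Rightarrow> (real \<Rightarrow> real) \<Rightarrow> bool"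
	where "AC_monotone a b G \<longleftrightarrow> mono_on {a..b} G \<and> (\<forall>e>0. \<exists>d>0. \<forall>J u v. finite J \<longrightarrow>
		(\<forall>j::nat\<in>J. a \<le> u j \<and> u j \<le> v j \<and> v j \<le> b) \<longrightarrow>
			nonoverlapping u v J \<longrightarrow> (\<Sum>j\<in>J. v j - u j) < d \<longrightarrow>
			(\<Sum>j\<in>J. G (v j) - G (u j)) < e)"

text \<open>
	\<open>W\<close> is the total variation from \<open>a\<close>. It is absolutely continuous because nearly optimal partitions of
	the members of a family of small total length form again a family of the same total length. The
	increments of \<open>W\<close> and of \<open>W - Re f\<close>, \<open>W - Im f\<close> lie between \<open>0\<close> and twice the variation.
\<close>

lemma Jordan_decomposition:
	assumes f: "abs_continuous_on a b f" and ab: "a \<le> b"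
	obtains W where "AC_monotone a b W" "AC_monotone a b (\<lambda>x. W x - Re (f x))" "AC_monotone a b (\<lambda>x. W x - Im (f x))"
proof -
	obtain B where B: "\<And>u v S. a \<le> u \<Longrightarrow> u \<le> v \<Longrightarrow> v \<le> b \<Longrightarrow> S \<in> variation_sums f u v \<Longrightarrow> S \<le> B"
		using abs_continuous_on_bounded_variation[OF f ab] by blast
	define V where "V u v = Sup (variation_sums f u v)" for u v
	define W where "W = V a"
	have bdd: "bdd_above (variation_sums f u v)" if "a \<le> u" "u \<le> v" "v \<le> b" for u v
		using B[OF that] by (rule bdd_aboveI)
	have ne: "variation_sums f u v \<noteq> {}" if "u \<le> v" for u v
		using variation_sums_single[OF that] by blast
	have W_ge: "W x + cmod (f y - f x) \<le> W y" if "a \<le> x" "x \<le> y" "y \<le> b" for x y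
	proof -
		have "W x \<le> W y - cmod (f y - f x)"
			unfolding W_def V_def
		proof (rule cSup_least[OF ne])
			fix S assume "S \<in> variation_sums f a x"
			then have "S + cmod (f y - f x) \<in> variation_sums f a y" by (rule variation_sums_append) (use that in auto)
			then have "S + cmod (f y - f x) \<le> Sup (variation_sums f a y)" by (rule cSup_upper[OF _ bdd]) (use that in auto)
			then show "S \<le> Sup (variation_sums f a y) - cmod (f y - f x)" by simp
		qed (use that in auto)
		then show ?thesis by simp
	qed
	have W_le: "W y - W x \<le> V x y" if axy: "a \<le> x" "x \<le> y" "y \<le> b" for x y
	proof -
		have "W y \<le> W x + V x y"
			unfolding W_def V_def
		proof (rule cSup_least[OF ne])
			fix S assume "S \<in> variation_sums f a y"
			then obtain S1 S2 where S: "S1 \<in> variation_sums f a x" "S2 \<in> variation_sums f x y" "S \<le> S1 + S2"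
				by (rule variation_sums_split[OF _ axy(1,2)])
			have "S1 \<le> Sup (variation_sums f a x)" by (rule cSup_upper[OF S(1) bdd]) (use axy in auto)
			moreover have "S2 \<le> Sup (variation_sums f x y)" by (rule cSup_upper[OF S(2) bdd]) (use axy in auto)
			ultimately show "S \<le> Sup (variation_sums f a x) + Sup (variation_sums f x y)" using S by simp
		qed (use that in auto)
		then show ?thesis by simp
	qed
	have AC: "\<exists>d>0. \<forall>J u v. finite J \<longrightarrow> (\<forall>j::nat\<in>J. a \<le> u j \<and> u j \<le> v j \<and> v j \<le> b) \<longrightarrow>
			nonoverlapping u v J \<longrightarrow> (\<Sum>j\<in>J. v j - u j) < d \<longrightarrow>
			(\<Sum>j\<in>J. V (u j) (v j)) < e" if e: "e > 0" for e
	proof -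
		have e2: "e/2 > 0" using e by simp
		obtain d where d: "d > 0" and D: "\<And>(J :: (nat \<times> nat) set) u v. finite J \<Longrightarrow>
			(\<And>j. j \<in> J \<Longrightarrow> a \<le> u j \<and> u j \<le> v j \<and> v j \<le> b) \<Longrightarrow>
			nonoverlapping u v J \<Longrightarrow> (\<Sum>j\<in>J. v j - u j) < d \<Longrightarrow>
			(\<Sum>j\<in>J. cmod (f (v j) - f (u j))) < e/2"
			by (rule abs_continuous_onD[OF f e2]) blast
		show ?thesis
		proof (intro exI[of _ d] conjI d allI impI)
			fix J :: "nat set" and u v
			assume J: "finite J" "\<forall>j\<in>J. a \<le> u j \<and> u j \<le> v j \<and> v j \<le> b"
				"nonoverlapping u v J" "(\<Sum>j\<in>J. v j - u j) < d"
			\<comment> \<open>Each of the suprema may be missed by \<open>\<eta>\<close>; in total this costs at most \<open>e/2\<close>.\<close>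
			define \<eta> where "\<eta> = e / (2 * real (Suc (card J)))"
			have \<eta>: "\<eta> > 0" using e by (simp add: \<eta>_def)
			have "\<exists>p n. mono p \<and> p 0 = u j \<and> p n = v j \<and> V (u j) (v j) - \<eta> < (\<Sum>i<n. cmod (f (p (Suc i)) - f (p i)))"
				if "j \<in> J" for j
			proof -
				have uv: "a \<le> u j" "u j \<le> v j" "v j \<le> b" using J(2) that by auto
				have "V (u j) (v j) - \<eta> < Sup (variation_sums f (u j) (v j))" using \<eta> by (simp add: V_def)
				then obtain S where "S \<in> variation_sums f (u j) (v j)" "V (u j) (v j) - \<eta> < S"
					using less_cSup_iff[OF ne[OF uv(2)] bdd[OF uv]] by blast
				then show ?thesis unfolding variation_sums_def by blast
			qed
			then have "\<forall>j\<in>J. \<exists>p n. mono p \<and> p 0 = u j \<and> p n = v j \<and> V (u j) (v j) - \<eta> < (\<Sum>i<n. cmod (f (p (Suc i)) - f (p i)))"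
				by blast
			from bchoice[OF this] obtain p where "\<forall>j\<in>J. \<exists>n. mono (p j) \<and> p j 0 = u j \<and> p j n = v j \<and>
					V (u j) (v j) - \<eta> < (\<Sum>i<n. cmod (f (p j (Suc i)) - f (p j i)))" by blast
			from bchoice[OF this] obtain n where p: "\<And>j. j \<in> J \<Longrightarrow> mono (p j) \<and> p j 0 = u j \<and> p j (n j) = v j \<and>
					V (u j) (v j) - \<eta> < (\<Sum>i<n j. cmod (f (p j (Suc i)) - f (p j i)))" by blast
			define I where "I = Sigma J (\<lambda>j. {..<n j})"
			have pin: "u j \<le> p j i \<and> p j i \<le> p j (Suc i) \<and> p j (Suc i) \<le> v j" if "j \<in> J" "i < n j" for i j
				using p[OF that(1)] that(2) monoD[of "p j" 0 i] monoD[of "p j" i "Suc i"] monoD[of "p j" "Suc i" "n j"] by auto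
			have "(\<Sum>(j,i)\<in>I. cmod (f (p j (Suc i)) - f (p j i))) = (\<Sum>x\<in>I. cmod (f (p (fst x) (Suc (snd x))) - f (p (fst x) (snd x))))"
				by (simp add: split_beta)
			also have "\<dots> < e/2"
			proof (rule D)
				show "finite I" using J by (auto simp: I_def)
				show "a \<le> p (fst x) (snd x) \<and> p (fst x) (snd x) \<le> p (fst x) (Suc (snd x)) \<and> p (fst x) (Suc (snd x)) \<le> b"
					if "x \<in> I" for x
				proof -
					have x: "fst x \<in> J" "snd x < n (fst x)" using that by (auto simp: I_def)
					from pin[OF this] J(2)[rule_format, OF x(1)] show ?thesis by linarith
				qed
				show "pairwise (\<lambda>i j. {p (fst i) (snd i)<..<p (fst i) (Suc (snd i))} \<inter> {p (fst j) (snd j)<..<p (fst j) (Suc (snd j))} = {}) I"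
				proof (rule pairwiseI)
					fix x y assume xy: "x \<in> I" "y \<in> I" "x \<noteq> y"
					have xyJ: "fst x \<in> J" "fst y \<in> J" using xy by (auto simp: I_def)
					show "{p (fst x) (snd x)<..<p (fst x) (Suc (snd x))} \<inter> {p (fst y) (snd y)<..<p (fst y) (Suc (snd y))} = {}"
					proof (cases "fst x = fst y")
						case True
						then have "snd x \<noteq> snd y" using xy by (auto simp: prod_eq_iff)
						moreover have "mono (p (fst x))" using p xy by (auto simp: I_def)
						ultimately show ?thesis using monotone_points_disjoint[of "p (fst x)" UNIV] True
							by (auto simp: pairwise_def)
					next
						case False
						have "{u (fst x)<..<v (fst x)} \<inter> {u (fst y)<..<v (fst y)} = {}"
							using J(3) False xyJ unfolding pairwise_def by simp
						moreover have "{p (fst z) (snd z)<..<p (fst z) (Suc (snd z))} \<subseteq> {u (fst z)<..<v (fst z)}" if "z \<in> I" for z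
							using pin[of "fst z" "snd z"] that by (auto simp: I_def)
						ultimately show ?thesis using xy by blast
					qed
				qed
				have "(\<Sum>x\<in>I. p (fst x) (Suc (snd x)) - p (fst x) (snd x)) = (\<Sum>j\<in>J. \<Sum>i<n j. p j (Suc i) - p j i)"
					unfolding I_def by (subst sum.Sigma) (use J in \<open>auto simp: split_beta\<close>)
				also have "\<dots> = (\<Sum>j\<in>J. v j - u j)"
					by (rule sum.cong) (use p in \<open>auto simp: sum_lessThan_telescope\<close>)
				finally show "(\<Sum>x\<in>I. p (fst x) (Suc (snd x)) - p (fst x) (snd x)) < d" using J by simp
			qed
			finally have 1: "(\<Sum>j\<in>J. \<Sum>i<n j. cmod (f (p j (Suc i)) - f (p j i))) < e/2"
				unfolding I_def by (subst sum.Sigma) (use J in auto)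
			have "(\<Sum>j\<in>J. V (u j) (v j)) \<le> (\<Sum>j\<in>J. (\<Sum>i<n j. cmod (f (p j (Suc i)) - f (p j i))) + \<eta>)"
				by (rule sum_mono) (use p in force)
			also have "\<dots> = (\<Sum>j\<in>J. \<Sum>i<n j. cmod (f (p j (Suc i)) - f (p j i))) + real (card J) * \<eta>"
				by (simp add: sum.distrib)
			also have "real (card J) * \<eta> \<le> real (Suc (card J)) * \<eta>" using \<eta> by simp
			also have "real (Suc (card J)) * \<eta> = e/2" by (simp add: \<eta>_def del: of_nat_Suc)
			finally show "(\<Sum>j\<in>J. V (u j) (v j)) < e" using 1 by simp
		qed
	qed
	have mk: "AC_monotone a b G" if mono: "\<And>x y. a \<le> x \<Longrightarrow> x \<le> y \<Longrightarrow> y \<le> b \<Longrightarrow> G x \<le> G y"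
		and le: "\<And>x y. a \<le> x \<Longrightarrow> x \<le> y \<Longrightarrow> y \<le> b \<Longrightarrow> G y - G x \<le> 2 * V x y" for G
		unfolding AC_monotone_def
	proof (intro conjI allI impI)
		show "mono_on {a..b} G" using mono by (auto intro!: mono_onI)
		fix e :: real assume "e > 0"
		then have "e/2 > 0" by simp
		from AC[OF this] obtain d where d: "d > 0" and D: "\<forall>J u v. finite J \<longrightarrow> (\<forall>j::nat\<in>J. a \<le> u j \<and> u j \<le> v j \<and> v j \<le> b) \<longrightarrow>
			nonoverlapping u v J \<longrightarrow> (\<Sum>j\<in>J. v j - u j) < d \<longrightarrow>
			(\<Sum>j\<in>J. V (u j) (v j)) < e/2" by blast
		have "(\<Sum>j\<in>J. G (v j) - G (u j)) < e" if J: "finite J" "\<forall>j::nat\<in>J. a \<le> u j \<and> u j \<le> v j \<and> v j \<le> b"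
			"nonoverlapping u v J" "(\<Sum>j\<in>J. v j - u j) < d" for J u v
		proof -
			have "(\<Sum>j\<in>J. G (v j) - G (u j)) \<le> (\<Sum>j\<in>J. 2 * V (u j) (v j))"
				by (rule sum_mono) (use le J in auto)
			also have "\<dots> = 2 * (\<Sum>j\<in>J. V (u j) (v j))" by (simp add: sum_distrib_left)
			also have "(\<Sum>j\<in>J. V (u j) (v j)) < e/2" using D J by blast
			finally show ?thesis by simp
		qed
		then show "\<exists>d>0. \<forall>J u v. finite J \<longrightarrow> (\<forall>j::nat\<in>J. a \<le> u j \<and> u j \<le> v j \<and> v j \<le> b) \<longrightarrow>
			nonoverlapping u v J \<longrightarrow> (\<Sum>j\<in>J. v j - u j) < d \<longrightarrow>
			(\<Sum>j\<in>J. G (v j) - G (u j)) < e" using d by blast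
	qed
	have Vge: "cmod (f y - f x) \<le> V x y" if "a \<le> x" "x \<le> y" "y \<le> b" for x y
		unfolding V_def by (rule cSup_upper[OF variation_sums_single bdd]) (use that in auto)
	show ?thesis
	proof (rule that[of W]; rule mk)
		fix x y assume xy: "a \<le> x" "x \<le> y" "y \<le> b"
		have c: "\<bar>Re (f y) - Re (f x)\<bar> \<le> cmod (f y - f x)" "\<bar>Im (f y) - Im (f x)\<bar> \<le> cmod (f y - f x)"
			using abs_Re_le_cmod[of "f y - f x"] abs_Im_le_cmod[of "f y - f x"] by simp_all
		note facts = W_ge[OF xy] W_le[OF xy] Vge[OF xy] c norm_ge_zero[of "f y - f x"]
		show "W x \<le> W y" "W x - Re (f x) \<le> W y - Re (f y)" "W x - Im (f x) \<le> W y - Im (f y)"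
			"W y - W x \<le> 2 * V x y" "W y - Re (f y) - (W x - Re (f x)) \<le> 2 * V x y"
			"W y - Im (f y) - (W x - Im (f x)) \<le> 2 * V x y"
			using facts by linarith+
	qed
qed

section \<open>Absolutely continuous functions are integrals of their derivatives\<close>

text \<open>
	The Stieltjes measure of \<open>G\<close>, extended by constants beyond \<open>[a, b]\<close>, vanishes on Lebesgue null sets: such a
	set has an open neighbourhood of small measure, which is exhausted by finite unions of intervals, and
	for these absolute continuity bounds the measure. The density comes from the theorem of Radon and Nikodym.
\<close>

lemma AC_monotone_density:
	assumes G: "AC_monotone a b G" and ab: "a \<le> b"
	obtains g where "g absolutely_integrable_on {a..b}"
		"\<And>x y. a \<le> x \<Longrightarrow> x \<le> y \<Longrightarrow> y \<le> b \<Longrightarrow> (g has_integral (G y - G x)) {x..y}"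
proof -
	define c where "c x = max a (min x b)" for x
	define H where "H x = G (c x)" for x
	have c_in: "a \<le> c x \<and> c x \<le> b" for x using ab by (auto simp: c_def)
	have c_mono: "c x \<le> c y" if "x \<le> y" for x y using that by (auto simp: c_def)
	have c_diff: "c y - c x \<le> y - x" if "x \<le> y" for x y using that by (auto simp: c_def)
	have H_mono: "H x \<le> H y" if "x \<le> y" for x y
		using G c_in c_mono[OF that] unfolding AC_monotone_def H_def mono_on_def by auto
	have AC: "\<exists>d>0. \<forall>J u v. finite J \<longrightarrow> (\<forall>j::nat\<in>J. u j \<le> v j) \<longrightarrow>
			nonoverlapping u v J \<longrightarrow> (\<Sum>j\<in>J. v j - u j) < d \<longrightarrow>
			(\<Sum>j\<in>J. H (v j) - H (u j)) < e" if "e > 0" for e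
	proof -
		obtain d where d: "d > 0" and D: "\<And>J u v. finite J \<Longrightarrow> (\<forall>j::nat\<in>J. a \<le> u j \<and> u j \<le> v j \<and> v j \<le> b) \<Longrightarrow>
			nonoverlapping u v J \<Longrightarrow> (\<Sum>j\<in>J. v j - u j) < d \<Longrightarrow>
			(\<Sum>j\<in>J. G (v j) - G (u j)) < e" using G \<open>e > 0\<close> unfolding AC_monotone_def by meson
		show ?thesis
		proof (intro exI[of _ d] conjI d allI impI)
			fix J u v assume J: "finite J" "\<forall>j::nat\<in>J. u j \<le> v j"
				"nonoverlapping u v J" "(\<Sum>j\<in>J. v j - u j) < d"
			have "(\<Sum>j\<in>J. G ((c \<circ> v) j) - G ((c \<circ> u) j)) < e"
			proof (rule D[OF J(1)])
				show "\<forall>j\<in>J. a \<le> (c \<circ> u) j \<and> (c \<circ> u) j \<le> (c \<circ> v) j \<and> (c \<circ> v) j \<le> b"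
					using c_in c_mono J by auto
				have "{c x<..<c y} \<subseteq> {x<..<y}" for x y
					by (auto simp: c_def)
				then have sub: "{(c \<circ> u) i<..<(c \<circ> v) i} \<subseteq> {u i<..<v i}" for i by auto
				show "pairwise (\<lambda>i j. {(c \<circ> u) i<..<(c \<circ> v) i} \<inter> {(c \<circ> u) j<..<(c \<circ> v) j} = {}) J"
					by (rule pairwise_mono[OF J(3)]) (use sub in blast)+
				have "(\<Sum>j\<in>J. (c \<circ> v) j - (c \<circ> u) j) \<le> (\<Sum>j\<in>J. v j - u j)"
					by (rule sum_mono) (use c_diff J in auto)
				then show "(\<Sum>j\<in>J. (c \<circ> v) j - (c \<circ> u) j) < d" using J by simp
			qed
			then show "(\<Sum>j\<in>J. H (v j) - H (u j)) < e" by (simp add: H_def)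
		qed
	qed
	have H_cont: "continuous_on UNIV H"
		unfolding continuous_on_iff
	proof (intro ballI allI impI)
		fix x e :: real assume "e > 0"
		from AC[OF this] obtain d where d: "d > 0" and D: "\<And>J u v. finite J \<Longrightarrow> (\<forall>j::nat\<in>J. u j \<le> v j) \<Longrightarrow>
			nonoverlapping u v J \<Longrightarrow> (\<Sum>j\<in>J. v j - u j) < d \<Longrightarrow>
			(\<Sum>j\<in>J. H (v j) - H (u j)) < e" by meson
		have D1: "H t - H s < e" if "s \<le> t" "t - s < d" for s t
			using D[of "{0}" "\<lambda>_. s" "\<lambda>_. t"] that by simp
		show "\<exists>d>0. \<forall>x'\<in>UNIV. dist x' x < d \<longrightarrow> dist (H x') (H x) < e"
		proof (intro exI[of _ d] conjI d ballI impI)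
			fix x' assume "dist x' x < d"
			then show "dist (H x') (H x) < e"
				using D1[of x x'] D1[of x' x] H_mono[of x x'] H_mono[of x' x]
				by (cases "x \<le> x'") (auto simp: dist_real_def)
		qed
	qed
	define \<mu> where "\<mu> = interval_measure H"
	have sets_mu: "sets \<mu> = sets borel" by (simp add: \<mu>_def)
	have mu_Icc: "emeasure \<mu> {x..y} = ennreal (H y - H x)" if "x \<le> y" for x y
		unfolding \<mu>_def by (rule emeasure_interval_measure_Icc[OF that H_mono H_cont])
	have null: "emeasure \<mu> A = 0" if A: "A \<in> null_sets lborel" for A
	proof -
		have "emeasure \<mu> A \<le> ennreal e" if e: "e > 0" for e
		proof -
			from AC[OF e] obtain d where d: "d > 0" and D: "\<And>J u v. finite J \<Longrightarrow> (\<forall>j::nat\<in>J. u j \<le> v j) \<Longrightarrow>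
				nonoverlapping u v J \<Longrightarrow> (\<Sum>j\<in>J. v j - u j) < d \<Longrightarrow>
				(\<Sum>j\<in>J. H (v j) - H (u j)) < e" by meson
			have Asets: "A \<in> sets borel" and A0: "emeasure lborel A = 0" using A by (auto simp: null_sets_def)
			obtain T where T: "open T" "A \<subseteq> T" "emeasure lebesgue (T - A) < ennreal d"
				using sets_lebesgue_outer_open[of A d] Asets d by (metis sets_completionI_sets sets_lborel)
			have Tb: "T \<in> sets borel" using T by auto
			have "emeasure lborel T \<le> emeasure lborel A + emeasure lborel (T - A)"
				using T(2) Asets Tb by (metis Diff_partition emeasure_subadditive sets.Diff sets_lborel)
			also have "\<dots> < ennreal d" using A0 T(3) Tb Asets by simp
			finally have Td: "emeasure lborel T < ennreal d" .
			have fin: "emeasure \<mu> (\<Union>\<F>) \<le> ennreal e" if F: "finite \<F>" "\<And>X. X \<in> \<F> \<Longrightarrow> \<exists>a b. X = cbox a b" "\<Union>\<F> \<subseteq> T" for \<F> :: "real set set"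
			proof -
				obtain p where p: "p division_of \<Union>\<F>" by (rule elementary_unions_intervals[OF F(1,2)])
				note pD = division_ofD[OF p]
				obtain \<phi> where \<phi>: "bij_betw \<phi> {0..<card p} p" using ex_bij_betw_nat_finite[OF pD(1)] by blast
				define J where "J = {0..<card p}"
				define u v where "u j = Inf (\<phi> j)" and "v j = Sup (\<phi> j)" for j
				have Kj: "\<phi> j = {u j..v j} \<and> u j \<le> v j \<and> \<phi> j \<in> p" if "j \<in> J" for j
				proof -
					have "\<phi> j \<in> p" using \<phi> that by (auto simp: J_def bij_betw_def)
					moreover from pD(3,4)[OF this] obtain l r where "\<phi> j = {l..r}" "\<phi> j \<noteq> {}" by auto
					ultimately show ?thesis by (auto simp: u_def v_def)
				qed
				have dis: "{u i<..<v i} \<inter> {u j<..<v j} = {}" if "i \<in> J" "j \<in> J" "i \<noteq> j" for i j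
				proof -
					have "\<phi> i \<noteq> \<phi> j" using \<phi> that by (auto simp: J_def bij_betw_def inj_on_def)
					then have "interior (\<phi> i) \<inter> interior (\<phi> j) = {}" using pD(5) Kj that by blast
					then show ?thesis using Kj[OF that(1)] Kj[OF that(2)] by (metis interior_atLeastAtMost_real)
				qed
				have pw: "nonoverlapping u v J"
					by (rule pairwiseI) (use dis in blast)
				have uv: "0 \<le> v j - u j" if "j \<in> J" for j using Kj[OF that] by simp
				have "ennreal (\<Sum>j\<in>J. v j - u j) = (\<Sum>j\<in>J. ennreal (v j - u j))"
					using uv by (rule sum_ennreal[symmetric])
				also have "\<dots> = (\<Sum>j\<in>J. emeasure lborel {u j<..<v j})"
					by (rule sum.cong) (use uv in auto)
				also have "\<dots> = emeasure lborel (\<Union>j\<in>J. {u j<..<v j})"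
					proof (rule sum_emeasure)
					show "disjoint_family_on (\<lambda>j. {u j<..<v j}) J" using dis unfolding disjoint_family_on_def by blast
				qed (auto simp: J_def)
				also have "\<dots> \<le> emeasure lborel T"
				proof (rule emeasure_mono)
					have "{u j<..<v j} \<subseteq> T" if "j \<in> J" for j
					proof -
						have "\<phi> j \<subseteq> \<Union>\<F>" using Kj[OF that] pD(2) by blast
						moreover have "{u j<..<v j} \<subseteq> \<phi> j"
							unfolding conjunct1[OF Kj[OF that]] by (rule greaterThanLessThan_subseteq_atLeastAtMost_iff[THEN iffD2]) simp
						ultimately show ?thesis using F(3) by blast
					qed
					then show "(\<Union>j\<in>J. {u j<..<v j}) \<subseteq> T" by blast
				qed (use Tb in simp)
				also have "\<dots> < ennreal d" by (rule Td)
				finally have "(\<Sum>j\<in>J. v j - u j) < d" using uv by (simp add: ennreal_less_iff sum_nonneg)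
				then have He: "(\<Sum>j\<in>J. H (v j) - H (u j)) < e"
					by (intro D) (use uv pw in \<open>auto simp: J_def\<close>)
				have U: "\<Union>\<F> = (\<Union>j\<in>J. {u j..v j})"
				proof -
					have "\<phi> ` J = p" using \<phi> by (simp add: J_def bij_betw_def)
					then have "\<Union>\<F> = (\<Union>j\<in>J. \<phi> j)" using pD(6) by auto
					then show ?thesis using Kj by auto
				qed
				have "emeasure \<mu> (\<Union>\<F>) \<le> (\<Sum>j\<in>J. emeasure \<mu> {u j..v j})"
					unfolding U by (rule emeasure_subadditive_finite) (auto simp: J_def sets_mu)
				also have "\<dots> = (\<Sum>j\<in>J. ennreal (H (v j) - H (u j)))"
					by (rule sum.cong[OF refl], rule mu_Icc) (use uv in force)
				also have "\<dots> = ennreal (\<Sum>j\<in>J. H (v j) - H (u j))"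
					by (rule sum_ennreal) (use uv H_mono in force)
				also have "\<dots> \<le> ennreal e" using He by (intro ennreal_leI) simp
				finally show ?thesis .
			qed
			obtain \<D> where D': "countable \<D>" "\<D> \<subseteq> Pow T" "\<And>X. X \<in> \<D> \<Longrightarrow> \<exists>a b. X = cbox a b" "\<Union>\<D> = T"
				using open_countable_Union_open_cbox[OF T(1)] by blast
			show ?thesis
			proof (cases "\<D> = {}")
				case True
				then have "A = {}" using D' T by auto
				then show ?thesis by simp
			next
				case False
				define U where "U n = (\<Union>k\<le>n. from_nat_into \<D> k)" for n
				have inD: "from_nat_into \<D> k \<in> \<D>" for k by (rule from_nat_into[OF False])
				have Usets: "U n \<in> sets \<mu>" for n
					unfolding U_def sets_mu
				proof (rule sets.finite_UN)
					fix k show "from_nat_into \<D> k \<in> sets borel" using D'(3)[OF inD[of k]] by auto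
				qed auto
				have TU: "T = (\<Union>n. U n)"
				proof -
					have "T = (\<Union>n. from_nat_into \<D> n)"
						using D'(4) range_from_nat_into[OF False D'(1)] by auto
					also have "\<dots> = (\<Union>n. U n)" unfolding U_def by blast
					finally show ?thesis .
				qed
				have "emeasure \<mu> A \<le> emeasure \<mu> T" by (rule emeasure_mono[OF T(2)]) (use Tb sets_mu in simp)
				also have "\<dots> = (SUP n. emeasure \<mu> (U n))"
				proof -
					have "incseq U" unfolding incseq_def U_def by (intro allI impI UN_mono) auto
					moreover have "range U \<subseteq> sets \<mu>" using Usets by blast
					ultimately show ?thesis unfolding TU by (rule SUP_emeasure_incseq[symmetric, rotated])
				qed
				also have "\<dots> \<le> ennreal e"
				proof (rule SUP_least)
					fix n
					show "emeasure \<mu> (U n) \<le> ennreal e"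
						unfolding U_def
					proof (rule fin)
						show "\<exists>a b. X = cbox a b" if "X \<in> from_nat_into \<D> ` {..n}" for X
						proof -
							from that obtain k where "X = from_nat_into \<D> k" by (rule imageE)
							then show ?thesis using D'(3)[OF inD[of k]] by simp
						qed
						have "from_nat_into \<D> k \<subseteq> T" for k using subsetD[OF D'(2) inD[of k]] by (rule PowD)
						then show "(\<Union>k\<le>n. from_nat_into \<D> k) \<subseteq> T" by (rule UN_least)
					qed simp
				qed
				finally show ?thesis .
			qed
		qed
		then have "emeasure \<mu> A \<le> 0"
			by (metis add_0 ennreal_le_epsilon)
		then show ?thesis by simp
	qed
	have "absolutely_continuous lborel \<mu>"
		unfolding absolutely_continuous_def using null sets_mu by (auto simp: null_sets_def)
	then obtain h where h: "h \<in> borel_measurable lborel" "density lborel h = \<mu>"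
		using sigma_finite_measure.Radon_Nikodym[OF sigma_finite_lborel] sets_mu by (metis sets_lborel)
	have hI: "(\<integral>\<^sup>+t. h t * indicator {x..y} t \<partial>lborel) = ennreal (H y - H x)" if "x \<le> y" for x y
		using mu_Icc[OF that] h by (simp add: emeasure_density[symmetric])
	define g where "g t = enn2real (h t)" for t
	have g_nn: "0 \<le> g t" for t by (simp add: g_def)
	have gm: "g \<in> borel_measurable borel" using h(1) unfolding g_def by simp
	have main: "(g has_integral (G y - G x)) {x..y}" if xy: "a \<le> x" "x \<le> y" "y \<le> b" for x y
	proof -
		have fin: "AE t in lborel. h t * indicator {x..y} t \<noteq> \<infinity>"
			by (rule nn_integral_PInf_AE) (use h hI[OF xy(2)] in auto)
		have "(\<integral>\<^sup>+t. ennreal (g t * indicator {x..y} t) \<partial>lborel) = (\<integral>\<^sup>+t. h t * indicator {x..y} t \<partial>lborel)"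
		proof (rule nn_integral_cong_AE)
			show "AE t in lborel. ennreal (g t * indicator {x..y} t) = h t * indicator {x..y} t"
				using fin by eventually_elim (auto simp: g_def indicator_def ennreal_enn2real_if split: if_splits)
		qed
		also have "\<dots> = ennreal (G y - G x)"
			using hI[OF xy(2)] xy by (simp add: H_def c_def)
		finally have "((\<lambda>t. g t * indicator {x..y} t) has_integral (G y - G x)) UNIV"
			by (intro nn_integral_has_integral)
				 (use gm xy H_mono[OF xy(2)] in \<open>auto simp: H_def c_def g_nn\<close>)
		moreover have "(\<lambda>t. g t * indicator {x..y} t) = (\<lambda>t. if t \<in> {x..y} then g t else 0)" by auto
		ultimately show ?thesis by (simp only: has_integral_restrict_UNIV)
	qed
	show ?thesis
	proof (rule that[of g])
		show "g absolutely_integrable_on {a..b}"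
			by (rule nonnegative_absolutely_integrable_1) (use main[of a b] ab in \<open>auto simp: g_def integrable_on_def\<close>)
	qed (rule main)
qed

lemma abs_continuous_on_imp_primitive:
	assumes f: "abs_continuous_on a b f" and ab: "a \<le> b"
	obtains g where "g absolutely_integrable_on {a..b}"
		"\<And>x y. a \<le> x \<Longrightarrow> x \<le> y \<Longrightarrow> y \<le> b \<Longrightarrow> (g has_integral (f y - f x)) {x..y}"
proof -
	obtain W where W: "AC_monotone a b W" "AC_monotone a b (\<lambda>x. W x - Re (f x))" "AC_monotone a b (\<lambda>x. W x - Im (f x))"
		by (rule Jordan_decomposition[OF f ab])
	obtain w where w: "w absolutely_integrable_on {a..b}"
		"\<And>x y. a \<le> x \<Longrightarrow> x \<le> y \<Longrightarrow> y \<le> b \<Longrightarrow> (w has_integral (W y - W x)) {x..y}"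
		by (rule AC_monotone_density[OF W(1) ab]) blast
	obtain r where r: "r absolutely_integrable_on {a..b}"
		"\<And>x y. a \<le> x \<Longrightarrow> x \<le> y \<Longrightarrow> y \<le> b \<Longrightarrow> (r has_integral ((W y - Re (f y)) - (W x - Re (f x)))) {x..y}"
		by (rule AC_monotone_density[OF W(2) ab]) blast
	obtain i where i: "i absolutely_integrable_on {a..b}"
		"\<And>x y. a \<le> x \<Longrightarrow> x \<le> y \<Longrightarrow> y \<le> b \<Longrightarrow> (i has_integral ((W y - Im (f y)) - (W x - Im (f x)))) {x..y}"
		by (rule AC_monotone_density[OF W(3) ab]) blast
	define g where "g x = cpx (w x - r x) + \<i> * cpx (w x - i x)" for x
	have bl: "bounded_linear (\<lambda>x. \<i> * cpx x)"
		by (rule bounded_linear_compose[OF bounded_linear_mult_right bounded_linear_of_real])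
	have "g absolutely_integrable_on {a..b}"
		unfolding g_def
		using absolutely_integrable_linear[OF set_integral_diff(1)[OF w(1) r(1)] bounded_linear_of_real]
			absolutely_integrable_linear[OF set_integral_diff(1)[OF w(1) i(1)] bl]
		by (intro set_integral_add) (auto simp: o_def)
	moreover have "(g has_integral (f y - f x)) {x..y}" if "a \<le> x" "x \<le> y" "y \<le> b" for x y
	proof -
		note 1 = has_integral_diff[OF w(2)[OF that] r(2)[OF that]]
		note 2 = has_integral_diff[OF w(2)[OF that] i(2)[OF that]]
		have "(g has_integral (cpx (W y - W x - (W y - Re (f y) - (W x - Re (f x))))
			+ \<i> * cpx (W y - W x - (W y - Im (f y) - (W x - Im (f x)))))) {x..y}"
			unfolding g_def
			using has_integral_linear[OF 1 bounded_linear_of_real[where 'a=complex]] has_integral_linear[OF 2 bl]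
			by (intro has_integral_add) (auto simp: o_def)
		moreover have "cpx (W y - W x - (W y - Re (f y) - (W x - Re (f x))))
			+ \<i> * cpx (W y - W x - (W y - Im (f y) - (W x - Im (f x)))) = f y - f x"
			by (simp add: complex_eq_iff)
		ultimately show ?thesis by simp
	qed
	ultimately show ?thesis by (rule that)
qed

text \<open>
	The part of \<open>cmod g\<close> above a large height \<open>k\<close> has small integral, and the part below \<open>k\<close> contributes at
	most \<open>k\<close> times the total length.
\<close>

lemma primitive_imp_abs_continuous_on:
	assumes g: "g absolutely_integrable_on {a..b}"
		and f: "\<And>x y. a \<le> x \<Longrightarrow> x \<le> y \<Longrightarrow> y \<le> b \<Longrightarrow> (g has_integral (f y - f x)) {x..y}"
	shows "abs_continuous_on a b f"
	unfolding abs_continuous_on_def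
proof (intro allI impI)
	fix e :: real assume e: "e > 0"
	define \<phi> where "\<phi> x = cmod (g x)" for x
	have \<phi>: "\<phi> absolutely_integrable_on {a..b}"
		using absolutely_integrable_norm[OF g] by (simp add: \<phi>_def[abs_def] o_def)
	define m where "m k x = min (\<phi> x) (real k)" for k :: nat and x
	have m: "m k absolutely_integrable_on {a..b}" for k
		unfolding m_def by (intro absolutely_integrable_min_1 \<phi> absolutely_integrable_on_const) auto
	have "(\<lambda>k. integral {a..b} (m k)) \<longlonglongrightarrow> integral {a..b} \<phi>"
	proof (rule dominated_convergence(2))
		show "m k integrable_on {a..b}" for k using m by (rule set_lebesgue_integral_eq_integral)
		show "\<phi> integrable_on {a..b}" using \<phi> by (rule set_lebesgue_integral_eq_integral)
		show "norm (m k x) \<le> \<phi> x" for k x by (auto simp: m_def \<phi>_def)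
		show "(\<lambda>k. m k x) \<longlonglongrightarrow> \<phi> x" for x
		proof (rule tendsto_eventually)
			obtain N where "\<phi> x < real N" using reals_Archimedean2 by blast
			then show "\<forall>\<^sub>F k in sequentially. m k x = \<phi> x"
				unfolding eventually_sequentially m_def by (intro exI[of _ N]) (auto simp: min_def)
		qed
	qed
	then obtain k where k: "\<bar>integral {a..b} (m k) - integral {a..b} \<phi>\<bar> < e/2"
		using e by (metis half_gt_zero LIMSEQ_D order_refl real_norm_def)
	define \<psi> where "\<psi> x = \<phi> x - m k x" for x
	have \<psi>: "\<psi> absolutely_integrable_on {a..b}" unfolding \<psi>_def by (intro set_integral_diff \<phi> m)
	have \<psi>I: "integral {a..b} \<psi> < e/2"
	proof -
		have "integral {a..b} \<psi> = integral {a..b} \<phi> - integral {a..b} (m k)"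
			unfolding \<psi>_def
			by (subst Henstock_Kurzweil_Integration.integral_diff) (auto intro: set_lebesgue_integral_eq_integral \<phi> m)
		then show ?thesis using k by linarith
	qed
	define d where "d = e / (2 * real (Suc k))"
	have d: "d > 0" using e by (simp add: d_def)
	show "\<exists>d>0. \<forall>\<D> T. \<D> division_of T \<and> T \<subseteq> {a..b} \<and> (\<Sum>K\<in>\<D>. Sup K - Inf K) < d \<longrightarrow>
			(\<Sum>K\<in>\<D>. cmod (f (Sup K) - f (Inf K))) < e"
	proof (intro exI[of _ d] conjI d allI impI)
		fix \<D> T assume D: "\<D> division_of T \<and> T \<subseteq> {a..b} \<and> (\<Sum>K\<in>\<D>. Sup K - Inf K) < d"
		note D' = division_ofD[OF conjunct1[OF D]]
		have K: "K = {Inf K..Sup K} \<and> Inf K \<le> Sup K \<and> a \<le> Inf K \<and> Sup K \<le> b \<and> K \<subseteq> {a..b}" if KD: "K \<in> \<D>" for K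
		proof -
			obtain l r where lr: "K = {l..r}" "K \<noteq> {}" using D'(3,4)[OF KD] by auto
			moreover have "K \<subseteq> {a..b}" using D D'(2)[OF KD] by auto
			ultimately show ?thesis by auto
		qed
		have \<psi>K: "\<psi> integrable_on K" if "K \<in> \<D>" for K
			using K[OF that] absolutely_integrable_on_subinterval[OF \<psi>, of "Inf K" "Sup K"]
			by (metis set_lebesgue_integral_eq_integral(1))
		have "(\<Sum>K\<in>\<D>. cmod (f (Sup K) - f (Inf K))) \<le> (\<Sum>K\<in>\<D>. integral K \<psi> + real k * (Sup K - Inf K))"
		proof (rule sum_mono)
			fix K assume KD: "K \<in> \<D>"
			define l r where "l = Inf K" and "r = Sup K"
			have lr: "K = {l..r}" "l \<le> r" "a \<le> l" "r \<le> b" using K[OF KD] by (auto simp: l_def r_def)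
			have hi: "(g has_integral (f r - f l)) {l..r}" by (rule f) (use lr in auto)
			have h2: "((\<lambda>x. \<psi> x + real k) has_integral (integral K \<psi> + real k * (r - l))) {l..r}"
				using has_integral_add[OF integrable_integral[OF \<psi>K[OF KD]] , of "\<lambda>x. real k" "real k * (r - l)"]
					has_integral_const_real[of "real k" l r] lr by (simp add: mult.commute)
			have "norm (integral {l..r} g) \<le> integral {l..r} (\<lambda>x. \<psi> x + real k)"
			proof (rule integral_norm_bound_integral)
				show "g integrable_on {l..r}" using hi by blast
				show "(\<lambda>x. \<psi> x + real k) integrable_on {l..r}" using h2 by blast
				show "norm (g x) \<le> \<psi> x + real k" for x by (auto simp: \<psi>_def m_def \<phi>_def)
			qed
			then show "cmod (f (Sup K) - f (Inf K)) \<le> integral K \<psi> + real k * (Sup K - Inf K)"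
				using integral_unique[OF hi] integral_unique[OF h2] by (simp add: l_def r_def)
		qed
		also have "\<dots> = (\<Sum>K\<in>\<D>. integral K \<psi>) + real k * (\<Sum>K\<in>\<D>. Sup K - Inf K)"
			by (simp add: sum.distrib sum_distrib_left)
		also have "(\<Sum>K\<in>\<D>. integral K \<psi>) = integral T \<psi>"
			by (rule integral_combine_division_bottomup[symmetric]) (use D \<psi>K in auto)
		also have "integral T \<psi> \<le> integral {a..b} \<psi>"
		proof (rule integral_subset_le)
			show "\<psi> integrable_on T" by (rule integrable_combine_division[OF conjunct1[OF D]]) (use \<psi>K in auto)
			show "\<psi> integrable_on {a..b}" using \<psi> by (rule set_lebesgue_integral_eq_integral)
		qed (use D in \<open>auto simp: \<psi>_def m_def\<close>)
		also have "real k * (\<Sum>K\<in>\<D>. Sup K - Inf K) \<le> real (Suc k) * d"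
			by (rule mult_mono) (use D d in \<open>auto intro!: sum_nonneg dest: K\<close>)
		also have "real (Suc k) * d = e/2" by (simp add: d_def del: of_nat_Suc)
		finally show "(\<Sum>K\<in>\<D>. cmod (f (Sup K) - f (Inf K))) < e" using \<psi>I by simp
	qed
qed

lemma abs_continuous_on_imp_continuous_on:
	assumes f: "abs_continuous_on a b f"
	shows "continuous_on {a..b} f"
	unfolding continuous_on_iff
proof (intro ballI allI impI)
	fix x e :: real assume x: "x \<in> {a..b}" and e: "e > 0"
	obtain d where d: "d > 0" and D: "\<And>(J :: nat set) u v. finite J \<Longrightarrow>
			(\<And>j. j \<in> J \<Longrightarrow> a \<le> u j \<and> u j \<le> v j \<and> v j \<le> b) \<Longrightarrow>
			nonoverlapping u v J \<Longrightarrow> (\<Sum>j\<in>J. v j - u j) < d \<Longrightarrow>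
			(\<Sum>j\<in>J. cmod (f (v j) - f (u j))) < e"
		by (rule abs_continuous_onD[OF f e]) blast
	have D1: "cmod (f t - f s) < e" if "a \<le> s" "s \<le> t" "t \<le> b" "t - s < d" for s t
		using D[of "{0}" "\<lambda>_. s" "\<lambda>_. t"] that by simp
	show "\<exists>d>0. \<forall>x'\<in>{a..b}. dist x' x < d \<longrightarrow> dist (f x') (f x) < e"
	proof (intro exI[of _ d] conjI d ballI impI)
		fix x' assume x': "x' \<in> {a..b}" "dist x' x < d"
		then show "dist (f x') (f x) < e"
			using D1[of x x'] D1[of x' x] x by (cases "x \<le> x'") (auto simp: dist_norm norm_minus_commute)
	qed
qed

lemma abs_continuous_on_mult:
	assumes f: "abs_continuous_on a b f" and h: "abs_continuous_on a b h"
	shows "abs_continuous_on a b (\<lambda>x. f x * h x)"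
proof -
	have "bounded (f ` {a..b})" "bounded (h ` {a..b})"
		using f h by (auto intro!: compact_imp_bounded compact_continuous_image abs_continuous_on_imp_continuous_on)
	then obtain B1 B2 where B1: "\<And>x. x \<in> {a..b} \<Longrightarrow> cmod (f x) \<le> B1" and B2: "\<And>x. x \<in> {a..b} \<Longrightarrow> cmod (h x) \<le> B2"
		unfolding bounded_iff by (metis imageI)
	define B where "B = max 1 (max B1 B2)"
	have B: "B > 0" "\<And>x. x \<in> {a..b} \<Longrightarrow> cmod (f x) \<le> B \<and> cmod (h x) \<le> B"
		using B1 B2 by (fastforce simp: B_def)+
	show ?thesis
		unfolding abs_continuous_on_def
	proof (intro allI impI)
		fix e :: real assume "e > 0"
		then have e': "e / (2 * B) > 0" using B by simp
		obtain d1 where d1: "d1 > 0" "\<And>\<D> T. \<D> division_of T \<and> T \<subseteq> {a..b} \<and> (\<Sum>K\<in>\<D>. Sup K - Inf K) < d1 \<Longrightarrow>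
				(\<Sum>K\<in>\<D>. cmod (f (Sup K) - f (Inf K))) < e / (2*B)"
			using f e' unfolding abs_continuous_on_def by meson
		obtain d2 where d2: "d2 > 0" "\<And>\<D> T. \<D> division_of T \<and> T \<subseteq> {a..b} \<and> (\<Sum>K\<in>\<D>. Sup K - Inf K) < d2 \<Longrightarrow>
				(\<Sum>K\<in>\<D>. cmod (h (Sup K) - h (Inf K))) < e / (2*B)"
			using h e' unfolding abs_continuous_on_def by meson
		show "\<exists>d>0. \<forall>\<D> T. \<D> division_of T \<and> T \<subseteq> {a..b} \<and> (\<Sum>K\<in>\<D>. Sup K - Inf K) < d \<longrightarrow>
				(\<Sum>K\<in>\<D>. cmod (f (Sup K) * h (Sup K) - f (Inf K) * h (Inf K))) < e"
		proof (intro exI[of _ "min d1 d2"] conjI allI impI)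
			show "min d1 d2 > 0" using d1 d2 by auto
			fix \<D> T assume D: "\<D> division_of T \<and> T \<subseteq> {a..b} \<and> (\<Sum>K\<in>\<D>. Sup K - Inf K) < min d1 d2"
			note D' = division_ofD[OF conjunct1[OF D]]
			have "(\<Sum>K\<in>\<D>. cmod (f (Sup K) * h (Sup K) - f (Inf K) * h (Inf K)))
					\<le> (\<Sum>K\<in>\<D>. B * cmod (h (Sup K) - h (Inf K)) + B * cmod (f (Sup K) - f (Inf K)))"
			proof (rule sum_mono)
				fix K assume KD: "K \<in> \<D>"
				obtain l r where lr: "K = {l..r}" "K \<noteq> {}" using D'(3,4)[OF KD] by auto
				moreover have "K \<subseteq> {a..b}" using D D'(2)[OF KD] by auto
				ultimately have in_ab: "Sup K \<in> {a..b}" "Inf K \<in> {a..b}" by auto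
				have "f (Sup K) * h (Sup K) - f (Inf K) * h (Inf K)
					= f (Sup K) * (h (Sup K) - h (Inf K)) + h (Inf K) * (f (Sup K) - f (Inf K))"
					by (simp add: algebra_simps)
				then have "cmod (f (Sup K) * h (Sup K) - f (Inf K) * h (Inf K))
					\<le> cmod (f (Sup K)) * cmod (h (Sup K) - h (Inf K)) + cmod (h (Inf K)) * cmod (f (Sup K) - f (Inf K))"
					by (metis norm_mult norm_triangle_ineq)
				also have "\<dots> \<le> B * cmod (h (Sup K) - h (Inf K)) + B * cmod (f (Sup K) - f (Inf K))"
					by (intro add_mono mult_right_mono) (use B in_ab in auto)
				finally show "cmod (f (Sup K) * h (Sup K) - f (Inf K) * h (Inf K))
					\<le> B * cmod (h (Sup K) - h (Inf K)) + B * cmod (f (Sup K) - f (Inf K))" .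
			qed
			also have "\<dots> = B * (\<Sum>K\<in>\<D>. cmod (h (Sup K) - h (Inf K))) + B * (\<Sum>K\<in>\<D>. cmod (f (Sup K) - f (Inf K)))"
				by (simp add: sum.distrib sum_distrib_left)
			also have "\<dots> < B * (e / (2*B)) + B * (e / (2*B))"
				by (intro add_strict_mono mult_strict_left_mono d1(2)[of _ T] d2(2)[of _ T] B) (use D in auto)
			also have "\<dots> = e" using B by simp
			finally show "(\<Sum>K\<in>\<D>. cmod (f (Sup K) * h (Sup K) - f (Inf K) * h (Inf K))) < e" .
		qed
	qed
qed

section \<open>The Hilbert space of square integrable functions\<close>

lemma L2_eq_iff:
	assumes "sq_integrable f" "sq_integrable g"
	shows "L2 f = L2 g \<longleftrightarrow> (AE x in half_line. f x = g x)"
	using Quotient_rel[OF Quotient_l2, of f g] assms by (auto simp: l2_rel_def)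

lemma L2_cases: obtains f where "sq_integrable f" "u = L2 f"
	by (induct u rule: l2.abs_induct) (auto simp: l2_rel_def)

lemma L2_add: "sq_integrable f \<Longrightarrow> sq_integrable g \<Longrightarrow> L2 f + L2 g = L2 (\<lambda>x. f x + g x)"
	by (rule plus_l2.abs_eq) (auto simp: l2_rel_def)

lemma L2_uminus: "sq_integrable f \<Longrightarrow> - L2 f = L2 (\<lambda>x. - f x)"
	by (rule uminus_l2.abs_eq) (auto simp: l2_rel_def)

lemma L2_diff: "sq_integrable f \<Longrightarrow> sq_integrable g \<Longrightarrow> L2 f - L2 g = L2 (\<lambda>x. f x - g x)"
	by (simp add: minus_l2_def L2_uminus L2_add sq_integrable_uminus)

lemma L2_scale: "sq_integrable f \<Longrightarrow> c *\<^sub>C L2 f = L2 (\<lambda>x. c * f x)"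
	by (rule l2_scale.abs_eq) (auto simp: l2_rel_def)

lemma L2_zero: "L2 (\<lambda>x. 0) = 0" by (simp add: zero_l2_def)

lemma l2_inner_L2:
	"sq_integrable f \<Longrightarrow> sq_integrable g \<Longrightarrow> l2_inner (L2 f) (L2 g) = (LINT x|half_line. f x * cnj (g x))"
	by (rule l2_inner.abs_eq) (auto simp: l2_rel_def)

lemma norm_L2_sq: "sq_integrable f \<Longrightarrow> (norm (L2 f))\<^sup>2 = (LINT x|half_line. (cmod (f x))\<^sup>2)"
	by (simp add: norm_l2_def Re_l2_inner_L2_self)

lemma sq_integrable_diff: "sq_integrable f \<Longrightarrow> sq_integrable g \<Longrightarrow> sq_integrable (\<lambda>x. f x - g x)"
	using sq_integrable_add[OF _ sq_integrable_uminus] by fastforce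

lemma AE_half_line_iff: "(AE x in half_line. P x) \<longleftrightarrow> negligible {x \<in> {0<..}. \<not> P x}"
proof -
	have "(AE x in half_line. P x) \<longleftrightarrow> (AE x in lebesgue. x \<in> {0<..} \<longrightarrow> P x)"
		by (rule AE_restrict_space_iff) simp
	also have "\<dots> \<longleftrightarrow> {x. \<not> (x \<in> {0<..} \<longrightarrow> P x)} \<in> null_sets lebesgue"
		by (simp add: completion.AE_iff_null_sets)
	also have "{x. \<not> (x \<in> {0<..} \<longrightarrow> P x)} = {x \<in> {0<..}. \<not> P x}" by auto
	finally show ?thesis by (simp add: negligible_iff_null_sets)
qed

lemma measurable_half_line_cong_AE:
	fixes f g :: "real \<Rightarrow> 'a::topological_space"
	assumes f: "f \<in> borel_measurable half_line" and fg: "AE x in half_line. f x = g x"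
	shows "g \<in> borel_measurable half_line"
proof (rule measurableI)
	fix A :: "'a set" assume A: "A \<in> sets borel"
	define N where "N = {x \<in> {0<..}. f x \<noteq> g x}"
	have N: "negligible N" using fg by (simp add: AE_half_line_iff N_def)
	have "f -` A \<inter> space half_line \<in> sets half_line" using f A by (rule measurable_sets)
	then have "f -` A \<inter> {0<..} \<in> sets lebesgue" by (simp add: sets_restrict_space_iff)
	moreover have "N \<in> sets lebesgue" "g -` A \<inter> N \<in> sets lebesgue"
		using N negligible_subset[OF N, of "g -` A \<inter> N"] by (auto simp: negligible_imp_sets)
	ultimately have "(f -` A \<inter> {0<..} - N) \<union> (g -` A \<inter> N) \<in> sets lebesgue" by auto
	moreover have "g -` A \<inter> {0<..} = (f -` A \<inter> {0<..} - N) \<union> (g -` A \<inter> N)" by (auto simp: N_def)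
	ultimately have "g -` A \<inter> {0<..} \<in> sets lebesgue" by argo
	then show "g -` A \<inter> space half_line \<in> sets half_line" by (simp add: sets_restrict_space_iff)
qed auto

lemma sq_integrable_cong_AE:
	assumes f: "sq_integrable f" and fg: "AE x in half_line. f x = g x"
	shows "sq_integrable g"
proof -
	have m: "g \<in> borel_measurable half_line"
		by (rule measurable_half_line_cong_AE[OF _ fg]) (use f in \<open>simp add: sq_integrable_def\<close>)
	have "integrable half_line (\<lambda>x. (cmod (g x))\<^sup>2)"
	proof (rule Bochner_Integration.integrable_cong_AE_imp)
		show "integrable half_line (\<lambda>x. (cmod (f x))\<^sup>2)" using f by (simp add: sq_integrable_def)
		show "AE x in half_line. (cmod (f x))\<^sup>2 = (cmod (g x))\<^sup>2" using fg by eventually_elim simp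
	qed (use m in measurable)
	with m show ?thesis by (simp add: sq_integrable_def)
qed

lemma Im_l2_inner: "Im (l2_inner u v) = inner ((- \<i>) *\<^sub>C u) v"
	unfolding inner_l2_def by (simp add: l2_inner_scale_left del: l2.scale_minus_left)

lemma norm_l2_scale: "norm (c *\<^sub>C u) = cmod c * norm u"
proof -
	have "l2_inner (c *\<^sub>C u) (c *\<^sub>C u) = c * cnj c * l2_inner u u"
		by (metis (no_types, lifting) complex_cnj_mult l2_inner_commute l2_inner_scale_left mult.assoc mult.commute)
	also have "c * cnj c = cpx ((cmod c)\<^sup>2)" by (simp add: complex_norm_square[symmetric])
	finally show ?thesis
		unfolding norm_l2_def by (simp add: real_sqrt_mult)
qed

lemma bounded_linear_l2_scale: "bounded_linear (\<lambda>u. c *\<^sub>C u :: l2)"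
	by (rule bounded_linear_intro[where K="cmod c"])
		 (auto simp: l2.scale_right_distrib scaleR_l2_def l2.scale_scale norm_l2_scale mult.commute)

lemma tendsto_l2_inner:
	assumes "(X \<longlongrightarrow> u) F" "(Y \<longlongrightarrow> v) F"
	shows "((\<lambda>n. l2_inner (X n) (Y n)) \<longlongrightarrow> l2_inner u v) F"
proof -
	have "((\<lambda>n. Complex (inner (X n) (Y n)) (inner ((- \<i>) *\<^sub>C X n) (Y n))) \<longlongrightarrow> Complex (inner u v) (inner ((- \<i>) *\<^sub>C u) v)) F"
		by (intro tendsto_Complex tendsto_inner assms bounded_linear.tendsto[OF bounded_linear_l2_scale])
	moreover have "Complex (inner x y) (inner ((- \<i>) *\<^sub>C x) y) = l2_inner x y" for x y
		by (rule complex_eqI) (simp_all add: Im_l2_inner inner_l2_def)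
	ultimately show ?thesis by simp
qed

lemma l2_inner_add_right: "l2_inner w (u + v) = l2_inner w u + l2_inner w v"
	by (metis complex_cnj_add l2_inner_add_left l2_inner_commute)

lemma l2_inner_scale_right: "l2_inner u (c *\<^sub>C v) = cnj c * l2_inner u v"
	by (metis complex_cnj_mult l2_inner_commute l2_inner_scale_left)

lemma l2_inner_minus_left: "l2_inner (- u) v = - l2_inner u v"
	using l2_inner_scale_left[of "-1" u v] by (simp add: l2.scale_minus_left)

lemma l2_inner_minus_right: "l2_inner u (- v) = - l2_inner u v"
	by (metis complex_cnj_minus l2_inner_commute l2_inner_minus_left)

lemma l2_inner_diff_left: "l2_inner (u - v) w = l2_inner u w - l2_inner v w"
	using l2_inner_add_left[of u "- v" w] by (simp add: l2_inner_minus_left)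

lemma l2_inner_diff_right: "l2_inner w (u - v) = l2_inner w u - l2_inner w v"
	using l2_inner_add_right[of w u "- v"] by (simp add: l2_inner_minus_right)

lemma l2_inner_zero [simp]: "l2_inner 0 u = 0" "l2_inner u 0 = 0"
	using l2_inner_diff_left[of u u u] l2_inner_diff_right[of u u u] by simp_all

lemma l2_inner_self: "l2_inner u u = cpx ((norm u)\<^sup>2)"
proof (rule complex_eqI)
	show "Re (l2_inner u u) = Re (cpx ((norm u)\<^sup>2))"
		by (simp add: power2_norm_eq_inner inner_l2_def)
	have "Im (l2_inner u u) = Im (cnj (l2_inner u u))" by (metis l2_inner_commute)
	then show "Im (l2_inner u u) = Im (cpx ((norm u)\<^sup>2))" by simp
qed

lemma cmod_l2_inner_le: "cmod (l2_inner u v) \<le> norm u * norm v"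
proof (cases "l2_inner u v = 0")
	case False
	define c where "c = cnj (sgn (l2_inner u v))"
	have c: "cmod c = 1" using False by (simp add: c_def norm_sgn)
	have "l2_inner (c *\<^sub>C u) v = cpx (cmod (l2_inner u v))"
		using False by (simp add: c_def l2_inner_scale_left sgn_eq mult.commute[of "cnj _"] complex_norm_square[symmetric] power2_eq_square)
	then have "cmod (l2_inner u v) = inner (c *\<^sub>C u) v" by (simp add: inner_l2_def)
	also have "\<dots> \<le> norm (c *\<^sub>C u) * norm v" by (rule norm_cauchy_schwarz)
	finally show ?thesis by (simp add: norm_l2_scale c)
qed simp

lemma nn_integral_sq_integrable:
	"sq_integrable h \<Longrightarrow> (\<integral>\<^sup>+x. ennreal ((cmod (h x))\<^sup>2) \<partial>half_line) = ennreal ((norm (L2 h))\<^sup>2)"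
	by (subst norm_L2_sq) (auto simp: sq_integrable_def intro: nn_integral_eq_integral)

text \<open>
	Along a subsequence with increments at most \<open>(1/2)^k\<close>, even the sum of the squared increments with
	weights \<open>2^k\<close> is integrable. So almost everywhere the increments decay geometrically and the
	subsequence converges pointwise; Fatou's lemma estimates its distance to the limit.
\<close>

lemma l2_complete:
	fixes X :: "nat \<Rightarrow> l2"
	assumes X: "Cauchy X"
	obtains u where "X \<longlonglongrightarrow> u"
proof -
	have "\<exists>N. \<forall>m\<ge>N. \<forall>n\<ge>N. norm (X m - X n) < (1/2)^k" for k
		using CauchyD[OF X, of "(1/2)^k"] by simp
	then obtain N where N: "\<And>k m n. m \<ge> N k \<Longrightarrow> n \<ge> N k \<Longrightarrow> norm (X m - X n) < (1/2)^k" by metis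
	define r where "r k = (\<Sum>j\<le>k. N j + 1)" for k
	have r_mono: "strict_mono r" by (auto simp: r_def strict_mono_Suc_iff)
	have r_ge: "r k \<ge> N k" for k
		unfolding r_def by (rule order_trans[OF _ member_le_sum[of k]]) auto
	have step: "norm (X (r n) - X (r k)) \<le> (1/2)^k" if "k \<le> n" for k n
		using N[of k "r n" "r k"] r_ge[of k] strict_mono_less_eq[OF r_mono, of k n] that by simp
	have "\<exists>f. sq_integrable f \<and> u = L2 f" for u using L2_cases by metis
	then obtain rep where rep: "\<And>u. sq_integrable (rep u) \<and> u = L2 (rep u)" by metis
	define f where "f k = rep (X (r k))" for k
	have f: "sq_integrable (f k)" "X (r k) = L2 (f k)" for k using rep unfolding f_def by auto
	have [measurable]: "f k \<in> borel_measurable half_line" for k using f(1)[of k] by (simp add: sq_integrable_def)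
	have nn: "(\<integral>\<^sup>+x. ennreal ((cmod (f n x - f k x))\<^sup>2) \<partial>half_line) \<le> ennreal ((1/4)^k)" if "k \<le> n" for k n
	proof -
		have "(norm (L2 (\<lambda>x. f n x - f k x)))\<^sup>2 \<le> ((1/2)^k)\<^sup>2"
			using step[OF that] by (intro power_mono) (simp_all add: f L2_diff)
		also have "\<dots> = (1/4)^k" by (simp add: power_divide power_mult[symmetric] mult.commute[of k] power_mult[of 2 2 k])
		finally show ?thesis by (simp add: nn_integral_sq_integrable[OF sq_integrable_diff[OF f(1) f(1)]] ennreal_leI)
	qed
	define S where "S x = (\<Sum>k. ennreal (2^k * (cmod (f (Suc k) x - f k x))\<^sup>2))" for x
	have "(\<integral>\<^sup>+x. S x \<partial>half_line) = (\<Sum>k. \<integral>\<^sup>+x. ennreal (2^k * (cmod (f (Suc k) x - f k x))\<^sup>2) \<partial>half_line)"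
		unfolding S_def by (rule nn_integral_suminf) measurable
	also have "\<dots> \<le> (\<Sum>k. ennreal ((1/2)^k))"
	proof (rule suminf_le)
		fix k
		have "(\<integral>\<^sup>+x. ennreal (2^k * (cmod (f (Suc k) x - f k x))\<^sup>2) \<partial>half_line)
				= ennreal (2^k) * (\<integral>\<^sup>+x. ennreal ((cmod (f (Suc k) x - f k x))\<^sup>2) \<partial>half_line)"
			by (simp add: ennreal_mult nn_integral_cmult)
		also have "\<dots> \<le> ennreal (2^k) * ennreal ((1/4)^k)" by (intro mult_left_mono nn) auto
		also have "\<dots> = ennreal ((1/2)^k)" by (simp add: ennreal_mult[symmetric] power_mult_distrib[symmetric])
		finally show "(\<integral>\<^sup>+x. ennreal (2^k * (cmod (f (Suc k) x - f k x))\<^sup>2) \<partial>half_line) \<le> ennreal ((1/2)^k)" .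
	qed auto
	also have "\<dots> < \<infinity>" by (simp add: ennreal_suminf_neq_top less_top[symmetric] summable_geometric)
	finally have "AE x in half_line. S x \<noteq> \<infinity>"
		by (intro nn_integral_PInf_AE) (auto simp: S_def)
	then have conv: "AE x in half_line. (\<lambda>n. f n x) \<longlonglongrightarrow> lim (\<lambda>n. f n x)"
	proof eventually_elim
		case (elim x)
		define M where "M = enn2real (S x)"
		have "cmod (f (Suc k) x - f k x) \<le> sqrt M * (sqrt (1/2))^k" for k
		proof -
			have "ennreal (2^k * (cmod (f (Suc k) x - f k x))\<^sup>2) \<le> (\<Sum>j<Suc k. ennreal (2^j * (cmod (f (Suc j) x - f j x))\<^sup>2))"
				by (rule member_le_sum) auto
			also have "\<dots> \<le> S x" unfolding S_def by (rule sum_le_suminf) auto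
			also have "S x = ennreal M" using elim by (simp add: M_def less_top)
			finally have "2^k * (cmod (f (Suc k) x - f k x))\<^sup>2 \<le> M" by (simp add: M_def ennreal_le_iff)
			then have "(cmod (f (Suc k) x - f k x))\<^sup>2 \<le> M * (1/2)^k" by (simp add: field_simps power_one_over)
			then have "cmod (f (Suc k) x - f k x) \<le> sqrt (M * (1/2)^k)" by (rule real_le_rsqrt)
			then show ?thesis by (simp add: real_sqrt_mult real_sqrt_power)
		qed
		moreover have "summable (\<lambda>k. sqrt M * (sqrt (1/2))^k)"
			by (intro summable_mult summable_geometric) simp
		ultimately have "summable (\<lambda>k. f (Suc k) x - f k x)" by (blast intro: summable_comparison_test')
		then have "convergent (\<lambda>n. f n x - f 0 x)"
			by (simp add: summable_iff_convergent sum_lessThan_telescope[of "\<lambda>n. f n x"])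
		then show ?case using convergent_diff_const_right_iff[of "\<lambda>n. f n x" "f 0 x"] convergent_LIMSEQ_iff by blast
	qed
	define F where "F x = lim (\<lambda>k. f k x)" for x
	have [measurable]: "F \<in> borel_measurable half_line" unfolding F_def by measurable
	have Fatou: "(\<integral>\<^sup>+x. ennreal ((cmod (F x - f k x))\<^sup>2) \<partial>half_line) \<le> ennreal ((1/4)^k)" for k
	proof -
		have "(\<integral>\<^sup>+x. ennreal ((cmod (F x - f k x))\<^sup>2) \<partial>half_line) = (\<integral>\<^sup>+x. liminf (\<lambda>n. ennreal ((cmod (f n x - f k x))\<^sup>2)) \<partial>half_line)"
		proof (rule nn_integral_cong_AE)
			show "AE x in half_line. ennreal ((cmod (F x - f k x))\<^sup>2) = liminf (\<lambda>n. ennreal ((cmod (f n x - f k x))\<^sup>2))"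
				using conv
			proof eventually_elim
				case (elim x)
				have "(\<lambda>n. ennreal ((cmod (f n x - f k x))\<^sup>2)) \<longlonglongrightarrow> ennreal ((cmod (F x - f k x))\<^sup>2)"
					by (intro tendsto_intros tendsto_ennrealI) (use elim in \<open>simp add: F_def\<close>)
				then show ?case by (rule lim_imp_Liminf[OF trivial_limit_sequentially, symmetric])
			qed
		qed
		also have "\<dots> \<le> liminf (\<lambda>n. \<integral>\<^sup>+x. ennreal ((cmod (f n x - f k x))\<^sup>2) \<partial>half_line)"
			by (rule nn_integral_liminf) measurable
		also have "\<dots> \<le> limsup (\<lambda>n. \<integral>\<^sup>+x. ennreal ((cmod (f n x - f k x))\<^sup>2) \<partial>half_line)"
			by (rule Liminf_le_Limsup) simp
		also have "\<dots> \<le> ennreal ((1/4)^k)"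
			by (rule Limsup_bounded) (use nn in \<open>auto simp: eventually_sequentially\<close>)
		finally show ?thesis .
	qed
	have sqd: "sq_integrable (\<lambda>x. F x - f k x)" for k
		unfolding sq_integrable_def
		by (intro conjI integrableI_bounded) (use order.strict_trans1[OF Fatou[of k]] in auto)
	have sqF: "sq_integrable F" using sq_integrable_add[OF sqd[of 0] f(1)[of 0]] by simp
	have "norm (X (r k) - L2 F) \<le> (1/2)^k" for k
	proof -
		have "ennreal ((norm (L2 F - X (r k)))\<^sup>2) \<le> ennreal ((1/4)^k)"
			using Fatou[of k] by (simp add: f(2) L2_diff[OF sqF f(1)] nn_integral_sq_integrable[OF sqd])
		then have "(norm (L2 F - X (r k)))\<^sup>2 \<le> ((1/2)^k)\<^sup>2"
			by (simp add: power_divide power_mult[symmetric] mult.commute[of k] power_mult[of 2 2 k])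
		then have "norm (L2 F - X (r k)) \<le> (1/2)^k" by (rule power2_le_imp_le) simp
		then show ?thesis by (simp add: norm_minus_commute)
	qed
	then have "(\<lambda>k. X (r k) - L2 F) \<longlonglongrightarrow> 0"
		by (intro Lim_null_comparison[OF _ LIMSEQ_realpow_zero[of "1/2"]]) auto
	then have "(\<lambda>k. X (r k)) \<longlonglongrightarrow> L2 F" by (simp add: LIM_zero_iff)
	then have "X \<longlonglongrightarrow> L2 F"
		using Cauchy_converges_subseq[OF X r_mono] by (simp add: o_def)
	then show ?thesis by (rule that)
qed

section \<open>Forms of operators that factor through a closed operator\<close>

text \<open>
	\<open>m\<close> is the point of \<open>M\<close> nearest to \<open>x\<close>; a minimizing sequence is Cauchy by the parallelogram identity.
\<close>

lemma orthogonal_to_complete_subspace: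
	fixes M :: "'a::real_inner set"
	assumes M: "subspace M" "complete M" and x: "x \<notin> M"
	obtains m where "m \<in> M" "\<And>m'. m' \<in> M \<Longrightarrow> inner (x - m) m' = 0"
proof -
	define d where "d = infdist x M"
	have ne: "M \<noteq> {}" using M(1) subspace_0 by blast
	have d_le: "d \<le> norm (x - m)" if "m \<in> M" for m
		unfolding d_def using infdist_le[OF that, of x] by (simp add: dist_norm)
	have d0: "0 \<le> d" by (simp add: d_def infdist_nonneg)
	have "\<exists>m\<in>M. norm (x - m) < d + 1 / real (Suc n)" for n
	proof -
		have "infdist x M < d + 1 / real (Suc n)" by (simp add: d_def)
		then have "Inf ((\<lambda>m. dist x m) ` M) < d + 1 / real (Suc n)" using ne by (simp add: infdist_def)
		then show ?thesis using cInf_lessD[of "(\<lambda>m. dist x m) ` M"] ne by (auto simp: dist_norm)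
	qed
	then obtain m where m: "\<And>n. m n \<in> M" "\<And>n. norm (x - m n) < d + 1 / real (Suc n)" by metis
	have lim: "(\<lambda>n. norm (x - m n)) \<longlonglongrightarrow> d"
	proof (rule tendsto_sandwich[of "\<lambda>_. d" _ _ "\<lambda>n. d + 1 / real (Suc n)"])
		show "(\<lambda>n. d + 1 / real (Suc n)) \<longlonglongrightarrow> d"
			using tendsto_add[OF tendsto_const LIMSEQ_inverse_real_of_nat, of d] by (simp add: inverse_eq_divide)
		show "\<forall>\<^sub>F n in sequentially. norm (x - m n) \<le> d + 1 / real (Suc n)"
			using m(2) by (intro always_eventually allI less_imp_le)
		show "\<forall>\<^sub>F n in sequentially. d \<le> norm (x - m n)"
			using d_le[OF m(1)] by simp
	qed simp
	have par: "(norm (m i - m j))\<^sup>2 \<le> 2 * (norm (x - m i))\<^sup>2 + 2 * (norm (x - m j))\<^sup>2 - 4 * d\<^sup>2" for i j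
	proof -
		define z where "z = (1/2) *\<^sub>R (m i + m j)"
		have "z \<in> M" unfolding z_def using M(1) m by (simp add: subspace_add subspace_scale)
		then have "d\<^sup>2 \<le> (norm (x - z))\<^sup>2" using d_le d0 by (intro power_mono) auto
		moreover have "(norm (m i - m j))\<^sup>2 + 4 * (norm (x - z))\<^sup>2 = 2 * (norm (x - m i))\<^sup>2 + 2 * (norm (x - m j))\<^sup>2"
			unfolding z_def power2_norm_eq_inner
			by (simp add: inner_diff_left inner_diff_right inner_add_left inner_add_right inner_commute algebra_simps)
		ultimately show ?thesis by linarith
	qed
	have "Cauchy m"
	proof (rule metric_CauchyI)
		fix e :: real assume e: "e > 0"
		have "(\<lambda>n. (norm (x - m n))\<^sup>2) \<longlonglongrightarrow> d\<^sup>2" by (rule tendsto_power[OF lim])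
		moreover have "e\<^sup>2 / 4 > 0" using e by simp
		ultimately obtain N where N: "\<And>n. n \<ge> N \<Longrightarrow> \<bar>(norm (x - m n))\<^sup>2 - d\<^sup>2\<bar> < e\<^sup>2/4"
			by (metis LIMSEQ_D real_norm_def)
		show "\<exists>N. \<forall>i\<ge>N. \<forall>j\<ge>N. dist (m i) (m j) < e"
		proof (intro exI[of _ N] allI impI)
			fix i j assume "N \<le> i" "N \<le> j"
			then have "(norm (m i - m j))\<^sup>2 < e\<^sup>2" using N[of i] N[of j] par[of i j] by linarith
			then show "dist (m i) (m j) < e" using e by (simp add: dist_norm power_less_imp_less_base)
		qed
	qed
	with M(2) m obtain l where l: "l \<in> M" "m \<longlonglongrightarrow> l" unfolding complete_def by metis
	have nl: "norm (x - l) = d"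
		using tendsto_norm[OF tendsto_diff[OF tendsto_const l(2)], of x] lim by (rule LIMSEQ_unique)
	have "inner (x - l) m' = 0" if m': "m' \<in> M" for m'
	proof (cases "m' = 0")
		case False
		define t where "t = inner (x - l) m' / (norm m')\<^sup>2"
		have "l + t *\<^sub>R m' \<in> M" using M(1) l m' by (simp add: subspace_add subspace_scale)
		then have "d\<^sup>2 \<le> (norm (x - (l + t *\<^sub>R m')))\<^sup>2" using d_le d0 by (intro power_mono) auto
		also have "(norm (x - (l + t *\<^sub>R m')))\<^sup>2 = (norm (x - l))\<^sup>2 - 2 * t * inner (x - l) m' + t\<^sup>2 * (norm m')\<^sup>2"
			unfolding power2_norm_eq_inner
			by (simp add: inner_diff_left inner_diff_right inner_add_left inner_add_right inner_commute algebra_simps power2_eq_square)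
		also have "\<dots> = d\<^sup>2 - (inner (x - l) m')\<^sup>2 / (norm m')\<^sup>2"
			using False by (simp add: nl t_def power2_eq_square field_simps)
		finally have "(inner (x - l) m')\<^sup>2 / (norm m')\<^sup>2 \<le> 0" by simp
		then show ?thesis using False by (simp add: divide_le_0_iff)
	qed simp
	with l(1) show ?thesis by (rule that)
qed

lemma complete_closed_l2_prod:
	fixes M :: "l2_op"
	assumes "closed M"
	shows "complete M"
	unfolding complete_def
proof (intro allI impI)
	fix X assume X: "(\<forall>n. X n \<in> M) \<and> Cauchy X"
	then have "Cauchy (\<lambda>n. fst (X n))" "Cauchy (\<lambda>n. snd (X n))" by (auto intro: Cauchy_fst Cauchy_snd)
	then obtain u v where "(\<lambda>n. fst (X n)) \<longlonglongrightarrow> u" "(\<lambda>n. snd (X n)) \<longlonglongrightarrow> v" by (metis l2_complete)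
	then have "(\<lambda>n. (fst (X n), snd (X n))) \<longlonglongrightarrow> (u, v)" by (rule tendsto_Pair)
	then have "X \<longlonglongrightarrow> (u, v)" by simp
	then show "\<exists>l\<in>M. X \<longlonglongrightarrow> l" using assms X by (metis closed_sequentially)
qed

definition linear_op :: "l2_op \<Rightarrow> bool"
	where "linear_op T \<longleftrightarrow> (0, 0) \<in> T \<and>
		(\<forall>x y x' y'. (x, y) \<in> T \<longrightarrow> (x', y') \<in> T \<longrightarrow> (x + x', y + y') \<in> T) \<and>
		(\<forall>c x y. (x, y) \<in> T \<longrightarrow> (c *\<^sub>C x, c *\<^sub>C y) \<in> T) \<and>
		(\<forall>x y y'. (x, y) \<in> T \<longrightarrow> (x, y') \<in> T \<longrightarrow> y = y')"

lemma linear_opD: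
	assumes "linear_op T"
	shows "(0, 0) \<in> T"
		"(x, y) \<in> T \<Longrightarrow> (x', y') \<in> T \<Longrightarrow> (x + x', y + y') \<in> T"
		"(x, y) \<in> T \<Longrightarrow> (c *\<^sub>C x, c *\<^sub>C y) \<in> T"
		"(x, y) \<in> T \<Longrightarrow> (x, y') \<in> T \<Longrightarrow> y = y'"
	using assms unfolding linear_op_def by blast+

lemma linear_op_diff:
	assumes T: "linear_op T" and xy: "(x, y) \<in> T" "(x', y') \<in> T"
	shows "(x - x', y - y') \<in> T"
	using linear_opD(2)[OF T xy(1) linear_opD(3)[OF T xy(2), of "-1"]] by (simp add: l2.scale_minus_left)

lemma linear_op_apply:
	assumes T: "linear_op T" and xy: "(x, y) \<in> T"
	shows "op_apply T x = y"
	unfolding op_apply_def by (rule the_equality) (use linear_opD(4)[OF T] xy in blast)+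

lemma linear_op_apply_mem: "linear_op T \<Longrightarrow> x \<in> Domain T \<Longrightarrow> (x, op_apply T x) \<in> T"
	using linear_op_apply by auto

lemma linear_op_apply_diff_mem:
	assumes T: "linear_op T" and x: "x \<in> Domain T" "x' \<in> Domain T"
	shows "(x - x', op_apply T (x - x')) \<in> T"
proof (rule linear_op_apply_mem[OF T])
	show "x - x' \<in> Domain T" using x linear_op_diff[OF T] by blast
qed

text \<open>
	If the form of \<open>T\<close> dominates \<open>\<parallel>G x\<parallel>\<^sup>2\<close> up to a multiple of \<open>\<parallel>x\<parallel>\<^sup>2\<close>, then \<open>G\<close> maps form convergent
	sequences to Cauchy sequences, and closedness of \<open>G\<close> bounds the form domain from above. With a
	constant \<open>c < 1\<close> this covers forms with a boundary term of small relative bound.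
\<close>

lemma form_convergent_imp:
	assumes T: "linear_op T" and G: "linear_op G" "closed G" and TG: "Domain T \<subseteq> Domain G"
		and c: "c > 0"
		and lower: "\<And>x y g. (x, y) \<in> T \<Longrightarrow> (x, g) \<in> G \<Longrightarrow> c * (norm g)\<^sup>2 \<le> cmod (l2_inner y x) + C * (norm x)\<^sup>2"
		and X: "form_convergent T X u"
	obtains g where "(u, g) \<in> G" "(\<lambda>n. op_apply G (X n)) \<longlonglongrightarrow> g"
proof -
	have XT: "X n \<in> Domain T" and Xu: "X \<longlonglongrightarrow> u" for n using X by (auto simp: form_convergent_def)
	define Z where "Z n = op_apply G (X n)" for n
	have XZ: "(X n, Z n) \<in> G" for n unfolding Z_def using XT TG linear_op_apply_mem[OF G(1)] by blast
	have "Cauchy Z"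
	proof (rule metric_CauchyI)
		fix e :: real assume e: "e > 0"
		define e' where "e' = c * e\<^sup>2 / 2"
		have e': "e' > 0" using e c by (simp add: e'_def)
		obtain N1 where N1: "\<And>m n. m \<ge> N1 \<Longrightarrow> n \<ge> N1 \<Longrightarrow> cmod (l2_inner (op_apply T (X m - X n)) (X m - X n)) < e'"
			using X e' unfolding form_convergent_def by meson
		define e2 where "e2 = sqrt (e' / (\<bar>C\<bar> + 1))"
		have e2: "e2 > 0" using e' by (simp add: e2_def)
		have "Cauchy X" using Xu by (rule LIMSEQ_imp_Cauchy)
		from CauchyD[OF this e2] obtain N2 where N2: "\<And>m n. m \<ge> N2 \<Longrightarrow> n \<ge> N2 \<Longrightarrow> norm (X m - X n) < e2" by blast
		show "\<exists>N. \<forall>m\<ge>N. \<forall>n\<ge>N. dist (Z m) (Z n) < e"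
		proof (intro exI[of _ "max N1 N2"] allI impI)
			fix m n assume mn: "max N1 N2 \<le> m" "max N1 N2 \<le> n"
			have d: "(X m - X n, op_apply T (X m - X n)) \<in> T"
				by (rule linear_op_apply_diff_mem[OF T XT XT])
			have "c * (norm (Z m - Z n))\<^sup>2 \<le> cmod (l2_inner (op_apply T (X m - X n)) (X m - X n)) + C * (norm (X m - X n))\<^sup>2"
				by (rule lower[OF d linear_op_diff[OF G(1) XZ XZ]])
			also have "C * (norm (X m - X n))\<^sup>2 \<le> (\<bar>C\<bar> + 1) * (norm (X m - X n))\<^sup>2" by (intro mult_right_mono) auto
			also have "(\<bar>C\<bar> + 1) * (norm (X m - X n))\<^sup>2 \<le> (\<bar>C\<bar> + 1) * e2\<^sup>2"
				by (intro mult_left_mono power_mono) (use N2[of m n] mn in auto)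
			also have "\<dots> = e'" using e' by (simp add: e2_def)
			finally have "c * (norm (Z m - Z n))\<^sup>2 < e' + e'" using N1[of m n] mn by simp
			also have "\<dots> = c * e\<^sup>2" by (simp add: e'_def)
			finally have "(norm (Z m - Z n))\<^sup>2 < e\<^sup>2" using c by simp
			then show "dist (Z m) (Z n) < e" using e by (simp add: dist_norm power_less_imp_less_base)
		qed
	qed
	then obtain g where g: "Z \<longlonglongrightarrow> g" using l2_complete by blast
	have "(\<lambda>n. (X n, Z n)) \<longlonglongrightarrow> (u, g)" by (rule tendsto_Pair[OF Xu g])
	then have "(u, g) \<in> G" by (rule closed_sequentially[OF G(2) XZ])
	with g show ?thesis using that unfolding Z_def by blast
qed

text \<open>
	Formally \<open>T\<close> is a restriction of \<open>G\<^sup>* G\<close> to a core of \<open>G\<close>; then its closed form is \<open>\<parallel>G u\<parallel>\<^sup>2\<close> on all of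
	\<open>dom G\<close>.
\<close>

definition factored_by :: "l2_op \<Rightarrow> l2_op \<Rightarrow> bool"
	where "factored_by T G \<longleftrightarrow> linear_op T \<and> linear_op G \<and> closed G \<and> Domain T \<subseteq> Domain G \<and>
		(\<forall>x y g v k. (x, y) \<in> T \<longrightarrow> (x, g) \<in> G \<longrightarrow> (v, k) \<in> G \<longrightarrow> l2_inner y v = l2_inner g k) \<and>
		(\<forall>p\<in>G. \<exists>X. (\<forall>n. X n \<in> G \<and> fst (X n) \<in> Domain T) \<and> X \<longlonglongrightarrow> p)"

lemma factored_byD:
	assumes "factored_by T G"
	shows "linear_op T" "linear_op G" "closed G" "Domain T \<subseteq> Domain G"
		"(x, y) \<in> T \<Longrightarrow> (x, g) \<in> G \<Longrightarrow> (v, k) \<in> G \<Longrightarrow> l2_inner y v = l2_inner g k"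
		"p \<in> G \<Longrightarrow> \<exists>X. (\<forall>n. X n \<in> G \<and> fst (X n) \<in> Domain T) \<and> X \<longlonglongrightarrow> p"
	using assms unfolding factored_by_def by blast+

lemma factored_by_form_convergent:
	assumes f: "factored_by T G" and X: "form_convergent T X u"
	obtains g where "(u, g) \<in> G" "(\<lambda>n. op_apply G (X n)) \<longlonglongrightarrow> g"
proof (rule form_convergent_imp[OF factored_byD(1-4)[OF f] zero_less_one _ X])
	fix x y g assume "(x, y) \<in> T" "(x, g) \<in> G"
	then have "l2_inner y x = cpx ((norm g)\<^sup>2)"
		using factored_byD(5)[OF f] l2_inner_self by metis
	then show "1 * (norm g)\<^sup>2 \<le> cmod (l2_inner y x) + 0 * (norm x)\<^sup>2" by (simp add: norm_power)
qed (use that in blast)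

lemma factored_by_form_convergent_exists:
	assumes f: "factored_by T G" and u: "(u, g) \<in> G"
	shows "\<exists>X. form_convergent T X u"
proof -
	note D = factored_byD[OF f]
	obtain Y where Y: "\<And>n. Y n \<in> G \<and> fst (Y n) \<in> Domain T" "Y \<longlonglongrightarrow> (u, g)" using D(6)[OF u] by blast
	define X Z where "X n = fst (Y n)" and "Z n = snd (Y n)" for n
	have XZ: "(X n, Z n) \<in> G" for n using Y(1)[of n] by (simp add: X_def Z_def)
	have lim: "X \<longlonglongrightarrow> u" "Z \<longlonglongrightarrow> g"
		using tendsto_fst[OF Y(2)] tendsto_snd[OF Y(2)] by (simp_all add: X_def[abs_def] Z_def[abs_def])
	have XT: "X n \<in> Domain T" for n using Y by (simp add: X_def)
	have "form_convergent T X u"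
		unfolding form_convergent_def
	proof (intro conjI allI impI XT lim)
		fix e :: real assume "e > 0"
		then have e: "sqrt e > 0" by simp
		from CauchyD[OF LIMSEQ_imp_Cauchy[OF lim(2)] e] obtain N where N: "\<And>m n. m \<ge> N \<Longrightarrow> n \<ge> N \<Longrightarrow> norm (Z m - Z n) < sqrt e" by blast
		show "\<exists>N. \<forall>m\<ge>N. \<forall>n\<ge>N. cmod (l2_inner (op_apply T (X m - X n)) (X m - X n)) < e"
		proof (intro exI[of _ N] allI impI)
			fix m n assume mn: "N \<le> m" "N \<le> n"
			have d: "(X m - X n, op_apply T (X m - X n)) \<in> T"
				by (rule linear_op_apply_diff_mem[OF D(1) XT XT])
			have dG: "(X m - X n, Z m - Z n) \<in> G" by (rule linear_op_diff[OF D(2) XZ XZ])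
			have "l2_inner (op_apply T (X m - X n)) (X m - X n) = cpx ((norm (Z m - Z n))\<^sup>2)"
				using D(5)[OF d dG dG] l2_inner_self by metis
			then have "cmod (l2_inner (op_apply T (X m - X n)) (X m - X n)) = (norm (Z m - Z n))\<^sup>2" by (simp add: norm_power)
			also have "\<dots> < (sqrt e)\<^sup>2" using N[OF mn] by (intro power_strict_mono) auto
			finally show "cmod (l2_inner (op_apply T (X m - X n)) (X m - X n)) < e" using \<open>e > 0\<close> by simp
		qed
	qed
	then show ?thesis by blast
qed

lemma factored_by_form_dom:
	assumes f: "factored_by T G"
	shows "form_dom T = Domain G"
proof (intro set_eqI iffI)
	fix u assume "u \<in> form_dom T"
	then obtain X where X: "form_convergent T X u" by (auto simp: form_dom_def)
	obtain g where "(u, g) \<in> G" by (rule factored_by_form_convergent[OF f X])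
	then show "u \<in> Domain G" by blast
next
	fix u assume "u \<in> Domain G"
	then show "u \<in> form_dom T"
		using factored_by_form_convergent_exists[OF f] by (auto simp: form_dom_def)
qed

lemma factored_by_op_form:
	assumes f: "factored_by T G" and u: "(u, g) \<in> G" and v: "(v, k) \<in> G"
	shows "op_form T u v = l2_inner g k"
proof -
	note D = factored_byD[OF f]
	have lim: "(\<lambda>n. l2_inner (op_apply T (X n)) (Y n)) \<longlonglongrightarrow> l2_inner g k"
		if X: "form_convergent T X u" and Y: "form_convergent T Y v" for X Y
	proof -
		obtain g' where g': "(u, g') \<in> G" "(\<lambda>n. op_apply G (X n)) \<longlonglongrightarrow> g'" by (rule factored_by_form_convergent[OF f X])
		obtain k' where k': "(v, k') \<in> G" "(\<lambda>n. op_apply G (Y n)) \<longlonglongrightarrow> k'" by (rule factored_by_form_convergent[OF f Y])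
		have "g' = g" "k' = k" using linear_opD(4)[OF D(2)] u v g' k' by blast+
		moreover have "l2_inner (op_apply T (X n)) (Y n) = l2_inner (op_apply G (X n)) (op_apply G (Y n))" for n
		proof (rule D(5))
			have "X n \<in> Domain T" "Y n \<in> Domain T" using X Y by (auto simp: form_convergent_def)
			then show "(X n, op_apply T (X n)) \<in> T" "(X n, op_apply G (X n)) \<in> G" "(Y n, op_apply G (Y n)) \<in> G"
				using linear_op_apply_mem[OF D(1)] linear_op_apply_mem[OF D(2)] D(4) by blast+
		qed
		ultimately show ?thesis using tendsto_l2_inner[OF g'(2) k'(2)] by simp
	qed
	obtain X where X: "form_convergent T X u" using factored_by_form_convergent_exists[OF f u] by blast
	obtain Y where Y: "form_convergent T Y v" using factored_by_form_convergent_exists[OF f v] by blast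
	show ?thesis
		unfolding op_form_def
		by (rule the_equality) (use lim LIMSEQ_unique X Y in blast)+
qed

section \<open>Primitives on the half-line\<close>

text \<open>
	\<open>g\<close> is a density of the locally absolutely continuous function \<open>f\<close>. In contrast to the derivative of \<open>f\<close>
	it may be changed on null sets, which makes sums, products and limits easy to treat.
\<close>

definition primitive :: "(real \<Rightarrow> complex) \<Rightarrow> (real \<Rightarrow> complex) \<Rightarrow> bool"
	where "primitive f g \<longleftrightarrow> (\<forall>a b. 0 < a \<longrightarrow> a \<le> b \<longrightarrow>
		g absolutely_integrable_on {a..b} \<and> (g has_integral (f b - f a)) {a..b})"

definition loc_integrable :: "(real \<Rightarrow> complex) \<Rightarrow> bool"
	where "loc_integrable g \<longleftrightarrow> (\<forall>a b. 0 < a \<longrightarrow> a \<le> b \<longrightarrow> g absolutely_integrable_on {a..b})"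

lemma primitiveD:
	assumes "primitive f g" "0 < a" "a \<le> b"
	shows "g absolutely_integrable_on {a..b}" "(g has_integral (f b - f a)) {a..b}"
		"integral {a..b} g = f b - f a"
	using assms by (auto simp: primitive_def integral_unique)

lemma primitive_loc_integrable: "primitive f g \<Longrightarrow> loc_integrable g"
	by (auto simp: primitive_def loc_integrable_def)

lemma loc_integrable_integrable_on: "loc_integrable g \<Longrightarrow> 0 < a \<Longrightarrow> g integrable_on {a..b}"
	by (cases "a \<le> b") (auto simp: loc_integrable_def set_lebesgue_integral_eq_integral(1))

lemma primitive_loc_abs_continuous_on:
	assumes "primitive f g" shows "loc_abs_continuous_on {0<..} f"
	unfolding loc_abs_continuous_on_def
proof (intro allI impI)
	fix a b :: real assume "a \<le> b" "{a..b} \<subseteq> {0<..}"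
	then have "0 < a" by auto
	show "abs_continuous_on a b f"
		by (rule primitive_imp_abs_continuous_on[where g=g])
			 (use assms \<open>0 < a\<close> \<open>a \<le> b\<close> in \<open>auto simp: primitive_def\<close>)
qed

lemma negligible_if_subintervals:
	fixes P :: "real \<Rightarrow> bool"
	assumes "\<And>a b. 0 < a \<Longrightarrow> a < b \<Longrightarrow> negligible {x \<in> {a<..<b}. P x}"
	shows "negligible {x \<in> {0<..}. P x}"
proof (rule negligible_subset)
	show "negligible (\<Union>n::nat. {x \<in> {1 / real (n+2)<..<real (n+2)}. P x})"
	proof (rule negligible_countable_Union)
		fix S assume "S \<in> range (\<lambda>n::nat. {x \<in> {1 / real (n+2)<..<real (n+2)}. P x})"
		then obtain n :: nat where S: "S = {x \<in> {1 / real (n+2)<..<real (n+2)}. P x}" by blast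
		have "1 / real (n+2) < 1" by simp
		also have "1 < real (n+2)" by simp
		finally show "negligible S" unfolding S by (intro assms) auto
	qed simp
	show "{x \<in> {0<..}. P x} \<subseteq> (\<Union>n::nat. {x \<in> {1 / real (n+2)<..<real (n+2)}. P x})"
	proof
		fix x assume x: "x \<in> {x \<in> {0<..}. P x}"
		obtain n :: nat where n: "max x (1/x) < real n" using reals_Archimedean2 by blast
		have "1 / real (n+2) < x"
		proof -
			have "1/x < real (n+2)" using n by simp
			then show ?thesis using x by (simp add: field_simps)
		qed
		then have "x \<in> {x \<in> {1 / real (n+2)<..<real (n+2)}. P x}" using x n by auto
		then show "x \<in> (\<Union>n::nat. {x \<in> {1 / real (n+2)<..<real (n+2)}. P x})" by blast
	qed
qed

lemma primitive_has_derivative_AE: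
	assumes "primitive f g"
	shows "AE x in half_line. (f has_vector_derivative g x) (at x)"
	unfolding AE_half_line_iff
proof (rule negligible_if_subintervals)
	fix a b :: real assume ab: "0 < a" "a < b"
	show "negligible {x \<in> {a<..<b}. \<not> (f has_vector_derivative g x) (at x)}"
	proof (rule negligible_not_has_vector_derivative_integral)
		show "g integrable_on {a..b}" using primitiveD(2)[OF assms ab(1), of b] ab by (auto simp: integrable_on_def)
		show "f y - f x = integral {x..y} g" if "a \<le> x" "x \<le> y" "y \<le> b" for x y
			using primitiveD(3)[OF assms, of x y] ab that by simp
	qed
qed

lemma deriv_on_at:
	assumes "x > 0"
	shows "deriv_on {0<..} f x = vector_derivative f (at x)" "deriv_on {0..} f x = vector_derivative f (at x)"
proof -
	have "at x within {0<..} = at x" by (rule at_within_open) (use assms in auto)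
	moreover have "at x within {0..} = at x"
		by (rule at_within_interior) (use assms in \<open>simp add: interior_real_atLeast\<close>)
	ultimately show "deriv_on {0<..} f x = vector_derivative f (at x)" "deriv_on {0..} f x = vector_derivative f (at x)"
		by (simp_all only: deriv_on_def)
qed

lemma deriv_on_eqI: "x > 0 \<Longrightarrow> (f has_vector_derivative d) (at x) \<Longrightarrow> deriv_on {0<..} f x = d"
	by (simp add: deriv_on_at vector_derivative_at)

lemma primitive_deriv_on_AE:
	assumes "primitive f g"
	shows "AE x in half_line. deriv_on {0<..} f x = g x"
	using primitive_has_derivative_AE[OF assms] AE_space[of half_line]
	by eventually_elim (auto intro: deriv_on_eqI)

lemma has_integral_AE_cong:
	assumes "(g has_integral i) {a..b}" "0 < a" "AE x in half_line. g x = g' x"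
	shows "(g' has_integral i) {a..b}"
	by (rule has_integral_spike[OF _ _ assms(1), of "{x \<in> {0<..}. \<not> g x = g' x}"])
		 (use assms in \<open>auto simp: AE_half_line_iff\<close>)

lemma loc_integrable_cong_AE:
	assumes "loc_integrable g" "AE x in half_line. g x = g' x"
	shows "loc_integrable g'"
	unfolding loc_integrable_def
proof (intro allI impI)
	fix a b :: real assume "0 < a" "a \<le> b"
	show "g' absolutely_integrable_on {a..b}"
		by (rule absolutely_integrable_spike[where f=g and S="{x \<in> {0<..}. \<not> g x = g' x}"])
			 (use assms \<open>0 < a\<close> \<open>a \<le> b\<close> in \<open>auto simp: AE_half_line_iff loc_integrable_def\<close>)
qed

lemma primitive_cong_AE:
	assumes "primitive f g" "AE x in half_line. g x = g' x" "\<And>x. x > 0 \<Longrightarrow> f' x = f x"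
	shows "primitive f' g'"
	using loc_integrable_cong_AE[OF primitive_loc_integrable[OF assms(1)] assms(2)] assms
	unfolding primitive_def loc_integrable_def by (auto intro!: has_integral_AE_cong[OF _ _ assms(2)])

text \<open>
	An absolutely continuous function has some density, and by Lebesgue's theorem its derivative agrees with
	that density almost everywhere.
\<close>

lemma primitive_of_loc_abs_continuous_on:
	assumes f: "loc_abs_continuous_on {0<..} f"
	shows "primitive f (deriv_on {0<..} f)"
	unfolding primitive_def
proof (intro allI impI)
	fix a b :: real assume ab: "0 < a" "a \<le> b"
	then have "{a..b} \<subseteq> {0<..}" by auto
	with ab have "abs_continuous_on a b f" using f unfolding loc_abs_continuous_on_def by blast
	then obtain g where g: "g absolutely_integrable_on {a..b}"
		"\<And>x y. a \<le> x \<Longrightarrow> x \<le> y \<Longrightarrow> y \<le> b \<Longrightarrow> (g has_integral (f y - f x)) {x..y}"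
		by (rule abs_continuous_on_imp_primitive[OF _ ab(2)]) blast
	define N where "N = {x \<in> {a<..<b}. \<not> (f has_vector_derivative g x) (at x)} \<union> {a, b}"
	have "negligible {x \<in> {a<..<b}. \<not> (f has_vector_derivative g x) (at x)}"
		by (rule negligible_not_has_vector_derivative_integral)
			 (use g in \<open>auto simp: set_lebesgue_integral_eq_integral(1) integral_unique[OF g(2)]\<close>)
	then have N: "negligible N" by (auto simp: N_def)
	have eq: "deriv_on {0<..} f x = g x" if "x \<in> {a..b} - N" for x
		by (rule deriv_on_eqI) (use that ab in \<open>auto simp: N_def\<close>)
	show "deriv_on {0<..} f absolutely_integrable_on {a..b} \<and> (deriv_on {0<..} f has_integral f b - f a) {a..b}"
		using absolutely_integrable_spike[OF g(1) N eq] has_integral_spike[OF N eq g(2)[of a b]] ab by auto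
qed

lemma primitive_continuous_on:
	assumes "primitive f g" shows "continuous_on {0<..} f"
proof -
	have "isCont f x" if x: "x > 0" for x
	proof -
		have "abs_continuous_on (x/2) (x+1) f"
		proof -
			have "{x/2..x+1} \<subseteq> {0<..}" "x/2 \<le> x+1" using x by auto
			then show ?thesis using primitive_loc_abs_continuous_on[OF assms] unfolding loc_abs_continuous_on_def by blast
		qed
		then have "continuous_on {x/2..x+1} f" by (rule abs_continuous_on_imp_continuous_on)
		moreover have "x \<in> interior {x/2..x+1}" using x by (simp add: interior_atLeastAtMost_real)
		ultimately show ?thesis by (rule continuous_on_interior)
	qed
	then show ?thesis by (simp add: continuous_on_eq_continuous_at)
qed

lemma continuous_on_measurable_half_line:
	"continuous_on {0<..} f \<Longrightarrow> f \<in> borel_measurable half_line"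
	by (rule continuous_imp_measurable_on_sets_lebesgue) simp_all

lemma primitive_measurable: "primitive f g \<Longrightarrow> f \<in> borel_measurable half_line"
	by (intro continuous_on_measurable_half_line primitive_continuous_on)

lemma primitive_add:
	assumes "primitive f g" "primitive f' g'"
	shows "primitive (\<lambda>x. f x + f' x) (\<lambda>x. g x + g' x)"
	unfolding primitive_def
proof (intro allI impI conjI)
	fix a b :: real assume ab: "0 < a" "a \<le> b"
	show "(\<lambda>x. g x + g' x) absolutely_integrable_on {a..b}"
		by (intro set_integral_add primitiveD(1)[OF assms(1) ab] primitiveD(1)[OF assms(2) ab])
	show "((\<lambda>x. g x + g' x) has_integral f b + f' b - (f a + f' a)) {a..b}"
		using has_integral_add[OF primitiveD(2)[OF assms(1) ab] primitiveD(2)[OF assms(2) ab]]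
		by (simp add: algebra_simps)
qed

lemma primitive_scale:
	assumes "primitive f g"
	shows "primitive (\<lambda>x. c * f x) (\<lambda>x. c * g x)"
	unfolding primitive_def
proof (intro allI impI conjI)
	fix a b :: real assume ab: "0 < a" "a \<le> b"
	show "(\<lambda>x. c * g x) absolutely_integrable_on {a..b}"
		using primitiveD(1)[OF assms ab] by simp
	show "((\<lambda>x. c * g x) has_integral c * f b - c * f a) {a..b}"
		using has_integral_mult_right[OF primitiveD(2)[OF assms ab], of c] by (simp add: algebra_simps)
qed

lemma primitive_diff:
	assumes "primitive f g" "primitive f' g'"
	shows "primitive (\<lambda>x. f x - f' x) (\<lambda>x. g x - g' x)"
	using primitive_add[OF assms(1) primitive_scale[OF assms(2), of "-1"]] by simp

lemma primitive_const: "primitive (\<lambda>x. c) (\<lambda>x. 0)"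
	by (auto simp: primitive_def)

lemma primitive_cnj:
	assumes "primitive f g"
	shows "primitive (\<lambda>x. cnj (f x)) (\<lambda>x. cnj (g x))"
	unfolding primitive_def
proof (intro allI impI conjI)
	fix a b :: real assume ab: "0 < a" "a \<le> b"
	show "(\<lambda>x. cnj (g x)) absolutely_integrable_on {a..b}"
		using absolutely_integrable_linear[OF primitiveD(1)[OF assms ab] bounded_linear_cnj] by (simp add: o_def)
	show "((\<lambda>x. cnj (g x)) has_integral cnj (f b) - cnj (f a)) {a..b}"
		using has_integral_linear[OF primitiveD(2)[OF assms ab] bounded_linear_cnj] by (simp add: o_def)
qed

lemma primitive_mult:
	assumes "primitive f g" "primitive f' g'"
	shows "primitive (\<lambda>x. f x * f' x) (\<lambda>x. g x * f' x + f x * g' x)"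
proof -
	have "loc_abs_continuous_on {0<..} (\<lambda>x. f x * f' x)"
		using primitive_loc_abs_continuous_on[OF assms(1)] primitive_loc_abs_continuous_on[OF assms(2)]
		by (auto simp: loc_abs_continuous_on_def intro: abs_continuous_on_mult)
	then have "primitive (\<lambda>x. f x * f' x) (deriv_on {0<..} (\<lambda>x. f x * f' x))"
		by (rule primitive_of_loc_abs_continuous_on)
	moreover have "AE x in half_line. deriv_on {0<..} (\<lambda>x. f x * f' x) x = g x * f' x + f x * g' x"
		using primitive_has_derivative_AE[OF assms(1)] primitive_has_derivative_AE[OF assms(2)] AE_space[of half_line]
	proof eventually_elim
		case (elim x)
		then show ?case
			by (intro deriv_on_eqI) (auto intro!: derivative_eq_intros simp: algebra_simps)
	qed
	ultimately show ?thesis by (rule primitive_cong_AE) simp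
qed

lemma primitive_of_has_derivative:
	assumes d: "\<And>x. x > 0 \<Longrightarrow> (f has_vector_derivative f' x) (at x)" and c: "continuous_on {0<..} f'"
	shows "primitive f f'"
	unfolding primitive_def
proof (intro allI impI conjI)
	fix a b :: real assume ab: "0 < a" "a \<le> b"
	show "f' absolutely_integrable_on {a..b}"
		by (rule absolutely_integrable_continuous_real) (use ab in \<open>auto intro: continuous_on_subset[OF c]\<close>)
	show "(f' has_integral f b - f a) {a..b}"
		by (rule fundamental_theorem_of_calculus) (use ab d in \<open>auto intro: has_vector_derivative_at_within\<close>)
qed

lemma loc_integrable_continuous_mult:
	assumes g: "loc_integrable g" and c: "continuous_on {0<..} h"
	shows "loc_integrable (\<lambda>x. h x * g x)"
	unfolding loc_integrable_def
proof (intro allI impI)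
	fix a b :: real assume ab: "0 < a" "a \<le> b"
	have ch: "continuous_on {a..b} h" by (rule continuous_on_subset[OF c]) (use ab in auto)
	have "compact (h ` {a..b})" using ch by (rule compact_continuous_image) simp
	then have bh: "bounded (h ` {a..b})" by (rule compact_imp_bounded)
	have bil: "bilinear ((*) :: complex \<Rightarrow> complex \<Rightarrow> complex)"
		by (simp add: bilinear_conv_bounded_bilinear bounded_bilinear_mult)
	show "(\<lambda>x. h x * g x) absolutely_integrable_on {a..b}"
		by (rule absolutely_integrable_bounded_measurable_product[OF bil _ _ bh])
			 (use g ab ch in \<open>auto simp: loc_integrable_def intro: continuous_imp_measurable_on_sets_lebesgue\<close>)
qed

lemma loc_integrable_continuous: "continuous_on {0<..} h \<Longrightarrow> loc_integrable h"
	unfolding loc_integrable_def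
	by (auto intro!: absolutely_integrable_continuous_real elim: continuous_on_subset)

lemma loc_integrable_add: "loc_integrable f \<Longrightarrow> loc_integrable g \<Longrightarrow> loc_integrable (\<lambda>x. f x + g x)"
	by (auto simp: loc_integrable_def intro: set_integral_add)

lemma sq_integrable_loc_integrable:
	assumes f: "sq_integrable f"
	shows "loc_integrable f"
	unfolding loc_integrable_def
proof (intro allI impI)
	fix a b :: real assume ab: "0 < a" "a \<le> b"
	have sub: "{a..b} \<subseteq> {0<..}" using ab by auto
	have fm: "f \<in> borel_measurable (lebesgue_on {a..b})"
		using f sub unfolding sq_integrable_def by (blast intro: measurable_restrict_mono)
	have "set_integrable lebesgue {0<..} (\<lambda>x. (cmod (f x))\<^sup>2)"
		using f by (simp add: sq_integrable_def integrable_restrict_space set_integrable_def)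
	then have i: "(\<lambda>x. (cmod (f x))\<^sup>2) absolutely_integrable_on {a..b}"
		by (rule set_integrable_subset) (use sub in auto)
	have "(\<lambda>x. 1 + (cmod (f x))\<^sup>2) absolutely_integrable_on {a..b}"
		by (intro set_integral_add i absolutely_integrable_on_const) auto
	then have "(\<lambda>x. 1 + (cmod (f x))\<^sup>2) integrable_on {a..b}"
		by (rule set_lebesgue_integral_eq_integral)
	moreover have "norm (f x) \<le> 1 + (cmod (f x))\<^sup>2" for x
	proof -
		have "2 * cmod (f x) \<le> 1 + (cmod (f x))\<^sup>2" using sum_squares_bound[of 1 "cmod (f x)"] by simp
		then show ?thesis using norm_ge_zero[of "f x"] by linarith
	qed
	ultimately show "f absolutely_integrable_on {a..b}"
		by (intro measurable_bounded_by_integrable_imp_absolutely_integrable[OF fm]) auto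
qed

lemma loc_integrable_primitive:
	assumes "loc_integrable w"
	shows "\<exists>W. primitive W w"
proof -
	define W where "W x = (if x \<ge> 1 then integral {1..x} w else - integral {x..1} w)" for x
	have "(w has_integral (W b - W a)) {a..b}" if ab: "0 < a" "a \<le> b" for a b
	proof -
		have int: "w integrable_on {x..y}" if "0 < x" for x y
			by (rule loc_integrable_integrable_on[OF assms that])
		have comb: "integral {x..y} w + integral {y..z} w = integral {x..z} w" if "0 < x" "x \<le> y" "y \<le> z" for x y z
			by (rule Henstock_Kurzweil_Integration.integral_combine) (use that int in auto)
		have "W b - W a = integral {a..b} w"
		proof -
			consider "1 \<le> a" | "a < 1" "1 \<le> b" | "b < 1" by linarith
			then show ?thesis
				using comb[of 1 a b] comb[of a 1 b] comb[of a b 1] ab by cases (auto simp: W_def algebra_simps)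
		qed
		then show ?thesis using int[OF ab(1)] by (simp add: integrable_integral)
	qed
	then show ?thesis using assms by (auto simp: primitive_def loc_integrable_def)
qed

lemma LINT_half_line_compact_support:
	fixes f :: "real \<Rightarrow> complex"
	assumes ab: "0 < a" "a \<le> b" and f: "f absolutely_integrable_on {a..b}"
		and z: "\<And>x. x > 0 \<Longrightarrow> x \<notin> {a..b} \<Longrightarrow> f x = 0"
	shows "integrable half_line f" "(LINT x|half_line. f x) = integral {a..b} f"
proof -
	have eq: "(\<lambda>x. indicator {0<..} x *\<^sub>R f x) = (\<lambda>x. indicator {a..b} x *\<^sub>R f x)"
		using z ab by (fastforce simp: indicator_def)
	show "integrable half_line f"
		using f unfolding set_integrable_def by (simp add: integrable_restrict_space eq)
	have "(LINT x|half_line. f x) = (LINT x:{a..b}|lebesgue. f x)"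
		unfolding set_lebesgue_integral_def by (subst integral_restrict_space) (simp_all add: eq)
	then show "(LINT x|half_line. f x) = integral {a..b} f"
		using set_lebesgue_integral_eq_integral(2)[OF f] by simp
qed

lemma continuous_AE_eq:
	fixes f g :: "real \<Rightarrow> complex"
	assumes f: "continuous_on {0<..} f" "continuous_on {0<..} g" and AE: "AE x in half_line. f x = g x" and x: "x > 0"
	shows "f x = g x"
proof (rule ccontr)
	assume ne: "f x \<noteq> g x"
	have "open {x \<in> {0<..}. f x - g x \<in> - {0}}"
		using continuous_open_preimage[of "{0<..}" "\<lambda>x. f x - g x" "- {0}"] f open_Compl[OF closed_singleton[of "0::complex"]]
		by (simp add: continuous_on_diff vimage_def Int_def conj_commute)
	moreover have "{x \<in> {0<..}. f x - g x \<in> - {0}} = {x \<in> {0<..}. \<not> f x = g x}" by auto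
	ultimately have "open {x \<in> {0<..}. \<not> f x = g x}" by simp
	moreover have "negligible {x \<in> {0<..}. \<not> f x = g x}" using AE by (simp add: AE_half_line_iff)
	ultimately have "{x \<in> {0<..}. \<not> f x = g x} = {}" using open_not_negligible by blast
	then show False using ne x by blast
qed

text \<open>
	A continuous density is a derivative at every point, so for functions in the maximal domain the first
	derivative needs no exceptional set.
\<close>

lemma primitive_continuous_imp_derivative:
	assumes p: "primitive f g" and c: "continuous_on {0<..} g" and x: "x > 0"
	shows "(f has_vector_derivative g x) (at x)"
proof -
	have "((\<lambda>u. integral {x/2..u} g) has_vector_derivative g x) (at x within {x/2..x+1})"
		by (rule integral_has_vector_derivative) (use x in \<open>auto intro: continuous_on_subset[OF c]\<close>)
	then have "((\<lambda>u. integral {x/2..u} g) has_vector_derivative g x) (at x)"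
		using x at_within_Icc_at[of "x/2" x "x+1"] by simp
	then have "((\<lambda>u. integral {x/2..u} g + f (x/2)) has_vector_derivative g x) (at x)"
		by (simp add: has_vector_derivative_add_const)
	then show ?thesis
	proof (rule has_vector_derivative_transform_within_open[where S="{x/2<..<x+1}"])
		fix y assume "y \<in> {x/2<..<x+1}"
		then show "integral {x/2..y} g + f (x/2) = f y" using primitiveD(3)[OF p, of "x/2" y] x by simp
	qed (use x in auto)
qed

section \<open>Test functions and the lemma of du Bois-Reymond\<close>

text \<open>
	\<open>\<psi>\<close> is a bounded density of \<open>\<phi>\<close>. Since \<open>\<psi>\<close> may be discontinuous, differences of indicator functions are
	available as test densities.
\<close>

definition test_fun :: "(real \<Rightarrow> complex) \<Rightarrow> (real \<Rightarrow> complex) \<Rightarrow> bool"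
	where "test_fun \<phi> \<psi> \<longleftrightarrow> primitive \<phi> \<psi> \<and> \<psi> \<in> borel_measurable half_line \<and> (\<exists>M. \<forall>x>0. cmod (\<psi> x) \<le> M) \<and>
		(\<exists>a b. 0 < a \<and> a \<le> b \<and> (\<forall>x>0. x \<notin> {a..b} \<longrightarrow> \<phi> x = 0 \<and> \<psi> x = 0))"

lemma test_fun_combination:
	assumes "test_fun \<phi> \<psi>" "test_fun \<phi>' \<psi>'"
	shows "test_fun (\<lambda>x. \<phi> x + c * \<phi>' x) (\<lambda>x. \<psi> x + c * \<psi>' x)"
proof -
	obtain M M' a b a' b' where M: "\<And>x. x > 0 \<Longrightarrow> cmod (\<psi> x) \<le> M" "\<And>x. x > 0 \<Longrightarrow> cmod (\<psi>' x) \<le> M'"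
		and ab: "0 < a" "a \<le> b" "\<And>x. x > 0 \<Longrightarrow> x \<notin> {a..b} \<Longrightarrow> \<phi> x = 0 \<and> \<psi> x = 0"
			"0 < a'" "a' \<le> b'" "\<And>x. x > 0 \<Longrightarrow> x \<notin> {a'..b'} \<Longrightarrow> \<phi>' x = 0 \<and> \<psi>' x = 0"
		using assms unfolding test_fun_def by metis
	have [measurable]: "\<psi> \<in> borel_measurable half_line" "\<psi>' \<in> borel_measurable half_line"
		using assms by (auto simp: test_fun_def)
	have "\<forall>x>0. cmod (\<psi> x + c * \<psi>' x) \<le> M + cmod c * M'"
		using M by (auto simp: norm_mult intro!: norm_triangle_mono mult_left_mono)
	moreover have "\<phi> x + c * \<phi>' x = 0 \<and> \<psi> x + c * \<psi>' x = 0" if "x > 0" "x \<notin> {min a a'..max b b'}" for x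
	proof -
		have "x \<notin> {a..b}" "x \<notin> {a'..b'}" using that by auto
		then show ?thesis using ab(3)[of x] ab(6)[of x] that(1) by simp
	qed
	moreover have "0 < min a a'" "min a a' \<le> max b b'" using ab by auto
	moreover have "primitive (\<lambda>x. \<phi> x + c * \<phi>' x) (\<lambda>x. \<psi> x + c * \<psi>' x)"
		using assms by (intro primitive_add primitive_scale) (auto simp: test_fun_def)
	moreover have "(\<lambda>x. \<psi> x + c * \<psi>' x) \<in> borel_measurable half_line" by measurable
	ultimately show ?thesis unfolding test_fun_def by blast
qed

lemma primitive_clamp:
	assumes xy: "0 < x" "x \<le> y"
	shows "primitive (\<lambda>t. cpx (max x (min y t))) (indicator {x..y})"
	unfolding primitive_def
proof (intro allI impI conjI)
	fix a b :: real assume ab: "0 < a" "a \<le> b"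
	show "((indicator {x..y} :: real \<Rightarrow> complex) has_integral cpx (max x (min y b)) - cpx (max x (min y a))) {a..b}"
	proof (rule fundamental_theorem_of_calculus_strong[of "{x, y}"])
		fix t assume t: "t \<in> {a..b} - {x, y}"
		let ?c = "\<lambda>t. cpx (max x (min y t))"
		from t consider "t < x" | "x < t" "t < y" | "y < t" by fastforce
		then have "(?c has_vector_derivative indicator {x..y} t) (at t)"
		proof cases
			case 1
			have "(?c has_vector_derivative 0) (at t)"
				by (rule has_vector_derivative_transform_within_open[OF has_vector_derivative_const[of "cpx x"], of "{..<x}"])
					 (use xy 1 in auto)
			then show ?thesis using 1 by simp
		next
			case 2
			have "(cpx has_vector_derivative 1) (at t)"
				using has_vector_derivative_of_real[OF DERIV_ident] by simp
			then show ?thesis using 2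
				by (auto intro!: has_vector_derivative_transform_within_open[of cpx _ _ "{x<..<y}"])
		next
			case 3
			have "(?c has_vector_derivative 0) (at t)"
				by (rule has_vector_derivative_transform_within_open[OF has_vector_derivative_const[of "cpx y"], of "{y<..}"])
					 (use xy 3 in auto)
			then show ?thesis using 3 by simp
		qed
		then show "(?c has_vector_derivative indicator {x..y} t) (at t)" .
	qed (use ab in \<open>auto intro!: continuous_intros\<close>)
	show "(indicator {x..y} :: real \<Rightarrow> complex) absolutely_integrable_on {a..b}"
	proof (rule measurable_bounded_by_integrable_imp_absolutely_integrable[where g="\<lambda>_. 1"])
		show "(indicator {x..y} :: real \<Rightarrow> complex) \<in> borel_measurable (lebesgue_on {a..b})"
			by (intro measurable_restrict_space1 borel_measurable_indicator) auto
	qed (auto simp: indicator_def)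
qed

text \<open>
	Multiples of the fixed interval \<open>[1, 2]\<close> correct the mean value of an indicator function to zero.
\<close>

lemma test_fun_step:
	assumes xy: "0 < x" "x \<le> y"
	shows "\<exists>\<phi>. test_fun \<phi> (\<lambda>t. indicator {x..y} t - cpx (y - x) * indicator {1..2} t)"
proof -
	define \<phi> where "\<phi> t = cpx (max x (min y t)) - cpx (y - x) * cpx (max 1 (min 2 t))
		- cpx (x - (y - x))" for t
	have "primitive \<phi> (\<lambda>t. indicator {x..y} t - cpx (y - x) * indicator {1..2} t - 0)"
		unfolding \<phi>_def by (intro primitive_diff primitive_scale primitive_clamp primitive_const) (use xy in auto)
	then have "test_fun \<phi> (\<lambda>t. indicator {x..y} t - cpx (y - x) * indicator {1..2} t)"
		unfolding test_fun_def
	proof (intro conjI)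
		show "(\<lambda>t. indicator {x..y} t - cpx (y - x) * indicator {1..2} t) \<in> borel_measurable half_line"
			by (intro borel_measurable_diff borel_measurable_times borel_measurable_const
					measurable_restrict_space1 borel_measurable_indicator) auto
		show "\<exists>M. \<forall>t>0. cmod (indicator {x..y} t - cpx (y - x) * indicator {1..2} t) \<le> M"
		proof (intro exI[of _ "1 + \<bar>y - x\<bar>"] allI impI)
			fix t :: real
			have "cmod (indicator {x..y} t - cpx (y - x) * indicator {1..2} t) \<le>
				cmod (indicator {x..y} t) + cmod (cpx (y - x) * indicator {1..2} t)" by (rule norm_triangle_ineq4)
			also have "\<dots> \<le> 1 + \<bar>y - x\<bar>" unfolding norm_mult norm_of_real by (intro add_mono) (auto simp: indicator_def)
			finally show "cmod (indicator {x..y} t - cpx (y - x) * indicator {1..2} t) \<le> 1 + \<bar>y - x\<bar>" .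
		qed
		show "\<exists>a b. 0 < a \<and> a \<le> b \<and> (\<forall>t>0. t \<notin> {a..b} \<longrightarrow> \<phi> t = 0 \<and>
				indicator {x..y} t - cpx (y - x) * indicator {1..2} t = 0)"
		proof (rule exI[of _ "min x 1"], rule exI[of _ "max y 2"], intro conjI allI impI)
			fix t assume t: "t \<notin> {min x 1..max y 2}"
			show "indicator {x..y} t - cpx (y - x) * indicator {1..2} t = 0" using t by (auto simp: indicator_def)
			have "max x (min y t) - (y - x) * max 1 (min 2 t) - (x - (y - x)) = 0"
			proof (cases "t < min x 1")
				case True then show ?thesis using xy by (auto simp: algebra_simps)
			next
				case False
				then have "t > max y 2" using t by auto
				then have "min y t = y" "min 2 t = 2" by auto
				then show ?thesis using xy by (simp add: algebra_simps)
			qed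
			then have "cpx (max x (min y t) - (y - x) * max 1 (min 2 t) - (x - (y - x))) = 0" by (simp only: of_real_0)
			then show "\<phi> t = 0" by (simp only: \<phi>_def of_real_diff of_real_mult)
		qed (use xy in auto)
	qed simp
	then show ?thesis by blast
qed

lemma primitive_compact_integral:
	assumes p: "primitive f g" and ab: "0 < a" "a \<le> b" and z: "\<And>x. x > 0 \<Longrightarrow> x \<notin> {a..b} \<Longrightarrow> f x = 0 \<and> g x = 0"
	shows "(LINT x|half_line. g x) = 0"
proof -
	have ab': "0 < a/2" "a/2 \<le> b + 1" using ab by auto
	have "(LINT x|half_line. g x) = integral {a/2..b+1} g"
		by (rule LINT_half_line_compact_support[OF ab' primitiveD(1)[OF p ab']]) (use z ab in auto)
	also have "\<dots> = f (b+1) - f (a/2)" by (rule primitiveD(3)[OF p ab'])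
	also have "\<dots> = 0" using z[of "b+1"] z[of "a/2"] ab by auto
	finally show ?thesis .
qed

lemma test_fun_integrable_mult:
	assumes u: "loc_integrable u" and t: "test_fun \<phi> \<psi>"
	shows "integrable half_line (\<lambda>x. u x * \<phi> x)" "integrable half_line (\<lambda>x. u x * \<psi> x)"
proof -
	obtain a b M where ab: "0 < a" "a \<le> b" "\<And>x. x > 0 \<Longrightarrow> x \<notin> {a..b} \<Longrightarrow> \<phi> x = 0 \<and> \<psi> x = 0"
		and M: "\<And>x. x > 0 \<Longrightarrow> cmod (\<psi> x) \<le> M" and pm: "\<psi> \<in> borel_measurable half_line" and p: "primitive \<phi> \<psi>"
		using t unfolding test_fun_def by metis
	have 1: "loc_integrable (\<lambda>x. \<phi> x * u x)"
		by (rule loc_integrable_continuous_mult[OF u primitive_continuous_on[OF p]])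
	show "integrable half_line (\<lambda>x. u x * \<phi> x)"
		by (rule LINT_half_line_compact_support(1)[OF ab(1,2)]) (use 1 ab in \<open>auto simp: loc_integrable_def mult.commute\<close>)
	have bil: "bilinear ((*) :: complex \<Rightarrow> complex \<Rightarrow> complex)"
		by (simp add: bilinear_conv_bounded_bilinear bounded_bilinear_mult)
	have "(\<lambda>x. \<psi> x * u x) absolutely_integrable_on {a..b}"
	proof (rule absolutely_integrable_bounded_measurable_product[OF bil])
		show "\<psi> \<in> borel_measurable (lebesgue_on {a..b})"
			by (rule measurable_restrict_mono[OF pm]) (use ab in auto)
		show "bounded (\<psi> ` {a..b})" unfolding bounded_iff using M ab by (auto intro!: exI[of _ M])
		show "u absolutely_integrable_on {a..b}" using u ab by (auto simp: loc_integrable_def)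
	qed auto
	then show "integrable half_line (\<lambda>x. u x * \<psi> x)"
		by (intro LINT_half_line_compact_support(1)[OF ab(1,2)]) (use ab in \<open>auto simp: mult.commute\<close>)
qed

lemma test_fun_by_parts:
	assumes W: "primitive W w" and t: "test_fun \<phi> \<psi>"
	shows "(LINT x|half_line. w x * \<phi> x) = - (LINT x|half_line. W x * \<psi> x)"
proof -
	obtain a b where ab: "0 < a" "a \<le> b" "\<And>x. x > 0 \<Longrightarrow> x \<notin> {a..b} \<Longrightarrow> \<phi> x = 0 \<and> \<psi> x = 0" and p: "primitive \<phi> \<psi>"
		using t unfolding test_fun_def by metis
	have "(LINT x|half_line. w x * \<phi> x + W x * \<psi> x) = 0"
		by (rule primitive_compact_integral[OF primitive_mult[OF W p] ab(1,2)]) (use ab in auto)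
	moreover have "(LINT x|half_line. w x * \<phi> x + W x * \<psi> x) = (LINT x|half_line. w x * \<phi> x) + (LINT x|half_line. W x * \<psi> x)"
		by (rule Bochner_Integration.integral_add)
			 (use test_fun_integrable_mult[OF primitive_loc_integrable[OF W] t]
					test_fun_integrable_mult[OF loc_integrable_continuous[OF primitive_continuous_on[OF W]] t] in auto)
	ultimately show ?thesis by (simp add: add_eq_0_iff2)
qed

text \<open>
	Testing with the step functions of mean zero shows that the integral of \<open>z\<close> over any interval is its
	length times the integral over \<open>[1, 2]\<close>.
\<close>

lemma du_Bois_Reymond_const:
	assumes z: "loc_integrable z" and zt: "\<And>\<phi> \<psi>. test_fun \<phi> \<psi> \<Longrightarrow> (LINT x|half_line. z x * \<psi> x) = 0"
	shows "\<exists>c. AE x in half_line. z x = c"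
proof -
	define c where "c = integral {1..2} z"
	have ind: "integrable half_line (\<lambda>t. z t * indicator {x..y} t) \<and> (LINT t|half_line. z t * indicator {x..y} t) = integral {x..y} z"
		if xy: "0 < x" "x \<le> y" for x y
	proof -
		have "(\<lambda>t. z t * indicator {x..y} t) absolutely_integrable_on {x..y}"
			by (rule absolutely_integrable_spike[where f=z and S="{}"]) (use z xy in \<open>auto simp: loc_integrable_def\<close>)
		note L = LINT_half_line_compact_support[OF xy this]
		have "integral {x..y} (\<lambda>t. z t * indicator {x..y} t) = integral {x..y} z"
			by (rule Henstock_Kurzweil_Integration.integral_cong) auto
		then show ?thesis using L by simp
	qed
	have "integral {x..y} z = cpx (y - x) * c" if xy: "0 < x" "x \<le> y" for x y
	proof -
		obtain \<phi> where "test_fun \<phi> (\<lambda>t. indicator {x..y} t - cpx (y - x) * indicator {1..2} t)"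
			using test_fun_step[OF xy] by blast
		from zt[OF this] have "0 = (LINT t|half_line. z t * indicator {x..y} t - cpx (y - x) * (z t * indicator {1..2} t))"
			by (simp add: algebra_simps)
		also have "\<dots> = (LINT t|half_line. z t * indicator {x..y} t) - cpx (y - x) * (LINT t|half_line. z t * indicator {1..2} t)"
			using ind[OF xy] ind[of 1 2] by (subst Bochner_Integration.integral_diff) auto
		finally show ?thesis using ind[OF xy] ind[of 1 2] by (simp add: c_def)
	qed
	then have "primitive (\<lambda>x. cpx x * c) z"
		using z loc_integrable_integrable_on[OF z]
		unfolding primitive_def loc_integrable_def
		by (auto simp: has_integral_integrable_integral algebra_simps)
	moreover have "primitive (\<lambda>x. cpx x * c) (\<lambda>x. c)"
		by (rule primitive_of_has_derivative) (auto intro!: derivative_eq_intros simp: has_vector_derivative_def scaleR_conv_of_real)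
	ultimately have "primitive (\<lambda>x. cpx x * c - cpx x * c) (\<lambda>x. z x - c)" by (rule primitive_diff)
	then have p0: "primitive (\<lambda>x. 0) (\<lambda>x. z x - c)" by simp
	have "AE x in half_line. z x = c"
		using primitive_has_derivative_AE[OF p0]
	proof eventually_elim
		case (elim x)
		then have "z x - c = 0" using vector_derivative_unique_at[OF elim has_vector_derivative_const] by simp
		then show ?case by simp
	qed
	then show ?thesis by blast
qed

lemma du_Bois_Reymond:
	assumes u: "loc_integrable u" and w: "loc_integrable w"
		and uw: "\<And>\<phi> \<psi>. test_fun \<phi> \<psi> \<Longrightarrow> (LINT x|half_line. w x * \<phi> x) = - (LINT x|half_line. u x * \<psi> x)"
	obtains f where "primitive f w" "AE x in half_line. u x = f x"
proof -
	obtain W where W: "primitive W w" using loc_integrable_primitive[OF w] by blast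
	have Wi: "loc_integrable W" by (rule loc_integrable_continuous[OF primitive_continuous_on[OF W]])
	have zi: "loc_integrable (\<lambda>x. u x - W x)"
		using loc_integrable_add[OF u loc_integrable_continuous_mult[OF Wi continuous_on_const[of _ "-1"]]] by simp
	have "(LINT x|half_line. (u x - W x) * \<psi> x) = 0" if t: "test_fun \<phi> \<psi>" for \<phi> \<psi>
	proof -
		have "(LINT x|half_line. u x * \<psi> x - W x * \<psi> x) = (LINT x|half_line. u x * \<psi> x) - (LINT x|half_line. W x * \<psi> x)"
			by (rule Bochner_Integration.integral_diff) (use test_fun_integrable_mult[OF u t] test_fun_integrable_mult[OF Wi t] in auto)
		also have "\<dots> = 0" using uw[OF t] test_fun_by_parts[OF W t] by simp
		finally show ?thesis by (simp add: left_diff_distrib)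
	qed
	from du_Bois_Reymond_const[OF zi this] obtain c where c: "AE x in half_line. u x - W x = c" ..
	have "primitive (\<lambda>x. W x + c) (\<lambda>x. w x + 0)" by (intro primitive_add W primitive_const)
	moreover have "AE x in half_line. u x = W x + c" using c by eventually_elim (simp add: algebra_simps)
	ultimately show ?thesis using that by simp
qed

lemma test_fun_loc_integrable: "test_fun \<phi> \<psi> \<Longrightarrow> loc_integrable \<phi>" "test_fun \<phi> \<psi> \<Longrightarrow> loc_integrable \<psi>"
	using primitive_loc_integrable loc_integrable_continuous primitive_continuous_on by (auto simp: test_fun_def)

lemma test_fun_integrable: "test_fun \<phi> \<psi> \<Longrightarrow> integrable half_line \<phi>"
	using test_fun_integrable_mult(1)[OF loc_integrable_continuous[OF continuous_on_const[of _ 1]]] by simp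

text \<open>
	After subtracting a second primitive of \<open>w\<close>, the function \<open>u\<close> annihilates all \<open>\<psi>\<close> whose primitive \<open>\<phi>\<close> has
	mean zero. Hence \<open>\<integral> z \<psi>\<close> is a fixed multiple of \<open>\<integral> \<phi>\<close>, which makes \<open>z\<close> affine.
\<close>

lemma du_Bois_Reymond2:
	assumes u: "loc_integrable u" and w: "loc_integrable w"
		and uw: "\<And>v \<phi> \<psi>. test_fun v \<phi> \<Longrightarrow> test_fun \<phi> \<psi> \<Longrightarrow> (LINT x|half_line. w x * v x) = (LINT x|half_line. u x * \<psi> x)"
	obtains f y where "primitive f y" "primitive y w" "AE x in half_line. u x = f x"
proof -
	obtain W1 where W1: "primitive W1 w" using loc_integrable_primitive[OF w] by blast
	have W1i: "loc_integrable W1" by (rule loc_integrable_continuous[OF primitive_continuous_on[OF W1]])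
	obtain W2 where W2: "primitive W2 W1" using loc_integrable_primitive[OF W1i] by blast
	have W2i: "loc_integrable W2" by (rule loc_integrable_continuous[OF primitive_continuous_on[OF W2]])
	define z where "z x = u x - W2 x" for x
	have zi: "loc_integrable z"
		using loc_integrable_add[OF u loc_integrable_continuous_mult[OF W2i continuous_on_const[of _ "-1"]]] by (simp add: z_def[abs_def])
	have z0: "(LINT x|half_line. z x * \<psi> x) = 0" if t: "test_fun \<phi> \<psi>" and m: "(LINT x|half_line. \<phi> x) = 0" for \<phi> \<psi>
	proof -
		obtain a b where ab: "0 < a" "a \<le> b" "\<And>x. x > 0 \<Longrightarrow> x \<notin> {a..b} \<Longrightarrow> \<phi> x = 0 \<and> \<psi> x = 0" and p: "primitive \<phi> \<psi>"
			using t unfolding test_fun_def by metis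
		obtain v0 where v0: "primitive v0 \<phi>" using loc_integrable_primitive[OF test_fun_loc_integrable(1)[OF t]] by blast
		define v where "v x = v0 x - v0 a" for x
		have v: "primitive v \<phi>" using primitive_diff[OF v0 primitive_const[of "v0 a"]] by (simp add: v_def[abs_def])
		have va: "v a = 0" by (simp add: v_def)
		have vb: "v b = 0"
			using primitiveD(3)[OF v ab(1,2)] LINT_half_line_compact_support(2)[OF ab(1,2) primitiveD(1)[OF v ab(1,2)]] ab(3) m va by simp
		have vout: "v x = 0" if x: "x > 0" "x \<notin> {a..b}" for x
		proof (cases "x < a")
			case True
			have "(\<phi> has_integral 0) {x..a}"
				by (rule has_integral_spike_finite[where f="\<lambda>_. 0" and S="{a}"]) (use ab(3) x ab(2) in auto)
			from has_integral_unique[OF this primitiveD(2)[OF v x(1), of a]] show ?thesis using True va by simp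
		next
			case False
			then have "b < x" using x by auto
			have "(\<phi> has_integral 0) {b..x}"
				by (rule has_integral_spike_finite[where f="\<lambda>_. 0" and S="{b}"]) (use ab x in auto)
			from has_integral_unique[OF this primitiveD(2)[OF v, of b x]] show ?thesis using \<open>b < x\<close> ab vb by simp
		qed
		have cphi: "continuous_on {a..b} \<phi>"
			by (rule continuous_on_subset[OF primitive_continuous_on[OF p]]) (use ab in auto)
		obtain M where M: "\<And>x. x \<in> {a..b} \<Longrightarrow> cmod (\<phi> x) \<le> M"
			using compact_imp_bounded[OF compact_continuous_image[OF cphi compact_Icc]] unfolding bounded_iff by (metis imageI)
		have "test_fun v \<phi>"
			unfolding test_fun_def
		proof (intro conjI v)
			show "\<phi> \<in> borel_measurable half_line" by (rule primitive_measurable[OF p])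
			show "\<exists>M. \<forall>x>0. cmod (\<phi> x) \<le> M"
			proof (intro exI[of _ "max M 0"] allI impI)
				fix x :: real assume "x > 0"
				then show "cmod (\<phi> x) \<le> max M 0" using M[of x] ab(3)[of x] by (cases "x \<in> {a..b}") auto
			qed
			show "\<exists>a b. 0 < a \<and> a \<le> b \<and> (\<forall>x>0. x \<notin> {a..b} \<longrightarrow> v x = 0 \<and> \<phi> x = 0)"
				using ab vout by blast
		qed
		then have tv: "test_fun v \<phi>" .
		have "(LINT x|half_line. u x * \<psi> x) = (LINT x|half_line. w x * v x)" using uw[OF tv t] by simp
		also have "\<dots> = - (LINT x|half_line. W1 x * \<phi> x)" by (rule test_fun_by_parts[OF W1 tv])
		also have "\<dots> = (LINT x|half_line. W2 x * \<psi> x)" using test_fun_by_parts[OF W2 t] by simp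
		finally have "(LINT x|half_line. u x * \<psi> x) - (LINT x|half_line. W2 x * \<psi> x) = 0" by simp
		then show ?thesis
			unfolding z_def left_diff_distrib
			by (subst Bochner_Integration.integral_diff) (use test_fun_integrable_mult[OF u t] test_fun_integrable_mult[OF W2i t] in auto)
	qed
	have "\<exists>c. \<forall>\<phi> \<psi>. test_fun \<phi> \<psi> \<longrightarrow> (LINT x|half_line. z x * \<psi> x) = c * (LINT x|half_line. \<phi> x)"
	proof (cases "\<exists>\<phi>0 \<psi>0. test_fun \<phi>0 \<psi>0 \<and> (LINT x|half_line. \<phi>0 x) \<noteq> 0")
		case True
		then obtain \<phi>0 \<psi>0 where t0: "test_fun \<phi>0 \<psi>0" "(LINT x|half_line. \<phi>0 x) \<noteq> 0" by blast
		define I0 where "I0 = (LINT x|half_line. \<phi>0 x)"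
		define c where "c = (LINT x|half_line. z x * \<psi>0 x) / I0"
		have "(LINT x|half_line. z x * \<psi> x) = c * (LINT x|half_line. \<phi> x)" if t: "test_fun \<phi> \<psi>" for \<phi> \<psi>
		proof -
			define k where "k = - (LINT x|half_line. \<phi> x) / I0"
			have tk: "test_fun (\<lambda>x. \<phi> x + k * \<phi>0 x) (\<lambda>x. \<psi> x + k * \<psi>0 x)"
				by (rule test_fun_combination[OF t t0(1)])
			have "(LINT x|half_line. \<phi> x + k * \<phi>0 x) = (LINT x|half_line. \<phi> x) + k * I0"
				using test_fun_integrable[OF t] test_fun_integrable[OF t0(1)] by (simp add: I0_def)
			also have "\<dots> = 0" using t0(2) by (simp add: k_def I0_def)
			finally have "(LINT x|half_line. z x * (\<psi> x + k * \<psi>0 x)) = 0" by (rule z0[OF tk])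
			moreover have "(LINT x|half_line. z x * (\<psi> x + k * \<psi>0 x)) = (LINT x|half_line. z x * \<psi> x + k * (z x * \<psi>0 x))"
				by (simp add: algebra_simps)
			moreover have "\<dots> = (LINT x|half_line. z x * \<psi> x) + k * (LINT x|half_line. z x * \<psi>0 x)"
				using test_fun_integrable_mult(2)[OF zi t] test_fun_integrable_mult(2)[OF zi t0(1)] by simp
			ultimately have "(LINT x|half_line. z x * \<psi> x) = - k * (LINT x|half_line. z x * \<psi>0 x)"
				by (simp add: add_eq_0_iff2)
			then show ?thesis by (simp add: k_def c_def)
		qed
		then show ?thesis by blast
	next
		case False
		then show ?thesis using z0 by (intro exI[of _ 0]) auto
	qed
	then obtain c where c: "\<And>\<phi> \<psi>. test_fun \<phi> \<psi> \<Longrightarrow> (LINT x|half_line. z x * \<psi> x) = c * (LINT x|half_line. \<phi> x)" by blast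
	obtain z' where z': "primitive z' (\<lambda>x. - c)" "AE x in half_line. z x = z' x"
	proof (rule du_Bois_Reymond[OF zi, of "\<lambda>x. - c"])
		show "loc_integrable (\<lambda>x. - c)" by (intro loc_integrable_continuous continuous_intros)
		show "(LINT x|half_line. - c * \<phi> x) = - (LINT x|half_line. z x * \<psi> x)" if "test_fun \<phi> \<psi>" for \<phi> \<psi>
			using c[OF that] test_fun_integrable[OF that] by simp
	qed (use that in blast)
	have "primitive (\<lambda>x. W2 x + z' x) (\<lambda>x. W1 x + - c)" by (rule primitive_add[OF W2 z'(1)])
	moreover have "primitive (\<lambda>x. W1 x + - c) w" using primitive_add[OF W1 primitive_const[of "- c"]] by simp
	moreover have "AE x in half_line. u x = W2 x + z' x" using z'(2) by eventually_elim (simp add: z_def algebra_simps)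
	ultimately show ?thesis by (rule that)
qed

section \<open>Square integrability and behaviour at the origin\<close>

lemma integrable_half_line_iff:
	fixes h :: "real \<Rightarrow> 'a::euclidean_space"
	shows "integrable half_line h \<longleftrightarrow> h absolutely_integrable_on {0<..}"
	by (simp add: integrable_restrict_space set_integrable_def)

lemma integrable_half_line_subinterval:
	fixes h :: "real \<Rightarrow> 'a::euclidean_space"
	assumes "integrable half_line h" "0 < a"
	shows "h absolutely_integrable_on {a..b}" "h integrable_on {a..b}"
proof -
	show "h absolutely_integrable_on {a..b}"
		by (rule set_integrable_subset[of _ "{0<..}"]) (use assms in \<open>auto simp: integrable_half_line_iff\<close>)
	then show "h integrable_on {a..b}" by (rule set_lebesgue_integral_eq_integral)
qed

lemma LINT_half_line_eq_integral:
	fixes h :: "real \<Rightarrow> 'a::euclidean_space"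
	assumes "integrable half_line h"
	shows "(LINT x|half_line. h x) = integral {0<..} h" "h integrable_on {0<..}"
proof -
	show "(LINT x|half_line. h x) = integral {0<..} h"
		by (rule lebesgue_integral_eq_integral) (use assms in auto)
	show "h integrable_on {0<..}"
		using assms by (simp add: integrable_half_line_iff set_lebesgue_integral_eq_integral(1))
qed

lemma integral_subinterval_le:
	fixes h :: "real \<Rightarrow> real"
	assumes h: "integrable half_line h" and nn: "\<And>x. 0 \<le> h x" and a: "0 < a"
	shows "integral {a..b} h \<le> (LINT x|half_line. h x)"
	unfolding LINT_half_line_eq_integral(1)[OF h]
	by (rule integral_subset_le)
		 (use a nn integrable_half_line_subinterval[OF h a] LINT_half_line_eq_integral(2)[OF h] in auto)

lemma sq_integrableD:
	assumes "sq_integrable f"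
	shows "f \<in> borel_measurable half_line" "integrable half_line (\<lambda>x. (cmod (f x))\<^sup>2)"
	using assms by (auto simp: sq_integrable_def)

lemma integral_sq_le:
	assumes f: "sq_integrable f" and a: "0 < a"
	shows "integral {a..b} (\<lambda>x. (cmod (f x))\<^sup>2) \<le> (norm (L2 f))\<^sup>2"
	using integral_subinterval_le[OF sq_integrableD(2)[OF f] _ a] by (simp add: norm_L2_sq f)

lemma integral_extend_by_0:
	fixes h :: "real \<Rightarrow> 'a::euclidean_space"
	assumes "S \<subseteq> T" "h integrable_on S"
	shows "(\<lambda>x. if x \<in> S then h x else 0) integrable_on T"
		"integral T (\<lambda>x. if x \<in> S then h x else 0) = integral S h"
proof -
	have "((\<lambda>x. if x \<in> S then h x else 0) has_integral integral S h) T"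
		unfolding has_integral_restrict[OF assms(1)] by (rule integrable_integral[OF assms(2)])
	then show "(\<lambda>x. if x \<in> S then h x else 0) integrable_on T"
		"integral T (\<lambda>x. if x \<in> S then h x else 0) = integral S h" by (auto simp: integral_unique)
qed

lemma inverse_Suc_bounds: "0 < 1 / real (Suc k)" "1 / real (Suc k) \<le> 1" "1 \<le> real (Suc k)" "1 / real (Suc k) \<le> real (Suc k)"
proof -
	show "0 < 1 / real (Suc k)" "1 \<le> real (Suc k)" by simp_all
	show le: "1 / real (Suc k) \<le> 1" by (simp add: divide_le_eq)
	show "1 / real (Suc k) \<le> real (Suc k)" by (rule order_trans[OF le]) simp
qed

lemma integrable_half_line_of_bounded:
	fixes h :: "real \<Rightarrow> real"
	assumes nn: "\<And>x. x > 0 \<Longrightarrow> 0 \<le> h x"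
		and int: "\<And>a b. 0 < a \<Longrightarrow> a \<le> b \<Longrightarrow> h integrable_on {a..b}"
		and le: "\<And>a b. 0 < a \<Longrightarrow> a \<le> b \<Longrightarrow> integral {a..b} h \<le> B"
	shows "integrable half_line h"
proof -
	define S where "S k = {1 / real (Suc k)..real (Suc k)}" for k
	define f where "f k x = (if x \<in> S k then h x else 0)" for k x
	have S_sub: "S k \<subseteq> S (Suc k)" for k by (auto simp: S_def frac_le elim!: order_trans[rotated])
	have S0: "S k \<subseteq> {0<..}" for k by (auto simp: S_def intro: less_le_trans[rotated])
	note S1 = inverse_Suc_bounds(1,4)
	have hS: "h integrable_on S k" for k unfolding S_def by (rule int[OF S1])
	have "h integrable_on {0<..} \<and> (\<lambda>k. integral {0<..} (f k)) \<longlonglongrightarrow> integral {0<..} h"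
	proof (rule monotone_convergence_increasing)
		show "f k integrable_on {0<..}" for k
			unfolding f_def by (rule integral_extend_by_0(1)[OF S0 hS])
		show "f k x \<le> f (Suc k) x" if "x \<in> {0<..}" for k x
			using S_sub[of k] nn that by (auto simp: f_def)
		show "(\<lambda>k. f k x) \<longlonglongrightarrow> h x" if "x \<in> {0<..}" for x
		proof (rule tendsto_eventually)
			have x: "x > 0" using that by simp
			obtain N :: nat where N: "max x (1/x) < real N" using reals_Archimedean2 by blast
			have "x \<in> S k" if "k \<ge> N" for k
			proof -
				have "1/x \<le> real (Suc k)" "x \<le> real (Suc k)" using N that by auto
				then show ?thesis using x by (auto simp: S_def field_simps)
			qed
			then show "\<forall>\<^sub>F k in sequentially. f k x = h x"
				unfolding eventually_sequentially f_def by (intro exI[of _ N]) auto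
		qed
		have "integral {0<..} (f k) = integral (S k) h" for k
			unfolding f_def by (rule integral_extend_by_0(2)[OF S0 hS])
		moreover have "0 \<le> integral (S k) h \<and> integral (S k) h \<le> B" for k
		proof
			show "0 \<le> integral (S k) h" by (rule integral_nonneg[OF hS]) (use S0[of k] nn in auto)
			show "integral (S k) h \<le> B" unfolding S_def by (rule le[OF S1])
		qed
		ultimately show "bounded (range (\<lambda>k. integral {0<..} (f k)))"
			unfolding bounded_iff by (intro exI[of _ B]) auto
	qed
	then show ?thesis
		unfolding integrable_half_line_iff by (intro nonnegative_absolutely_integrable_1) (use nn in auto)
qed

lemma sq_integrable_of_bounded:
	assumes m: "f \<in> borel_measurable half_line"
		and int: "\<And>a b. 0 < a \<Longrightarrow> a \<le> b \<Longrightarrow> (\<lambda>x. (cmod (f x))\<^sup>2) integrable_on {a..b}"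
		and le: "\<And>a b. 0 < a \<Longrightarrow> a \<le> b \<Longrightarrow> integral {a..b} (\<lambda>x. (cmod (f x))\<^sup>2) \<le> B"
	shows "sq_integrable f"
	unfolding sq_integrable_def
	by (intro conjI m integrable_half_line_of_bounded[where B=B]) (use int le in auto)

lemma sq_integrable_dominated:
	assumes m: "f \<in> borel_measurable half_line" and g: "sq_integrable g"
		and le: "\<And>x. x > 0 \<Longrightarrow> cmod (f x) \<le> cmod (g x)"
	shows "sq_integrable f"
	unfolding sq_integrable_def
proof (intro conjI m)
	show "integrable half_line (\<lambda>x. (cmod (f x))\<^sup>2)"
	proof (rule Bochner_Integration.integrable_bound[OF sq_integrableD(2)[OF g]])
		show "AE x in half_line. norm ((cmod (f x))\<^sup>2) \<le> norm ((cmod (g x))\<^sup>2)"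
			using AE_space[of half_line] by eventually_elim (use le in \<open>auto intro: power_mono\<close>)
	qed (use m in measurable)
qed

lemma sq_integrable_cmod: "sq_integrable h \<Longrightarrow> sq_integrable (\<lambda>x. cpx (cmod (h x)))"
	by (auto simp: sq_integrable_def intro: borel_measurable_of_real)

lemma integrable_half_line_exhaust:
	fixes k :: "real \<Rightarrow> 'a::euclidean_space"
	assumes k: "integrable half_line k"
	shows "(\<lambda>n. integral {1 / real (Suc n)..real (Suc n)} k) \<longlonglongrightarrow> (LINT x|half_line. k x)"
proof -
	define S where "S n = {1 / real (Suc n)..real (Suc n)}" for n
	have S0: "S n \<subseteq> {0<..}" for n by (auto simp: S_def intro: less_le_trans[rotated])
	have kS: "k integrable_on S n" for n
		unfolding S_def by (rule integrable_half_line_subinterval(2)[OF k]) simp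
	have "(\<lambda>n. integral {0<..} (\<lambda>x. if x \<in> S n then k x else 0)) \<longlonglongrightarrow> integral {0<..} k"
	proof (rule dominated_convergence(2)[where h="\<lambda>x. norm (k x)"])
		show "(\<lambda>x. if x \<in> S n then k x else 0) integrable_on {0<..}" for n
			by (rule integral_extend_by_0(1)[OF S0 kS])
		show "(\<lambda>x. norm (k x)) integrable_on {0<..}"
			using k by (simp add: integrable_half_line_iff absolutely_integrable_on_def)
		show "(\<lambda>n. if x \<in> S n then k x else 0) \<longlonglongrightarrow> k x" if "x \<in> {0<..}" for x
		proof (rule tendsto_eventually)
			have x: "x > 0" using that by simp
			obtain N :: nat where N: "max x (1/x) < real N" using reals_Archimedean2 by blast
			have "x \<in> S k" if "k \<ge> N" for k
			proof -
				have "1/x \<le> real (Suc k)" "x \<le> real (Suc k)" using N that by auto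
				then show ?thesis using x by (auto simp: S_def field_simps)
			qed
			then show "\<forall>\<^sub>F n in sequentially. (if x \<in> S n then k x else 0) = k x"
				unfolding eventually_sequentially by (intro exI[of _ N]) auto
		qed
	qed auto
	moreover have "integral {0<..} (\<lambda>x. if x \<in> S n then k x else 0) = integral (S n) k" for n
		by (rule integral_extend_by_0(2)[OF S0 kS])
	ultimately show ?thesis by (simp add: S_def LINT_half_line_eq_integral(1)[OF k])
qed

lemma integrable_half_line_tail:
	fixes k :: "real \<Rightarrow> 'a::euclidean_space"
	assumes k: "integrable half_line k"
	shows "(\<lambda>n. integral {real (Suc n)..real (Suc n) + 1} (\<lambda>x. norm (k x))) \<longlonglongrightarrow> 0"
proof -
	define h where "h x = norm (k x)" for x
	have hi: "integrable half_line h" using k by (simp add: h_def[abs_def])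
	define S where "S n = integral {1 / real (Suc n)..real (Suc n)} h" for n
	have S: "S \<longlonglongrightarrow> (LINT x|half_line. h x)" unfolding S_def by (rule integrable_half_line_exhaust[OF hi])
	have "(\<lambda>n. S (Suc n) - S n) \<longlonglongrightarrow> 0" using tendsto_diff[OF LIMSEQ_Suc[OF S] S] by simp
	moreover have "norm (integral {real (Suc n)..real (Suc n) + 1} h) \<le> S (Suc n) - S n" for n
	proof -
		note ih = integrable_half_line_subinterval(2)[OF hi]
		have "S n + integral {real (Suc n)..real (Suc n) + 1} h = integral {1 / real (Suc n)..real (Suc n) + 1} h"
			unfolding S_def using inverse_Suc_bounds(4)[of n]
			by (intro Henstock_Kurzweil_Integration.integral_combine ih inverse_Suc_bounds) simp_all
		also have "\<dots> \<le> S (Suc n)"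
			unfolding S_def by (rule integral_subset_le) (auto intro!: ih simp: h_def frac_le)
		finally show ?thesis
			using integral_nonneg[OF ih[of "real (Suc n)" "real (Suc n) + 1"]] by (simp add: h_def)
	qed
	ultimately have "(\<lambda>n. integral {real (Suc n)..real (Suc n) + 1} h) \<longlonglongrightarrow> 0"
		by (rule Lim_null_comparison[OF always_eventually[OF allI], rotated])
	then show ?thesis by (simp add: h_def[abs_def])
qed

lemma filterlim_inverse_Suc: "filterlim (\<lambda>n. 1 / real (Suc n)) (at_right 0) sequentially"
proof (rule tendsto_imp_filterlim_at_right)
	show "(\<lambda>n. 1 / real (Suc n)) \<longlonglongrightarrow> 0"
		using LIMSEQ_inverse_real_of_nat by (simp only: inverse_eq_divide)
qed simp

lemma primitive_LINT:
	assumes p: "primitive q k" and k: "integrable half_line k" and q: "integrable half_line q"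
		and l: "lim0 q l"
	shows "(LINT x|half_line. k x) = - l"
proof -
	have kn: "integrable half_line (\<lambda>x. cmod (k x))" and qn: "integrable half_line (\<lambda>x. cmod (q x))" using k q by auto
	have bound: "cmod (q (real (Suc n))) \<le> integral {real (Suc n)..real (Suc n) + 1} (\<lambda>x. cmod (k x))
			+ integral {real (Suc n)..real (Suc n) + 1} (\<lambda>x. cmod (q x))" for n
	proof -
		define a where "a = real (Suc n)"
		have a: "a > 0" by (simp add: a_def)
		define K where "K = integral {a..a+1} (\<lambda>x. cmod (k x))"
		note ki = integrable_half_line_subinterval(2)[OF kn a] and qi = integrable_half_line_subinterval(2)[OF qn a]
		have "cmod (q a) \<le> K + cmod (q t)" if t: "t \<in> {a..a+1}" for t
		proof -
			have "cmod (q t - q a) = cmod (integral {a..t} k)" using primitiveD(3)[OF p a, of t] t by simp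
			also have "\<dots> \<le> integral {a..t} (\<lambda>x. cmod (k x))"
				by (rule integral_norm_bound_integral) (use integrable_half_line_subinterval(2)[OF k a] ki in auto)
			also have "\<dots> \<le> K" unfolding K_def by (rule integral_subset_le) (use t ki in auto)
			finally have "cmod (q t - q a) \<le> K" .
			moreover have "cmod (q a) \<le> cmod (q t - q a) + cmod (q t)"
				using norm_triangle_ineq[of "q a - q t" "q t"] by (simp add: norm_minus_commute)
			ultimately show ?thesis by linarith
		qed
		then have "integral {a..a+1} (\<lambda>t. cmod (q a)) \<le> integral {a..a+1} (\<lambda>t. K + cmod (q t))"
			by (intro integral_le) (auto intro!: integrable_add qi)
		also have "integral {a..a+1} (\<lambda>t. K + cmod (q t)) = K + integral {a..a+1} (\<lambda>t. cmod (q t))"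
			by (subst Henstock_Kurzweil_Integration.integral_add) (use qi in auto)
		finally show ?thesis by (simp add: K_def a_def)
	qed
	have "(\<lambda>n. integral {real (Suc n)..real (Suc n) + 1} (\<lambda>x. cmod (k x))
			+ integral {real (Suc n)..real (Suc n) + 1} (\<lambda>x. cmod (q x))) \<longlonglongrightarrow> 0 + 0"
		by (intro tendsto_add integrable_half_line_tail k q)
	then have "(\<lambda>n. integral {real (Suc n)..real (Suc n) + 1} (\<lambda>x. cmod (k x))
			+ integral {real (Suc n)..real (Suc n) + 1} (\<lambda>x. cmod (q x))) \<longlonglongrightarrow> 0" by (simp only: add_0)
	then have q_inf: "(\<lambda>n. q (real (Suc n))) \<longlonglongrightarrow> 0"
		by (rule Lim_null_comparison[OF always_eventually, rotated]) (use bound in blast)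
	have q0: "(\<lambda>n. q (1 / real (Suc n))) \<longlonglongrightarrow> l" by (rule filterlim_compose[OF l filterlim_inverse_Suc])
	have "integral {1 / real (Suc n)..real (Suc n)} k = q (real (Suc n)) - q (1 / real (Suc n))" for n
		by (rule primitiveD(3)[OF p inverse_Suc_bounds(1,4)])
	then have "(\<lambda>n. integral {1 / real (Suc n)..real (Suc n)} k) \<longlonglongrightarrow> 0 - l"
		using tendsto_diff[OF q_inf q0] by simp
	then show ?thesis using LIMSEQ_unique[OF integrable_half_line_exhaust[OF k]] by simp
qed

lemma continuous_on_powr_half_line: "continuous_on {0<..} (\<lambda>x. pw p x)"
	by (intro continuous_intros) auto

lemma cmod_weighted_integral_le:
	assumes z: "sq_integrable z" and ab: "0 < a" "a \<le> b"
	shows "cmod (integral {a..b} (\<lambda>x. pw p x * z x))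
		\<le> norm (L2 z) * sqrt (integral {a..b} (\<lambda>x. x powr (2 * p)))"
proof -
	define w where "w x = indicator {a..b} x * pw p x" for x
	have wsq: "(\<lambda>x. (cmod (w x))\<^sup>2) = (\<lambda>x. indicator {a..b} x * x powr (2 * p))"
		by (auto simp: w_def norm_mult indicator_def power2_eq_square powr_add[symmetric])
	have pc: "continuous_on {a..b} (\<lambda>x. x powr (2 * p))" by (intro continuous_intros) (use ab in auto)
	have eq: "(\<lambda>x. indicator {0<..} x *\<^sub>R (indicator {a..b} x * x powr (2 * p))) = (\<lambda>x. indicator {a..b} x *\<^sub>R x powr (2 * p))"
		using ab by (auto simp: indicator_def)
	have wi: "integrable half_line (\<lambda>x. indicator {a..b} x * x powr (2 * p))"
		using absolutely_integrable_continuous_real[OF pc] unfolding set_integrable_def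
		by (subst integrable_restrict_space) (simp_all only: eq, simp)
	have w: "sq_integrable w"
		unfolding sq_integrable_def wsq
		by (intro conjI wi, unfold w_def, intro borel_measurable_times measurable_restrict_space1 borel_measurable_indicator
				continuous_on_measurable_half_line continuous_on_powr_half_line) auto
	have "(norm (L2 w))\<^sup>2 = (LINT x|half_line. indicator {a..b} x * x powr (2 * p))" by (simp add: norm_L2_sq w wsq)
	also have "\<dots> = (LINT x:{a..b}|lebesgue. x powr (2 * p))"
		unfolding set_lebesgue_integral_def by (subst integral_restrict_space) (simp_all only: eq, simp)
	also have "\<dots> = integral {a..b} (\<lambda>x. x powr (2 * p))"
		by (rule set_lebesgue_integral_eq_integral(2)[OF absolutely_integrable_continuous_real[OF pc]])
	finally have nw: "norm (L2 w) = sqrt (integral {a..b} (\<lambda>x. x powr (2 * p)))"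
		by (metis norm_ge_zero real_sqrt_unique)
	have li: "loc_integrable (\<lambda>x. pw p x * z x)"
		by (intro loc_integrable_continuous_mult sq_integrable_loc_integrable z continuous_on_powr_half_line)
	have "l2_inner (L2 z) (L2 w) = (LINT x|half_line. z x * cnj (w x))" by (rule l2_inner_L2[OF z w])
	also have "\<dots> = (LINT x|half_line. indicator {a..b} x * (pw p x * z x))"
		by (rule Bochner_Integration.integral_cong) (auto simp: w_def indicator_def)
	also have "\<dots> = integral {a..b} (\<lambda>x. indicator {a..b} x * (pw p x * z x))"
	proof (rule LINT_half_line_compact_support(2)[OF ab])
		show "(\<lambda>x. indicator {a..b} x * (pw p x * z x)) absolutely_integrable_on {a..b}"
			by (rule absolutely_integrable_spike[where f="\<lambda>x. pw p x * z x" and S="{}"])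
				 (use li ab in \<open>auto simp: loc_integrable_def\<close>)
	qed auto
	also have "\<dots> = integral {a..b} (\<lambda>x. pw p x * z x)"
		by (rule Henstock_Kurzweil_Integration.integral_cong) auto
	finally show ?thesis using cmod_l2_inner_le[of "L2 z" "L2 w"] by (simp add: nw)
qed

lemma integral_powr_le:
	fixes a b q :: real
	assumes ab: "0 < a" "a \<le> b" and q: "q > -1"
	shows "integral {a..b} (\<lambda>x. x powr q) \<le> b powr (q + 1) / (q + 1)"
proof -
	have "((\<lambda>x. x powr q) has_integral (b powr (q+1) / (q+1) - a powr (q+1) / (q+1))) {a..b}"
		by (rule fundamental_theorem_of_calculus[where f="\<lambda>x. x powr (q+1) / (q+1)"])
			 (use ab q in \<open>auto intro!: derivative_eq_intros simp: has_real_derivative_iff_has_vector_derivative[symmetric]\<close>)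
	then have "integral {a..b} (\<lambda>x. x powr q) = b powr (q+1) / (q+1) - a powr (q+1) / (q+1)" by (rule integral_unique)
	moreover have "0 \<le> a powr (q+1) / (q+1)" using q by simp
	ultimately show ?thesis by linarith
qed

lemma AE_half_lineI: "(\<And>x. x > 0 \<Longrightarrow> P x) \<Longrightarrow> AE x in half_line. P x"
	using AE_space[of half_line] by (auto elim: eventually_mono)

lemma L2_eqI: "sq_integrable f \<Longrightarrow> (\<And>x. x > 0 \<Longrightarrow> f x = g x) \<Longrightarrow> L2 f = L2 g"
	using sq_integrable_cong_AE[of f g] by (simp add: L2_eq_iff AE_half_lineI)

lemma sq_integrable_piecewise:
	fixes f1 f2 :: "real \<Rightarrow> real"
	assumes c: "c > 0" and c1: "continuous_on {0<..c} f1" and c2: "continuous_on {c..} f2"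
		and b1: "\<And>a. 0 < a \<Longrightarrow> a \<le> c \<Longrightarrow> integral {a..c} (\<lambda>x. (f1 x)\<^sup>2) \<le> K"
		and b2: "\<And>b. c \<le> b \<Longrightarrow> integral {c..b} (\<lambda>x. (f2 x)\<^sup>2) \<le> L"
	shows "sq_integrable (\<lambda>x. cpx (if x < c then f1 x else f2 x))"
proof -
	define f where "f x = (if x < c then f1 x else f2 x)" for x
	have m: "(\<lambda>x. indicator {0<..<c} x *\<^sub>R f1 x + indicator {c..} x *\<^sub>R f2 x) \<in> borel_measurable borel"
		by (intro borel_measurable_add borel_measurable_continuous_on_indicator c2 continuous_on_subset[OF c1]) auto
	have "(\<lambda>x. indicator {0<..<c} x *\<^sub>R f1 x + indicator {c..} x *\<^sub>R f2 x) \<in> borel_measurable half_line"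
		by (intro measurable_restrict_space1 measurable_completion) (use m in simp)
	then have fm: "f \<in> borel_measurable half_line"
		by (rule measurable_half_line_cong_AE) (rule AE_half_lineI, auto simp: f_def indicator_def)
	have i1: "(\<lambda>x. (f x)\<^sup>2) integrable_on {a..c} \<and> integral {a..c} (\<lambda>x. (f x)\<^sup>2) = integral {a..c} (\<lambda>x. (f1 x)\<^sup>2)" if "0 < a" for a
	proof -
		have 1: "(\<lambda>x. (f1 x)\<^sup>2) integrable_on {a..c}"
			by (rule integrable_continuous_real) (intro continuous_intros continuous_on_subset[OF c1], use that in auto)
		have 2: "(f x)\<^sup>2 = (f1 x)\<^sup>2" if "x \<in> {a..c} - {c}" for x using that by (auto simp: f_def)
		have "integral {a..c} (\<lambda>x. (f1 x)\<^sup>2) = integral {a..c} (\<lambda>x. (f x)\<^sup>2)"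
			by (rule integral_spike[OF negligible_sing[of c] 2])
		then show ?thesis using integrable_spike[OF 1 negligible_sing[of c] 2] by simp
	qed
	have i2: "(\<lambda>x. (f x)\<^sup>2) integrable_on {c..b} \<and> integral {c..b} (\<lambda>x. (f x)\<^sup>2) = integral {c..b} (\<lambda>x. (f2 x)\<^sup>2)" for b
	proof -
		have 1: "(\<lambda>x. (f2 x)\<^sup>2) integrable_on {c..b}"
			by (rule integrable_continuous_real) (intro continuous_intros continuous_on_subset[OF c2], auto)
		have 2: "(f x)\<^sup>2 = (f2 x)\<^sup>2" if "x \<in> {c..b}" for x using that by (auto simp: f_def)
		have "(\<lambda>x. (f x)\<^sup>2) integrable_on {c..b}" by (rule integrable_eq[OF 1 2[symmetric]])
		moreover have "integral {c..b} (\<lambda>x. (f x)\<^sup>2) = integral {c..b} (\<lambda>x. (f2 x)\<^sup>2)"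
			by (rule Henstock_Kurzweil_Integration.integral_cong[OF 2])
		ultimately show ?thesis by (rule conjI)
	qed
	have i: "(\<lambda>x. (f x)\<^sup>2) integrable_on {a..b} \<and> integral {a..b} (\<lambda>x. (f x)\<^sup>2) \<le> K + L" if ab: "0 < a" "a \<le> b" for a b
	proof -
		define a' b' where "a' = min a c" and "b' = max b c"
		have ab': "0 < a'" "a' \<le> c" "c \<le> b'" "{a..b} \<subseteq> {a'..b'}" using ab c by (auto simp: a'_def b'_def)
		have ia: "(\<lambda>x. (f x)\<^sup>2) integrable_on {a'..b'}"
			by (rule Henstock_Kurzweil_Integration.integrable_combine[OF ab'(2,3)]) (use i1[OF ab'(1)] i2 in auto)
		then have ib: "(\<lambda>x. (f x)\<^sup>2) integrable_on {a..b}" by (rule integrable_on_subinterval[OF _ ab'(4)])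
		have "integral {a..b} (\<lambda>x. (f x)\<^sup>2) \<le> integral {a'..b'} (\<lambda>x. (f x)\<^sup>2)"
			by (rule integral_subset_le[OF ab'(4) ib ia]) simp
		also have "\<dots> = integral {a'..c} (\<lambda>x. (f x)\<^sup>2) + integral {c..b'} (\<lambda>x. (f x)\<^sup>2)"
			by (rule Henstock_Kurzweil_Integration.integral_combine[symmetric, OF ab'(2,3) ia])
		also have "\<dots> \<le> K + L" using i1[OF ab'(1)] i2[of b'] b1[OF ab'(1,2)] b2[OF ab'(3)] by simp
		finally show ?thesis using ib by blast
	qed
	have "sq_integrable (\<lambda>x. cpx (f x))"
		by (rule sq_integrable_of_bounded[where B="K + L"]) (use fm i in \<open>auto intro: borel_measurable_of_real\<close>)
	then show ?thesis by (simp add: f_def[abs_def])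
qed

text \<open>
	A function with the growth \<open>x powr p\<close> at \<open>0\<close> and a square integrable tail, used as a majorant.
\<close>

definition weight :: "real \<Rightarrow> real \<Rightarrow> complex"
	where "weight p x = cpx (if x < 1 then x powr p else 1 / x)"

lemma sq_integrable_weight:
	assumes p: "p > -1/2"
	shows "sq_integrable (weight p)"
proof -
	have "sq_integrable (\<lambda>x. cpx (if x < 1 then x powr p else 1 / x))"
	proof (rule sq_integrable_piecewise)
		show "continuous_on {0<..1} (\<lambda>x. x powr p)" by (intro continuous_intros) auto
		show "continuous_on {1..} (\<lambda>x::real. 1 / x)" by (intro continuous_intros) auto
		show "integral {a..1} (\<lambda>x. (x powr p)\<^sup>2) \<le> 1 / (2 * p + 1)" if a: "0 < a" "a \<le> 1" for a
		proof -
			have "(\<lambda>x. (x powr p)\<^sup>2) = (\<lambda>x. x powr (2 * p))" by (auto simp: power2_eq_square powr_add[symmetric])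
			then show ?thesis using integral_powr_le[OF a, of "2 * p"] p by simp
		qed
		show "integral {1..b} (\<lambda>x. (1 / x)\<^sup>2) \<le> 1" if b: "1 \<le> b" for b :: real
		proof -
			have "((\<lambda>x. (1 / x)\<^sup>2) has_integral (- 1 / b - (- 1 / 1))) {1..b}"
				by (rule fundamental_theorem_of_calculus)
					 (use b in \<open>auto intro!: derivative_eq_intros simp: has_real_derivative_iff_has_vector_derivative[symmetric] power2_eq_square\<close>)
			then show ?thesis using b by (simp add: integral_unique)
		qed
	qed simp
	then show ?thesis by (simp add: weight_def[abs_def])
qed

lemma sq_integrable_le_weight:
	assumes m: "f \<in> borel_measurable half_line" and p: "p > -1/2"
		and near: "\<And>x. 0 < x \<Longrightarrow> x < 1 \<Longrightarrow> cmod (f x) \<le> K * x powr p"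
		and far: "\<And>x. 1 \<le> x \<Longrightarrow> cmod (f x) \<le> K / x"
	shows "sq_integrable f"
proof (rule sq_integrable_dominated[OF m sq_integrable_scale[OF sq_integrable_weight[OF p], of "cpx K"]])
	have K: "K \<ge> 0" using order_trans[OF norm_ge_zero far[of 1]] by simp
	fix x :: real assume "x > 0"
	then show "cmod (f x) \<le> cmod (cpx K * weight p x)"
		using near[of x] far[of x] K by (auto simp: weight_def norm_mult)
qed

text \<open>
	By the Cauchy-Schwarz inequality the increment of \<open>y\<close> over \<open>[x', x]\<close> is at most the norm of \<open>z\<close> times the
	square root of the integral of \<open>t powr (2 p)\<close>, which converges at \<open>0\<close>.
\<close>

lemma primitive_limit_at_0:
	assumes y: "primitive y (\<lambda>x. pw p x * z x)" and z: "sq_integrable z" and p: "2 * p + 1 > 0"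
	obtains l where "lim0 y l"
		"\<And>x. x > 0 \<Longrightarrow> cmod (y x - l) \<le> norm (L2 z) / sqrt (2 * p + 1) * x powr (p + 1/2)"
proof -
	define K where "K = norm (L2 z) / sqrt (2 * p + 1)"
	have K: "K \<ge> 0" using p by (simp add: K_def)
	have d: "cmod (y b - y a) \<le> K * b powr (p + 1/2)" if ab: "0 < a" "a \<le> b" for a b
	proof -
		have "cmod (y b - y a) = cmod (integral {a..b} (\<lambda>x. pw p x * z x))"
			using primitiveD(3)[OF y ab] by simp
		also have "\<dots> \<le> norm (L2 z) * sqrt (integral {a..b} (\<lambda>x. x powr (2 * p)))"
			by (rule cmod_weighted_integral_le[OF z ab])
		also have "\<dots> \<le> norm (L2 z) * sqrt (b powr (2 * p + 1) / (2 * p + 1))"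
			by (intro mult_left_mono real_sqrt_le_mono integral_powr_le ab) (use p in auto)
		also have "sqrt (b powr (2 * p + 1) / (2 * p + 1)) = b powr (p + 1/2) / sqrt (2 * p + 1)"
			using ab by (simp add: real_sqrt_divide powr_half_sqrt[symmetric] powr_powr algebra_simps add_divide_distrib)
		finally show ?thesis by (simp add: K_def)
	qed
	have lim0: "lim0 (\<lambda>x. K * x powr (p + 1/2)) 0"
	proof -
		have "lim0 (\<lambda>x. x powr (p + 1/2)) (0 powr (p + 1/2))"
			by (rule tendsto_powr2) (use p in \<open>auto intro!: tendsto_ident_at eventually_at_right_less[THEN eventually_mono]\<close>)
		from tendsto_mult_right_zero[of _ _ K] this show ?thesis by simp
	qed
	define s where "s n = y (1 / real (Suc n))" for n
	note inv = filterlim_inverse_Suc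
	have "Cauchy s"
	proof (rule CauchyI)
		fix e :: real assume "e > 0"
		from order_tendstoD(2)[OF filterlim_compose[OF lim0 inv] this]
		obtain N where N: "\<And>n. n \<ge> N \<Longrightarrow> K * (1 / real (Suc n)) powr (p + 1/2) < e"
			unfolding eventually_sequentially by blast
		have *: "norm (s m - s n) < e" if "N \<le> m" "m \<le> n" for m n
		proof -
			have "1 / real (Suc n) \<le> 1 / real (Suc m)" using that by (intro divide_left_mono) auto
			then have "cmod (s m - s n) \<le> K * (1 / real (Suc m)) powr (p + 1/2)" unfolding s_def by (intro d) auto
			then show ?thesis using N[OF that(1)] by simp
		qed
		show "\<exists>M. \<forall>m\<ge>M. \<forall>n\<ge>M. norm (s m - s n) < e"
		proof (intro exI[of _ N] allI impI)
			fix m n assume "N \<le> m" "N \<le> n"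
			then show "norm (s m - s n) < e" using *[of m n] *[of n m] by (cases "m \<le> n") (auto simp: norm_minus_commute)
		qed
	qed
	then obtain l where l: "s \<longlonglongrightarrow> l" using Cauchy_convergent convergent_def by blast
	have bd: "cmod (y x - l) \<le> K * x powr (p + 1/2)" if x: "x > 0" for x
	proof (rule LIMSEQ_le_const2)
		show "(\<lambda>n. cmod (y x - s n)) \<longlonglongrightarrow> cmod (y x - l)" by (intro tendsto_intros l)
		obtain N :: nat where N: "1/x < real N" using reals_Archimedean2 by blast
		show "\<exists>N. \<forall>n\<ge>N. cmod (y x - s n) \<le> K * x powr (p + 1/2)"
		proof (intro exI[of _ N] allI impI)
			fix n assume "N \<le> n"
			then have "1/x \<le> real (Suc n)" using N by simp
			then have "1 / real (Suc n) \<le> x" using x by (simp add: field_simps)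
			then show "cmod (y x - s n) \<le> K * x powr (p + 1/2)" unfolding s_def by (intro d) auto
		qed
	qed
	have "lim0 (\<lambda>x. y x - l) 0"
		by (rule Lim_null_comparison[OF _ lim0]) (use bd in \<open>auto simp: eventually_at_right_less[THEN eventually_mono]\<close>)
	then have "lim0 y l" by (simp add: LIM_zero_iff)
	with bd show ?thesis using that unfolding K_def by blast
qed

section \<open>Non-integrability at the origin and Hardy's inequality\<close>

text \<open>
	\<open>ln \<bar>ln x\<bar>\<close> is an unbounded primitive of the lower bound.
\<close>

lemma not_sq_integrable_log:
	assumes c: "c > 0" and d: "\<delta> > 0"
		and le: "\<And>x. 0 < x \<Longrightarrow> x < \<delta> \<Longrightarrow> c / (x * \<bar>ln x\<bar>) \<le> (cmod (y x))\<^sup>2"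
	shows "\<not> sq_integrable y"
proof
	assume y: "sq_integrable y"
	define b where "b = min (\<delta>/2) (1/2)"
	have b: "0 < b" "b < \<delta>" "b < 1" using d by (auto simp: b_def)
	define L where "L = ln (- ln b)"
	have main: "c * (t - L) \<le> (norm (L2 y))\<^sup>2" if t: "t > L" for t
	proof -
		define a where "a = exp (- exp t)"
		have a: "a > 0" "ln (- ln a) = t" by (auto simp: a_def)
		have "exp L = - ln b" using b by (simp add: L_def)
		then have "- exp t < ln b" using t exp_less_mono[of L t] by linarith
		then have "ln a < ln b" by (simp add: a_def)
		then have ab: "a < b" using a(1) b(1) by simp
		have "((\<lambda>x. c / (x * \<bar>ln x\<bar>)) has_integral (- c * ln (- ln b) - (- c * ln (- ln a)))) {a..b}"
		proof (rule fundamental_theorem_of_calculus)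
			fix x assume x: "x \<in> {a..b}"
			then have "0 < x" "ln x < 0" using a b by auto
			then show "((\<lambda>x. - c * ln (- ln x)) has_vector_derivative c / (x * \<bar>ln x\<bar>)) (at x within {a..b})"
				unfolding has_real_derivative_iff_has_vector_derivative[symmetric]
				by (auto intro!: derivative_eq_intros simp: field_simps)
		qed (use ab in simp)
		then have hi: "((\<lambda>x. c / (x * \<bar>ln x\<bar>)) has_integral c * (t - L)) {a..b}"
			by (simp add: a L_def[symmetric] algebra_simps)
		have "c * (t - L) = integral {a..b} (\<lambda>x. c / (x * \<bar>ln x\<bar>))" using hi by (simp add: integral_unique)
		also have "\<dots> \<le> integral {a..b} (\<lambda>x. (cmod (y x))\<^sup>2)"
		proof (rule integral_le)
			show "(\<lambda>x. c / (x * \<bar>ln x\<bar>)) integrable_on {a..b}" using hi by (rule has_integral_integrable)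
			show "(\<lambda>x. (cmod (y x))\<^sup>2) integrable_on {a..b}"
				by (rule integrable_half_line_subinterval(2)[OF sq_integrableD(2)[OF y] a(1)])
			show "c / (x * \<bar>ln x\<bar>) \<le> (cmod (y x))\<^sup>2" if "x \<in> {a..b}" for x
				by (rule le) (use that a(1) b in auto)
		qed
		also have "\<dots> \<le> (norm (L2 y))\<^sup>2" by (rule integral_sq_le[OF y a(1)])
		finally show ?thesis .
	qed
	have "c * ((L + ((norm (L2 y))\<^sup>2 + 1) / c) - L) \<le> (norm (L2 y))\<^sup>2"
	proof (rule main)
		have "0 < ((norm (L2 y))\<^sup>2 + 1) / c" by (intro divide_pos_pos add_nonneg_pos c) auto
		then show "L < L + ((norm (L2 y))\<^sup>2 + 1) / c" by simp
	qed
	then show False using c by simp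
qed

lemma not_sq_integrable_powr:
	assumes c: "c > 0" and d: "\<delta> > 0" and p: "p \<le> -1/2"
		and le: "\<And>x. 0 < x \<Longrightarrow> x < \<delta> \<Longrightarrow> c * x powr p \<le> cmod (y x)"
	shows "\<not> sq_integrable y"
proof (rule not_sq_integrable_log)
	show "c\<^sup>2 > 0" "min \<delta> (1/exp 1) > 0" using c d by auto
	fix x :: real assume x: "0 < x" "x < min \<delta> (1/exp 1)"
	then have "ln x < ln (1 / exp 1)" by (subst ln_less_cancel_iff) auto
	then have l: "ln x < -1" by (simp add: ln_div)
	have x1: "x < 1" using x by (auto intro: less_trans[of _ "1 / exp 1"])
	have "c\<^sup>2 / (x * \<bar>ln x\<bar>) \<le> c\<^sup>2 / (x * 1)"
		by (intro divide_left_mono mult_left_mono mult_pos_pos) (use x l in auto)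
	also have "\<dots> = c\<^sup>2 * x powr (-1)" using x by (simp add: powr_minus divide_inverse)
	also have "\<dots> \<le> c\<^sup>2 * x powr (2 * p)"
		using x x1 p by (intro mult_left_mono powr_mono') auto
	also have "\<dots> = (c * x powr p)\<^sup>2" by (simp add: power_mult_distrib power2_eq_square powr_add[symmetric])
	also have "\<dots> \<le> (cmod (y x))\<^sup>2" by (intro power_mono le) (use x c in auto)
	finally show "c\<^sup>2 / (x * \<bar>ln x\<bar>) \<le> (cmod (y x))\<^sup>2" .
qed

lemma primitive_of_real_derivative:
	fixes f f' :: "real \<Rightarrow> real"
	assumes d: "\<And>x. x > 0 \<Longrightarrow> (f has_real_derivative f' x) (at x)" and c: "continuous_on {0<..} f'"
	shows "primitive (\<lambda>x. cpx (f x)) (\<lambda>x. cpx (f' x))"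
	by (rule primitive_of_has_derivative)
		 (use d in \<open>auto intro!: has_vector_derivative_of_real continuous_on_of_real c simp: has_real_derivative_iff_has_vector_derivative\<close>)

lemma primitive_inverse: "primitive (\<lambda>x. cpx (1 / x)) (\<lambda>x. cpx (- 1 / x\<^sup>2))"
	by (rule primitive_of_real_derivative)
		 (auto intro!: continuous_intros derivative_eq_intros simp: power2_eq_square)

text \<open>
	Integrate the derivative \<open>2 Re (z cnj y) / x + (2 \<sigma> - 1) \<bar>y/x\<bar>\<^sup>2\<close> of \<open>\<bar>y\<bar>\<^sup>2 / x\<close> over \<open>[a, 1]\<close>. The boundary
	term at \<open>a\<close> has the favourable sign if \<open>\<sigma> > 1/2\<close>, and it is bounded by hypothesis if \<open>\<sigma> < 1/2\<close>. Half of the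
	integral of \<open>\<bar>y/x\<bar>\<^sup>2\<close> absorbs the mixed term.
\<close>

lemma Hardy:
	assumes y: "sq_integrable y" and z: "sq_integrable z"
		and p: "primitive y (\<lambda>x. z x + cpx (\<sigma> / x) * y x)"
		and s: "\<sigma> > 1/2 \<or> (\<sigma> < 1/2 \<and> (\<exists>C. \<forall>x. 0 < x \<and> x < 1 \<longrightarrow> (cmod (y x))\<^sup>2 \<le> C * x))"
	shows "sq_integrable (\<lambda>x. y x / cpx x)"
proof -
	define w where "w x = z x + cpx (\<sigma> / x) * y x" for x
	have pw: "primitive y w" using p by (simp add: w_def[abs_def])
	define q where "q x = y x * cnj (y x) * cpx (1 / x)" for x
	define k where "k x = (w x * cnj (y x) + y x * cnj (w x)) * cpx (1 / x) + (y x * cnj (y x)) * cpx (- 1 / x\<^sup>2)" for x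
	have pq: "primitive q k"
		unfolding q_def k_def by (intro primitive_mult primitive_cnj pw primitive_inverse)
	define r where "r x = (cmod (y x / cpx x))\<^sup>2" for x
	define \<kappa> where "\<kappa> = \<bar>2 * \<sigma> - 1\<bar>"
	have \<kappa>: "\<kappa> > 0" using s by (auto simp: \<kappa>_def)
	define e where "e x = 2 * Re (z x * cnj (y x)) / x" for x
	have Rek: "Re (k x) = e x + (2 * \<sigma> - 1) * r x" if "x > 0" for x
	proof -
		have "y x * cnj (y x) = cpx ((cmod (y x))\<^sup>2)" by (simp add: complex_norm_square[symmetric])
		moreover have "w x * cnj (y x) + y x * cnj (w x) = cpx (2 * Re (w x * cnj (y x)))"
			using complex_add_cnj[of "w x * cnj (y x)"] by (simp add: mult.commute)
		moreover have "Re (w x * cnj (y x)) = Re (z x * cnj (y x)) + \<sigma> / x * (cmod (y x))\<^sup>2"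
		proof -
			have "w x * cnj (y x) = z x * cnj (y x) + cpx (\<sigma> / x * (cmod (y x))\<^sup>2)"
				using calculation(1) by (simp add: w_def algebra_simps)
			then show ?thesis by (simp only: plus_complex.sel Re_complex_of_real)
		qed
		ultimately have "k x = cpx ((2 * (Re (z x * cnj (y x)) + \<sigma> / x * (cmod (y x))\<^sup>2)) * (1/x) + (cmod (y x))\<^sup>2 * (-1 / x\<^sup>2))"
			by (simp only: k_def of_real_mult of_real_add)
		then have "Re (k x) = (2 * (Re (z x * cnj (y x)) + \<sigma> / x * (cmod (y x))\<^sup>2)) * (1/x) + (cmod (y x))\<^sup>2 * (-1 / x\<^sup>2)"
			by (simp only: Re_complex_of_real)
		also have "\<dots> = e x + (2 * \<sigma> - 1) * r x"
			using that by (simp add: e_def r_def norm_divide power_divide power2_eq_square field_simps)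
		finally show ?thesis .
	qed
	have Req: "Re (q x) = (cmod (y x))\<^sup>2 / x" for x
		by (simp add: q_def complex_norm_square[symmetric] flip: of_real_mult of_real_divide)
	have yc: "continuous_on {0<..} y" by (rule primitive_continuous_on[OF p])
	have rc: "continuous_on {0<..} r"
		unfolding r_def by (intro continuous_intros yc) auto
	have ri: "r integrable_on {a..b}" if "0 < a" for a b
		by (rule integrable_continuous_real) (rule continuous_on_subset[OF rc], use that in auto)
	have zi: "(\<lambda>x. (cmod (z x))\<^sup>2) integrable_on {a..b}" if "0 < a" for a b
		by (rule integrable_half_line_subinterval(2)[OF sq_integrableD(2)[OF z] that])
	define Z where "Z = (norm (L2 z))\<^sup>2"
	obtain C where C0: "C \<ge> 0" and C: "\<sigma> > 1/2 \<or> (\<sigma> < 1/2 \<and> (\<forall>x. 0 < x \<and> x < 1 \<longrightarrow> (cmod (y x))\<^sup>2 \<le> C * x))"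
	proof -
		from s consider "\<sigma> > 1/2" | C' where "\<sigma> < 1/2" "\<forall>x. 0 < x \<and> x < 1 \<longrightarrow> (cmod (y x))\<^sup>2 \<le> C' * x" by blast
		then show ?thesis
		proof cases
			case 1 then show ?thesis using that[of 0] by simp
		next
			case 2
			have "(cmod (y x))\<^sup>2 \<le> max C' 0 * x" if "0 < x" "x < 1" for x
			proof -
				have "C' * x \<le> max C' 0 * x" using that by (intro mult_right_mono) auto
				then show ?thesis using 2(2) that by (meson order_trans)
			qed
			then show ?thesis using 2(1) that[of "max C' 0"] by simp
		qed
	qed
	define D where "D = (2 / \<kappa>) * ((cmod (y 1))\<^sup>2 + C + (2 / \<kappa>) * Z)"
	have small: "integral {a..1} r \<le> D" if a: "0 < a" "a < 1" for a
	proof -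
		have a1: "a \<le> 1" using a by simp
		have hk: "((\<lambda>x. Re (k x)) has_integral (Re (q 1) - Re (q a))) {a..1}"
			using has_integral_linear[OF primitiveD(2)[OF pq a(1) a1] bounded_linear_Re] by (simp add: o_def)
		have hkr: "((\<lambda>x. e x + (2 * \<sigma> - 1) * r x) has_integral (Re (q 1) - Re (q a))) {a..1}"
			by (rule has_integral_eq[OF _ hk]) (use Rek a in auto)
		have he: "(e has_integral (Re (q 1) - Re (q a) - (2 * \<sigma> - 1) * integral {a..1} r)) {a..1}"
			using has_integral_diff[OF hkr has_integral_mult_right[OF integrable_integral[OF ri[OF a(1)]], of "2 * \<sigma> - 1" 1]] by simp
		have "\<bar>integral {a..1} e\<bar> \<le> integral {a..1} (\<lambda>x. (2 / \<kappa>) * (cmod (z x))\<^sup>2 + (\<kappa> / 2) * r x)"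
			unfolding real_norm_def[symmetric]
		proof (rule integral_norm_bound_integral)
			show "e integrable_on {a..1}" using he by (rule has_integral_integrable)
			show "(\<lambda>x. (2 / \<kappa>) * (cmod (z x))\<^sup>2 + (\<kappa> / 2) * r x) integrable_on {a..1}"
				by (intro integrable_add integrable_on_mult_right zi ri a)
			fix x assume "x \<in> {a..1}"
			then have x: "x > 0" using a by auto
			define A B where "A = cmod (z x)" and "B = cmod (y x) / x"
			have "\<bar>Re (z x * cnj (y x))\<bar> \<le> cmod (z x) * cmod (y x)"
				using abs_Re_le_cmod[of "z x * cnj (y x)"] by (simp only: norm_mult complex_mod_cnj)
			then have "norm (e x) \<le> 2 * (A * B)"
				using x by (simp add: e_def A_def B_def abs_mult divide_simps)
			also have "\<dots> \<le> (2 / \<kappa>) * A\<^sup>2 + (\<kappa> / 2) * B\<^sup>2"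
			proof -
				have "0 \<le> (2 * A - \<kappa> * B)\<^sup>2 / (2 * \<kappa>)" using \<kappa> by simp
				also have "\<dots> = (2 / \<kappa>) * A\<^sup>2 + (\<kappa> / 2) * B\<^sup>2 - 2 * (A * B)"
					using \<kappa> by (simp add: power2_eq_square field_simps)
				finally show ?thesis by simp
			qed
			finally show "norm (e x) \<le> (2 / \<kappa>) * (cmod (z x))\<^sup>2 + (\<kappa> / 2) * r x"
				using x by (simp add: A_def B_def r_def norm_divide)
		qed
		also have "\<dots> = (2 / \<kappa>) * integral {a..1} (\<lambda>x. (cmod (z x))\<^sup>2) + (\<kappa> / 2) * integral {a..1} r"
		proof -
			have "integral {a..1} (\<lambda>x. (2 / \<kappa>) * (cmod (z x))\<^sup>2 + (\<kappa> / 2) * r x)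
				= integral {a..1} (\<lambda>x. (2 / \<kappa>) * (cmod (z x))\<^sup>2) + integral {a..1} (\<lambda>x. (\<kappa> / 2) * r x)"
				by (rule Henstock_Kurzweil_Integration.integral_add; intro integrable_on_mult_right zi ri a)
			then show ?thesis by (simp only: Henstock_Kurzweil_Integration.integral_mult_right)
		qed
		also have "(2 / \<kappa>) * integral {a..1} (\<lambda>x. (cmod (z x))\<^sup>2) \<le> (2 / \<kappa>) * Z"
			unfolding Z_def by (intro mult_left_mono integral_sq_le[OF z a(1)]) (use \<kappa> in auto)
		finally have eb: "\<bar>Re (q 1) - Re (q a) - (2 * \<sigma> - 1) * integral {a..1} r\<bar> \<le> (2 / \<kappa>) * Z + (\<kappa> / 2) * integral {a..1} r"
			by (simp add: integral_unique[OF he])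
		have q1: "Re (q 1) = (cmod (y 1))\<^sup>2" by (simp add: Req)
		have qa: "0 \<le> Re (q a)" using a by (simp add: Req)
		have "\<kappa> * integral {a..1} r \<le> (cmod (y 1))\<^sup>2 + C + ((2 / \<kappa>) * Z + (\<kappa> / 2) * integral {a..1} r)"
			using C
		proof
			assume "\<sigma> > 1/2"
			then have k': "(2 * \<sigma> - 1) * integral {a..1} r = \<kappa> * integral {a..1} r" by (simp add: \<kappa>_def)
			show ?thesis using eb q1 qa C0 unfolding k' by linarith
		next
			assume h: "\<sigma> < 1/2 \<and> (\<forall>x. 0 < x \<and> x < 1 \<longrightarrow> (cmod (y x))\<^sup>2 \<le> C * x)"
			then have k': "(2 * \<sigma> - 1) * integral {a..1} r = - (\<kappa> * integral {a..1} r)" by (simp add: \<kappa>_def algebra_simps)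
			have "Re (q a) \<le> C" using h a by (simp add: Req pos_divide_le_eq)
			then show ?thesis using eb q1 C0 zero_le_power2[of "cmod (y 1)"] unfolding k' by linarith
		qed
		then have "(\<kappa> / 2) * integral {a..1} r \<le> (cmod (y 1))\<^sup>2 + C + (2 / \<kappa>) * Z" by linarith
		then have "(2 / \<kappa>) * ((\<kappa> / 2) * integral {a..1} r) \<le> D"
			unfolding D_def by (rule mult_left_mono) (use \<kappa> in auto)
		then show ?thesis using \<kappa> by simp
	qed
	have r': "(cmod (y x) / x)\<^sup>2 = r x" if "x > 0" for x using that by (simp add: r_def norm_divide)
	have c: "continuous_on {0<..} (\<lambda>x. cmod (y x) / x)" by (intro continuous_intros yc) auto
	have "sq_integrable (\<lambda>x. cpx (if x < 1 then cmod (y x) / x else cmod (y x) / x))"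
	proof (rule sq_integrable_piecewise)
		show "continuous_on {0<..1} (\<lambda>x. cmod (y x) / x)" "continuous_on {1..} (\<lambda>x. cmod (y x) / x)"
			by (rule continuous_on_subset[OF c], force)+
		show "integral {a..1} (\<lambda>x. (cmod (y x) / x)\<^sup>2) \<le> D" if a: "0 < a" "a \<le> 1" for a
		proof (cases "a = 1")
			case True
			then show ?thesis using C0 \<kappa> by (simp add: D_def Z_def)
		next
			case False
			have "integral {a..1} (\<lambda>x. (cmod (y x) / x)\<^sup>2) = integral {a..1} r"
				by (rule Henstock_Kurzweil_Integration.integral_cong) (use a r' in auto)
			then show ?thesis using small a False by simp
		qed
		show "integral {1..b} (\<lambda>x. (cmod (y x) / x)\<^sup>2) \<le> (norm (L2 y))\<^sup>2" if b: "1 \<le> b" for b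
		proof -
			have "integral {1..b} (\<lambda>x. (cmod (y x) / x)\<^sup>2) \<le> integral {1..b} (\<lambda>x. (cmod (y x))\<^sup>2)"
			proof (rule integral_le)
				show "(\<lambda>x. (cmod (y x) / x)\<^sup>2) integrable_on {1..b}"
					by (rule integrable_continuous_real) (intro continuous_intros continuous_on_subset[OF c], auto)
				show "(\<lambda>x. (cmod (y x))\<^sup>2) integrable_on {1..b}"
					by (rule integrable_half_line_subinterval(2)[OF sq_integrableD(2)[OF y]]) simp
				show "(cmod (y x) / x)\<^sup>2 \<le> (cmod (y x))\<^sup>2" if "x \<in> {1..b}" for x
					using that by (intro power_mono) (auto simp: divide_le_eq mult_le_cancel_left1)
			qed
			also have "\<dots> \<le> (norm (L2 y))\<^sup>2" by (rule integral_sq_le[OF y]) simp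
			finally show ?thesis .
		qed
	qed simp
	then show ?thesis
		by (rule sq_integrable_dominated[rotated])
			 (auto simp: norm_divide intro!: continuous_on_measurable_half_line continuous_intros yc)
qed

text \<open>
	\<open>Q = Re (y cnj f)\<close> is half the derivative of \<open>\<bar>f\<bar>\<^sup>2\<close>, and its own derivative is \<open>\<bar>y\<bar>\<^sup>2\<close> plus an integrable
	function. If the integral of \<open>\<bar>y\<bar>\<^sup>2\<close> became too large, then \<open>Q \<ge> 1\<close> from some point on and \<open>\<bar>f\<bar>\<^sup>2\<close> would
	grow linearly.
\<close>

lemma derivative_sq_integrable_at_infinity:
	assumes f: "sq_integrable f" and v: "sq_integrable v" and pf: "primitive f y" and py: "primitive y w"
		and wv: "\<And>x. x \<ge> 1 \<Longrightarrow> cmod (w x) \<le> cmod (v x)"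
	obtains B where "\<And>b. b \<ge> 1 \<Longrightarrow> integral {1..b} (\<lambda>x. (cmod (y x))\<^sup>2) \<le> B"
proof -
	define N where "N b = integral {1..b} (\<lambda>x. (cmod (y x))\<^sup>2)" for b
	have yc: "continuous_on {0<..} y" by (rule primitive_continuous_on[OF py])
	have fc: "continuous_on {0<..} f" by (rule primitive_continuous_on[OF pf])
	have yi: "(\<lambda>x. (cmod (y x))\<^sup>2) integrable_on {a..b}" if "0 < a" for a b
		by (rule integrable_continuous_real) (intro continuous_intros continuous_on_subset[OF yc], use that in auto)
	have fi: "(\<lambda>x. (cmod (f x))\<^sup>2) integrable_on {a..b}" if "0 < a" for a b
		by (rule integrable_half_line_subinterval(2)[OF sq_integrableD(2)[OF f] that])
	have vi: "(\<lambda>x. (cmod (v x))\<^sup>2) integrable_on {a..b}" if "0 < a" for a b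
		by (rule integrable_half_line_subinterval(2)[OF sq_integrableD(2)[OF v] that])
	define Q where "Q x = Re (y x * cnj (f x))" for x
	have pQ: "primitive (\<lambda>x. y x * cnj (f x)) (\<lambda>x. w x * cnj (f x) + y x * cnj (y x))"
		by (rule primitive_mult[OF py primitive_cnj[OF pf]])
	have hQ: "((\<lambda>x. Re (w x * cnj (f x)) + (cmod (y x))\<^sup>2) has_integral (Q b - Q a)) {a..b}" if "0 < a" "a \<le> b" for a b
	proof -
		have "((\<lambda>x. Re (w x * cnj (f x) + y x * cnj (y x))) has_integral (Q b - Q a)) {a..b}"
			using has_integral_linear[OF primitiveD(2)[OF pQ that] bounded_linear_Re] by (simp add: o_def Q_def)
		moreover have "Re (w x * cnj (f x) + y x * cnj (y x)) = Re (w x * cnj (f x)) + (cmod (y x))\<^sup>2" for x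
			by (simp add: complex_norm_square[symmetric] cmod_power2 power2_eq_square)
		ultimately show ?thesis by simp
	qed
	define K where "K = \<bar>Q 1\<bar> + (norm (L2 v))\<^sup>2 + (norm (L2 f))\<^sup>2"
	have QN: "N b - K \<le> Q b" if b: "b \<ge> 1" for b
	proof -
		have h1: "((\<lambda>x. Re (w x * cnj (f x))) has_integral (Q b - Q 1 - N b)) {1..b}"
			using has_integral_diff[OF hQ[OF zero_less_one b] integrable_integral[OF yi[OF zero_less_one]]] by (simp add: N_def)
		have "norm (integral {1..b} (\<lambda>x. Re (w x * cnj (f x)))) \<le> integral {1..b} (\<lambda>x. (cmod (v x))\<^sup>2 + (cmod (f x))\<^sup>2)"
		proof (rule integral_norm_bound_integral)
			show "(\<lambda>x. Re (w x * cnj (f x))) integrable_on {1..b}" using h1 by (rule has_integral_integrable)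
			show "(\<lambda>x. (cmod (v x))\<^sup>2 + (cmod (f x))\<^sup>2) integrable_on {1..b}" by (intro integrable_add vi fi) auto
			fix x assume x: "x \<in> {1..b}"
			have "norm (Re (w x * cnj (f x))) \<le> cmod (w x) * cmod (f x)"
				using abs_Re_le_cmod[of "w x * cnj (f x)"] by (simp only: norm_mult complex_mod_cnj real_norm_def)
			also have "\<dots> \<le> cmod (v x) * cmod (f x)" by (rule mult_right_mono) (use wv x in auto)
			also have "\<dots> \<le> (cmod (v x))\<^sup>2 + (cmod (f x))\<^sup>2"
				using sum_squares_bound[of "cmod (v x)" "cmod (f x)"] mult_nonneg_nonneg[OF norm_ge_zero[of "v x"] norm_ge_zero[of "f x"]] by linarith
			finally show "norm (Re (w x * cnj (f x))) \<le> (cmod (v x))\<^sup>2 + (cmod (f x))\<^sup>2" .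
		qed
		also have "\<dots> = integral {1..b} (\<lambda>x. (cmod (v x))\<^sup>2) + integral {1..b} (\<lambda>x. (cmod (f x))\<^sup>2)"
			by (rule Henstock_Kurzweil_Integration.integral_add) (auto intro: vi fi)
		also have "\<dots> \<le> (norm (L2 v))\<^sup>2 + (norm (L2 f))\<^sup>2"
			by (intro add_mono integral_sq_le f v) auto
		finally have "\<bar>Q b - Q 1 - N b\<bar> \<le> (norm (L2 v))\<^sup>2 + (norm (L2 f))\<^sup>2" unfolding integral_unique[OF h1] real_norm_def .
		then show ?thesis by (simp add: K_def)
	qed
	have "N b \<le> K + 1" if b: "b \<ge> 1" for b
	proof (rule ccontr)
		assume "\<not> N b \<le> K + 1"
		have Q1: "1 \<le> Q x" if "x \<ge> b" for x
		proof -
			have "N b \<le> N x" unfolding N_def by (rule integral_subset_le) (use that b yi in auto)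
			then show ?thesis using QN[of x] that b \<open>\<not> N b \<le> K + 1\<close> by linarith
		qed
		have pf2: "primitive (\<lambda>x. f x * cnj (f x)) (\<lambda>x. y x * cnj (f x) + f x * cnj (y x))"
			by (rule primitive_mult[OF pf primitive_cnj[OF pf]])
		have b0: "b > 0" using b by simp
		have grow: "2 * (x - b) \<le> (cmod (f x))\<^sup>2" if x: "x \<ge> b" for x
		proof -
			have h: "((\<lambda>t. 2 * Q t) has_integral ((cmod (f x))\<^sup>2 - (cmod (f b))\<^sup>2)) {b..x}"
			proof -
				have "((\<lambda>t. Re (y t * cnj (f t) + f t * cnj (y t))) has_integral Re (f x * cnj (f x) - f b * cnj (f b))) {b..x}"
					using has_integral_linear[OF primitiveD(2)[OF pf2 b0 x] bounded_linear_Re] by (simp only: o_def)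
				moreover have "Re (y t * cnj (f t) + f t * cnj (y t)) = 2 * Q t" for t
					by (simp add: Q_def algebra_simps)
				moreover have "Re (f x * cnj (f x) - f b * cnj (f b)) = (cmod (f x))\<^sup>2 - (cmod (f b))\<^sup>2"
					by (simp only: complex_norm_square[symmetric] of_real_diff[symmetric] Re_complex_of_real)
				ultimately show ?thesis by simp
			qed
			have "((\<lambda>t. 2::real) has_integral (2 * (x - b))) {b..x}"
				using has_integral_const_real[of "2::real" b x] x by (simp add: mult.commute)
			then have "2 * (x - b) \<le> (cmod (f x))\<^sup>2 - (cmod (f b))\<^sup>2"
				by (rule has_integral_le[OF _ h]) (use Q1 in force)
			then show ?thesis using zero_le_power2[of "cmod (f b)"] by linarith
		qed
		define t where "t = norm (L2 f) + 1"
		have t: "t > 0" by (simp add: t_def add_nonneg_pos)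
		have ht: "((\<lambda>x. 2 * (x - b)) has_integral t\<^sup>2) {b..b+t}"
		proof -
			have "((\<lambda>x. 2 * (x - b)) has_integral ((b + t - b)\<^sup>2 - (b - b)\<^sup>2)) {b..b+t}"
				by (rule fundamental_theorem_of_calculus[where f="\<lambda>x. (x - b)\<^sup>2"])
					 (use t in \<open>auto intro!: derivative_eq_intros simp: has_real_derivative_iff_has_vector_derivative[symmetric]\<close>)
			then show ?thesis by simp
		qed
		have "t\<^sup>2 \<le> integral {b..b+t} (\<lambda>x. (cmod (f x))\<^sup>2)"
			by (rule has_integral_le[OF ht integrable_integral[OF fi[OF b0]]]) (use grow in auto)
		also have "\<dots> \<le> (norm (L2 f))\<^sup>2" by (rule integral_sq_le[OF f b0])
		finally have "t \<le> norm (L2 f)" using t by (simp add: power2_le_iff_abs_le)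
		then show False by (simp add: t_def)
	qed
	then show ?thesis using that unfolding N_def by blast
qed

section \<open>The first order factor of the Bessel operator\<close>

text \<open>
	The factor \<open>d/dx - s/x\<close> of the Bessel operator; it annihilates \<open>x powr s\<close>.
\<close>

definition grad :: "real \<Rightarrow> (real \<Rightarrow> complex) \<Rightarrow> real \<Rightarrow> complex"
	where "grad s f x = deriv_on {0<..} f x - cpx (s / x) * f x"

definition grad_dom :: "real \<Rightarrow> (real \<Rightarrow> complex) set"
	where "grad_dom s = {f. sq_integrable f \<and> loc_abs_continuous_on {0<..} f \<and> sq_integrable (grad s f)}"

definition grad_op :: "real \<Rightarrow> l2_op"
	where "grad_op s = {(L2 f, L2 (grad s f)) | f. f \<in> grad_dom s}"

lemma grad_domD:
	assumes "f \<in> grad_dom s"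
	shows "sq_integrable f" "sq_integrable (grad s f)" "primitive f (\<lambda>x. grad s f x + cpx (s / x) * f x)"
		"primitive f (deriv_on {0<..} f)"
	using assms primitive_of_loc_abs_continuous_on[of f] by (auto simp: grad_dom_def grad_def)

lemma grad_domI:
	assumes f: "sq_integrable f" and z: "sq_integrable z" and p: "primitive f (\<lambda>x. z x + cpx (s / x) * f x)"
	shows "f \<in> grad_dom s" "AE x in half_line. grad s f x = z x" "L2 (grad s f) = L2 z"
proof -
	show ae: "AE x in half_line. grad s f x = z x"
		using primitive_deriv_on_AE[OF p] by eventually_elim (simp add: grad_def)
	then have ae': "AE x in half_line. z x = grad s f x" by eventually_elim simp
	have g: "sq_integrable (grad s f)" by (rule sq_integrable_cong_AE[OF z ae'])
	then show "f \<in> grad_dom s" using f primitive_loc_abs_continuous_on[OF p] by (simp add: grad_dom_def)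
	show "L2 (grad s f) = L2 z" using ae by (simp add: L2_eq_iff g z)
qed

lemma grad_op_iff:
	"(u, g) \<in> grad_op s \<longleftrightarrow> (\<exists>f z. u = L2 f \<and> g = L2 z \<and> sq_integrable f \<and> sq_integrable z \<and>
		 primitive f (\<lambda>x. z x + cpx (s / x) * f x))" (is "_ \<longleftrightarrow> ?R")
proof
	assume "(u, g) \<in> grad_op s"
	then obtain f where "u = L2 f" "g = L2 (grad s f)" "f \<in> grad_dom s" by (auto simp: grad_op_def)
	then show ?R using grad_domD[of f s] by blast
next
	assume ?R
	then obtain f z where "u = L2 f" "g = L2 z" "sq_integrable f" "sq_integrable z"
		 "primitive f (\<lambda>x. z x + cpx (s / x) * f x)" by blast
	then show "(u, g) \<in> grad_op s" using grad_domI[of f z s] unfolding grad_op_def by auto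
qed

lemma linear_grad_op: "linear_op (grad_op s)"
	unfolding linear_op_def
proof (intro conjI allI impI)
	show "(0, 0) \<in> grad_op s"
		unfolding grad_op_iff
		by (intro exI[of _ "\<lambda>_. 0"]) (simp add: L2_zero sq_integrable_zero primitive_const)
next
	fix x y x' y' assume "(x, y) \<in> grad_op s" "(x', y') \<in> grad_op s"
	then obtain f z f' z' where *: "x = L2 f" "y = L2 z" "sq_integrable f" "sq_integrable z"
		 "primitive f (\<lambda>x. z x + cpx (s / x) * f x)"
		"x' = L2 f'" "y' = L2 z'" "sq_integrable f'" "sq_integrable z'"
		 "primitive f' (\<lambda>x. z' x + cpx (s / x) * f' x)" unfolding grad_op_iff by blast
	have "primitive (\<lambda>x. f x + f' x) (\<lambda>x. (z x + z' x) + cpx (s / x) * (f x + f' x))"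
		using primitive_add[OF *(5) *(10)] by (simp add: algebra_simps add_divide_distrib)
	then show "(x + x', y + y') \<in> grad_op s"
		unfolding grad_op_iff using * by (metis L2_add sq_integrable_add)
next
	fix c x y assume "(x, y) \<in> grad_op s"
	then obtain f z where *: "x = L2 f" "y = L2 z" "sq_integrable f" "sq_integrable z"
		 "primitive f (\<lambda>x. z x + cpx (s / x) * f x)" unfolding grad_op_iff by blast
	have "primitive (\<lambda>x. c * f x) (\<lambda>x. c * z x + cpx (s / x) * (c * f x))"
		using primitive_scale[OF *(5), of c] by (simp add: algebra_simps)
	then show "(c *\<^sub>C x, c *\<^sub>C y) \<in> grad_op s"
		unfolding grad_op_iff using * by (metis L2_scale sq_integrable_scale)
next
	fix x y y' assume "(x, y) \<in> grad_op s" "(x, y') \<in> grad_op s"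
	then obtain f z f' z' where *: "x = L2 f" "y = L2 z" "sq_integrable f" "sq_integrable z"
		 "primitive f (\<lambda>x. z x + cpx (s / x) * f x)"
		"x = L2 f'" "y' = L2 z'" "sq_integrable f'" "sq_integrable z'"
		 "primitive f' (\<lambda>x. z' x + cpx (s / x) * f' x)" unfolding grad_op_iff by blast
	have eq: "f' t = f t" if "t > 0" for t
		by (rule continuous_AE_eq[OF primitive_continuous_on[OF *(10)] primitive_continuous_on[OF *(5)] _ that])
			 (use * L2_eq_iff in metis)
	have p2: "primitive f (\<lambda>x. z' x + cpx (s / x) * f' x)"
		by (rule primitive_cong_AE[OF *(10)]) (use eq in auto)
	have "AE x in half_line. z x = z' x"
		using primitive_has_derivative_AE[OF *(5)] primitive_has_derivative_AE[OF p2] AE_space[of half_line]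
	proof eventually_elim
		case (elim t)
		then have "z t + cpx (s / t) * f t = z' t + cpx (s / t) * f' t"
			by (intro vector_derivative_unique_at)
		then show ?case using eq[of t] elim by simp
	qed
	then show "y = y'" using * by (simp add: L2_eq_iff)
qed

lemma test_fun_cnj: "test_fun \<phi> \<psi> \<Longrightarrow> test_fun (\<lambda>x. cnj (\<phi> x)) (\<lambda>x. cnj (\<psi> x))"
proof -
	assume t: "test_fun \<phi> \<psi>"
	have m: "(\<lambda>x. cnj (\<psi> x)) \<in> borel_measurable half_line"
		using t borel_measurable_continuous_onI[of cnj] continuous_on_cnj[OF continuous_on_id]
		by (auto simp: test_fun_def intro!: measurable_compose[of \<psi> half_line borel cnj])
	show ?thesis
		using t m primitive_cnj[of \<phi> \<psi>] unfolding test_fun_def by auto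
qed

lemma test_fun_sq_integrable:
	assumes t: "test_fun \<phi> \<psi>" and c: "continuous_on {0<..} h"
	shows "sq_integrable (\<lambda>x. h x * \<phi> x)" "sq_integrable (\<lambda>x. h x * \<psi> x)"
proof -
	obtain a b M where ab: "0 < a" "a \<le> b" "\<And>x. x > 0 \<Longrightarrow> x \<notin> {a..b} \<Longrightarrow> \<phi> x = 0 \<and> \<psi> x = 0"
		and M: "\<And>x. x > 0 \<Longrightarrow> cmod (\<psi> x) \<le> M" and pm: "\<psi> \<in> borel_measurable half_line" and p: "primitive \<phi> \<psi>"
		using t unfolding test_fun_def by metis
	have bd: "sq_integrable k" if km: "k \<in> borel_measurable half_line" and kb: "\<And>x. x \<in> {a..b} \<Longrightarrow> cmod (k x) \<le> K"
		and k0: "\<And>x. x > 0 \<Longrightarrow> x \<notin> {a..b} \<Longrightarrow> k x = 0" for k K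
	proof (rule sq_integrable_le_weight[OF km, where p=0 and K="max K 0 * max 1 b"])
		have k: "cmod (k x) \<le> (if x \<in> {a..b} then max K 0 else 0)" if "x > 0" for x using kb[of x] k0[of x] that by auto
		show "cmod (k x) \<le> max K 0 * max 1 b * x powr 0" if "0 < x" "x < 1" for x
			using k[OF that(1)] mult_left_mono[of 1 "max 1 b" "max K 0"] that by (auto split: if_splits)
		show "cmod (k x) \<le> max K 0 * max 1 b / x" if "1 \<le> x" for x
			using k[of x] mult_mono[of x b "cmod (k x)" "max K 0"] that by (auto simp: field_simps split: if_splits)
	qed simp
	have hc: "continuous_on {a..b} h" by (rule continuous_on_subset[OF c]) (use ab in auto)
	have pc: "continuous_on {0<..} \<phi>" by (rule primitive_continuous_on[OF p])
	obtain H where H: "\<And>x. x \<in> {a..b} \<Longrightarrow> cmod (h x) \<le> H"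
		using compact_imp_bounded[OF compact_continuous_image[OF hc compact_Icc]] unfolding bounded_iff by (metis imageI)
	have "continuous_on {a..b} (\<lambda>x. h x * \<phi> x)"
		by (intro continuous_on_mult hc continuous_on_subset[OF pc]) (use ab in auto)
	from compact_imp_bounded[OF compact_continuous_image[OF this compact_Icc]]
	obtain K where K: "\<And>x. x \<in> {a..b} \<Longrightarrow> cmod (h x * \<phi> x) \<le> K" unfolding bounded_iff by (metis imageI)
	have hm: "h \<in> borel_measurable half_line" by (rule continuous_on_measurable_half_line[OF c])
	show "sq_integrable (\<lambda>x. h x * \<phi> x)"
		by (rule bd[OF _ K]) (use ab in \<open>auto intro!: continuous_on_measurable_half_line continuous_on_mult c pc\<close>)
	show "sq_integrable (\<lambda>x. h x * \<psi> x)"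
	proof (rule bd)
		show "(\<lambda>x. h x * \<psi> x) \<in> borel_measurable half_line" by (intro borel_measurable_times hm pm)
		show "cmod (h x * \<psi> x) \<le> H * M" if "x \<in> {a..b}" for x
			unfolding norm_mult
			by (intro mult_mono H M that) (use that ab H[OF that] in \<open>auto intro: order_trans[OF norm_ge_zero]\<close>)
	qed (use ab in auto)
qed

lemma primitive_powr_mult:
	assumes p: "primitive u (\<lambda>x. z x + cpx (\<sigma> / x) * u x)"
	shows "primitive (\<lambda>x. pw \<tau> x * u x)
		(\<lambda>x. pw \<tau> x * z x + cpx ((\<sigma> + \<tau>) / x) * (pw \<tau> x * u x))"
proof -
	have pp: "primitive (\<lambda>x. pw \<tau> x) (\<lambda>x. cpx (\<tau> * x powr (\<tau> - 1)))"
		by (rule primitive_of_real_derivative) (auto intro!: derivative_eq_intros continuous_intros)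
	show ?thesis
	proof (rule primitive_cong_AE[OF primitive_mult[OF pp p]])
		show "AE x in half_line. cpx (\<tau> * x powr (\<tau> - 1)) * u x + pw \<tau> x * (z x + cpx (\<sigma> / x) * u x)
			= pw \<tau> x * z x + cpx ((\<sigma> + \<tau>) / x) * (pw \<tau> x * u x)"
			using AE_space[of half_line]
		proof eventually_elim
			case (elim x)
			then have "x powr (\<tau> - 1) = x powr \<tau> / x" by (simp add: powr_diff)
			then show ?case by (simp add: algebra_simps add_divide_distrib)
		qed
	qed simp
qed

lemma primitive_powr_cancel:
	assumes p: "primitive u (\<lambda>x. z x + cpx (\<sigma> / x) * u x)"
	shows "primitive (\<lambda>x. pw (- \<sigma>) x * u x) (\<lambda>x. pw (- \<sigma>) x * z x)"
	using primitive_powr_mult[OF p, of "- \<sigma>"] by simp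

abbreviation (input) grad_hi :: "real \<Rightarrow> l2_op"
	where "grad_hi \<nu> \<equiv> grad_op (1/2 + \<nu>)"

text \<open>
	By the Cauchy-Schwarz inequality the increments of \<open>x powr (- s) * h n x\<close> converge. A subsequence of the \<open>h n\<close> itself
	converges almost everywhere; one point of convergence fixes the constant and gives convergence everywhere.
\<close>

lemma closed_grad_op: "closed (grad_op s)"
	unfolding closed_sequential_limits
proof (intro allI impI)
	fix X l assume X: "(\<forall>n. X n \<in> grad_op s) \<and> X \<longlonglongrightarrow> l"
	obtain f z where l: "l = (L2 f, L2 z)" and f: "sq_integrable f" and z: "sq_integrable z"
		by (metis L2_cases prod.exhaust_sel)
	have "\<exists>h k. X n = (L2 h, L2 k) \<and> sq_integrable h \<and> sq_integrable k \<and> primitive h (\<lambda>x. k x + cpx (s / x) * h x)" for n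
		using X grad_op_iff[of "fst (X n)" "snd (X n)" s] by (metis prod.collapse)
	then obtain h k where hk: "X n = (L2 (h n), L2 (k n))" "sq_integrable (h n)" "sq_integrable (k n)"
		"primitive (h n) (\<lambda>x. k n x + cpx (s / x) * h n x)" for n by metis
	have lim: "(\<lambda>n. L2 (h n)) \<longlonglongrightarrow> L2 f" "(\<lambda>n. L2 (k n)) \<longlonglongrightarrow> L2 z"
		using tendsto_fst[of X l] tendsto_snd[of X l] X by (simp_all add: l hk)
	define v where "v n x = pw (- s) x * h n x" for n x
	have pv: "primitive (v n) (\<lambda>x. pw (- s) x * k n x)" for n
		unfolding v_def by (rule primitive_powr_cancel[OF hk(4)])
	obtain V where V: "primitive V (\<lambda>x. pw (- s) x * z x)"
		using loc_integrable_primitive[OF loc_integrable_continuous_mult[OF sq_integrable_loc_integrable[OF z] continuous_on_powr_half_line]] by blast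
	have inc: "(\<lambda>n. (v n b - V b) - (v n a - V a)) \<longlonglongrightarrow> 0" if ab: "0 < a" "a \<le> b" for a b
	proof (rule Lim_null_comparison)
		have "(\<lambda>n. norm (L2 (k n) - L2 z)) \<longlonglongrightarrow> 0" by (rule tendsto_norm_zero[OF LIM_zero[OF lim(2)]])
		from tendsto_mult_left_zero[OF this]
		show "(\<lambda>n. norm (L2 (k n) - L2 z) * sqrt (integral {a..b} (\<lambda>x. x powr (2 * - s)))) \<longlonglongrightarrow> 0" .
		have "cmod ((v n b - V b) - (v n a - V a)) \<le> norm (L2 (k n) - L2 z) * sqrt (integral {a..b} (\<lambda>x. x powr (2 * - s)))" for n
			using cmod_weighted_integral_le[OF sq_integrable_diff[OF hk(3)[of n] z] ab, of "- s"]
				primitiveD(3)[OF primitive_diff[OF pv[of n] V] ab]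
			by (simp add: right_diff_distrib L2_diff hk z)
		then show "\<forall>\<^sub>F n in sequentially. norm ((v n b - V b) - (v n a - V a)) \<le> norm (L2 (k n) - L2 z) * sqrt (integral {a..b} (\<lambda>x. x powr (2 * - s)))"
			by simp
	qed
	have "(\<lambda>n. LINT x|half_line. norm ((cmod (h n x - f x))\<^sup>2)) \<longlonglongrightarrow> 0"
		using tendsto_power[OF tendsto_norm_zero[OF LIM_zero[OF lim(1)]], of 2]
		by (simp add: L2_diff hk f norm_L2_sq sq_integrable_diff)
	moreover have "integrable half_line (\<lambda>x. (cmod (h n x - f x))\<^sup>2)" for n
		using sq_integrable_diff[OF hk(2) f] by (simp add: sq_integrable_def)
	ultimately obtain r :: "nat \<Rightarrow> nat" where r: "strict_mono r" "AE x in half_line. (\<lambda>n. (cmod (h (r n) x - f x))\<^sup>2) \<longlonglongrightarrow> 0"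
		using tendsto_L1_AE_subseq[of half_line "\<lambda>n x. (cmod (h n x - f x))\<^sup>2"] by blast
	have ae: "AE x in half_line. (\<lambda>n. h (r n) x) \<longlonglongrightarrow> f x"
		using r(2)
	proof eventually_elim
		case (elim x)
		then have "(\<lambda>n. sqrt ((cmod (h (r n) x - f x))\<^sup>2)) \<longlonglongrightarrow> sqrt 0" by (rule tendsto_real_sqrt)
		then show ?case by (simp add: LIM_zero_iff tendsto_norm_zero_iff)
	qed
	obtain x0 where x0: "x0 > 0" "(\<lambda>n. h (r n) x0) \<longlonglongrightarrow> f x0"
	proof (rule ccontr)
		assume "\<not> thesis"
		then have "{x \<in> {0<..}. \<not> (\<lambda>n. h (r n) x) \<longlonglongrightarrow> f x} = {0<..}" using that by auto
		then show False using ae open_not_negligible[OF open_greaterThan greaterThan_non_empty, of "0::real"] by (simp add: AE_half_line_iff)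
	qed
	define F where "F x = pw s x * (V x - V x0 + cpx (x0 powr (- s)) * f x0)" for x
	have hF: "(\<lambda>n. h (r n) x) \<longlonglongrightarrow> F x" if x: "x > 0" for x
	proof -
		have "(\<lambda>n. (v n x - V x) - (v n x0 - V x0)) \<longlonglongrightarrow> 0"
		proof (cases "x0 \<le> x")
			case False
			then show ?thesis using tendsto_minus[OF inc[OF x, of x0]] by (simp add: algebra_simps)
		qed (rule inc[OF x0(1)])
		from LIMSEQ_subseq_LIMSEQ[OF this r(1)]
		have "(\<lambda>n. (v (r n) x - V x) - (v (r n) x0 - V x0)) \<longlonglongrightarrow> 0" by (simp add: o_def)
		moreover have "(\<lambda>n. v (r n) x0) \<longlonglongrightarrow> cpx (x0 powr (- s)) * f x0"
			unfolding v_def by (rule tendsto_mult_left[OF x0(2)])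
		ultimately have "(\<lambda>n. ((v (r n) x - V x) - (v (r n) x0 - V x0)) + v (r n) x0 + (V x - V x0)) \<longlonglongrightarrow>
				0 + cpx (x0 powr (- s)) * f x0 + (V x - V x0)"
			by (intro tendsto_add tendsto_const)
		then have "(\<lambda>n. pw s x * v (r n) x) \<longlonglongrightarrow> F x"
			unfolding F_def by (intro tendsto_mult_left) (simp add: algebra_simps)
		moreover have "pw s x * v n x = h n x" for n using x by (simp add: v_def powr_minus field_simps)
		ultimately show ?thesis by simp
	qed
	have fF: "AE x in half_line. f x = F x"
		using ae AE_space[of half_line]
	proof eventually_elim
		case (elim x)
		then show ?case using LIMSEQ_unique[OF elim(1) hF] by simp
	qed
	have Fs: "sq_integrable F" by (rule sq_integrable_cong_AE[OF f fF])
	define W where "W x = V x - (V x0 - cpx (x0 powr (- s)) * f x0)" for x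
	have "primitive W (\<lambda>x. pw (- s) x * z x + cpx (0 / x) * W x)"
		using primitive_diff[OF V primitive_const] by (simp add: W_def[abs_def])
	from primitive_powr_mult[OF this, of s]
	have "primitive F (\<lambda>x. z x + cpx (s / x) * F x)"
	proof (rule primitive_cong_AE[OF _ AE_half_lineI])
		fix x :: real assume x: "x > 0"
		show FW: "F x = pw s x * W x" by (simp add: F_def W_def)
		show "pw s x * (pw (- s) x * z x) + cpx ((0 + s) / x) * (pw s x * W x)
			= z x + cpx (s / x) * F x"
			unfolding FW using x by (simp add: powr_minus field_simps)
	qed
	then show "l \<in> grad_op s" unfolding l grad_op_iff using L2_eq_iff[OF f Fs] fF Fs z by blast
qed

section \<open>Boundary behaviour of functions in the maximal domain\<close>

lemma bessel_max_funD:
	assumes f: "f \<in> bessel_max_fun \<nu>"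
	shows "sq_integrable f" "sq_integrable (bessel_expr \<nu> f)" "primitive f (deriv_on {0<..} f)"
		"primitive (deriv_on {0<..} f) (\<lambda>x. pot \<nu> x * f x - bessel_expr \<nu> f x)"
proof -
	show "sq_integrable f" "sq_integrable (bessel_expr \<nu> f)" using f by (auto simp: bessel_max_fun_def)
	show "primitive f (deriv_on {0<..} f)"
		using f by (auto simp: bessel_max_fun_def intro: primitive_of_loc_abs_continuous_on)
	have "primitive (deriv_on {0<..} f) (deriv_on {0<..} (deriv_on {0<..} f))"
		using f by (auto simp: bessel_max_fun_def intro: primitive_of_loc_abs_continuous_on)
	moreover have "deriv_on {0<..} (deriv_on {0<..} f) = (\<lambda>x. pot \<nu> x * f x - bessel_expr \<nu> f x)"
		by (simp add: bessel_expr_def fun_eq_iff)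
	ultimately show "primitive (deriv_on {0<..} f) (\<lambda>x. pot \<nu> x * f x - bessel_expr \<nu> f x)"
		by simp
qed

lemma bessel_max_funI:
	assumes f: "sq_integrable f" and w: "sq_integrable w" and fy: "primitive f y"
		and yw: "primitive y (\<lambda>x. pot \<nu> x * f x - w x)"
	shows "f \<in> bessel_max_fun \<nu>" "AE x in half_line. bessel_expr \<nu> f x = w x" "L2 (bessel_expr \<nu> f) = L2 w"
		"\<And>x. x > 0 \<Longrightarrow> deriv_on {0<..} f x = y x"
proof -
	have yc: "continuous_on {0<..} y" by (rule primitive_continuous_on[OF yw])
	have d: "(f has_vector_derivative y x) (at x)" if "x > 0" for x
		by (rule primitive_continuous_imp_derivative[OF fy yc that])
	show dy: "deriv_on {0<..} f x = y x" if "x > 0" for x by (rule deriv_on_eqI[OF that d[OF that]])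
	have diff: "f differentiable_on {0<..}"
		unfolding differentiable_on_def
		by (meson d differentiable_at_withinI differentiableI_vector greaterThan_iff)
	have pd: "primitive (deriv_on {0<..} f) (\<lambda>x. pot \<nu> x * f x - w x)"
		by (rule primitive_cong_AE[OF yw]) (use dy in auto)
	show ae: "AE x in half_line. bessel_expr \<nu> f x = w x"
		using primitive_deriv_on_AE[OF pd] by eventually_elim (simp add: bessel_expr_def)
	then have ae': "AE x in half_line. w x = bessel_expr \<nu> f x" by eventually_elim simp
	have b: "sq_integrable (bessel_expr \<nu> f)" by (rule sq_integrable_cong_AE[OF w ae'])
	show "L2 (bessel_expr \<nu> f) = L2 w" using ae by (simp add: L2_eq_iff b w)
	show "f \<in> bessel_max_fun \<nu>"
		using f b diff primitive_loc_abs_continuous_on[OF fy] primitive_loc_abs_continuous_on[OF pd]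
		by (simp add: bessel_max_fun_def)
qed

text \<open>
	This is the factorization \<open>\<tau> = (- d/dx - \<sigma>/x) (d/dx - \<sigma>/x)\<close>.
\<close>

lemma max_fun_grad_primitive:
	assumes f: "f \<in> bessel_max_fun \<nu>" and s: "\<sigma>\<^sup>2 - \<sigma> = \<nu>\<^sup>2 - 1/4"
	shows "primitive (grad \<sigma> f) (\<lambda>x. - bessel_expr \<nu> f x + cpx (- \<sigma> / x) * grad \<sigma> f x)"
proof -
	note D = bessel_max_funD[OF f]
	have pi: "primitive (\<lambda>x. cpx (\<sigma> / x)) (\<lambda>x. cpx (- \<sigma> / x\<^sup>2))"
		by (rule primitive_of_real_derivative) (auto intro!: derivative_eq_intros continuous_intros simp: power2_eq_square)
	show ?thesis
		unfolding grad_def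
	proof (rule primitive_cong_AE[OF primitive_diff[OF D(4) primitive_mult[OF pi D(3)]]])
		show "AE x in half_line. pot \<nu> x * f x - bessel_expr \<nu> f x -
				(cpx (- \<sigma> / x\<^sup>2) * f x + cpx (\<sigma> / x) * deriv_on {0<..} f x)
			= - bessel_expr \<nu> f x + cpx (- \<sigma> / x) * (deriv_on {0<..} f x - cpx (\<sigma> / x) * f x)"
			using AE_space[of half_line]
		proof eventually_elim
			case (elim x)
			have "(\<nu>\<^sup>2 - 1/4) / x\<^sup>2 + \<sigma> / x\<^sup>2 = \<sigma>\<^sup>2 / x\<^sup>2" unfolding s[symmetric] by (simp add: diff_divide_distrib)
			then have "pot \<nu> x * f x + cpx (\<sigma> / x\<^sup>2) * f x = cpx (\<sigma>\<^sup>2 / x\<^sup>2) * f x"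
				by (metis distrib_right of_real_add)
			then show ?case by (simp add: algebra_simps power2_eq_square)
		qed
	qed simp
qed

text \<open>
	By the factorization, \<open>x powr \<sigma> * grad \<sigma> f\<close> has the derivative \<open>- x powr \<sigma> * \<tau> f\<close>.
\<close>

lemma max_fun_boundary_limit:
	assumes f: "f \<in> bessel_max_fun \<nu>" and s: "\<sigma>\<^sup>2 - \<sigma> = \<nu>\<^sup>2 - 1/4" "\<sigma> > -1/2"
	shows "\<exists>l C. lim0 (\<lambda>x. pw \<sigma> x * grad \<sigma> f x) l \<and> C \<ge> 0 \<and>
		(\<forall>x>0. cmod (pw \<sigma> x * grad \<sigma> f x - l) \<le> C * x powr (\<sigma> + 1/2))"
proof -
	have p: "primitive (\<lambda>x. pw \<sigma> x * grad \<sigma> f x) (\<lambda>x. pw \<sigma> x * - bessel_expr \<nu> f x)"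
		using primitive_powr_mult[OF max_fun_grad_primitive[OF f s(1)], of \<sigma>] by simp
	have z: "sq_integrable (\<lambda>x. - bessel_expr \<nu> f x)" by (rule sq_integrable_uminus[OF bessel_max_funD(2)[OF f]])
	have "2 * \<sigma> + 1 > 0" using s by simp
	from primitive_limit_at_0[OF p z this] obtain l where
		l: "lim0 (\<lambda>x. pw \<sigma> x * grad \<sigma> f x) l"
		"\<And>x. x > 0 \<Longrightarrow> cmod (pw \<sigma> x * grad \<sigma> f x - l) \<le>
			norm (L2 (\<lambda>x. - bessel_expr \<nu> f x)) / sqrt (2 * \<sigma> + 1) * x powr (\<sigma> + 1/2)" by blast
	have "norm (L2 (\<lambda>x. - bessel_expr \<nu> f x)) / sqrt (2 * \<sigma> + 1) \<ge> 0" using s by simp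
	with l show ?thesis by blast
qed

lemma cmod_le_of_powr_mult:
	assumes "x > 0" "cmod (pw \<sigma> x * u - l) \<le> C * x powr (\<sigma> + t)"
	shows "cmod (u - pw (- \<sigma>) x * l) \<le> C * x powr t"
proof -
	have e: "u - pw (- \<sigma>) x * l = pw (- \<sigma>) x * (pw \<sigma> x * u - l)"
	proof -
		have "pw (- \<sigma>) x * (pw \<sigma> x * u) = u"
			using assms(1) by (simp add: mult.assoc[symmetric] powr_minus of_real_mult[symmetric] del: of_real_mult of_real_inverse)
		then show ?thesis by (simp add: right_diff_distrib)
	qed
	have "cmod (u - pw (- \<sigma>) x * l) = x powr (- \<sigma>) * cmod (pw \<sigma> x * u - l)"
		unfolding e norm_mult by simp
	also have "\<dots> \<le> x powr (- \<sigma>) * (C * x powr (\<sigma> + t))" by (rule mult_left_mono[OF assms(2)]) simp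
	also have "\<dots> = C * x powr t" using assms(1) by (simp add: powr_add powr_minus field_simps)
	finally show ?thesis .
qed

lemma cmod_sq_add_le: "(cmod (a + b))\<^sup>2 \<le> 2 * (cmod a)\<^sup>2 + 2 * (cmod b)\<^sup>2"
proof -
	have "(cmod (a + b))\<^sup>2 \<le> (cmod a + cmod b)\<^sup>2" by (simp add: norm_triangle_ineq power_mono)
	also have "\<dots> \<le> 2 * (cmod a)\<^sup>2 + 2 * (cmod b)\<^sup>2"
		using sum_squares_bound[of "cmod a" "cmod b"] by (simp add: power2_sum)
	finally show ?thesis .
qed

lemma max_fun_derivative_at_infinity:
	assumes f: "f \<in> bessel_max_fun \<nu>"
	shows "sq_integrable (\<lambda>x. cpx (if x < 1 then 0 else cmod (deriv_on {0<..} f x)))"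
proof -
	note D = bessel_max_funD[OF f]
	define c where "c = \<nu>\<^sup>2 - 1/4"
	define v where "v x = cpx \<bar>c\<bar> * cpx (cmod (f x)) + cpx (cmod (bessel_expr \<nu> f x))" for x
	have v: "sq_integrable v"
		unfolding v_def by (intro sq_integrable_add sq_integrable_scale sq_integrable_cmod D)
	have le: "cmod (pot \<nu> x * f x - bessel_expr \<nu> f x) \<le> cmod (v x)" if x: "x \<ge> 1" for x
	proof -
		have "cmod (cpx (c / x\<^sup>2) * f x - bessel_expr \<nu> f x) \<le> \<bar>c\<bar> / x\<^sup>2 * cmod (f x) + cmod (bessel_expr \<nu> f x)"
			using norm_triangle_ineq4[of "cpx (c / x\<^sup>2) * f x" "bessel_expr \<nu> f x"] by (simp add: norm_mult norm_divide norm_power)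
		also have "\<bar>c\<bar> / x\<^sup>2 \<le> \<bar>c\<bar> / 1" by (rule divide_left_mono) (use x in \<open>auto simp: one_le_power\<close>)
		finally have "cmod (cpx (c / x\<^sup>2) * f x - bessel_expr \<nu> f x) \<le> \<bar>c\<bar> * cmod (f x) + cmod (bessel_expr \<nu> f x)"
			by (simp add: mult_right_mono)
		then show ?thesis unfolding v_def c_def of_real_mult[symmetric] of_real_add[symmetric] norm_of_real by (rule order_trans[OF _ abs_ge_self])
	qed
	obtain B where B: "\<And>b. b \<ge> 1 \<Longrightarrow> integral {1..b} (\<lambda>x. (cmod (deriv_on {0<..} f x))\<^sup>2) \<le> B"
		using derivative_sq_integrable_at_infinity[OF D(1) v D(3) D(4) le] by blast
	show ?thesis
		by (rule sq_integrable_piecewise[where K=0 and L=B])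
			 (use B in \<open>auto intro!: continuous_intros continuous_on_subset[OF primitive_continuous_on[OF D(4)]]\<close>)
qed

text \<open>
	Near \<open>0\<close> the function \<open>grad \<sigma> f\<close> is \<open>l x powr (- \<sigma>)\<close> up to a bounded error, and \<open>x powr (- \<sigma>)\<close> is square
	integrable there if \<open>\<sigma> < 1/2\<close>.
\<close>

lemma max_fun_in_grad_dom:
	assumes f: "f \<in> bessel_max_fun \<nu>" and s: "\<sigma>\<^sup>2 - \<sigma> = \<nu>\<^sup>2 - 1/4" "\<sigma> > -1/2"
		and l: "lim0 (\<lambda>x. pw \<sigma> x * grad \<sigma> f x) l" and ls: "\<sigma> < 1/2 \<or> l = 0"
	shows "f \<in> grad_dom \<sigma>"
proof -
	note D = bessel_max_funD[OF f]
	obtain l' C where l': "lim0 (\<lambda>x. pw \<sigma> x * grad \<sigma> f x) l'" and C: "C \<ge> 0"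
		and le: "\<And>x. x > 0 \<Longrightarrow> cmod (pw \<sigma> x * grad \<sigma> f x - l') \<le> C * x powr (\<sigma> + 1/2)"
		using max_fun_boundary_limit[OF f s] by blast
	have "l' = l" using tendsto_unique[OF _ l' l] by simp
	define p where "p = (if \<sigma> < 1/2 then - \<sigma> else 0)"
	define V where "V x = cmod l * (if x < 1 then x powr p else 1 / x) + C * (if x < 1 then x powr 0 else 1 / x)
		+ (if x < 1 then 0 else cmod (deriv_on {0<..} f x)) + \<bar>\<sigma>\<bar> * cmod (f x)" for x
	have "sq_integrable (\<lambda>x. cpx (cmod l) * weight p x + cpx C * weight 0 x
		+ cpx (if x < 1 then 0 else cmod (deriv_on {0<..} f x)) + cpx \<bar>\<sigma>\<bar> * cpx (cmod (f x)))"
		by (intro sq_integrable_add sq_integrable_scale sq_integrable_weight sq_integrable_cmod D max_fun_derivative_at_infinity[OF f])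
			 (simp_all add: p_def)
	then have "sq_integrable (\<lambda>x. cpx (V x))" by (simp only: V_def weight_def of_real_add of_real_mult)
	then have "sq_integrable (grad \<sigma> f)"
	proof (rule sq_integrable_dominated[rotated])
		show "grad \<sigma> f \<in> borel_measurable half_line"
			by (rule primitive_measurable[OF max_fun_grad_primitive[OF f s(1)]])
		fix x :: real assume x: "x > 0"
		have "cmod (grad \<sigma> f x) \<le> V x"
		proof (cases "x < 1")
			case True
			have "cmod (grad \<sigma> f x - pw (- \<sigma>) x * l) \<le> C * x powr (1/2)"
				by (rule cmod_le_of_powr_mult[OF x]) (use le[OF x] in \<open>simp add: \<open>l' = l\<close>\<close>)
			also have "\<dots> \<le> C * 1" using x True C by (intro mult_left_mono powr_le1) auto
			finally have "cmod (grad \<sigma> f x) \<le> C + x powr (- \<sigma>) * cmod l"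
				using norm_triangle_ineq2[of "grad \<sigma> f x" "pw (- \<sigma>) x * l"] by (simp add: norm_mult)
			moreover have "x powr (- \<sigma>) * cmod l = cmod l * x powr p" using ls by (auto simp: p_def)
			ultimately show ?thesis using True x by (simp add: V_def add_increasing2)
		next
			case False
			have "cmod (grad \<sigma> f x) \<le> cmod (deriv_on {0<..} f x) + \<bar>\<sigma>\<bar> / x * cmod (f x)"
				using norm_triangle_ineq4[of "deriv_on {0<..} f x" "cpx (\<sigma> / x) * f x"] x
				by (simp add: grad_def norm_mult norm_divide)
			also have "\<bar>\<sigma>\<bar> / x * cmod (f x) \<le> \<bar>\<sigma>\<bar> * cmod (f x)"
				by (rule mult_right_mono) (use False in \<open>auto simp: divide_le_eq mult_le_cancel_left1\<close>)
			finally have "cmod (grad \<sigma> f x) \<le> cmod (deriv_on {0<..} f x) + \<bar>\<sigma>\<bar> * cmod (f x)" by simp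
			moreover have "0 \<le> cmod l / x" "0 \<le> C / x" using x C by auto
			moreover have "V x = cmod l / x + C / x + cmod (deriv_on {0<..} f x) + \<bar>\<sigma>\<bar> * cmod (f x)" using False by (simp add: V_def)
			ultimately show ?thesis by linarith
		qed
		then show "cmod (grad \<sigma> f x) \<le> cmod (cpx (V x))" by simp
	qed
	then show ?thesis
		using D(1) primitive_loc_abs_continuous_on[OF D(3)] by (simp add: grad_dom_def)
qed

text \<open>
	If \<open>\<sigma> \<ge> 1/2\<close>, then \<open>x powr (- \<sigma>)\<close> is not square integrable at \<open>0\<close>, so the coefficient in front of it vanishes.
\<close>

lemma grad_dom_boundary_zero:
	assumes f: "f \<in> bessel_max_fun \<nu>" and s: "\<sigma>\<^sup>2 - \<sigma> = \<nu>\<^sup>2 - 1/4" "\<sigma> \<ge> 1/2"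
		and fd: "f \<in> grad_dom \<sigma>"
	shows "lim0 (\<lambda>x. pw \<sigma> x * grad \<sigma> f x) 0"
		"\<exists>C\<ge>0. \<forall>x>0. cmod (grad \<sigma> f x) \<le> C * x powr (1/2)"
proof -
	have s': "\<sigma> > -1/2" using s by simp
	obtain l C where l: "lim0 (\<lambda>x. pw \<sigma> x * grad \<sigma> f x) l" and C: "C \<ge> 0"
		and le: "\<And>x. x > 0 \<Longrightarrow> cmod (pw \<sigma> x * grad \<sigma> f x - l) \<le> C * x powr (\<sigma> + 1/2)"
		using max_fun_boundary_limit[OF f s(1) s'] by blast
	have l0: "l = 0"
	proof (rule ccontr)
		assume "l \<noteq> 0"
		then have "cmod l / 2 > 0" by simp
		from tendstoD[OF l this] obtain d where d: "d > 0" "\<And>x. 0 < x \<Longrightarrow> x < d \<Longrightarrow> dist (pw \<sigma> x * grad \<sigma> f x) l < cmod l / 2"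
			unfolding eventually_at_right_field by auto
		have "\<not> sq_integrable (grad \<sigma> f)"
		proof (rule not_sq_integrable_powr[of "cmod l / 2" d "- \<sigma>"])
			fix x assume x: "0 < x" "x < d"
			have "cmod l - cmod (pw \<sigma> x * grad \<sigma> f x) \<le> dist (pw \<sigma> x * grad \<sigma> f x) l"
				using norm_triangle_ineq2[of l "pw \<sigma> x * grad \<sigma> f x"] by (simp add: dist_norm norm_minus_commute)
			then have "cmod l / 2 \<le> x powr \<sigma> * cmod (grad \<sigma> f x)" using d(2)[OF x] by (simp add: norm_mult)
			then have "x powr (- \<sigma>) * (cmod l / 2) \<le> x powr (- \<sigma>) * (x powr \<sigma> * cmod (grad \<sigma> f x))" by (rule mult_left_mono) simp
			then show "cmod l / 2 * x powr (- \<sigma>) \<le> cmod (grad \<sigma> f x)" using x by (simp add: powr_minus field_simps)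
		qed (use d \<open>l \<noteq> 0\<close> s in auto)
		then show False using fd by (simp add: grad_dom_def)
	qed
	show "lim0 (\<lambda>x. pw \<sigma> x * grad \<sigma> f x) 0" using l l0 by simp
	have "cmod (grad \<sigma> f x) \<le> C * x powr (1/2)" if "x > 0" for x
		using cmod_le_of_powr_mult[OF that le[OF that]] by (simp add: l0)
	then show "\<exists>C\<ge>0. \<forall>x>0. cmod (grad \<sigma> f x) \<le> C * x powr (1/2)" using C by blast
qed

lemma grad_dom_bounded_near_0:
	assumes f: "f \<in> grad_dom s" and s: "s \<ge> 0"
	shows "\<exists>C. \<forall>x. 0 < x \<and> x < 1 \<longrightarrow> cmod (f x) \<le> C"
proof -
	note D = grad_domD[OF f]
	define v where "v x = pw (- s) x * f x" for x
	have pv: "primitive v (\<lambda>x. pw (- s) x * grad s f x)"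
		unfolding v_def by (rule primitive_powr_cancel[OF D(3)])
	have "cmod (f x) \<le> cmod (f 1) + norm (L2 (grad s f))" if x: "0 < x" "x < 1" for x
	proof -
		have "cmod (v 1 - v x) = cmod (integral {x..1} (\<lambda>x. pw (- s) x * grad s f x))"
			using primitiveD(3)[OF pv x(1), of 1] x by simp
		also have "\<dots> \<le> norm (L2 (grad s f)) * sqrt (integral {x..1} (\<lambda>x. x powr (2 * - s)))"
			by (rule cmod_weighted_integral_le[OF D(2)]) (use x in auto)
		also have "integral {x..1} (\<lambda>t. t powr (2 * - s)) \<le> integral {x..1} (\<lambda>t. x powr (2 * - s))"
		proof (rule integral_le)
			show "(\<lambda>t. t powr (2 * - s)) integrable_on {x..1}"
				by (rule integrable_continuous_real) (intro continuous_intros, use x in auto)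
			fix t assume "t \<in> {x..1}"
			then show "t powr (2 * - s) \<le> x powr (2 * - s)" using x s by (intro powr_mono2') auto
		qed auto
		also have "\<dots> \<le> x powr (2 * - s)" using x by (simp add: mult_left_le_one_le)
		also have "sqrt (x powr (2 * - s)) = x powr (- s)" by (simp add: powr_half_sqrt[symmetric] powr_powr)
		finally have "cmod (v 1 - v x) \<le> norm (L2 (grad s f)) * x powr (- s)" by (simp add: mult_left_mono real_sqrt_le_mono)
		then have vx: "cmod (v x) \<le> cmod (v 1) + norm (L2 (grad s f)) * x powr (- s)"
			using norm_triangle_ineq2[of "v x" "v 1"] by (simp add: norm_minus_commute)
		have "f x = pw s x * v x" using x by (simp add: v_def powr_minus)
		then have "cmod (f x) = x powr s * cmod (v x)" by (simp add: norm_mult)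
		also have "\<dots> \<le> x powr s * (cmod (v 1) + norm (L2 (grad s f)) * x powr (- s))" by (rule mult_left_mono[OF vx]) simp
		also have "\<dots> = x powr s * cmod (v 1) + norm (L2 (grad s f))" using x by (simp add: powr_minus field_simps)
		also have "x powr s * cmod (v 1) \<le> 1 * cmod (v 1)" by (rule mult_right_mono) (use x s in \<open>auto intro: powr_le1\<close>)
		also have "v 1 = f 1" by (simp add: v_def)
		finally show ?thesis by simp
	qed
	then show ?thesis by blast
qed

text \<open>
	Integration by parts: \<open>grad \<sigma> f * cnj v\<close> is a primitive of
	\<open>grad \<sigma> f * cnj (grad \<sigma> v) - \<tau> f * cnj v\<close>, because the terms with \<open>\<sigma>/x\<close> cancel.
\<close>

lemma Green_formula:
	assumes f: "f \<in> bessel_max_fun \<nu>" and s: "\<sigma>\<^sup>2 - \<sigma> = \<nu>\<^sup>2 - 1/4" and fd: "f \<in> grad_dom \<sigma>" and v: "v \<in> grad_dom \<sigma>"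
		and l: "lim0 (\<lambda>x. grad \<sigma> f x * cnj (v x)) l"
	shows "l2_inner (L2 (bessel_expr \<nu> f)) (L2 v) = l2_inner (L2 (grad \<sigma> f)) (L2 (grad \<sigma> v)) + l"
proof -
	note D = bessel_max_funD[OF f] and Df = grad_domD[OF fd] and Dv = grad_domD[OF v]
	define k where "k x = grad \<sigma> f x * cnj (grad \<sigma> v x) - bessel_expr \<nu> f x * cnj (v x)" for x
	have pq: "primitive (\<lambda>x. grad \<sigma> f x * cnj (v x)) k"
	proof (rule primitive_cong_AE[OF primitive_mult[OF max_fun_grad_primitive[OF f s] primitive_cnj[OF Dv(3)]]])
		show "AE x in half_line. (- bessel_expr \<nu> f x + cpx (- \<sigma> / x) * grad \<sigma> f x) * cnj (v x) +
				grad \<sigma> f x * cnj (grad \<sigma> v x + cpx (\<sigma> / x) * v x) = k x"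
			by (simp add: k_def algebra_simps)
	qed simp
	have i1: "integrable half_line (\<lambda>x. grad \<sigma> f x * cnj (grad \<sigma> v x))" by (rule sq_integrable_mult_cnj[OF Df(2) Dv(2)])
	have i2: "integrable half_line (\<lambda>x. bessel_expr \<nu> f x * cnj (v x))" by (rule sq_integrable_mult_cnj[OF D(2) Dv(1)])
	have "(LINT x|half_line. k x) = - l"
		by (rule primitive_LINT[OF pq _ _ l]) (use i1 i2 sq_integrable_mult_cnj[OF Df(2) Dv(1)] in \<open>auto simp: k_def[abs_def]\<close>)
	moreover have "(LINT x|half_line. k x) = l2_inner (L2 (grad \<sigma> f)) (L2 (grad \<sigma> v)) - l2_inner (L2 (bessel_expr \<nu> f)) (L2 v)"
		unfolding l2_inner_L2[OF Df(2) Dv(2)] l2_inner_L2[OF D(2) Dv(1)] k_def by (rule Bochner_Integration.integral_diff[OF i1 i2])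
	ultimately show ?thesis by (simp add: algebra_simps)
qed

section \<open>The minimal operator and its core\<close>

lemma max_fun_cong:
	assumes f: "f \<in> bessel_max_fun \<nu>" and eq: "\<And>x. x > 0 \<Longrightarrow> f' x = f x" and f': "sq_integrable f'"
	shows "f' \<in> bessel_max_fun \<nu>" "L2 (bessel_expr \<nu> f') = L2 (bessel_expr \<nu> f)"
proof -
	note D = bessel_max_funD[OF f]
	have p1: "primitive f' (deriv_on {0<..} f)" by (rule primitive_cong_AE[OF D(3)]) (use eq in auto)
	have p2: "primitive (deriv_on {0<..} f) (\<lambda>x. pot \<nu> x * f' x - bessel_expr \<nu> f x)"
		by (rule primitive_cong_AE[OF D(4)]) (use AE_space[of half_line] eq in \<open>auto elim!: eventually_mono\<close>)
	show "f' \<in> bessel_max_fun \<nu>" "L2 (bessel_expr \<nu> f') = L2 (bessel_expr \<nu> f)"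
		by (rule bessel_max_funI[OF f' D(2) p1 p2])+
qed

lemma max_fun_add:
	assumes f: "f \<in> bessel_max_fun \<nu>" and g: "g \<in> bessel_max_fun \<nu>"
	shows "(\<lambda>x. f x + g x) \<in> bessel_max_fun \<nu>"
		"L2 (bessel_expr \<nu> (\<lambda>x. f x + g x)) = L2 (bessel_expr \<nu> f) + L2 (bessel_expr \<nu> g)"
		"\<And>x. x > 0 \<Longrightarrow> deriv_on {0<..} (\<lambda>x. f x + g x) x = deriv_on {0<..} f x + deriv_on {0<..} g x"
proof -
	note F = bessel_max_funD[OF f] and G = bessel_max_funD[OF g]
	have s: "sq_integrable (\<lambda>x. f x + g x)" "sq_integrable (\<lambda>x. bessel_expr \<nu> f x + bessel_expr \<nu> g x)"
		by (intro sq_integrable_add F G)+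
	have p: "primitive (\<lambda>x. deriv_on {0<..} f x + deriv_on {0<..} g x)
			(\<lambda>x. pot \<nu> x * (f x + g x) - (bessel_expr \<nu> f x + bessel_expr \<nu> g x))"
		by (rule primitive_cong_AE[OF primitive_add[OF F(4) G(4)]]) (auto simp only: distrib_left add_diff_add)
	note I = bessel_max_funI[OF s primitive_add[OF F(3) G(3)] p]
	show "(\<lambda>x. f x + g x) \<in> bessel_max_fun \<nu>"
		"\<And>x. x > 0 \<Longrightarrow> deriv_on {0<..} (\<lambda>x. f x + g x) x = deriv_on {0<..} f x + deriv_on {0<..} g x" by (rule I, assumption?)+
	show "L2 (bessel_expr \<nu> (\<lambda>x. f x + g x)) = L2 (bessel_expr \<nu> f) + L2 (bessel_expr \<nu> g)"
		using I(3) by (simp add: L2_add F G)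
qed

lemma max_fun_scale:
	assumes f: "f \<in> bessel_max_fun \<nu>"
	shows "(\<lambda>x. c * f x) \<in> bessel_max_fun \<nu>"
		"L2 (bessel_expr \<nu> (\<lambda>x. c * f x)) = c *\<^sub>C L2 (bessel_expr \<nu> f)"
		"\<And>x. x > 0 \<Longrightarrow> deriv_on {0<..} (\<lambda>x. c * f x) x = c * deriv_on {0<..} f x"
proof -
	note F = bessel_max_funD[OF f]
	have s: "sq_integrable (\<lambda>x. c * f x)" "sq_integrable (\<lambda>x. c * bessel_expr \<nu> f x)"
		by (intro sq_integrable_scale F)+
	have p: "primitive (\<lambda>x. c * deriv_on {0<..} f x)
			(\<lambda>x. pot \<nu> x * (c * f x) - c * bessel_expr \<nu> f x)"
		by (rule primitive_cong_AE[OF primitive_scale[OF F(4), of c]]) (auto simp: algebra_simps)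
	note I = bessel_max_funI[OF s primitive_scale[OF F(3), of c] p]
	show "(\<lambda>x. c * f x) \<in> bessel_max_fun \<nu>"
		"\<And>x. x > 0 \<Longrightarrow> deriv_on {0<..} (\<lambda>x. c * f x) x = c * deriv_on {0<..} f x" by (rule I, assumption?)+
	show "L2 (bessel_expr \<nu> (\<lambda>x. c * f x)) = c *\<^sub>C L2 (bessel_expr \<nu> f)"
		using I(3) by (simp add: L2_scale F)
qed

lemma max_fun_zero: "(\<lambda>x. 0) \<in> bessel_max_fun \<nu>" "L2 (bessel_expr \<nu> (\<lambda>x. 0)) = 0"
proof -
	have p: "primitive (\<lambda>x. 0) (\<lambda>x. pot \<nu> x * 0 - 0)" using primitive_const[of 0] by simp
	note I = bessel_max_funI[OF sq_integrable_zero sq_integrable_zero primitive_const p]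
	show "(\<lambda>x. 0) \<in> bessel_max_fun \<nu>" "L2 (bessel_expr \<nu> (\<lambda>x. 0)) = 0" using I(1,3) by (simp_all add: L2_zero)
qed

text \<open>
	Restrictions of the maximal operator that are described by a condition on the continuous representative.
\<close>

definition max_restrict :: "real \<Rightarrow> (real \<Rightarrow> complex) set \<Rightarrow> l2_op"
	where "max_restrict \<nu> P = {(L2 f, L2 (bessel_expr \<nu> f)) | f. f \<in> bessel_max_fun \<nu> \<and> f \<in> P}"

lemma linear_max_restrict:
	assumes "(\<lambda>x. 0) \<in> P" "\<And>f g. f \<in> bessel_max_fun \<nu> \<Longrightarrow> g \<in> bessel_max_fun \<nu> \<Longrightarrow> f \<in> P \<Longrightarrow> g \<in> P \<Longrightarrow> (\<lambda>x. f x + g x) \<in> P"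
		"\<And>c f. f \<in> bessel_max_fun \<nu> \<Longrightarrow> f \<in> P \<Longrightarrow> (\<lambda>x. c * f x) \<in> P"
	shows "linear_op (max_restrict \<nu> P)"
	unfolding linear_op_def
proof (intro conjI allI impI)
	show "(0, 0) \<in> max_restrict \<nu> P"
		unfolding max_restrict_def using max_fun_zero assms(1) by (auto intro!: exI[of _ "\<lambda>x. 0"] simp: L2_zero)
next
	fix x y x' y' assume "(x, y) \<in> max_restrict \<nu> P" "(x', y') \<in> max_restrict \<nu> P"
	then obtain f g where fg: "f \<in> bessel_max_fun \<nu>" "g \<in> bessel_max_fun \<nu>" "f \<in> P" "g \<in> P"
		"x = L2 f" "y = L2 (bessel_expr \<nu> f)" "x' = L2 g" "y' = L2 (bessel_expr \<nu> g)" unfolding max_restrict_def by blast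
	have "x + x' = L2 (\<lambda>x. f x + g x)" using fg by (simp add: L2_add bessel_max_funD)
	then show "(x + x', y + y') \<in> max_restrict \<nu> P"
		unfolding max_restrict_def using max_fun_add[OF fg(1,2)] assms(2)[OF fg(1-4)] fg by auto
next
	fix c x y assume "(x, y) \<in> max_restrict \<nu> P"
	then obtain f where f: "f \<in> bessel_max_fun \<nu>" "f \<in> P"
		"x = L2 f" "y = L2 (bessel_expr \<nu> f)" unfolding max_restrict_def by blast
	have "c *\<^sub>C x = L2 (\<lambda>x. c * f x)" using f by (simp add: L2_scale bessel_max_funD)
	then show "(c *\<^sub>C x, c *\<^sub>C y) \<in> max_restrict \<nu> P"
		unfolding max_restrict_def using max_fun_scale[OF f(1)] assms(3)[OF f(1,2)] f by auto
next
	fix x y y' assume "(x, y) \<in> max_restrict \<nu> P" "(x, y') \<in> max_restrict \<nu> P"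
	then obtain f g where fg: "f \<in> bessel_max_fun \<nu>" "g \<in> bessel_max_fun \<nu>"
		"x = L2 f" "y = L2 (bessel_expr \<nu> f)" "x = L2 g" "y' = L2 (bessel_expr \<nu> g)" unfolding max_restrict_def by blast
	note F = bessel_max_funD[OF fg(1)] and G = bessel_max_funD[OF fg(2)]
	have "AE t in half_line. g t = f t" using fg by (metis L2_eq_iff F(1) G(1))
	then have "g t = f t" if "t > 0" for t
		by (rule continuous_AE_eq[OF primitive_continuous_on[OF G(3)] primitive_continuous_on[OF F(3)] _ that])
	from max_fun_cong(2)[OF fg(1) this G(1)] show "y = y'" using fg by simp
qed

definition compact_funs :: "(real \<Rightarrow> complex) set"
	where "compact_funs = {f. compact_support_in {0<..} f}"

lemma compact_support_iff:
	"compact_support_in {0<..} f \<longleftrightarrow> (\<exists>a b. 0 < a \<and> a \<le> b \<and> (\<forall>x>0. x \<notin> {a..b} \<longrightarrow> f x = 0))"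
proof
	assume "compact_support_in {0<..} f"
	then obtain K where K: "compact K" "K \<subseteq> {0<..}" "\<And>x. x \<in> {0<..} - K \<Longrightarrow> f x = 0" by (auto simp: compact_support_in_def)
	show "\<exists>a b. 0 < a \<and> a \<le> b \<and> (\<forall>x>0. x \<notin> {a..b} \<longrightarrow> f x = 0)"
	proof (cases "K = {}")
		case True
		then show ?thesis using K by (intro exI[of _ 1] exI[of _ 1]) auto
	next
		case False
		obtain a where a: "a \<in> K" "\<And>x. x \<in> K \<Longrightarrow> a \<le> x" using compact_attains_inf[OF K(1) False] by blast
		obtain b where b: "b \<in> K" "\<And>x. x \<in> K \<Longrightarrow> x \<le> b" using compact_attains_sup[OF K(1) False] by blast
		show ?thesis
		proof (rule exI[of _ a], rule exI[of _ b], intro conjI allI impI)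
			show "0 < a" using a K by auto
			show "a \<le> b" using a b by auto
			fix x :: real assume "0 < x" "x \<notin> {a..b}"
			then have "x \<notin> K" using a b by auto
			then show "f x = 0" using K(3) \<open>0 < x\<close> by auto
		qed
	qed
next
	assume "\<exists>a b. 0 < a \<and> a \<le> b \<and> (\<forall>x>0. x \<notin> {a..b} \<longrightarrow> f x = 0)"
	then obtain a b where ab: "0 < a" "a \<le> b" "\<forall>x>0. x \<notin> {a..b} \<longrightarrow> f x = 0" by blast
	then show "compact_support_in {0<..} f"
		unfolding compact_support_in_def by (intro exI[of _ "{a..b}"]) auto
qed

definition bessel_core :: "real \<Rightarrow> l2_op"
	where "bessel_core \<nu> = max_restrict \<nu> compact_funs"

lemma bessel_min_closure: "bessel_min \<nu> = closure (bessel_core \<nu>)"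
	by (simp add: bessel_min_def bessel_core_def max_restrict_def compact_funs_def)

lemma linear_bessel_core: "linear_op (bessel_core \<nu>)"
	unfolding bessel_core_def
proof (rule linear_max_restrict)
	show "(\<lambda>x. 0) \<in> compact_funs" unfolding compact_funs_def by (auto simp: compact_support_in_def)
	fix f g assume fg: "f \<in> compact_funs" "g \<in> compact_funs"
	obtain K where K: "compact K" "K \<subseteq> {0<..}" "\<forall>x\<in>{0<..} - K. f x = 0"
		using fg(1) unfolding compact_funs_def compact_support_in_def by auto
	obtain K' where K': "compact K'" "K' \<subseteq> {0<..}" "\<forall>x\<in>{0<..} - K'. g x = 0"
		using fg(2) unfolding compact_funs_def compact_support_in_def by auto
	have "\<forall>x\<in>{0<..} - (K \<union> K'). f x + g x = 0" using K(3) K'(3) by simp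
	then show "(\<lambda>x. f x + g x) \<in> compact_funs"
		unfolding compact_funs_def compact_support_in_def using K K' compact_Un[of K K'] by blast
next
	fix c f assume "f \<in> compact_funs"
	then show "(\<lambda>x. c * f x) \<in> compact_funs" unfolding compact_funs_def compact_support_in_def by auto
qed

lemma compact_fun_zero_near_0:
	assumes f: "f \<in> compact_funs"
	obtains a where "a > 0" "\<And>x. 0 < x \<Longrightarrow> x < a \<Longrightarrow> f x = 0 \<and> deriv_on {0<..} f x = 0"
proof -
	obtain a b where ab: "0 < a" "a \<le> b" "\<And>x. x > 0 \<Longrightarrow> x \<notin> {a..b} \<Longrightarrow> f x = 0"
		using f unfolding compact_funs_def compact_support_iff by auto
	have "f x = 0 \<and> deriv_on {0<..} f x = 0" if x: "0 < x" "x < a" for x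
	proof
		show "f x = 0" using ab x by auto
		have "(f has_vector_derivative 0) (at x)"
			by (rule has_vector_derivative_transform_within_open[OF has_vector_derivative_const[of 0], of "{0<..<a}"])
				 (use ab x in auto)
		then show "deriv_on {0<..} f x = 0" by (rule deriv_on_eqI[OF x(1)])
	qed
	with ab(1) show ?thesis by (rule that)
qed

lemma tendsto_zero_near_0:
	fixes h :: "real \<Rightarrow> complex"
	assumes "a > 0" "\<And>x. 0 < x \<Longrightarrow> x < a \<Longrightarrow> h x = 0"
	shows "lim0 h 0"
	by (rule tendsto_eventually) (use assms in \<open>auto simp: eventually_at_right_field\<close>)

lemma compact_fun_grad_dom:
	assumes f: "f \<in> bessel_max_fun \<nu>" "f \<in> compact_funs" and s: "\<sigma>\<^sup>2 - \<sigma> = \<nu>\<^sup>2 - 1/4" "\<sigma> > -1/2"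
	shows "f \<in> grad_dom \<sigma>"
proof (rule max_fun_in_grad_dom[OF f(1) s])
	obtain a where a: "a > 0" "\<And>x. 0 < x \<Longrightarrow> x < a \<Longrightarrow> f x = 0 \<and> deriv_on {0<..} f x = 0"
		by (rule compact_fun_zero_near_0[OF f(2)]) blast
	show "lim0 (\<lambda>x. pw \<sigma> x * grad \<sigma> f x) 0"
		by (rule tendsto_zero_near_0[OF a(1)]) (use a in \<open>auto simp: grad_def\<close>)
qed simp

lemma compact_fun_Green:
	assumes f: "f \<in> bessel_max_fun \<nu>" "f \<in> compact_funs" and s: "\<sigma>\<^sup>2 - \<sigma> = \<nu>\<^sup>2 - 1/4" "\<sigma> > -1/2" and v: "v \<in> grad_dom \<sigma>"
	shows "l2_inner (L2 (bessel_expr \<nu> f)) (L2 v) = l2_inner (L2 (grad \<sigma> f)) (L2 (grad \<sigma> v))"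
proof -
	obtain a where a: "a > 0" "\<And>x. 0 < x \<Longrightarrow> x < a \<Longrightarrow> f x = 0 \<and> deriv_on {0<..} f x = 0"
		by (rule compact_fun_zero_near_0[OF f(2)]) blast
	have "lim0 (\<lambda>x. grad \<sigma> f x * cnj (v x)) 0"
		by (rule tendsto_zero_near_0[OF a(1)]) (use a in \<open>auto simp: grad_def\<close>)
	from Green_formula[OF f(1) s(1) compact_fun_grad_dom[OF f s] v this] show ?thesis by simp
qed

lemma tendsto_zero_powr_bound:
	fixes f :: "real \<Rightarrow> complex"
	assumes "\<And>x. 0 < x \<Longrightarrow> x < 1 \<Longrightarrow> cmod (f x) \<le> C * x powr q" "q > 0"
	shows "lim0 f 0"
proof (rule Lim_null_comparison)
	show "\<forall>\<^sub>F x in at_right 0. norm (f x) \<le> C * x powr q"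
		unfolding eventually_at_right_field using assms(1) by (intro exI[of _ 1]) auto
	have "lim0 (\<lambda>x::real. x powr q) (0 powr q)"
		by (rule tendsto_powr2[OF tendsto_ident_at tendsto_const]) (use assms(2) in \<open>auto simp: eventually_at_right_field intro: exI[of _ 1]\<close>)
	from tendsto_mult_left[OF this, of C] show "lim0 (\<lambda>x. C * x powr q) 0" by simp
qed

lemma friedrichs_Green:
	assumes nu: "\<nu> \<ge> 0" and s: "s = 1/2 + \<nu>" and f: "f \<in> bessel_max_fun \<nu>" "f \<in> grad_dom s" and v: "v \<in> grad_dom s"
	shows "l2_inner (L2 (bessel_expr \<nu> f)) (L2 v) = l2_inner (L2 (grad s f)) (L2 (grad s v))"
proof -
	have ss: "s\<^sup>2 - s = \<nu>\<^sup>2 - 1/4" "s \<ge> 1/2" using nu by (auto simp: s power2_eq_square algebra_simps)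
	obtain C where C: "\<And>x. x > 0 \<Longrightarrow> cmod (grad s f x) \<le> C * x powr (1/2)"
		using grad_dom_boundary_zero(2)[OF f(1) ss f(2)] by blast
	obtain C' where C': "\<And>x. 0 < x \<Longrightarrow> x < 1 \<Longrightarrow> cmod (v x) \<le> C'"
		using grad_dom_bounded_near_0[OF v] ss by auto
	have "lim0 (\<lambda>x. grad s f x * cnj (v x)) 0"
	proof (rule tendsto_zero_powr_bound)
		fix x :: real assume x: "0 < x" "x < 1"
		have "cmod (grad s f x * cnj (v x)) \<le> (C * x powr (1/2)) * C'"
			unfolding norm_mult complex_mod_cnj
			by (rule mult_mono[OF C[OF x(1)] C'[OF x]]) (use order_trans[OF norm_ge_zero C[OF x(1)]] in auto)
		then show "cmod (grad s f x * cnj (v x)) \<le> (C * C') * x powr (1/2)" by (simp add: mult_ac)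
	qed simp
	from Green_formula[OF f(1) ss(1) f(2) v this] show ?thesis by simp
qed

text \<open>
	This operator turns out to be the Friedrichs extension.
\<close>

definition finite_energy_op :: "real \<Rightarrow> l2_op"
	where "finite_energy_op \<nu> = max_restrict \<nu> (grad_dom (1/2 + \<nu>))"

lemma grad_dom_add:
	assumes f: "f \<in> grad_dom s" and g: "g \<in> grad_dom s"
	shows "(\<lambda>x. f x + g x) \<in> grad_dom s" "L2 (grad s (\<lambda>x. f x + g x)) = L2 (grad s f) + L2 (grad s g)"
proof -
	note F = grad_domD[OF f] and G = grad_domD[OF g]
	have p: "primitive (\<lambda>x. f x + g x) (\<lambda>x. (grad s f x + grad s g x) + cpx (s / x) * (f x + g x))"
		using primitive_add[OF F(3) G(3)] by (simp add: algebra_simps add_divide_distrib)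
	note I = grad_domI[OF sq_integrable_add[OF F(1) G(1)] sq_integrable_add[OF F(2) G(2)] p]
	show "(\<lambda>x. f x + g x) \<in> grad_dom s" by (rule I)
	show "L2 (grad s (\<lambda>x. f x + g x)) = L2 (grad s f) + L2 (grad s g)" using I(3) by (simp add: L2_add F G)
qed

lemma grad_dom_scale:
	assumes f: "f \<in> grad_dom s"
	shows "(\<lambda>x. c * f x) \<in> grad_dom s" "L2 (grad s (\<lambda>x. c * f x)) = c *\<^sub>C L2 (grad s f)"
proof -
	note F = grad_domD[OF f]
	have p: "primitive (\<lambda>x. c * f x) (\<lambda>x. c * grad s f x + cpx (s / x) * (c * f x))"
		using primitive_scale[OF F(3), of c] by (simp add: algebra_simps)
	note I = grad_domI[OF sq_integrable_scale[OF F(1)] sq_integrable_scale[OF F(2)] p]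
	show "(\<lambda>x. c * f x) \<in> grad_dom s" by (rule I)
	show "L2 (grad s (\<lambda>x. c * f x)) = c *\<^sub>C L2 (grad s f)" using I(3) by (simp add: L2_scale F)
qed

lemma grad_dom_zero: "(\<lambda>x. 0) \<in> grad_dom s"
	by (rule grad_domI(1)[OF sq_integrable_zero sq_integrable_zero]) (simp add: primitive_const)

lemma linear_finite_energy_op: "linear_op (finite_energy_op \<nu>)"
	unfolding finite_energy_op_def
	by (rule linear_max_restrict) (auto intro: grad_dom_zero grad_dom_add grad_dom_scale)

lemma grad_dom_cong:
	assumes f: "f \<in> grad_dom s" and eq: "\<And>x. x > 0 \<Longrightarrow> f' x = f x" and f': "sq_integrable f'"
	shows "f' \<in> grad_dom s" "L2 (grad s f') = L2 (grad s f)"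
proof -
	note F = grad_domD[OF f]
	have p: "primitive f' (\<lambda>x. grad s f x + cpx (s / x) * f' x)"
		by (rule primitive_cong_AE[OF F(3)]) (use AE_space[of half_line] eq in \<open>auto elim!: eventually_mono\<close>)
	show "f' \<in> grad_dom s" "L2 (grad s f') = L2 (grad s f)" by (rule grad_domI[OF f' F(2) p])+
qed

lemma grad_op_memD:
	assumes f: "sq_integrable f" "primitive f y" and m: "(L2 f, g) \<in> grad_op s"
	shows "f \<in> grad_dom s" "g = L2 (grad s f)"
proof -
	obtain h where h: "L2 f = L2 h" "g = L2 (grad s h)" "h \<in> grad_dom s" using m by (auto simp: grad_op_def)
	note H = grad_domD[OF h(3)]
	have "AE x in half_line. f x = h x" using h(1) by (simp add: L2_eq_iff f H)
	then have eq: "f x = h x" if "x > 0" for x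
		by (rule continuous_AE_eq[OF primitive_continuous_on[OF f(2)] primitive_continuous_on[OF H(3)] _ that])
	show "f \<in> grad_dom s" "g = L2 (grad s f)" using grad_dom_cong[OF h(3) eq f(1)] h(2) by auto
qed

lemma finite_energy_op_grad:
	assumes nu: "\<nu> \<ge> 0" and xy: "(x, y) \<in> finite_energy_op \<nu>" and g: "(x, g) \<in> grad_hi \<nu>" and vk: "(v, k) \<in> grad_hi \<nu>"
	shows "l2_inner y v = l2_inner g k"
proof -
	obtain f where f: "x = L2 f" "y = L2 (bessel_expr \<nu> f)" "f \<in> bessel_max_fun \<nu>" "f \<in> grad_dom (1/2 + \<nu>)"
		using xy by (auto simp: finite_energy_op_def max_restrict_def)
	have "g = L2 (grad (1/2 + \<nu>) f)"
		by (rule linear_opD(4)[OF linear_grad_op g]) (use f in \<open>auto simp: grad_op_def\<close>)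
	moreover obtain h where "v = L2 h" "k = L2 (grad (1/2 + \<nu>) h)" "h \<in> grad_dom (1/2 + \<nu>)" using vk by (auto simp: grad_op_def)
	ultimately show ?thesis using friedrichs_Green[OF nu refl f(3,4)] f by simp
qed

lemma bessel_core_subset: "\<nu> \<ge> 0 \<Longrightarrow> bessel_core \<nu> \<subseteq> finite_energy_op \<nu>"
	unfolding bessel_core_def finite_energy_op_def max_restrict_def
	using compact_fun_grad_dom[of _ \<nu> "1/2 + \<nu>"] by (auto simp: power2_eq_square algebra_simps)

lemma finite_energy_op_Domain: "Domain (finite_energy_op \<nu>) \<subseteq> Domain (grad_hi \<nu>)"
	by (auto simp: finite_energy_op_def max_restrict_def grad_op_def)

lemma test_fun_bessel_core:
	assumes v: "test_fun v \<phi>" and \<phi>: "test_fun \<phi> \<psi>"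
	shows "(L2 v, L2 (\<lambda>x. pot \<nu> x * v x - \<psi> x)) \<in> bessel_core \<nu>"
		"sq_integrable v" "sq_integrable (\<lambda>x. pot \<nu> x * v x - \<psi> x)"
proof -
	have c: "continuous_on {0<..} (\<lambda>x. pot \<nu> x)" by (intro continuous_intros) auto
	show vs: "sq_integrable v" using test_fun_sq_integrable(1)[OF v continuous_on_const[of _ 1]] by simp
	have ps: "sq_integrable \<psi>" using test_fun_sq_integrable(2)[OF \<phi> continuous_on_const[of _ 1]] by simp
	show ws: "sq_integrable (\<lambda>x. pot \<nu> x * v x - \<psi> x)"
		by (intro sq_integrable_diff test_fun_sq_integrable(1)[OF v c] ps)
	have p1: "primitive v \<phi>" "primitive \<phi> \<psi>" using v \<phi> by (auto simp: test_fun_def)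
	have p2: "primitive \<phi> (\<lambda>x. pot \<nu> x * v x - (pot \<nu> x * v x - \<psi> x))"
		using p1 by simp
	note I = bessel_max_funI[OF vs ws p1(1) p2]
	have "v \<in> compact_funs" using v unfolding compact_funs_def compact_support_iff test_fun_def by blast
	then show "(L2 v, L2 (\<lambda>x. pot \<nu> x * v x - \<psi> x)) \<in> bessel_core \<nu>"
		unfolding bessel_core_def max_restrict_def using I(1) I(3)[symmetric] by blast
qed

text \<open>
	Weak solutions of \<open>\<tau> f = w\<close> are strong ones, by the second order lemma of du Bois-Reymond.
\<close>

lemma bessel_core_orthogonal:
	assumes f: "sq_integrable f" and w: "sq_integrable w"
		and o: "\<And>v \<tau>v. (v, \<tau>v) \<in> bessel_core \<nu> \<Longrightarrow> l2_inner (L2 w) v = l2_inner (L2 f) \<tau>v"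
	obtains f' where "f' \<in> bessel_max_fun \<nu>" "L2 f = L2 f'" "L2 w = L2 (bessel_expr \<nu> f')"
proof -
	define c where "c x = pot \<nu> x" for x :: real
	have cc: "continuous_on {0<..} c" unfolding c_def by (intro continuous_intros) auto
	have fl: "loc_integrable f" and wl: "loc_integrable w" using f w by (auto intro: sq_integrable_loc_integrable)
	have cfl: "loc_integrable (\<lambda>x. c x * f x)" by (rule loc_integrable_continuous_mult[OF fl cc])
	have cwl: "loc_integrable (\<lambda>x. c x * f x + (-1) * w x)"
		by (rule loc_integrable_add[OF cfl loc_integrable_continuous_mult[OF wl continuous_on_const]])
	obtain f' y where fy: "primitive f' y" "primitive y (\<lambda>x. c x * f x + (-1) * w x)" "AE x in half_line. f x = f' x"
	proof (rule du_Bois_Reymond2[OF fl cwl])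
		fix v \<phi> \<psi> assume v: "test_fun v \<phi>" and \<phi>: "test_fun \<phi> \<psi>"
		note core = test_fun_bessel_core(1)[OF test_fun_cnj[OF v] test_fun_cnj[OF \<phi>], where \<nu>=\<nu>]
			test_fun_bessel_core(2)[OF test_fun_cnj[OF v] test_fun_cnj[OF \<phi>]]
			test_fun_bessel_core(3)[OF test_fun_cnj[OF v] test_fun_cnj[OF \<phi>], where \<nu>=\<nu>]
		have i: "integrable half_line (\<lambda>x. w x * v x)" "integrable half_line (\<lambda>x. f x * \<psi> x)" "integrable half_line (\<lambda>x. c x * f x * v x)"
			using test_fun_integrable_mult[OF wl v] test_fun_integrable_mult[OF fl \<phi>] test_fun_integrable_mult[OF cfl v] by auto
		have "(LINT x|half_line. w x * v x) = l2_inner (L2 w) (L2 (\<lambda>x. cnj (v x)))"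
			by (simp add: l2_inner_L2[OF w core(2)])
		also have "\<dots> = l2_inner (L2 f) (L2 (\<lambda>x. pot \<nu> x * cnj (v x) - cnj (\<psi> x)))"
			by (rule o[OF core(1)])
		also have "\<dots> = (LINT x|half_line. c x * f x * v x - f x * \<psi> x)"
			unfolding l2_inner_L2[OF f core(3)] by (rule Bochner_Integration.integral_cong) (auto simp: c_def algebra_simps)
		also have "\<dots> = (LINT x|half_line. c x * f x * v x) - (LINT x|half_line. f x * \<psi> x)"
			by (rule Bochner_Integration.integral_diff[OF i(3,2)])
		finally have e: "(LINT x|half_line. w x * v x) = (LINT x|half_line. c x * f x * v x) - (LINT x|half_line. f x * \<psi> x)" .
		have "(LINT x|half_line. (c x * f x + (-1) * w x) * v x) = (LINT x|half_line. c x * f x * v x - w x * v x)"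
			by (rule Bochner_Integration.integral_cong) (auto simp: algebra_simps)
		also have "\<dots> = (LINT x|half_line. c x * f x * v x) - (LINT x|half_line. w x * v x)"
			by (rule Bochner_Integration.integral_diff[OF i(3,1)])
		finally show "(LINT x|half_line. (c x * f x + (-1) * w x) * v x) = (LINT x|half_line. f x * \<psi> x)" using e by simp
	qed (use that in blast)
	have f': "sq_integrable f'" by (rule sq_integrable_cong_AE[OF f fy(3)])
	have p: "primitive y (\<lambda>x. pot \<nu> x * f' x - w x)"
	proof (rule primitive_cong_AE[OF fy(2)])
		show "AE x in half_line. c x * f x + (-1) * w x = pot \<nu> x * f' x - w x"
			using fy(3) by eventually_elim (simp add: c_def)
	qed simp
	note I = bessel_max_funI[OF f' w fy(1) p]
	have "L2 f = L2 f'" using fy(3) by (simp add: L2_eq_iff f f')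
	then show ?thesis using that I(1,3) by metis
qed

section \<open>The Friedrichs extension\<close>

lemma closure_subspace:
	fixes S :: "'a::real_normed_vector set"
	assumes S: "subspace S"
	shows "subspace (closure S)"
	unfolding subspace_def
proof (intro conjI ballI allI)
	show "0 \<in> closure S" using subspace_0[OF S] closure_subset by blast
next
	fix x y assume "x \<in> closure S" "y \<in> closure S"
	then have "x + y \<in> (\<lambda>p. fst p + snd p) ` closure (S \<times> S)" by (force simp: closure_Times)
	also have "\<dots> \<subseteq> closure ((\<lambda>p. fst p + snd p) ` (S \<times> S))"
		by (intro closure_bounded_linear_image_subset bounded_linear_add bounded_linear_fst bounded_linear_snd)
	also have "\<dots> \<subseteq> closure S" by (rule closure_mono) (auto intro: subspace_add[OF S])
	finally show "x + y \<in> closure S" .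
next
	fix c x assume "x \<in> closure S"
	then have "c *\<^sub>R x \<in> closure ((*\<^sub>R) c ` S)"
		using closure_bounded_linear_image_subset[OF bounded_linear_scaleR_right] by blast
	also have "\<dots> \<subseteq> closure S" by (rule closure_mono) (auto intro: subspace_scale[OF S])
	finally show "c *\<^sub>R x \<in> closure S" .
qed

lemma linear_op_subspace: "linear_op T \<Longrightarrow> subspace T"
	using linear_opD(1)[of T] linear_opD(2,3)[of T "fst _" "snd _"]
	by (auto simp: subspace_def zero_prod_def scaleR_prod_def scaleR_l2_def dest: linear_opD(2,3))

text \<open>
	Let \<open>(u, g)\<close> in the graph be orthogonal to the core. This says that \<open>\<tau> u = - u\<close> weakly, hence strongly, and
	Green's formula then gives \<open>\<parallel>g\<parallel>\<^sup>2 = - \<parallel>u\<parallel>\<^sup>2\<close>.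
\<close>

lemma bessel_core_grad_dense:
	assumes nu: "\<nu> \<ge> 0" and p: "p \<in> grad_hi \<nu>"
	shows "\<exists>X. (\<forall>n. X n \<in> grad_hi \<nu> \<and> fst (X n) \<in> Domain (bessel_core \<nu>)) \<and> X \<longlonglongrightarrow> p"
proof -
	define G where "G = grad_hi \<nu>"
	define M where "M = {q \<in> G. fst q \<in> Domain (bessel_core \<nu>)}"
	note lG = linear_grad_op[of "1/2 + \<nu>", folded G_def] and lC = linear_bessel_core[of \<nu>]
	have linM: "linear_op M"
		unfolding linear_op_def
	proof (intro conjI allI impI)
		show "(0, 0) \<in> M" using linear_opD(1)[OF lG] linear_opD(1)[OF lC] by (auto simp: M_def)
		show "(v + v', k + k') \<in> M" if "(v, k) \<in> M" "(v', k') \<in> M" for v k v' k'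
			using that linear_opD(2)[OF lG, of v k v' k'] linear_opD(2)[OF lC, of v _ v' _] by (auto simp: M_def Domain_iff)
		show "(c *\<^sub>C v, c *\<^sub>C k) \<in> M" if "(v, k) \<in> M" for c v k
			using that linear_opD(3)[OF lG, of v k c] linear_opD(3)[OF lC, of v _ c] by (auto simp: M_def Domain_iff)
		show "k = k'" if "(v, k) \<in> M" "(v, k') \<in> M" for v k k'
			using that linear_opD(4)[OF lG] by (auto simp: M_def)
	qed
	have "p \<in> closure M"
	proof (rule ccontr)
		assume np: "p \<notin> closure M"
		have comp: "complete (closure M)" by (rule complete_closed_l2_prod) simp
		obtain m where m: "m \<in> closure M" "\<And>m'. m' \<in> closure M \<Longrightarrow> inner (p - m) m' = 0"
			using orthogonal_to_complete_subspace[OF closure_subspace[OF linear_op_subspace[OF linM]] comp np] by blast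
		have clG: "closure M \<subseteq> G" by (rule closure_minimal) (auto simp: M_def G_def closed_grad_op)
		obtain u g where ug: "p - m = (u, g)" by (cases "p - m") auto
		have ugG: "(u, g) \<in> G"
			using linear_op_diff[OF lG, of "fst p" "snd p" "fst m" "snd m"] p m(1) clG ug by (auto simp: G_def minus_prod_def)
		have orth: "l2_inner u v + l2_inner g k = 0" if vk: "(v, k) \<in> M" for v k
		proof (rule complex_eqI)
			have r: "inner u v' + inner g k' = 0" if "(v', k') \<in> M" for v' k'
				using m(2)[of "(v', k')"] that closure_subset[of M] by (auto simp: ug inner_prod_def)
			show "Re (l2_inner u v + l2_inner g k) = Re 0" using r[OF vk] by (simp add: inner_l2_def)
			show "Im (l2_inner u v + l2_inner g k) = Im 0"
				using r[OF linear_opD(3)[OF linM vk, of \<i>]] by (simp add: inner_l2_def l2_inner_scale_right)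
		qed
		obtain f where f: "u = L2 f" "g = L2 (grad (1/2 + \<nu>) f)" "f \<in> grad_dom (1/2 + \<nu>)"
			using ugG by (auto simp: G_def grad_op_def)
		have fs: "sq_integrable f" by (rule grad_domD(1)[OF f(3)])
		have "\<exists>f'. f' \<in> bessel_max_fun \<nu> \<and> L2 f = L2 f' \<and> L2 (\<lambda>x. (-1) * f x) = L2 (bessel_expr \<nu> f')"
		proof -
			have o: "l2_inner (L2 (\<lambda>x. (-1) * f x)) v = l2_inner (L2 f) \<tau>v" if v: "(v, \<tau>v) \<in> bessel_core \<nu>" for v \<tau>v
			proof -
				obtain k where k: "(v, k) \<in> G"
					using v bessel_core_subset[OF nu] finite_energy_op_Domain[of \<nu>] unfolding G_def by blast
				have kM: "(v, k) \<in> M" using k v by (auto simp: M_def)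
				have "l2_inner \<tau>v u = l2_inner k g"
					by (rule finite_energy_op_grad[OF nu _ k[unfolded G_def] ugG[unfolded G_def]]) (use v bessel_core_subset[OF nu] in blast)
				then have "l2_inner g k = l2_inner u \<tau>v" by (metis l2_inner_commute)
				then have "l2_inner u \<tau>v = - l2_inner u v" using orth[OF kM] by (simp add: add_eq_0_iff2)
				moreover have "L2 (\<lambda>x. (-1) * f x) = (-1) *\<^sub>C u" using f(1) by (simp only: L2_scale[OF fs])
				ultimately show ?thesis using f(1) by (simp add: l2_inner_minus_left l2.scale_minus_left)
			qed
			show ?thesis
				using bessel_core_orthogonal[OF fs sq_integrable_scale[OF fs, of "-1"] o] by blast
		qed
		then obtain f' where f': "f' \<in> bessel_max_fun \<nu>" "L2 f = L2 f'" "L2 (\<lambda>x. (-1) * f x) = L2 (bessel_expr \<nu> f')" by blast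
		note D = bessel_max_funD[OF f'(1)]
		have "(L2 f', g) \<in> grad_hi \<nu>" using ugG f f' by (simp add: G_def)
		from grad_op_memD[OF D(1,3) this] have f'd: "f' \<in> grad_dom (1/2 + \<nu>)" "g = L2 (grad (1/2 + \<nu>) f')" by auto
		have "l2_inner (L2 (bessel_expr \<nu> f')) (L2 f') = l2_inner g g"
			using friedrichs_Green[OF nu refl f'(1) f'd(1) f'd(1)] f'd(2) by simp
		moreover have "L2 (bessel_expr \<nu> f') = (-1) *\<^sub>C u" using f'(3) f(1) L2_scale[OF fs, of "-1"] by simp
		moreover have "L2 f' = u" using f f' by simp
		ultimately have "l2_inner g g = - l2_inner u u" by (simp add: l2_inner_minus_left)
		then have "cpx ((norm g)\<^sup>2 + (norm u)\<^sup>2) = 0" by (simp add: l2_inner_self)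
		then have "(norm g)\<^sup>2 + (norm u)\<^sup>2 = 0" by (simp only: of_real_eq_0_iff)
		then have "g = 0" "u = 0" by (auto simp: add_nonneg_eq_0_iff)
		then have "p = m" using ug by (simp add: zero_prod_def[symmetric])
		then show False using m(1) np by simp
	qed
	then obtain X where "\<forall>n. X n \<in> M" "X \<longlonglongrightarrow> p" unfolding closure_sequential by blast
	then show ?thesis by (intro exI[of _ X]) (auto simp: M_def G_def)
qed

lemma factored_by_core:
	assumes nu: "\<nu> \<ge> 0"
	shows "factored_by (bessel_core \<nu>) (grad_hi \<nu>)"
	unfolding factored_by_def
proof (intro conjI allI impI ballI)
	show "linear_op (bessel_core \<nu>)" by (rule linear_bessel_core)
	show "linear_op (grad_hi \<nu>)" by (rule linear_grad_op)
	show "closed (grad_hi \<nu>)" by (rule closed_grad_op)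
	show "Domain (bessel_core \<nu>) \<subseteq> Domain (grad_hi \<nu>)"
		using bessel_core_subset[OF nu] finite_energy_op_Domain[of \<nu>] by blast
	show "l2_inner y v = l2_inner g k" if "(x, y) \<in> bessel_core \<nu>" "(x, g) \<in> grad_hi \<nu>" "(v, k) \<in> grad_hi \<nu>" for x y g v k
		using finite_energy_op_grad[OF nu _ that(2,3)] that(1) bessel_core_subset[OF nu] by blast
	show "\<exists>X. (\<forall>n. X n \<in> grad_hi \<nu> \<and> fst (X n) \<in> Domain (bessel_core \<nu>)) \<and> X \<longlonglongrightarrow> p" if "p \<in> grad_hi \<nu>" for p
		by (rule bessel_core_grad_dense[OF nu that])
qed

lemma factored_by_extend:
	assumes f: "factored_by T G" and S: "linear_op S" "T \<subseteq> S"
		and SG: "Domain S \<subseteq> Domain G" "\<And>x y g v k. (x, y) \<in> S \<Longrightarrow> (x, g) \<in> G \<Longrightarrow> (v, k) \<in> G \<Longrightarrow> l2_inner y v = l2_inner g k"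
	shows "factored_by S G"
proof -
	have "\<exists>X. (\<forall>n. X n \<in> G \<and> fst (X n) \<in> Domain S) \<and> X \<longlonglongrightarrow> p" if "p \<in> G" for p
		using factored_byD(6)[OF f that] S(2) by blast
	then show ?thesis
		unfolding factored_by_def using factored_byD(2,3)[OF f] S SG by blast
qed

lemma factored_by_finite_energy_op: "\<nu> \<ge> 0 \<Longrightarrow> factored_by (finite_energy_op \<nu>) (grad_hi \<nu>)"
	by (rule factored_by_extend[OF factored_by_core linear_finite_energy_op bessel_core_subset finite_energy_op_Domain finite_energy_op_grad])
		 assumption+

text \<open>
	The core is dense: a vector \<open>w\<close> orthogonal to it satisfies \<open>\<tau> 0 = w\<close> weakly.
\<close>

lemma dense_zero:
	assumes d: "\<And>v. v \<in> Domain (bessel_core \<nu>) \<Longrightarrow> l2_inner u v = 0"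
	shows "u = 0"
proof -
	obtain w where w: "sq_integrable w" "u = L2 w" by (rule L2_cases)
	have "l2_inner (L2 w) v = l2_inner (L2 (\<lambda>x. 0)) \<tau>v" if "(v, \<tau>v) \<in> bessel_core \<nu>" for v \<tau>v
		using d[of v] that w by (auto simp: L2_zero)
	then obtain f' where f': "f' \<in> bessel_max_fun \<nu>" "L2 (\<lambda>x. 0) = L2 f'" "L2 w = L2 (bessel_expr \<nu> f')"
		by (rule bessel_core_orthogonal[OF sq_integrable_zero w(1)]) blast
	have "(0, L2 w) \<in> max_restrict \<nu> UNIV" unfolding max_restrict_def using f' by (auto simp: L2_zero)
	moreover have lin: "linear_op (max_restrict \<nu> UNIV)" by (rule linear_max_restrict) auto
	ultimately show ?thesis using linear_opD(4)[OF lin linear_opD(1)[OF lin]] w by simp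
qed

lemma tendsto_pair_components:
	assumes "X \<longlonglongrightarrow> (u, w)"
	shows "(\<lambda>n. fst (X n)) \<longlonglongrightarrow> u" "(\<lambda>n. snd (X n)) \<longlonglongrightarrow> w"
	using tendsto_fst[OF assms] tendsto_snd[OF assms] by simp_all

text \<open>
	A sequence in the core that converges in the graph norm of \<open>\<tau>\<close> is Cauchy for the form, so \<open>grad\<close>
	converges along it as well.
\<close>

lemma bessel_min_limit:
	assumes nu: "\<nu> \<ge> 0" and uw: "(u, w) \<in> bessel_min \<nu>"
	obtains g where "(u, g) \<in> grad_hi \<nu>" "\<And>v k. (v, k) \<in> grad_hi \<nu> \<Longrightarrow> l2_inner w v = l2_inner g k"
proof -
	note F = factored_by_core[OF nu] note D = factored_byD[OF F]
	obtain X where X: "\<And>n. X n \<in> bessel_core \<nu>" "X \<longlonglongrightarrow> (u, w)"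
		using uw unfolding bessel_min_closure closure_sequential by blast
	define x y where "x n = fst (X n)" and "y n = snd (X n)" for n
	have xy: "(x n, y n) \<in> bessel_core \<nu>" for n using X(1)[of n] by (simp add: x_def y_def)
	have lim: "x \<longlonglongrightarrow> u" "y \<longlonglongrightarrow> w"
		using tendsto_pair_components[OF X(2)] by (simp_all add: x_def[abs_def] y_def[abs_def])
	have "form_convergent (bessel_core \<nu>) x u"
		unfolding form_convergent_def
	proof (intro conjI allI impI lim(1))
		show "x n \<in> Domain (bessel_core \<nu>)" for n using xy by blast
		fix e :: real assume e: "e > 0"
		obtain K where K: "\<And>n. norm (x n) \<le> K" using lim(1) convergent_imp_Bseq[of x] by (auto simp: convergent_def Bseq_def)
		have K0: "K \<ge> 0" using order_trans[OF norm_ge_zero K[of 0]] .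
		have "e / (2 * K + 1) > 0" using e K0 by simp
		from CauchyD[OF LIMSEQ_imp_Cauchy[OF lim(2)] this]
		obtain N where N: "\<And>m n. m \<ge> N \<Longrightarrow> n \<ge> N \<Longrightarrow> norm (y m - y n) < e / (2 * K + 1)" by blast
		show "\<exists>N. \<forall>m\<ge>N. \<forall>n\<ge>N. cmod (l2_inner (op_apply (bessel_core \<nu>) (x m - x n)) (x m - x n)) < e"
		proof (intro exI[of _ N] allI impI)
			fix m n assume mn: "N \<le> m" "N \<le> n"
			have "op_apply (bessel_core \<nu>) (x m - x n) = y m - y n"
				by (rule linear_op_apply[OF D(1) linear_op_diff[OF D(1) xy xy]])
			then have "cmod (l2_inner (op_apply (bessel_core \<nu>) (x m - x n)) (x m - x n)) \<le> norm (y m - y n) * norm (x m - x n)"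
				by (simp add: cmod_l2_inner_le)
			also have "\<dots> \<le> norm (y m - y n) * (2 * K + 1)"
				by (rule mult_left_mono) (use norm_triangle_ineq4[of "x m" "x n"] K[of m] K[of n] in auto)
			also have "\<dots> < e / (2 * K + 1) * (2 * K + 1)"
				by (rule mult_strict_right_mono[OF N[OF mn]]) (use K0 in simp)
			also have "\<dots> = e" using K0 by simp
			finally show "cmod (l2_inner (op_apply (bessel_core \<nu>) (x m - x n)) (x m - x n)) < e" .
		qed
	qed
	then obtain g where g: "(u, g) \<in> grad_hi \<nu>" "(\<lambda>n. op_apply (grad_hi \<nu>) (x n)) \<longlonglongrightarrow> g"
		by (rule factored_by_form_convergent[OF F])
	have "l2_inner w v = l2_inner g k" if vk: "(v, k) \<in> grad_hi \<nu>" for v k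
	proof -
		have "l2_inner (y n) v = l2_inner (op_apply (grad_hi \<nu>) (x n)) k" for n
			by (rule D(5)[OF xy linear_op_apply_mem[OF D(2)] vk]) (use D(4) xy in blast)
		moreover have "(\<lambda>n. l2_inner (y n) v) \<longlonglongrightarrow> l2_inner w v" by (intro tendsto_l2_inner lim tendsto_const)
		moreover have "(\<lambda>n. l2_inner (op_apply (grad_hi \<nu>) (x n)) k) \<longlonglongrightarrow> l2_inner g k"
			by (intro tendsto_l2_inner g(2) tendsto_const)
		ultimately show ?thesis by (simp add: LIMSEQ_unique)
	qed
	with g(1) show ?thesis using that by blast
qed

text \<open>
	The first representation theorem for the form \<open>\<parallel>grad u\<parallel>\<^sup>2\<close>: testing with the core gives \<open>\<tau> u = w\<close> weakly.
\<close>

lemma finite_energy_opI: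
	assumes nu: "\<nu> \<ge> 0" and ug: "(u, g) \<in> grad_hi \<nu>"
		and w: "\<And>v k. (v, k) \<in> grad_hi \<nu> \<Longrightarrow> l2_inner w v = l2_inner g k"
	shows "(u, w) \<in> finite_energy_op \<nu>"
proof -
	obtain f where f: "sq_integrable f" "u = L2 f" by (rule L2_cases)
	obtain h where h: "sq_integrable h" "w = L2 h" by (rule L2_cases)
	note D = factored_byD[OF factored_by_core[OF nu]]
	have o: "l2_inner (L2 h) v = l2_inner (L2 f) \<tau>v" if v: "(v, \<tau>v) \<in> bessel_core \<nu>" for v \<tau>v
	proof -
		obtain k where k: "(v, k) \<in> grad_hi \<nu>" using v D(4) by blast
		have "l2_inner \<tau>v u = l2_inner k g" by (rule D(5)[OF v k ug])
		then have "l2_inner g k = l2_inner u \<tau>v" by (metis l2_inner_commute)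
		then show ?thesis using w[OF k] f h by simp
	qed
	obtain f' where f': "f' \<in> bessel_max_fun \<nu>" "L2 f = L2 f'" "L2 h = L2 (bessel_expr \<nu> f')"
		using bessel_core_orthogonal[OF f(1) h(1) o] by blast
	note D' = bessel_max_funD[OF f'(1)]
	have "f' \<in> grad_dom (1/2 + \<nu>)" by (rule grad_op_memD(1)[OF D'(1,3)]) (use ug f f' in simp)
	then show ?thesis unfolding finite_energy_op_def max_restrict_def using f' f h by blast
qed

lemma bessel_min_subset:
	assumes nu: "\<nu> \<ge> 0" shows "bessel_min \<nu> \<subseteq> finite_energy_op \<nu>"
proof
	fix p assume p: "p \<in> bessel_min \<nu>"
	obtain u w where uw: "p = (u, w)" by (cases p)
	obtain g where "(u, g) \<in> grad_hi \<nu>" "\<And>v k. (v, k) \<in> grad_hi \<nu> \<Longrightarrow> l2_inner w v = l2_inner g k"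
		by (rule bessel_min_limit[OF nu p[unfolded uw]]) blast
	then show "p \<in> finite_energy_op \<nu>" unfolding uw by (rule finite_energy_opI[OF nu])
qed

lemma linear_bessel_min:
	assumes nu: "\<nu> \<ge> 0" shows "linear_op (bessel_min \<nu>)"
	unfolding linear_op_def
proof (intro conjI allI impI)
	note L = linear_bessel_core[of \<nu>]
	show "(0, 0) \<in> bessel_min \<nu>"
		using linear_opD(1)[OF L] closure_subset unfolding bessel_min_closure by blast
	show "y = y'" if "(x, y) \<in> bessel_min \<nu>" "(x, y') \<in> bessel_min \<nu>" for x y y'
		using linear_opD(4)[OF linear_finite_energy_op] bessel_min_subset[OF nu] that by blast
	show "(x + x', y + y') \<in> bessel_min \<nu>" if "(x, y) \<in> bessel_min \<nu>" "(x', y') \<in> bessel_min \<nu>" for x y x' y'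
		using subspace_add[OF closure_subspace[OF linear_op_subspace[OF L]] that[unfolded bessel_min_closure]]
		by (simp add: bessel_min_closure)
	show "(c *\<^sub>C x, c *\<^sub>C y) \<in> bessel_min \<nu>" if "(x, y) \<in> bessel_min \<nu>" for c x y
	proof -
		let ?m = "\<lambda>p. (c *\<^sub>C fst p, c *\<^sub>C snd p)"
		have "bounded_linear ?m"
			by (intro bounded_linear_Pair bounded_linear_compose[OF bounded_linear_l2_scale] bounded_linear_fst bounded_linear_snd)
		then have "?m (x, y) \<in> closure (?m ` bessel_core \<nu>)"
			using closure_bounded_linear_image_subset that unfolding bessel_min_closure by blast
		also have "\<dots> \<subseteq> closure (bessel_core \<nu>)" by (rule closure_mono) (auto intro: linear_opD(3)[OF L])
		finally show ?thesis by (simp add: bessel_min_closure)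
	qed
qed

lemma factored_by_bessel_min:
	assumes nu: "\<nu> \<ge> 0" shows "factored_by (bessel_min \<nu>) (grad_hi \<nu>)"
proof (rule factored_by_extend[OF factored_by_core[OF nu] linear_bessel_min[OF nu]])
	show "bessel_core \<nu> \<subseteq> bessel_min \<nu>" unfolding bessel_min_closure by (rule closure_subset)
	show "Domain (bessel_min \<nu>) \<subseteq> Domain (grad_hi \<nu>)"
		using bessel_min_subset[OF nu] finite_energy_op_Domain[of \<nu>] by blast
	show "l2_inner y v = l2_inner g k" if "(x, y) \<in> bessel_min \<nu>" "(x, g) \<in> grad_hi \<nu>" "(v, k) \<in> grad_hi \<nu>" for x y g v k
		using finite_energy_op_grad[OF nu _ that(2,3)] that(1) bessel_min_subset[OF nu] by blast
qed

lemma friedrichs_eq: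
	assumes nu: "\<nu> \<ge> 0" shows "friedrichs (bessel_min \<nu>) = finite_energy_op \<nu>"
proof (intro set_eqI iffI)
	note F = factored_by_bessel_min[OF nu] note fd = factored_by_form_dom[OF F]
	fix p :: "l2 \<times> l2"
	obtain u w where p: "p = (u, w)" by (cases p)
	{
		assume "p \<in> friedrichs (bessel_min \<nu>)"
		then have u: "u \<in> Domain (grad_hi \<nu>)" and w: "\<And>v. v \<in> Domain (grad_hi \<nu>) \<Longrightarrow> op_form (bessel_min \<nu>) u v = l2_inner w v"
			unfolding p friedrichs_def fd by auto
		obtain g where g: "(u, g) \<in> grad_hi \<nu>" using u by blast
		show "p \<in> finite_energy_op \<nu>"
			unfolding p
		proof (rule finite_energy_opI[OF nu g])
			fix v k assume vk: "(v, k) \<in> grad_hi \<nu>"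
			then have "op_form (bessel_min \<nu>) u v = l2_inner w v" by (intro w) blast
			then show "l2_inner w v = l2_inner g k" using factored_by_op_form[OF F g vk] by simp
		qed
	next
		assume m: "p \<in> finite_energy_op \<nu>"
		then obtain g where g: "(u, g) \<in> grad_hi \<nu>" using finite_energy_op_Domain[of \<nu>] unfolding p by blast
		have "op_form (bessel_min \<nu>) u v = l2_inner w v" if v: "v \<in> Domain (grad_hi \<nu>)" for v
		proof -
			obtain k where vk: "(v, k) \<in> grad_hi \<nu>" using v by blast
			show ?thesis using factored_by_op_form[OF F g vk] finite_energy_op_grad[OF nu m[unfolded p] g vk] by simp
		qed
		then show "p \<in> friedrichs (bessel_min \<nu>)" unfolding p friedrichs_def fd using g by blast
	}
qed

lemma op_adjoint_closure: "op_adjoint (closure T) = op_adjoint T"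
proof (intro set_eqI iffI)
	fix p :: "l2 \<times> l2"
	obtain v w where p: "p = (v, w)" by (cases p)
	{
		assume "p \<in> op_adjoint (closure T)"
		then show "p \<in> op_adjoint T" using closure_subset[of T] unfolding op_adjoint_def by blast
	next
		assume h: "p \<in> op_adjoint T"
		have "l2_inner y v = l2_inner x w" if xy: "(x, y) \<in> closure T" for x y
		proof -
			obtain X where X: "\<And>n. X n \<in> T" "X \<longlonglongrightarrow> (x, y)" using xy unfolding closure_sequential by blast
			have "l2_inner (snd (X n)) v = l2_inner (fst (X n)) w" for n
				using h X(1)[of n] unfolding p op_adjoint_def by (auto simp: split_beta)
			moreover have "(\<lambda>n. l2_inner (snd (X n)) v) \<longlonglongrightarrow> l2_inner y v" "(\<lambda>n. l2_inner (fst (X n)) w) \<longlonglongrightarrow> l2_inner x w"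
				by (intro tendsto_l2_inner tendsto_pair_components[OF X(2)] tendsto_const)+
			ultimately show ?thesis by (simp add: LIMSEQ_unique)
		qed
		then show "p \<in> op_adjoint (closure T)" unfolding p op_adjoint_def by auto
	}
qed

lemma op_adjoint_bessel_min: "op_adjoint (bessel_min \<nu>) = op_adjoint (bessel_core \<nu>)"
	by (simp add: bessel_min_closure op_adjoint_closure)

lemma bessel_adjoint_single_valued:
	assumes "(v, w) \<in> op_adjoint (bessel_min \<nu>)" "(v, w') \<in> op_adjoint (bessel_min \<nu>)"
	shows "w = w'"
proof -
	have "l2_inner (w - w') x = 0" if x: "x \<in> Domain (bessel_core \<nu>)" for x
	proof -
		obtain y where "(x, y) \<in> bessel_core \<nu>" using x by blast
		then have "l2_inner x w = l2_inner x w'"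
			using assms unfolding op_adjoint_bessel_min unfolding op_adjoint_def by fastforce
		then have "l2_inner w x = l2_inner w' x" by (metis l2_inner_commute)
		then show ?thesis by (simp add: l2_inner_diff_left)
	qed
	then have "w - w' = 0" by (rule dense_zero)
	then show ?thesis by simp
qed

lemma finite_energy_op_adjoint:
	assumes nu: "\<nu> \<ge> 0" shows "finite_energy_op \<nu> \<subseteq> op_adjoint (bessel_min \<nu>)"
proof
	fix p assume m: "p \<in> finite_energy_op \<nu>"
	obtain u w where p: "p = (u, w)" by (cases p)
	obtain g where g: "(u, g) \<in> grad_hi \<nu>" using m finite_energy_op_Domain[of \<nu>] unfolding p by blast
	have "l2_inner y u = l2_inner x w" if xy: "(x, y) \<in> bessel_core \<nu>" for x y
	proof -
		have xy': "(x, y) \<in> finite_energy_op \<nu>" using bessel_core_subset[OF nu] xy by blast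
		obtain k where k: "(x, k) \<in> grad_hi \<nu>" using xy' finite_energy_op_Domain[of \<nu>] by blast
		have "l2_inner y u = l2_inner k g" by (rule finite_energy_op_grad[OF nu xy' k g])
		also have "\<dots> = cnj (l2_inner g k)" by (rule l2_inner_commute)
		also have "l2_inner g k = l2_inner w x" by (rule finite_energy_op_grad[OF nu m[unfolded p] g k, symmetric])
		also have "cnj (l2_inner w x) = l2_inner x w" by (rule l2_inner_commute[symmetric])
		finally show ?thesis .
	qed
	then show "p \<in> op_adjoint (bessel_min \<nu>)" unfolding p op_adjoint_bessel_min unfolding op_adjoint_def by auto
qed

lemma finite_energy_op_restrict:
	assumes nu: "\<nu> \<ge> 0"
	shows "finite_energy_op \<nu> = op_restrict (op_adjoint (bessel_min \<nu>)) (Domain (finite_energy_op \<nu>))"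
proof (intro set_eqI iffI)
	fix p assume "p \<in> finite_energy_op \<nu>"
	then show "p \<in> op_restrict (op_adjoint (bessel_min \<nu>)) (Domain (finite_energy_op \<nu>))"
		using finite_energy_op_adjoint[OF nu] unfolding op_restrict_def by (cases p) auto
next
	fix p assume "p \<in> op_restrict (op_adjoint (bessel_min \<nu>)) (Domain (finite_energy_op \<nu>))"
	then obtain u w w' where p: "p = (u, w)" "(u, w) \<in> op_adjoint (bessel_min \<nu>)" "(u, w') \<in> finite_energy_op \<nu>"
		unfolding op_restrict_def by blast
	then have "w = w'" using finite_energy_op_adjoint[OF nu] bessel_adjoint_single_valued by blast
	then show "p \<in> finite_energy_op \<nu>" using p by simp
qed

section \<open>The form domain and Sobolev functions\<close>

lemma integrable_half_line_at_0:
	fixes k :: "real \<Rightarrow> complex"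
	assumes "integrable half_line k"
	shows "k absolutely_integrable_on {0..b}"
proof -
	have 1: "k absolutely_integrable_on {0<..b}"
		by (rule set_integrable_subset[of _ "{0<..}"]) (use assms in \<open>auto simp: integrable_half_line_iff\<close>)
	have "negligible {x \<in> {0<..b} - {0..b}. k x \<noteq> 0}" "negligible {x \<in> {0..b} - {0<..b}. k x \<noteq> 0}"
		by (rule negligible_subset[of "{0}"]; auto)+
	then show ?thesis using 1 absolutely_integrable_spike_set_eq by blast
qed

lemma sq_integrable_at_0:
	assumes z: "sq_integrable z"
	shows "z absolutely_integrable_on {0..b}"
proof -
	define k where "k x = (if x \<in> {0..b} then z x else 0)" for x
	define w where "w x = (if x \<in> {0..b} then 1 else 0 :: complex)" for x
	have wm: "w \<in> borel_measurable half_line"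
		unfolding w_def by (intro measurable_restrict_space1 measurable_If) auto
	have "w absolutely_integrable_on {0..b}"
		by (rule absolutely_integrable_spike[where f="\<lambda>_. 1" and S="{}"]) (auto simp: w_def)
	have wi: "integrable half_line (\<lambda>x. (cmod (w x))\<^sup>2)"
	proof -
		have "integrable half_line (\<lambda>x. indicat_real {0<..b} x)"
		proof (rule integrable_real_indicator)
			show s: "{0<..b} \<in> sets half_line" by (auto simp: sets_restrict_space_iff)
			have "emeasure half_line {0<..b} = emeasure lebesgue {0<..b}" by (rule emeasure_restrict_space) auto
			then show "emeasure half_line {0<..b} < \<infinity>" by (cases "0 \<le> b") auto
		qed
		moreover have eq: "(cmod (w x))\<^sup>2 = indicat_real {0<..b} x" if "x \<in> space half_line" for x
			using that by (auto simp: w_def indicator_def)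
		ultimately show ?thesis by (simp only: Bochner_Integration.integrable_cong[OF refl eq])
	qed
	have w: "sq_integrable w" using wm wi by (simp add: sq_integrable_def)
	have "integrable half_line (\<lambda>x. z x * cnj (w x))" by (rule sq_integrable_mult_cnj[OF z w])
	from integrable_half_line_at_0[OF this, of b] show ?thesis
		by (rule absolutely_integrable_spike[where S="{}"]) (auto simp: w_def)
qed

lemma primitive_limit_at_0_exists:
	assumes q: "primitive q k" and c: "c > 0" and k: "k absolutely_integrable_on {0..c}"
	shows "lim0 q (q c - integral {0..c} k)"
proof -
	have "continuous_on {0..c} (\<lambda>x. integral {x..c} k)"
		by (rule indefinite_integral_continuous_1'[OF set_lebesgue_integral_eq_integral(1)[OF k]])
	then have "((\<lambda>x. integral {x..c} k) \<longlongrightarrow> integral {0..c} k) (at 0 within {0..c})"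
		using c by (auto simp: continuous_on)
	then have "lim0 (\<lambda>x. q c - integral {x..c} k) (q c - integral {0..c} k)"
		using c by (intro tendsto_intros) (simp add: at_within_Icc_at_right)
	then show ?thesis
	proof (rule Lim_transform_eventually)
		show "\<forall>\<^sub>F x in at_right 0. q c - integral {x..c} k = q x"
			unfolding eventually_at_right_field using primitiveD(3)[OF q] c by (intro exI[of _ c]) auto
	qed
qed

lemma loc_abs_continuous_on_closed_half_line:
	assumes f: "primitive f z" and z: "sq_integrable z" and f0: "lim0 f (f 0)"
	shows "loc_abs_continuous_on {0..} f"
	unfolding loc_abs_continuous_on_def
proof (intro allI impI)
	fix a b :: real assume ab: "a \<le> b" "{a..b} \<subseteq> {0..}"
	then have a0: "0 \<le> a" by auto
	have zi: "z absolutely_integrable_on {0..b}" for b by (rule sq_integrable_at_0[OF z])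
	show "abs_continuous_on a b f"
	proof (rule primitive_imp_abs_continuous_on)
		show "z absolutely_integrable_on {a..b}"
			by (rule absolutely_integrable_on_subinterval[OF zi[of b]]) (use a0 in auto)
		fix x y assume xy: "a \<le> x" "x \<le> y" "y \<le> b"
		consider "x > 0" | "x = 0" "y = 0" | "x = 0" "y > 0" using xy a0 by linarith
		then show "(z has_integral f y - f x) {x..y}"
		proof cases
			case 3
			have "f 0 = f y - integral {0..y} z"
				using tendsto_unique[OF _ f0 primitive_limit_at_0_exists[OF f 3(2) zi]] by simp
			then show ?thesis
				using integrable_integral[OF set_lebesgue_integral_eq_integral(1)[OF zi[of y]]] 3 by simp
		qed (use primitiveD(2)[OF f, of x y] xy in auto)
	qed
qed

text \<open>
	The representatives, without prescribed value at \<open>0\<close>, of the elements of \<open>H\<^sub>0\<^sup>1\<close>. The condition on \<open>f/x\<close>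
	replaces \<open>f 0 = 0\<close> and makes the domain of \<open>grad s\<close> independent of \<open>s\<close>.
\<close>

definition hardy_dom :: "(real \<Rightarrow> complex) set"
	where "hardy_dom = {f \<in> grad_dom 0. sq_integrable (\<lambda>x. f x / cpx x)}"

lemma grad_diff: "x > 0 \<Longrightarrow> grad s f x = grad t f x + cpx (t - s) * (f x / cpx x)"
	by (simp add: grad_def algebra_simps diff_divide_distrib)

lemma grad_dom_change:
	assumes f: "f \<in> grad_dom s" and h: "sq_integrable (\<lambda>x. f x / cpx x)"
	shows "f \<in> grad_dom t"
proof -
	note D = grad_domD[OF f]
	have 1: "sq_integrable (\<lambda>x. grad s f x + cpx (s - t) * (f x / cpx x))"
		by (intro sq_integrable_add sq_integrable_scale D h)
	have "sq_integrable (grad t f)"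
		by (rule sq_integrable_cong_AE[OF 1 AE_half_lineI]) (simp add: grad_diff[of _ t f s])
	then show ?thesis using f by (simp add: grad_dom_def)
qed

text \<open>
	Different factors \<open>grad s\<close> differ by multiples of \<open>f/x\<close>.
\<close>

lemma hardy_dom_iff: "f \<in> hardy_dom \<longleftrightarrow> f \<in> grad_dom s \<and> sq_integrable (\<lambda>x. f x / cpx x)"
	using grad_dom_change by (auto simp: hardy_dom_def)

text \<open>
	Hardy's inequality applies without any boundary condition if \<open>s > 1/2\<close>.
\<close>

lemma grad_dom_eq_hardy_dom:
	assumes s: "s > 1/2"
	shows "grad_dom s = hardy_dom"
proof (intro set_eqI iffI)
	fix f assume f: "f \<in> grad_dom s"
	note D = grad_domD[OF f]
	have "sq_integrable (\<lambda>x. f x / cpx x)"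
		by (rule Hardy[OF D(1,2,3)]) (use s in auto)
	with f show "f \<in> hardy_dom" using hardy_dom_iff by blast
qed (use hardy_dom_iff in blast)

lemma tendsto_abs_lower:
	fixes f :: "real \<Rightarrow> complex"
	assumes "lim0 f l" "l \<noteq> 0"
	shows "\<exists>d>0. \<forall>x. 0 < x \<and> x < d \<longrightarrow> cmod l / 2 \<le> cmod (f x)"
proof -
	have "cmod l / 2 > 0" using assms(2) by simp
	from tendstoD[OF assms(1) this] obtain d where d: "d > 0" "\<And>x. 0 < x \<Longrightarrow> x < d \<Longrightarrow> dist (f x) l < cmod l / 2"
		unfolding eventually_at_right_field by auto
	have "cmod l / 2 \<le> cmod (f x)" if x: "0 < x" "x < d" for x
	proof -
		have "cmod l - cmod (f x) \<le> dist (f x) l"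
			using norm_triangle_ineq2[of l "f x"] by (simp add: dist_norm norm_minus_commute)
		then show ?thesis using d(2)[OF x] by simp
	qed
	with d(1) show ?thesis by blast
qed

lemma hardy_dom_limit:
	assumes f: "f \<in> hardy_dom"
	shows "lim0 f 0"
proof -
	have fd: "f \<in> grad_dom 0" and h: "sq_integrable (\<lambda>x. f x / cpx x)" using f by (auto simp: hardy_dom_def)
	note D = grad_domD[OF fd]
	have p: "primitive f (grad 0 f)" using D(3) by simp
	define l where "l = f 1 - integral {0..1} (grad 0 f)"
	have l: "lim0 f l" unfolding l_def by (rule primitive_limit_at_0_exists[OF p zero_less_one sq_integrable_at_0[OF D(2)]])
	have "l = 0"
	proof (rule ccontr)
		assume l0: "l \<noteq> 0"
		obtain d where d: "d > 0" "\<And>x. 0 < x \<Longrightarrow> x < d \<Longrightarrow> cmod l / 2 \<le> cmod (f x)"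
			using tendsto_abs_lower[OF l l0] by blast
		have "\<not> sq_integrable (\<lambda>x. f x / cpx x)"
		proof (rule not_sq_integrable_powr[of "cmod l / 2" d "-1"])
			fix x assume x: "0 < x" "x < d"
			have "cmod l / 2 / x \<le> cmod (f x) / x" by (rule divide_right_mono[OF d(2)[OF x]]) (use x in auto)
			moreover have "x powr (-1) = 1 / x" using x powr_minus_divide[of x 1] by simp
			moreover have "cmod (f x / cpx x) = cmod (f x) / x" using x by (simp add: norm_divide)
			ultimately show "cmod l / 2 * x powr (-1) \<le> cmod (f x / cpx x)" by simp
		qed (use d l0 in auto)
		then show False using h by simp
	qed
	then show ?thesis using l by simp
qed

lemma loc_abs_continuous_on_subset: "loc_abs_continuous_on S f \<Longrightarrow> T \<subseteq> S \<Longrightarrow> loc_abs_continuous_on T f"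
	unfolding loc_abs_continuous_on_def by blast

lemma deriv_on_closed_eq: "x > 0 \<Longrightarrow> deriv_on {0..} f x = deriv_on {0<..} f x"
	by (simp add: deriv_on_at)

lemma loc_abs_continuous_on_limit_0:
	assumes "loc_abs_continuous_on {0..} f"
	shows "lim0 f (f 0)"
proof -
	have "abs_continuous_on 0 1 f" using assms by (auto simp: loc_abs_continuous_on_def)
	then have "continuous_on {0..1} f" by (rule abs_continuous_on_imp_continuous_on)
	then have "(f \<longlongrightarrow> f 0) (at 0 within {0..1})" by (auto simp: continuous_on)
	then show ?thesis by (simp add: at_within_Icc_at_right)
qed

lemma H1_funD:
	assumes f: "f \<in> H1_fun"
	shows "f \<in> grad_dom 0" "lim0 f (f 0)"
		"\<exists>C. \<forall>x>0. cmod (f x - f 0) \<le> C * x powr (1/2)"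
proof -
	have lac: "loc_abs_continuous_on {0..} f" using f by (auto simp: H1_fun_def)
	show l: "lim0 f (f 0)" by (rule loc_abs_continuous_on_limit_0[OF lac])
	have "sq_integrable (deriv_on {0..} f)" using f by (auto simp: H1_fun_def)
	then have g: "sq_integrable (grad 0 f)"
		by (rule sq_integrable_cong_AE[OF _ AE_half_lineI]) (simp add: grad_def deriv_on_closed_eq)
	show fd: "f \<in> grad_dom 0"
	proof -
		have "loc_abs_continuous_on {0<..} f" by (rule loc_abs_continuous_on_subset[OF lac]) auto
		then show ?thesis using f g by (auto simp: grad_dom_def H1_fun_def)
	qed
	note D = grad_domD[OF fd]
	have p: "primitive f (\<lambda>x. pw 0 x * grad 0 f x)"
		by (rule primitive_cong_AE[OF D(3) AE_half_lineI]) simp_all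
	have "2 * 0 + 1 > (0::real)" by simp
	from primitive_limit_at_0[OF p D(2) this] obtain l where l': "lim0 f l"
		"\<And>x. x > 0 \<Longrightarrow> cmod (f x - l) \<le> norm (L2 (grad 0 f)) / sqrt (2 * 0 + 1) * x powr (0 + 1/2)" by blast
	have "l = f 0" using tendsto_unique[OF _ l'(1) l] by simp
	then show "\<exists>C. \<forall>x>0. cmod (f x - f 0) \<le> C * x powr (1/2)" using l'(2) by (intro exI[of _ "norm (L2 (grad 0 f))"]) simp
qed

lemma H1_fun_Hardy:
	assumes f: "f \<in> H1_fun" and f0: "f 0 = 0"
	shows "sq_integrable (\<lambda>x. f x / cpx x)"
proof -
	note D = grad_domD[OF H1_funD(1)[OF f]]
	obtain C where C: "\<And>x. x > 0 \<Longrightarrow> cmod (f x) \<le> C * x powr (1/2)" using H1_funD(3)[OF f] f0 by auto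
	have "(cmod (f x))\<^sup>2 \<le> C\<^sup>2 * x" if "x > 0" for x
	proof -
		have "(cmod (f x))\<^sup>2 \<le> (C * x powr (1/2))\<^sup>2" by (rule power_mono[OF C[OF that]]) simp
		also have "\<dots> = C\<^sup>2 * x" using that by (simp add: power_mult_distrib power2_eq_square powr_add[symmetric])
		finally show ?thesis .
	qed
	then show ?thesis by (intro Hardy[OF D(1,2,3)]) auto
qed

lemma H10_fun_hardy_dom: "f \<in> H10_fun \<Longrightarrow> f \<in> hardy_dom"
	using H1_funD(1) H1_fun_Hardy by (auto simp: H10_fun_def hardy_dom_def)

lemma H1_funI:
	assumes f: "sq_integrable f" and z: "sq_integrable z" and p: "primitive f z" and l: "lim0 f (f 0)"
	shows "f \<in> H1_fun"
proof -
	have "AE x in half_line. z x = deriv_on {0..} f x"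
		using primitive_deriv_on_AE[OF p] AE_space[of half_line] by eventually_elim (simp add: deriv_on_closed_eq)
	then have "sq_integrable (deriv_on {0..} f)" by (rule sq_integrable_cong_AE[OF z])
	then show ?thesis using f loc_abs_continuous_on_closed_half_line[OF p z l] by (simp add: H1_fun_def)
qed

lemma hardy_dom_H10_fun:
	assumes f: "f \<in> hardy_dom"
	shows "(\<lambda>x. if x \<le> 0 then 0 else f x) \<in> H10_fun" "L2 f = L2 (\<lambda>x. if x \<le> 0 then 0 else f x)"
proof -
	define f0 where "f0 x = (if x \<le> 0 then 0 else f x)" for x
	have eq: "f0 x = f x" if "x > 0" for x using that by (simp add: f0_def)
	have fd: "f \<in> grad_dom 0" using f by (auto simp: hardy_dom_def)
	note D = grad_domD[OF fd]
	have fs: "sq_integrable f0" by (rule sq_integrable_cong_AE[OF D(1) AE_half_lineI]) (simp add: eq)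
	have p: "primitive f0 (grad 0 f)" by (rule primitive_cong_AE[OF D(3)]) (auto simp: eq)
	have "lim0 f0 0"
		by (rule Lim_transform_eventually[OF hardy_dom_limit[OF f]])
			 (auto simp: eventually_at_right_field eq intro: exI[of _ 1])
	then have "lim0 f0 (f0 0)" by (simp add: f0_def)
	from H1_funI[OF fs D(2) p this] show "(\<lambda>x. if x \<le> 0 then 0 else f x) \<in> H10_fun"
		by (simp add: H10_fun_def f0_def[abs_def])
	have "AE x in half_line. f x = f0 x" by (rule AE_half_lineI) (simp add: eq)
	then show "L2 f = L2 (\<lambda>x. if x \<le> 0 then 0 else f x)" using L2_eq_iff[OF D(1) fs] by (simp add: f0_def[abs_def])
qed

lemma H10_eq: "H10 = L2 ` hardy_dom"
	unfolding H10_def using H10_fun_hardy_dom hardy_dom_H10_fun by (fastforce simp: image_iff)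

lemma Domain_grad_op: "Domain (grad_op s) = L2 ` grad_dom s"
	by (auto simp: grad_op_def)

lemma form_dom_friedrichs: "\<nu> \<ge> 0 \<Longrightarrow> form_dom (friedrichs (bessel_min \<nu>)) = L2 ` grad_dom (1/2 + \<nu>)"
	by (simp add: friedrichs_eq factored_by_form_dom[OF factored_by_finite_energy_op] Domain_grad_op)

lemma op_form_friedrichs:
	assumes nu: "\<nu> \<ge> 0" and f: "f \<in> grad_dom (1/2 + \<nu>)"
	shows "op_form (friedrichs (bessel_min \<nu>)) (L2 f) (L2 f) = cpx (LINT x|half_line. (cmod (grad (1/2 + \<nu>) f x))\<^sup>2)"
proof -
	have "(L2 f, L2 (grad (1/2 + \<nu>) f)) \<in> grad_hi \<nu>" using f by (auto simp: grad_op_def)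
	then have "op_form (friedrichs (bessel_min \<nu>)) (L2 f) (L2 f) = l2_inner (L2 (grad (1/2 + \<nu>) f)) (L2 (grad (1/2 + \<nu>) f))"
		unfolding friedrichs_eq[OF nu] by (intro factored_by_op_form[OF factored_by_finite_energy_op[OF nu]])
	then show ?thesis by (simp add: l2_inner_self norm_L2_sq grad_domD(2)[OF f])
qed

text \<open>
	\<open>grad s f = f' - s f/x\<close>, and \<open>\<bar>f\<bar>\<^sup>2/x\<close> has the derivative \<open>2 Re (f' cnj f)/x - \<bar>f\<bar>\<^sup>2/x\<^sup>2\<close> and vanishes at \<open>0\<close>,
	so that \<open>2 Re (f', f/x) = \<parallel>f/x\<parallel>\<^sup>2\<close>. The norm of \<open>f' - s f/x\<close> is then expanded in \<open>L\<^sup>2\<close>.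
\<close>

lemma hardy_dom_energy:
	assumes f: "f \<in> hardy_dom"
	shows "integrable half_line (\<lambda>x. (cmod (f x))\<^sup>2 / x\<^sup>2)"
		"(LINT x|half_line. (cmod (grad s f x))\<^sup>2) = (LINT x|half_line. (cmod (grad 0 f x))\<^sup>2) +
			(s\<^sup>2 - s) * (LINT x|half_line. (cmod (f x))\<^sup>2 / x\<^sup>2)"
proof -
	define g h where "g = grad 0 f" and "h x = f x / cpx x" for x
	have h: "sq_integrable h" and fd: "f \<in> grad_dom 0" using f by (auto simp: hardy_dom_def h_def[abs_def])
	note D = grad_domD[OF fd, folded g_def]
	have pg: "primitive f g" using D(3) by simp
	have r: "(cmod (f x))\<^sup>2 / x\<^sup>2 = (cmod (h x))\<^sup>2" for x by (simp add: h_def norm_divide power_divide)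
	show "integrable half_line (\<lambda>x. (cmod (f x))\<^sup>2 / x\<^sup>2)" unfolding r by (rule sq_integrableD(2)[OF h])
	define k where "k x = g x * cnj (h x) + h x * cnj (g x) - h x * cnj (h x)" for x
	have ki: "integrable half_line k"
		unfolding k_def by (intro Bochner_Integration.integrable_diff Bochner_Integration.integrable_add sq_integrable_mult_cnj D h)
	have pq: "primitive (\<lambda>x. f x * cnj (h x)) k"
	proof (rule primitive_cong_AE[OF primitive_mult[OF pg primitive_cnj[OF primitive_mult[OF pg primitive_inverse]]] AE_half_lineI])
		fix x :: real assume "x > 0"
		then show "g x * cnj (f x * cpx (1 / x)) + f x * cnj (g x * cpx (1 / x) + f x * cpx (- 1 / x\<^sup>2)) = k x"
			by (simp add: k_def h_def power2_eq_square algebra_simps)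
	qed (simp add: h_def)
	obtain l where l: "lim0 (\<lambda>x. f x * cnj (h x)) l"
		using primitive_limit_at_0_exists[OF pq zero_less_one integrable_half_line_at_0[OF ki]] by blast
	have "l = 0"
	proof (rule ccontr)
		assume l0: "l \<noteq> 0"
		obtain d where d: "d > 0" "\<And>x. 0 < x \<Longrightarrow> x < d \<Longrightarrow> cmod l / 2 \<le> cmod (f x * cnj (h x))"
			using tendsto_abs_lower[OF l l0] by blast
		have "\<not> sq_integrable h"
		proof (rule not_sq_integrable_powr[of "sqrt (cmod l / 2)" d "-1/2"])
			fix x assume x: "0 < x" "x < d"
			have "cmod (f x * cnj (h x)) = x * (cmod (h x))\<^sup>2" using x by (simp add: h_def norm_mult norm_divide power2_eq_square)
			then have "sqrt (cmod l / 2) \<le> sqrt (x * (cmod (h x))\<^sup>2)" using d(2)[OF x] by simp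
			then have "sqrt (cmod l / 2) / sqrt x \<le> cmod (h x)" using x by (simp add: real_sqrt_mult divide_le_eq mult.commute)
			moreover have "x powr (-1/2) = 1 / sqrt x" using x powr_minus_divide[of x "1/2"] by (simp add: powr_half_sqrt)
			ultimately show "sqrt (cmod l / 2) * x powr (-1/2) \<le> cmod (h x)" by simp
		qed (use d l0 in auto)
		then show False using h by simp
	qed
	define u v where "u = L2 g" and "v = L2 h"
	have "(LINT x|half_line. k x) = l2_inner u v + l2_inner v u - l2_inner v v"
		unfolding k_def u_def v_def l2_inner_L2[OF D(2) h] l2_inner_L2[OF h D(2)] l2_inner_L2[OF h h]
		by (simp add: Bochner_Integration.integral_diff Bochner_Integration.integral_add sq_integrable_mult_cnj D h)
	moreover have "(LINT x|half_line. k x) = 0"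
		using primitive_LINT[OF pq ki sq_integrable_mult_cnj[OF D(1) h] l] \<open>l = 0\<close> by simp
	ultimately have "Re (l2_inner u v + l2_inner v u - l2_inner v v) = 0" by simp
	then have cross: "2 * inner u v = (norm v)\<^sup>2" by (simp add: inner_l2_def[symmetric] inner_commute power2_norm_eq_inner)
	have gs: "sq_integrable (grad s f)" using grad_domD(2)[of f s] f hardy_dom_iff[of f s] by blast
	have "L2 (grad s f) = u - s *\<^sub>R v"
		unfolding u_def v_def scaleR_l2_def L2_scale[OF h] L2_diff[OF D(2) sq_integrable_scale[OF h]]
		by (rule L2_eqI[OF gs]) (use grad_diff[of _ s f 0] in \<open>simp add: g_def h_def\<close>)
	then have "(norm (L2 (grad s f)))\<^sup>2 = (norm u)\<^sup>2 - s * (2 * inner u v) + s\<^sup>2 * (norm v)\<^sup>2"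
		unfolding power2_norm_eq_inner by (simp add: inner_diff_left inner_diff_right inner_commute power2_eq_square)
	then have "(norm (L2 (grad s f)))\<^sup>2 = (norm u)\<^sup>2 + (s\<^sup>2 - s) * (norm v)\<^sup>2" unfolding cross by (simp add: algebra_simps)
	then show "(LINT x|half_line. (cmod (grad s f x))\<^sup>2) = (LINT x|half_line. (cmod (grad 0 f x))\<^sup>2) +
			(s\<^sup>2 - s) * (LINT x|half_line. (cmod (f x))\<^sup>2 / x\<^sup>2)"
		unfolding r u_def v_def norm_L2_sq[OF gs] norm_L2_sq[OF D(2)] norm_L2_sq[OF h]
		by (simp only: g_def)
qed

lemma friedrichs_form_positive_order:
	assumes nu: "0 < \<nu>" "\<nu> < 1"
	shows "form_dom (friedrichs (bessel_min \<nu>)) = H10"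
		"f \<in> H10_fun \<Longrightarrow> integrable half_line (\<lambda>x. (cmod (f x))\<^sup>2 / x\<^sup>2)"
		"f \<in> H10_fun \<Longrightarrow> op_form (friedrichs (bessel_min \<nu>)) (L2 f) (L2 f) = cpx (
						(LINT x|half_line. (cmod (deriv_on {0..} f x))\<^sup>2) +
						(\<nu>\<^sup>2 - 1/4) * (LINT x|half_line. (cmod (f x))\<^sup>2 / x\<^sup>2))"
proof -
	have eq: "grad_dom (1/2 + \<nu>) = hardy_dom" by (rule grad_dom_eq_hardy_dom) (use nu in simp)
	show "form_dom (friedrichs (bessel_min \<nu>)) = H10" using nu by (simp add: form_dom_friedrichs eq H10_eq)
	assume f: "f \<in> H10_fun"
	then have fh: "f \<in> hardy_dom" by (rule H10_fun_hardy_dom)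
	show "integrable half_line (\<lambda>x. (cmod (f x))\<^sup>2 / x\<^sup>2)" by (rule hardy_dom_energy(1)[OF fh])
	have "(1/2 + \<nu>)\<^sup>2 - (1/2 + \<nu>) = \<nu>\<^sup>2 - 1/4" by (simp add: power2_eq_square algebra_simps)
	moreover have "(LINT x|half_line. (cmod (grad 0 f x))\<^sup>2) = (LINT x|half_line. (cmod (deriv_on {0..} f x))\<^sup>2)"
		by (rule Bochner_Integration.integral_cong) (auto simp: grad_def deriv_on_closed_eq)
	ultimately show "op_form (friedrichs (bessel_min \<nu>)) (L2 f) (L2 f) = cpx (
						(LINT x|half_line. (cmod (deriv_on {0..} f x))\<^sup>2) +
						(\<nu>\<^sup>2 - 1/4) * (LINT x|half_line. (cmod (f x))\<^sup>2 / x\<^sup>2))"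
		using op_form_friedrichs[of \<nu> f] hardy_dom_energy(2)[OF fh, of "1/2 + \<nu>"] nu fh eq by simp
qed

lemma friedrichs_form_zero_order:
	assumes u: "u \<in> form_dom (friedrichs (bessel_min 0))"
	shows "\<exists>f. sq_integrable f \<and> u = L2 f \<and> loc_abs_continuous_on {0<..} f \<and>
					integrable half_line (\<lambda>x. (cmod (deriv_on {0<..} f x - f x / cpx (2 * x)))\<^sup>2) \<and>
					op_form (friedrichs (bessel_min 0)) u u = cpx (
						LINT x|half_line. (cmod (deriv_on {0<..} f x - f x / cpx (2 * x)))\<^sup>2)"
proof -
	obtain f where f: "f \<in> grad_dom (1/2)" "u = L2 f" using u by (auto simp: form_dom_friedrichs)
	have g: "grad (1/2) f = (\<lambda>x. deriv_on {0<..} f x - f x / cpx (2 * x))"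
		by (auto simp: grad_def fun_eq_iff)
	show ?thesis
		using f(1) f(2) op_form_friedrichs[of 0 f] sq_integrableD(2)[OF grad_domD(2)[OF f(1)]] unfolding g grad_dom_def
		by (intro exI[of _ f]) (simp add: g)
qed

section \<open>Powers with a cutoff\<close>

locale cutoff =
	fixes \<xi> :: "real \<Rightarrow> complex"
	assumes C1: "\<xi> \<in> C1_0" and one: "\<And>x. 0 < x \<Longrightarrow> x < 1/2 \<Longrightarrow> \<xi> x = 1" and zero: "\<And>x. x \<ge> 3/4 \<Longrightarrow> \<xi> x = 0"
begin

definition \<xi>' :: "real \<Rightarrow> complex" where "\<xi>' = deriv_on {0..} \<xi>"

lemma has_derivative: "x > 0 \<Longrightarrow> (\<xi> has_vector_derivative \<xi>' x) (at x)"
proof -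
	assume x: "x > 0"
	have at: "at x within {0..} = at x" by (rule at_within_interior) (use x in \<open>simp add: interior_real_atLeast\<close>)
	have "\<xi> differentiable (at x within {0..})" using C1 x by (auto simp: C1_0_def differentiable_on_def)
	then have "(\<xi> has_vector_derivative vector_derivative \<xi> (at x within {0..})) (at x within {0..})"
		by (simp add: vector_derivative_works)
	then show ?thesis by (simp add: at \<xi>'_def deriv_on_def)
qed

lemma \<xi>'_continuous: "continuous_on {0..} \<xi>'"
	using C1 by (simp add: C1_0_def \<xi>'_def)

lemma \<xi>'_near_0: "0 < x \<Longrightarrow> x < 1/2 \<Longrightarrow> \<xi>' x = 0"
proof -
	assume x: "0 < x" "x < 1/2"
	have "(\<xi> has_vector_derivative 0) (at x)"
		by (rule has_vector_derivative_transform_within_open[OF has_vector_derivative_const[of 1], of "{0<..<1/2}"])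
			 (use x one in auto)
	then show ?thesis using has_derivative[OF x(1)] vector_derivative_unique_at by blast
qed

lemma \<xi>'_far: "x > 3/4 \<Longrightarrow> \<xi>' x = 0"
proof -
	assume x: "x > 3/4"
	then have "(\<xi> has_vector_derivative 0) (at x)"
		by (intro has_vector_derivative_transform_within_open[OF has_vector_derivative_const[of 0], of "{3/4<..}"])
			 (use zero in auto)
	moreover have "(\<xi> has_vector_derivative \<xi>' x) (at x)" by (rule has_derivative) (use x in simp)
	ultimately show ?thesis using vector_derivative_unique_at by blast
qed

lemma primitive_\<xi>: "primitive \<xi> \<xi>'"
	by (rule primitive_of_has_derivative[OF has_derivative continuous_on_subset[OF \<xi>'_continuous]]) auto

lemma bounded: obtains M where "M \<ge> 0" "\<And>x. x > 0 \<Longrightarrow> cmod (\<xi> x) \<le> M" "\<And>x. x > 0 \<Longrightarrow> cmod (\<xi>' x) \<le> M"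
proof -
	have "continuous_on {0..1} \<xi>"
		using C1 by (auto simp: C1_0_def intro: continuous_on_subset differentiable_imp_continuous_on)
	then have "bounded (\<xi> ` {0..1})" by (intro compact_imp_bounded compact_continuous_image) auto
	then obtain M1 where M1: "\<And>x. x \<in> {0..1} \<Longrightarrow> cmod (\<xi> x) \<le> M1" unfolding bounded_iff by (metis imageI)
	have "continuous_on {0..1} \<xi>'" by (rule continuous_on_subset[OF \<xi>'_continuous]) auto
	then have "bounded (\<xi>' ` {0..1})" by (intro compact_imp_bounded compact_continuous_image) auto
	then obtain M2 where M2: "\<And>x. x \<in> {0..1} \<Longrightarrow> cmod (\<xi>' x) \<le> M2" unfolding bounded_iff by (metis imageI)
	show ?thesis
	proof (rule that[of "max 0 (max M1 M2)"])
		fix x :: real assume "x > 0"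
		show "cmod (\<xi> x) \<le> max 0 (max M1 M2)"
			using M1[of x] zero[of x] \<open>x > 0\<close> by (cases "x \<le> 1") auto
		show "cmod (\<xi>' x) \<le> max 0 (max M1 M2)"
			using M2[of x] \<xi>'_far[of x] \<open>x > 0\<close> by (cases "x \<le> 1") auto
	qed simp
qed

definition powr_cut :: "real \<Rightarrow> real \<Rightarrow> complex"
	where "powr_cut p x = pw p x * \<xi> x"

lemma primitive_powr_cut: "primitive (powr_cut p) (\<lambda>x. pw p x * \<xi>' x + cpx (p / x) * powr_cut p x)"
	using primitive_powr_mult[of \<xi> \<xi>' 0 p] primitive_\<xi> by (simp add: powr_cut_def[abs_def])

lemma \<xi>'_measurable: "\<xi>' \<in> borel_measurable half_line"
	by (rule continuous_on_measurable_half_line[OF continuous_on_subset[OF \<xi>'_continuous]]) auto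

lemma powr_cut_sq_integrable:
	assumes p: "p > -1/2"
	shows "sq_integrable (powr_cut p)" "sq_integrable (\<lambda>x. pw p x * \<xi>' x)"
proof -
	obtain M where M: "M \<ge> 0" "\<And>x. x > 0 \<Longrightarrow> cmod (\<xi> x) \<le> M" "\<And>x. x > 0 \<Longrightarrow> cmod (\<xi>' x) \<le> M" by (rule bounded) blast
	show "sq_integrable (powr_cut p)"
		by (rule sq_integrable_le_weight[OF primitive_measurable[OF primitive_powr_cut] p, where K=M])
			 (use M zero in \<open>auto simp: powr_cut_def norm_mult mult.commute[of M] intro: mult_left_mono\<close>)
	show "sq_integrable (\<lambda>x. pw p x * \<xi>' x)"
	proof (rule sq_integrable_le_weight[OF _ p, where K=M])
		show "(\<lambda>x. pw p x * \<xi>' x) \<in> borel_measurable half_line"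
			by (intro borel_measurable_times \<xi>'_measurable continuous_on_measurable_half_line continuous_on_powr_half_line)
	qed (use M \<xi>'_far in \<open>auto simp: norm_mult mult.commute[of M] intro: mult_left_mono\<close>)
qed

lemma powr_cut_grad_dom:
	assumes p: "p > -1/2"
	shows "powr_cut p \<in> grad_dom p"
	by (rule grad_domI(1)[OF powr_cut_sq_integrable[OF p] primitive_powr_cut])

end

lemma exp_neg_sq_le: "x \<ge> 1 \<Longrightarrow> q \<le> 5 \<Longrightarrow> x powr q * exp (- x\<^sup>2) \<le> 27 / x" for x q :: real
proof -
	assume x: "x \<ge> 1" and q: "q \<le> 5"
	have "(x\<^sup>2 / 3) ^ 3 \<le> (exp (x\<^sup>2 / 3)) ^ 3"
	proof (rule power_mono)
		show "x\<^sup>2 / 3 \<le> exp (x\<^sup>2 / 3)" using exp_ge_add_one_self[of "x\<^sup>2 / 3"] by linarith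
	qed simp
	also have "\<dots> = exp (x\<^sup>2)" by (simp add: exp_of_nat_mult[symmetric])
	finally have e: "x ^ 6 / 27 \<le> exp (x\<^sup>2)" by (simp add: power_divide)
	have "x powr q \<le> x powr 5" by (rule powr_mono[OF q x])
	also have "x powr 5 = x ^ 5" using x powr_realpow[of x 5] by simp
	finally have "x powr q * x \<le> x ^ 5 * x" using x by (intro mult_right_mono) auto
	also have "x ^ 5 * x = x ^ 6" using power_Suc2[of x 5] by simp
	finally have "x powr q * x \<le> x ^ 6" .
	then have "x powr q * x \<le> 27 * exp (x\<^sup>2)" using e by simp
	then have "x powr q * x * exp (- x\<^sup>2) \<le> 27 * exp (x\<^sup>2) * exp (- x\<^sup>2)" by (rule mult_right_mono) simp
	also have "\<dots> = 27" by (simp add: mult.assoc exp_add[symmetric])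
	finally show ?thesis using x by (simp add: field_simps)
qed

text \<open>
	Multiplying powers by a Gaussian factor, unlike multiplying them by \<open>\<xi>\<close>, gives elements of the maximal domain
	without a second derivative of \<open>\<xi>\<close>.
\<close>

definition gauss_powr :: "real \<Rightarrow> real \<Rightarrow> complex"
	where "gauss_powr q x = cpx (x powr q * exp (- x\<^sup>2))"

lemma gauss_powr_continuous: "continuous_on {0<..} (gauss_powr q)"
	unfolding gauss_powr_def by (intro continuous_intros) auto

lemma gauss_powr_sq_integrable:
	assumes q: "-1/2 < q" "q \<le> 5"
	shows "sq_integrable (gauss_powr q)"
proof (rule sq_integrable_le_weight[OF _ q(1), of _ 27])
	show "gauss_powr q \<in> borel_measurable half_line"
		by (rule continuous_on_measurable_half_line[OF gauss_powr_continuous])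
	show "cmod (gauss_powr q x) \<le> 27 / x" if "1 \<le> x" for x
		using exp_neg_sq_le[OF that q(2)] by (simp add: gauss_powr_def abs_mult del: of_real_mult)
	show "cmod (gauss_powr q x) \<le> 27 * x powr q" if "0 < x" "x < 1" for x
	proof -
		have "x powr q * exp (- x\<^sup>2) \<le> x powr q * 1" by (rule mult_left_mono) auto
		also have "\<dots> \<le> 27 * x powr q" by simp
		finally show ?thesis by (simp add: gauss_powr_def abs_mult del: of_real_mult)
	qed
qed

lemma primitive_gauss_powr:
	"primitive (gauss_powr q) (\<lambda>x. cpx q * gauss_powr (q - 1) x + cpx (- 2) * gauss_powr (q + 1) x)"
proof -
	have "primitive (\<lambda>x. cpx (exp (- x\<^sup>2))) (\<lambda>x. cpx (exp (- x\<^sup>2) * (- (2 * x))))"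
	proof (rule primitive_of_real_derivative)
		show "((\<lambda>x. exp (- x\<^sup>2)) has_real_derivative exp (- x\<^sup>2) * (- (2 * x))) (at x)" for x :: real
			by (rule derivative_eq_intros refl | simp)+
		show "continuous_on {0<..} (\<lambda>x::real. exp (- x\<^sup>2) * (- (2 * x)))" by (intro continuous_intros)
	qed
	then have "primitive (\<lambda>x. cpx (exp (- x\<^sup>2)))
			(\<lambda>x. cpx (exp (- x\<^sup>2) * (- (2 * x))) + cpx (0 / x) * cpx (exp (- x\<^sup>2)))"
		by simp
	from primitive_powr_mult[OF this, of q] show ?thesis
	proof (rule primitive_cong_AE[OF _ AE_half_lineI])
		fix x :: real assume x: "x > 0"
		have e: "x powr (q + 1) = x powr q * x" "x powr (q - 1) = x powr q / x" using x by (simp_all add: powr_add powr_diff)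
		show "gauss_powr q x = pw q x * cpx (exp (- x\<^sup>2))" by (simp add: gauss_powr_def)
		show "pw q x * cpx (exp (- x\<^sup>2) * - (2 * x)) +
				 cpx ((0 + q) / x) * (pw q x * cpx (exp (- x\<^sup>2))) =
				 cpx q * gauss_powr (q - 1) x + cpx (- 2) * gauss_powr (q + 1) x"
			unfolding gauss_powr_def e by simp
	qed
qed

lemma gauss_powr_max_fun:
	assumes p: "-1/2 < p" "p < 3/2" and c: "p\<^sup>2 - p = \<nu>\<^sup>2 - 1/4"
	shows "gauss_powr p \<in> bessel_max_fun \<nu>"
		"\<And>x. x > 0 \<Longrightarrow> deriv_on {0<..} (gauss_powr p) x =
			cpx p * gauss_powr (p - 1) x + cpx (- 2) * gauss_powr (p + 1) x"
proof -
	define w where "w x = cpx (4 * p + 2) * gauss_powr p x + cpx (- 4) * gauss_powr (p + 2) x" for x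
	have ws: "sq_integrable w" unfolding w_def
		by (intro sq_integrable_add sq_integrable_scale gauss_powr_sq_integrable) (use p in auto)
	have p3: "primitive (\<lambda>x. cpx p * gauss_powr (p - 1) x + cpx (- 2) * gauss_powr (p + 1) x)
		(\<lambda>x. pot \<nu> x * gauss_powr p x - w x)"
	proof (rule primitive_cong_AE[OF primitive_add[OF primitive_scale[OF primitive_gauss_powr] primitive_scale[OF primitive_gauss_powr]] AE_half_lineI])
		fix x :: real assume x: "x > 0"
		have e: "gauss_powr (p - 1 - 1) x = gauss_powr p x / cpx (x\<^sup>2)"
			using x powr_diff[of x p 2] by (simp add: gauss_powr_def)
		have c': "pot \<nu> x * gauss_powr p x = (cpx p * cpx (p - 1)) * (gauss_powr p x / cpx (x\<^sup>2))"
			unfolding c[symmetric] of_real_mult[symmetric] by (simp add: right_diff_distrib power2_eq_square)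
		show "cpx p * (cpx (p - 1) * gauss_powr (p - 1 - 1) x + cpx (- 2) * gauss_powr (p - 1 + 1) x) +
				 cpx (- 2) * (cpx (p + 1) * gauss_powr (p + 1 - 1) x + cpx (- 2) * gauss_powr (p + 1 + 1) x) =
				 pot \<nu> x * gauss_powr p x - w x"
			unfolding e c' w_def by (simp add: algebra_simps)
	qed simp
	have gs: "sq_integrable (gauss_powr p)" by (rule gauss_powr_sq_integrable) (use p in auto)
	note I = bessel_max_funI[OF gs ws primitive_gauss_powr p3]
	show "gauss_powr p \<in> bessel_max_fun \<nu>" by (rule I)
	show "deriv_on {0<..} (gauss_powr p) x = cpx p * gauss_powr (p - 1) x + cpx (- 2) * gauss_powr (p + 1) x" if "x > 0" for x
		by (rule I(4)[OF that])
qed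

lemma cmod_powr_half: "x > 0 \<Longrightarrow> (C * x powr (1/2))\<^sup>2 = C\<^sup>2 * x" for x C :: real
	by (simp add: power_mult_distrib power2_eq_square powr_add[symmetric])

text \<open>
	\<open>f/x\<close> satisfies an equation of the same kind with \<open>s - 1 < 1/2\<close> in place of \<open>s\<close>, and Hardy's inequality applies
	to it.
\<close>

lemma hardy_quotient:
	assumes f: "sq_integrable f" and g: "sq_integrable (\<lambda>x. g x / cpx x)"
		and p: "primitive f (\<lambda>x. g x + cpx (s / x) * f x)" and s: "s < 3/2"
		and C: "\<And>x. x > 0 \<Longrightarrow> cmod (f x) \<le> C * x powr (3/2)"
	shows "sq_integrable (\<lambda>x. f x / cpx x)" "sq_integrable (\<lambda>x. f x / cpx x / cpx x)"
proof -
	define h where "h x = f x / cpx x" for x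
	have fc: "continuous_on {0<..} f" by (rule primitive_continuous_on[OF p])
	have hm: "h \<in> borel_measurable half_line"
		unfolding h_def by (rule continuous_on_measurable_half_line) (intro continuous_intros fc, auto)
	have hb: "cmod (h x) \<le> C * x powr (1/2)" if "x > 0" for x
	proof -
		have e: "x powr (3/2) = x powr (1/2) * x" using that powr_add[of x "1/2" 1] by simp
		have "cmod (h x) = cmod (f x) / x" using that by (simp add: h_def norm_divide)
		also have "\<dots> \<le> (C * x powr (3/2)) / x" by (rule divide_right_mono[OF C[OF that]]) (use that in simp)
		also have "\<dots> = C * x powr (1/2)" using that by (simp add: e)
		finally show ?thesis .
	qed
	have C0: "C \<ge> 0" using order_trans[OF norm_ge_zero C[of 1]] by simp
	have hs: "sq_integrable h"
	proof (rule sq_integrable_dominated[OF hm])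
		show "sq_integrable (\<lambda>x. cpx C * weight 0 x + cpx (cmod (f x)))"
			using f by (intro sq_integrable_add sq_integrable_scale sq_integrable_weight)
				(auto simp: sq_integrable_def intro: borel_measurable_of_real)
		fix x :: real assume x: "x > 0"
		have w: "cpx C * weight 0 x + cpx (cmod (f x)) = cpx (C * (if x < 1 then 1 else 1 / x) + cmod (f x))"
			using x by (simp add: weight_def)
		have nn: "0 \<le> C * (if x < 1 then 1 else 1 / x)" using C0 x by simp
		show "cmod (h x) \<le> cmod (cpx C * weight 0 x + cpx (cmod (f x)))"
		proof (cases "x < 1")
			case True
			have "C * x powr (1/2) \<le> C * 1" by (rule mult_left_mono) (use True x C0 in \<open>auto intro: powr_le1\<close>)
			then have "cmod (h x) \<le> C" using hb[OF x] by simp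
			also have "C \<le> \<bar>C + cmod (f x)\<bar>" using norm_ge_zero[of "f x"] by linarith
			finally show ?thesis unfolding w norm_of_real using True by simp
		next
			case False
			have "cmod (h x) = cmod (f x) / x" using x by (simp add: h_def norm_divide)
			also have "\<dots> \<le> cmod (f x) / 1" by (rule divide_left_mono) (use False in auto)
			finally show ?thesis unfolding w norm_of_real using nn by simp
		qed
	qed
	have "primitive (\<lambda>x. pw (-1) x * f x) (\<lambda>x. pw (-1) x * g x +
			cpx ((s + -1) / x) * (pw (-1) x * f x))"
		by (rule primitive_powr_mult[OF p])
	then have ph: "primitive h (\<lambda>x. g x / cpx x + cpx ((s - 1) / x) * h x)"
	proof (rule primitive_cong_AE[OF _ AE_half_lineI])
		fix x :: real assume "x > 0"
		then have "x powr (-1) = 1 / x" using powr_minus_divide[of x 1] by simp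
		then show "pw (-1) x * g x + cpx ((s + -1) / x) * (pw (-1) x * f x)
			= g x / cpx x + cpx ((s - 1) / x) * h x" "h x = pw (-1) x * f x"
			by (simp_all add: h_def)
	qed
	have "sq_integrable (\<lambda>x. h x / cpx x)"
	proof (rule Hardy[OF hs g ph])
		have "(cmod (h x))\<^sup>2 \<le> C\<^sup>2 * x" if "x > 0" for x
			using power_mono[OF hb[OF that] norm_ge_zero, of 2] cmod_powr_half[OF that] by simp
		then show "s - 1 > 1/2 \<or> s - 1 < 1/2 \<and> (\<exists>C. \<forall>x. 0 < x \<and> x < 1 \<longrightarrow> (cmod (h x))\<^sup>2 \<le> C * x)" using s by auto
	qed
	then show "sq_integrable (\<lambda>x. f x / cpx x)" "sq_integrable (\<lambda>x. f x / cpx x / cpx x)"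
		using hs by (simp_all add: h_def[abs_def])
qed

section \<open>The domain of the Friedrichs extension\<close>

text \<open>
	Hardy's inequality with exponent \<open>- s\<close>, applied to \<open>grad s f\<close>, shows that \<open>x powr (- s) * f\<close> has a derivative
	of the form \<open>x powr (1 - s)\<close> times a square integrable function; \<open>\<nu> < 1\<close> makes it integrable at \<open>0\<close>.
\<close>

lemma friedrichs_domain_leading_term:
	assumes nu: "0 \<le> \<nu>" "\<nu> < 1" and s: "s = 1/2 + \<nu>" and f: "f \<in> bessel_max_fun \<nu>" "f \<in> grad_dom s"
	shows "sq_integrable (\<lambda>x. grad s f x / cpx x)"
		"\<exists>\<beta> K. \<forall>x>0. cmod (f x - \<beta> * pw s x) \<le> K * x powr (3/2)"
proof -
	have sq: "s\<^sup>2 - s = \<nu>\<^sup>2 - 1/4" "s \<ge> 1/2" using nu by (simp_all add: s power2_eq_square algebra_simps)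
	note Df = grad_domD[OF f(2)]
	obtain C where C: "C \<ge> 0" "\<And>x. x > 0 \<Longrightarrow> cmod (grad s f x) \<le> C * x powr (1/2)"
		using grad_dom_boundary_zero(2)[OF f(1) sq f(2)] by blast
	show q: "sq_integrable (\<lambda>x. grad s f x / cpx x)"
	proof (rule Hardy[OF Df(2) sq_integrable_uminus[OF bessel_max_funD(2)[OF f(1)]] max_fun_grad_primitive[OF f(1) sq(1)]])
		have "(cmod (grad s f x))\<^sup>2 \<le> C\<^sup>2 * x" if "x > 0" for x
			using power_mono[OF C(2)[OF that] norm_ge_zero, of 2] cmod_powr_half[OF that] by simp
		then show "- s > 1/2 \<or> - s < 1/2 \<and> (\<exists>C. \<forall>x. 0 < x \<and> x < 1 \<longrightarrow> (cmod (grad s f x))\<^sup>2 \<le> C * x)" using sq(2) by auto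
	qed
	have "primitive (\<lambda>x. pw (- s) x * f x) (\<lambda>x. pw (- s) x * grad s f x)"
		by (rule primitive_powr_cancel[OF Df(3)])
	then have p: "primitive (\<lambda>x. pw (- s) x * f x) (\<lambda>x. pw (1 - s) x * (grad s f x / cpx x))"
	proof (rule primitive_cong_AE[OF _ AE_half_lineI])
		fix x :: real assume "x > 0"
		then show "pw (- s) x * grad s f x = pw (1 - s) x * (grad s f x / cpx x)"
			by (simp add: powr_diff powr_minus field_simps)
	qed simp
	have "2 * (1 - s) + 1 > 0" using nu s by simp
	from primitive_limit_at_0[OF p q this] obtain l where
		l: "\<And>x. x > 0 \<Longrightarrow> cmod (pw (- s) x * f x - l) \<le>
			norm (L2 (\<lambda>x. grad s f x / cpx x)) / sqrt (2 * (1 - s) + 1) * x powr (1 - s + 1/2)" by blast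
	have e: "1 - s + 1/2 = - s + 3/2" by simp
	have "cmod (f x - pw (- (- s)) x * l) \<le> norm (L2 (\<lambda>x. grad s f x / cpx x)) / sqrt (2 * (1 - s) + 1) * x powr (3/2)"
		if "x > 0" for x
		by (rule cmod_le_of_powr_mult[OF that l[OF that, unfolded e]])
	then have "\<forall>x>0. cmod (f x - l * pw s x) \<le> norm (L2 (\<lambda>x. grad s f x / cpx x)) / sqrt (2 * (1 - s) + 1) * x powr (3/2)"
		by (simp add: mult.commute)
	then show "\<exists>\<beta> K. \<forall>x>0. cmod (f x - \<beta> * pw s x) \<le> K * x powr (3/2)" by blast
qed

text \<open>
	The decay gives \<open>f/x\<^sup>2 \<in> L\<^sup>2\<close>, so that \<open>f''\<close>, the difference of a multiple of \<open>f/x\<^sup>2\<close> and \<open>\<tau> f\<close>, is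
	square integrable.
\<close>

lemma decaying_max_fun_H20:
	assumes nu: "0 \<le> \<nu>" "\<nu> < 1" and s: "s = 1/2 + \<nu>" and f: "f \<in> bessel_max_fun \<nu>" "f \<in> grad_dom s"
		and K: "\<And>x. x > 0 \<Longrightarrow> cmod (f x) \<le> K * x powr (3/2)"
	shows "\<exists>h\<in>H20_fun. \<forall>x>0. h x = f x"
proof -
	have sq: "s\<^sup>2 - s = \<nu>\<^sup>2 - 1/4" "s \<ge> 1/2" using nu by (simp_all add: s power2_eq_square algebra_simps)
	note Df = grad_domD[OF f(2)] and D = bessel_max_funD[OF f(1)]
	define y where "y = deriv_on {0<..} f"
	have quo: "sq_integrable (\<lambda>x. f x / cpx x)" "sq_integrable (\<lambda>x. f x / cpx x / cpx x)"
		using hardy_quotient[OF Df(1) friedrichs_domain_leading_term(1)[OF nu s f] Df(3) _ K] nu s by simp_all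
	have y_eq: "y x = grad s f x + cpx s * (f x / cpx x)" for x
		by (simp add: y_def grad_def)
	have ys: "sq_integrable y"
		unfolding y_eq[abs_def] by (intro sq_integrable_add sq_integrable_scale quo Df)
	define z where "z x = cpx (\<nu>\<^sup>2 - 1/4) * (f x / cpx x / cpx x) - bessel_expr \<nu> f x" for x
	have zs: "sq_integrable z" unfolding z_def by (intro sq_integrable_diff sq_integrable_scale quo D)
	have yz: "primitive y z" using D(4) by (simp add: y_def z_def[abs_def] power2_eq_square)
	have yc: "continuous_on {0<..} y" by (rule primitive_continuous_on[OF yz])
	obtain C where C: "C \<ge> 0" "\<And>x. x > 0 \<Longrightarrow> cmod (grad s f x) \<le> C * x powr (1/2)"
		using grad_dom_boundary_zero(2)[OF f(1) sq f(2)] by blast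
	have y0: "lim0 y 0"
	proof (rule tendsto_zero_powr_bound)
		fix x :: real assume x: "0 < x"
		have e: "x powr (3/2) = x powr (1/2) * x" using x powr_add[of x "1/2" 1] by simp
		have "cmod (y x) \<le> cmod (grad s f x) + cmod (cpx s * (f x / cpx x))"
			unfolding y_eq by (rule norm_triangle_ineq)
		also have "cmod (cpx s * (f x / cpx x)) = s * (cmod (f x) / x)"
			using x sq(2) by (simp add: norm_mult norm_divide)
		also have "cmod (f x) / x \<le> K * x powr (3/2) / x" by (rule divide_right_mono[OF K[OF x]]) (use x in simp)
		also have "\<dots> = K * x powr (1/2)" using x by (simp add: e)
		also have "cmod (grad s f x) \<le> C * x powr (1/2)" by (rule C(2)[OF x])
		finally show "cmod (y x) \<le> (C + s * K) * x powr (1/2)" using sq(2) by (simp add: algebra_simps)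
	qed simp
	\<comment> \<open>The representative that is continuously differentiable up to \<open>0\<close>, where \<open>f\<close> may have any value.\<close>
	define h where "h x = (if x \<le> 0 then 0 else f x)" for x
	have h_pos: "h x = f x" if "x > 0" for x using that by (simp add: h_def)
	have hs: "sq_integrable h" by (rule sq_integrable_cong_AE[OF Df(1) AE_half_lineI]) (simp add: h_pos)
	have hy: "primitive h y" by (rule primitive_cong_AE[OF D(3)]) (auto simp: y_def h_pos)
	have hd: "(h has_vector_derivative y x) (at x within {0..})" if "x > 0" for x
		by (rule has_vector_derivative_at_within[OF primitive_continuous_imp_derivative[OF hy yc that]])
	have at0: "at 0 within {0..} = at_right (0::real)" by (rule at_within_nhd[of _ UNIV]) auto
	have hd0: "(h has_vector_derivative 0) (at 0 within {0..})"
	proof -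
		have "((\<lambda>x. cmod (h x - h 0) / \<bar>x - 0\<bar>) \<longlongrightarrow> 0) (at 0 within {0..})"
		proof -
			show ?thesis unfolding at0
			proof (rule Lim_null_comparison)
				show "\<forall>\<^sub>F x in at_right 0. norm (cmod (h x - h 0) / \<bar>x - 0\<bar>) \<le> cmod (f x / cpx x)"
					unfolding eventually_at_right_field by (intro exI[of _ 1]) (auto simp: h_def norm_divide)
				have "lim0 (\<lambda>x. f x / cpx x) 0"
				proof (rule tendsto_zero_powr_bound)
					fix x :: real assume x: "0 < x"
					have e: "x powr (3/2) = x powr (1/2) * x" using x powr_add[of x "1/2" 1] by simp
					have "cmod (f x / cpx x) \<le> K * x powr (3/2) / x"
						using divide_right_mono[OF K[OF x], of x] x by (simp add: norm_divide)
					also have "\<dots> = K * x powr (1/2)" using x by (simp add: e)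
					finally show "cmod (f x / cpx x) \<le> K * x powr (1/2)" .
				qed simp
				then show "lim0 (\<lambda>x. cmod (f x / cpx x)) 0" by (rule tendsto_norm_zero)
			qed
		qed
		then have "(h has_derivative (\<lambda>x. 0)) (at 0 within {0..})"
			by (simp add: has_derivative_iff_norm)
		then show ?thesis by (simp add: has_vector_derivative_def)
	qed
	define k where "k = deriv_on {0..} h"
	have k_pos: "k x = y x" if "x > 0" for x
		unfolding k_def deriv_on_at(2)[OF that]
		by (rule vector_derivative_at[OF primitive_continuous_imp_derivative[OF hy yc that]])
	have k0: "k 0 = 0"
		unfolding k_def deriv_on_def by (rule vector_derivative_within[OF _ hd0]) (simp add: at0)
	have ks: "sq_integrable k" by (rule sq_integrable_cong_AE[OF ys AE_half_lineI]) (simp add: k_pos)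
	have kz: "primitive k z" by (rule primitive_cong_AE[OF yz]) (auto simp: k_pos)
	have "lim0 k 0"
		by (rule tendsto_cong[THEN iffD1, OF _ y0]) (auto simp: eventually_at_right_field k_pos intro: exI[of _ 1])
	then have k1: "k \<in> H1_fun" by (intro H1_funI[OF ks zs kz]) (simp add: k0)
	have "lim0 h 0"
		by (rule tendsto_zero_powr_bound[of _ K "3/2"]) (use K h_pos in auto)
	then have h1: "h \<in> H1_fun" by (intro H1_funI[OF hs ys hy]) (simp add: h_def)
	have "h differentiable_on {0..}"
		unfolding differentiable_on_def
	proof
		fix x :: real assume "x \<in> {0..}"
		then show "h differentiable at x within {0..}"
			using hd[of x] hd0 by (cases "x = 0") (auto intro: differentiableI_vector)
	qed
	then have "h \<in> H20_fun" using h1 k1 k0 by (simp add: H20_fun_def H2_fun_def k_def h_def)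
	then show ?thesis using h_pos by blast
qed

text \<open>
	Hardy's inequality for \<open>f'\<close> and then for \<open>f/x\<close>, using \<open>f = O(x powr (3/2))\<close>.
\<close>

lemma H20_fun_friedrichs_domain:
	assumes f: "f \<in> H20_fun"
	shows "f \<in> bessel_max_fun \<nu>" "f \<in> grad_dom s" "sq_integrable (\<lambda>x. f x / cpx x / cpx x)"
proof -
	define y where "y = deriv_on {0..} f"
	have f1: "f \<in> H1_fun" "f 0 = 0" and y1: "y \<in> H1_fun" "y 0 = 0"
		using f by (auto simp: H20_fun_def H2_fun_def y_def)
	note Df = H1_funD[OF f1(1)] and Dy = H1_funD[OF y1(1)]
	have fy: "primitive f y"
		by (rule primitive_cong_AE[OF grad_domD(4)[OF Df(1)] AE_half_lineI]) (simp_all add: y_def deriv_on_closed_eq)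
	have fs: "sq_integrable f" by (rule grad_domD(1)[OF Df(1)])
	have yx: "sq_integrable (\<lambda>x. y x / cpx x)" by (rule H1_fun_Hardy[OF y1])
	have "primitive f (\<lambda>x. pw 1 x * (y x / cpx x))"
		by (rule primitive_cong_AE[OF fy AE_half_lineI]) simp_all
	from primitive_limit_at_0[OF this yx] obtain l where l: "lim0 f l"
		"\<And>x. x > 0 \<Longrightarrow> cmod (f x - l) \<le> norm (L2 (\<lambda>x. y x / cpx x)) / sqrt (2 * 1 + 1) * x powr (1 + 1/2)" by auto
	have "l = 0" using tendsto_unique[OF _ l(1) Df(2)] f1(2) by simp
	then have K: "\<And>x. x > 0 \<Longrightarrow> cmod (f x) \<le> norm (L2 (\<lambda>x. y x / cpx x)) / sqrt 3 * x powr (3/2)"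
		using l(2) by simp
	have fy0: "primitive f (\<lambda>x. y x + cpx (0 / x) * f x)" using fy by simp
	show q: "sq_integrable (\<lambda>x. f x / cpx x / cpx x)"
		by (rule hardy_quotient(2)[OF fs yx fy0 _ K]) simp
	define w where "w x = cpx (\<nu>\<^sup>2 - 1/4) * (f x / cpx x / cpx x) - grad 0 y x" for x
	have ws: "sq_integrable w" unfolding w_def by (intro sq_integrable_diff sq_integrable_scale q grad_domD(2)[OF Dy(1)])
	have "primitive y (\<lambda>x. pot \<nu> x * f x - w x)"
		by (rule primitive_cong_AE[OF grad_domD(3)[OF Dy(1)]]) (auto simp: w_def power2_eq_square)
	then show "f \<in> bessel_max_fun \<nu>" by (rule bessel_max_funI(1)[OF fs ws fy])
	have "f \<in> hardy_dom" by (rule H10_fun_hardy_dom) (use f1 in \<open>simp add: H10_fun_def\<close>)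
	then show "f \<in> grad_dom s" by (simp only: hardy_dom_iff[of f s])
qed

lemma Domain_finite_energy_op: "Domain (finite_energy_op \<nu>) = L2 ` (bessel_max_fun \<nu> \<inter> grad_dom (1/2 + \<nu>))"
	by (auto simp: finite_energy_op_def max_restrict_def)

lemma zero_H20: "0 \<in> H20"
proof -
	obtain h where h: "h \<in> H20_fun" "\<And>x. x > 0 \<Longrightarrow> h x = 0"
		using decaying_max_fun_H20[OF order_refl zero_less_one refl max_fun_zero(1) grad_dom_zero, of 0] by auto
	have "L2 (\<lambda>x. 0) = L2 h" by (rule L2_eqI[OF sq_integrable_zero]) (simp add: h)
	then show ?thesis using h(1) by (auto simp: H20_def L2_zero)
qed

context cutoff
begin

lemma powr_cut_max_fun:
	assumes H2: "\<xi> \<in> H2_fun" and p: "p \<ge> 1/2" "p\<^sup>2 - p = \<nu>\<^sup>2 - 1/4"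
	shows "powr_cut p \<in> bessel_max_fun \<nu>"
proof -
	define z where "z = grad 0 \<xi>'"
	have H1: "\<xi>' \<in> H1_fun" using H2 by (simp add: H2_fun_def \<xi>'_def)
	note D = grad_domD[OF H1_funD(1)[OF H1]]
	have pz: "primitive \<xi>' (\<lambda>x. z x + cpx (0 / x) * \<xi>' x)" using D(3) by (simp add: z_def)
	have z0: "z x = 0" if "0 < x" "x < 1/2 \<or> x > 3/4" for x
	proof -
		have "(\<xi>' has_vector_derivative 0) (at x)"
			using that(2)
		proof
			assume "x < 1/2"
			then show ?thesis
				by (intro has_vector_derivative_transform_within_open[OF has_vector_derivative_const[of 0], of "{0<..<1/2}"])
					 (use that(1) \<xi>'_near_0 in auto)
		next
			assume "x > 3/4"
			then show ?thesis
				by (intro has_vector_derivative_transform_within_open[OF has_vector_derivative_const[of 0], of "{3/4<..}"])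
					 (use \<xi>'_far in auto)
		qed
		then show ?thesis using deriv_on_eqI[OF that(1)] by (simp add: z_def grad_def)
	qed
	have zs: "sq_integrable (\<lambda>x. pw p x * z x)"
	proof (rule sq_integrable_dominated[OF _ D(2)])
		show "(\<lambda>x. pw p x * z x) \<in> borel_measurable half_line"
		proof (rule borel_measurable_times)
			show "z \<in> borel_measurable half_line" using D(2) by (simp add: z_def sq_integrable_def)
			show "(\<lambda>x. pw p x) \<in> borel_measurable half_line"
				by (rule continuous_on_measurable_half_line[OF continuous_on_powr_half_line])
		qed
		fix x :: real assume x: "x > 0"
		show "cmod (pw p x * z x) \<le> cmod (grad 0 \<xi>' x)"
		proof (cases "x \<le> 1")
			case True
			have "x powr p * cmod (z x) \<le> 1 * cmod (z x)" by (rule mult_right_mono) (use True x p in \<open>auto intro: powr_le1\<close>)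
			then show ?thesis by (simp add: norm_mult z_def)
		qed (use z0[OF x] in simp)
	qed
	have xs: "sq_integrable (\<lambda>x. pw (p - 1) x * \<xi>' x)"
	proof (rule sq_integrable_dominated[OF _ sq_integrable_scale[OF D(1), of 2]])
		show "(\<lambda>x. pw (p - 1) x * \<xi>' x) \<in> borel_measurable half_line"
			by (intro borel_measurable_times \<xi>'_measurable continuous_on_measurable_half_line continuous_on_powr_half_line)
		fix x :: real assume x: "x > 0"
		show "cmod (pw (p - 1) x * \<xi>' x) \<le> cmod (2 * \<xi>' x)"
		proof (cases "x < 1/2 \<or> x > 3/4")
			case True
			then show ?thesis using \<xi>'_near_0[OF x] \<xi>'_far[of x] by auto
		next
			case False
			have "x powr p \<le> 1" using False x p by (auto intro: powr_le1)
			then have "x powr (p - 1) \<le> 1 / x" using x by (simp add: powr_diff divide_right_mono)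
			also have "1 / x \<le> 2" using False x by (simp add: field_simps)
			finally show ?thesis by (simp add: norm_mult mult_right_mono)
		qed
	qed
	define w where "w x = cpx (- 1) * (pw p x * z x) + cpx (- 2 * p) * (pw (p - 1) x * \<xi>' x)" for x
	have ws: "sq_integrable w" unfolding w_def by (intro sq_integrable_add sq_integrable_scale zs xs)
	have fs: "sq_integrable (powr_cut p)" by (rule powr_cut_sq_integrable(1)) (use p in simp)
	have "primitive (\<lambda>x. pw p x * \<xi>' x + cpx (p / x) * powr_cut p x)
		(\<lambda>x. pot \<nu> x * powr_cut p x - w x)"
	proof (rule primitive_cong_AE[OF primitive_add[OF primitive_powr_mult[OF pz, of p] primitive_scale[OF primitive_powr_cut[of "p - 1"], of "cpx p"]] AE_half_lineI])
		fix x :: real assume x: "x > 0"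
		have e: "x powr (p - 1) = x powr p / x" using x by (simp add: powr_diff)
		show "pw p x * \<xi>' x + cpx (p / x) * powr_cut p x =
			pw p x * \<xi>' x + cpx p * powr_cut (p - 1) x"
			by (simp add: powr_cut_def e)
		have c: "pot \<nu> x * powr_cut p x = cpx p * (cpx ((p - 1) / x) * powr_cut (p - 1) x)"
			unfolding p(2)[symmetric] powr_cut_def e by (simp add: power2_eq_square algebra_simps diff_divide_distrib)
		show "pw p x * z x + cpx ((0 + p) / x) * (pw p x * \<xi>' x) +
				 cpx p * (pw (p - 1) x * \<xi>' x + cpx ((p - 1) / x) * powr_cut (p - 1) x) =
				 pot \<nu> x * powr_cut p x - w x"
			unfolding c w_def e by (simp add: algebra_simps)
	qed
	then show ?thesis by (rule bessel_max_funI(1)[OF fs ws primitive_powr_cut])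
qed

text \<open>
	The multiple of the cut off power is the leading term at \<open>0\<close>. The sum is direct because \<open>x powr (s - 2)\<close> is not
	square integrable at \<open>0\<close> for \<open>\<nu> < 1\<close>, whereas \<open>f/x\<^sup>2\<close> is for \<open>f\<close> in \<open>H\<^sub>0\<^sup>2\<close>.
\<close>

theorem friedrichs_domain:
	assumes H2: "\<xi> \<in> H2_fun" and nu: "0 \<le> \<nu>" "\<nu> < 1"
	shows "is_direct_sum (Domain (friedrichs (bessel_min \<nu>))) H20 (l2.span {L2 (powr_cut (1/2 + \<nu>))})"
proof -
	define s where "s = 1/2 + \<nu>"
	have sq: "s\<^sup>2 - s = \<nu>\<^sup>2 - 1/4" "s \<ge> 1/2" using nu by (simp_all add: s_def power2_eq_square algebra_simps)
	have cm: "powr_cut s \<in> bessel_max_fun \<nu>" by (rule powr_cut_max_fun[OF H2 sq(2,1)])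
	have cg: "powr_cut s \<in> grad_dom s" by (rule powr_cut_grad_dom) (use sq in simp)
	have cs: "sq_integrable (powr_cut s)" by (rule grad_domD(1)[OF cg])
	have dom: "Domain (friedrichs (bessel_min \<nu>)) = L2 ` (bessel_max_fun \<nu> \<inter> grad_dom s)"
		by (simp add: friedrichs_eq[OF nu(1)] Domain_finite_energy_op s_def)
	have H20s: "sq_integrable h" if "h \<in> H20_fun" for h using grad_domD(1)[OF H20_fun_friedrichs_domain(2)[OF that]] .
	have int: "u = 0" if u: "u \<in> H20" "u \<in> range (\<lambda>k. k *\<^sub>C L2 (powr_cut s))" for u
	proof -
		obtain f where f: "f \<in> H20_fun" "u = L2 f" using u(1) by (auto simp: H20_def)
		obtain k where k: "u = k *\<^sub>C L2 (powr_cut s)" using u(2) by auto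
		have ae: "AE x in half_line. f x = k * powr_cut s x"
			using f(2) k unfolding L2_scale[OF cs] by (intro L2_eq_iff[OF H20s[OF f(1)] sq_integrable_scale[OF cs], THEN iffD1]) simp
		have "AE x in half_line. f x / cpx x / cpx x = k * powr_cut s x / cpx x / cpx x"
			using ae by eventually_elim simp
		from sq_integrable_cong_AE[OF H20_fun_friedrichs_domain(3)[OF f(1)] this]
		have q: "sq_integrable (\<lambda>x. k * powr_cut s x / cpx x / cpx x)" .
		have "k = 0"
		proof (rule ccontr)
			assume k0: "k \<noteq> 0"
			have "\<not> sq_integrable (\<lambda>x. k * powr_cut s x / cpx x / cpx x)"
			proof (rule not_sq_integrable_powr[of "cmod k" "1/2" "s - 2"])
				fix x :: real assume x: "0 < x" "x < 1/2"
				have "x powr (s - 2) = x powr s / x / x" using x powr_diff[of x s 2] by (simp add: power2_eq_square)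
				then show "cmod k * x powr (s - 2) \<le> cmod (k * powr_cut s x / cpx x / cpx x)"
					using x one[OF x] by (simp add: powr_cut_def norm_mult norm_divide)
			qed (use k0 nu in \<open>auto simp: s_def\<close>)
			with q show False by simp
		qed
		then show ?thesis using k by simp
	qed
	have "L2 ` (bessel_max_fun \<nu> \<inter> grad_dom s) \<subseteq> sum_space H20 (range (\<lambda>k. k *\<^sub>C L2 (powr_cut s)))"
	proof
		fix u assume "u \<in> L2 ` (bessel_max_fun \<nu> \<inter> grad_dom s)"
		then obtain f where f: "f \<in> bessel_max_fun \<nu>" "f \<in> grad_dom s" "u = L2 f" by auto
		obtain \<beta> K where K: "\<And>x. x > 0 \<Longrightarrow> cmod (f x - \<beta> * pw s x) \<le> K * x powr (3/2)"
			using friedrichs_domain_leading_term(2)[OF nu s_def f(1,2)] by blast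
		define f1 where "f1 x = f x + (- \<beta>) * powr_cut s x" for x
		have f1: "f1 \<in> bessel_max_fun \<nu>" "f1 \<in> grad_dom s"
			unfolding f1_def by (rule max_fun_add(1)[OF f(1) max_fun_scale(1)[OF cm]], rule grad_dom_add(1)[OF f(2) grad_dom_scale(1)[OF cg]])
		obtain M where M: "M \<ge> 0" "\<And>x. x > 0 \<Longrightarrow> cmod (\<xi> x) \<le> M" by (rule bounded) blast
		have "cmod (f1 x) \<le> (K + cmod \<beta> * (2 * (1 + M))) * x powr (3/2)" if x: "x > 0" for x
		proof -
			have "cmod (\<beta> * (pw s x - powr_cut s x)) \<le> cmod \<beta> * (2 * (1 + M)) * x powr (3/2)"
			proof (cases "x < 1/2")
				case True
				then show ?thesis using one[OF x] M by (simp add: powr_cut_def)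
			next
				case False
				have "x powr s = x powr (\<nu> - 1) * x powr (3/2)" by (simp add: powr_add[symmetric] s_def)
				also have "x powr (\<nu> - 1) \<le> 2"
				proof -
					have "x powr (\<nu> - 1) \<le> (1/2) powr (\<nu> - 1)" by (rule powr_mono2') (use False nu in auto)
					also have "(1/2::real) powr (\<nu> - 1) = 2 powr (1 - \<nu>)"
						using powr_minus_divide[of "2::real" "\<nu> - 1"] by (simp add: powr_divide)
					also have "\<dots> \<le> 2 powr 1" by (rule powr_mono) (use nu in auto)
					finally show ?thesis by simp
				qed
				finally have xs: "x powr s \<le> 2 * x powr (3/2)" by (simp add: mult_right_mono)
				have "pw s x - powr_cut s x = pw s x * (1 - \<xi> x)"
					by (simp add: powr_cut_def algebra_simps)
				then have "cmod (pw s x - powr_cut s x) = x powr s * cmod (1 - \<xi> x)" by (simp add: norm_mult)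
				also have "\<dots> \<le> (2 * x powr (3/2)) * (1 + M)"
				proof (rule mult_mono[OF xs])
					show "cmod (1 - \<xi> x) \<le> 1 + M" using norm_triangle_ineq4[of 1 "\<xi> x"] M(2)[OF x] by simp
				qed auto
				finally have "cmod \<beta> * cmod (pw s x - powr_cut s x) \<le> cmod \<beta> * ((2 * x powr (3/2)) * (1 + M))"
					by (rule mult_left_mono) simp
				then show ?thesis unfolding norm_mult by (simp only: mult_ac)
			qed
			moreover have "f1 x = (f x - \<beta> * pw s x) + \<beta> * (pw s x - powr_cut s x)"
				by (simp add: f1_def algebra_simps)
			ultimately have "cmod (f1 x) \<le> K * x powr (3/2) + cmod \<beta> * (2 * (1 + M)) * x powr (3/2)"
				using norm_triangle_le[OF add_mono[OF K[OF x]]] by metis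
			then show ?thesis by (simp add: distrib_right)
		qed
		from decaying_max_fun_H20[OF nu s_def f1 this] obtain h where h: "h \<in> H20_fun" "\<And>x. x > 0 \<Longrightarrow> h x = f1 x" by blast
		have "u = L2 (\<lambda>x. h x + \<beta> * powr_cut s x)"
			unfolding f(3) by (rule L2_eqI[OF grad_domD(1)[OF f(2)]]) (simp add: h f1_def)
		also have "\<dots> = L2 h + \<beta> *\<^sub>C L2 (powr_cut s)"
			by (simp add: L2_scale[OF cs] L2_add[OF H20s[OF h(1)] sq_integrable_scale[OF cs]])
		finally show "u \<in> sum_space H20 (range (\<lambda>k. k *\<^sub>C L2 (powr_cut s)))"
			using h(1) by (auto simp: sum_space_def H20_def)
	qed
	moreover have "sum_space H20 (range (\<lambda>k. k *\<^sub>C L2 (powr_cut s))) \<subseteq> L2 ` (bessel_max_fun \<nu> \<inter> grad_dom s)"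
	proof
		fix u assume "u \<in> sum_space H20 (range (\<lambda>k. k *\<^sub>C L2 (powr_cut s)))"
		then obtain h k where h: "h \<in> H20_fun" and u: "u = L2 h + k *\<^sub>C L2 (powr_cut s)" by (auto simp: sum_space_def H20_def)
		have "u = L2 (\<lambda>x. h x + k * powr_cut s x)"
			unfolding u by (simp add: L2_scale[OF cs] L2_add[OF H20s[OF h(1)] sq_integrable_scale[OF cs]])
		moreover have "(\<lambda>x. h x + k * powr_cut s x) \<in> bessel_max_fun \<nu>"
			by (rule max_fun_add(1)[OF H20_fun_friedrichs_domain(1)[OF h] max_fun_scale(1)[OF cm]])
		moreover have "(\<lambda>x. h x + k * powr_cut s x) \<in> grad_dom s"
			by (rule grad_dom_add(1)[OF H20_fun_friedrichs_domain(2)[OF h] grad_dom_scale(1)[OF cg]])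
		ultimately show "u \<in> L2 ` (bessel_max_fun \<nu> \<inter> grad_dom s)" by blast
	qed
	moreover have "0 \<in> range (\<lambda>k. k *\<^sub>C L2 (powr_cut s))" by (intro range_eqI[of _ _ 0]) simp
	ultimately show ?thesis
		unfolding is_direct_sum_def dom l2.span_singleton s_def[symmetric] using int zero_H20 by blast
qed

end

section \<open>Form domains of the other self-adjoint extensions\<close>

text \<open>
	The boundary value \<open>a\<close> of \<open>f\<close>: the coefficient of \<open>x powr \<sigma>\<close> in its expansion at \<open>0\<close>.
\<close>

lemma grad_dom_trace:
	assumes f: "f \<in> grad_dom \<sigma>" and s: "\<sigma> < 1/2"
	shows "\<exists>a. lim0 (\<lambda>x. pw (- \<sigma>) x * f x) a \<and>
		(\<forall>x>0. cmod (pw (- \<sigma>) x * f x - a) \<le> norm (L2 (grad \<sigma> f)) / sqrt (1 - 2 * \<sigma>) * x powr (1/2 - \<sigma>))"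
proof -
	note D = grad_domD[OF f]
	have "2 * (- \<sigma>) + 1 > 0" using s by simp
	from primitive_limit_at_0[OF primitive_powr_cancel[OF D(3)] D(2) this] obtain l where
		l: "lim0 (\<lambda>x. pw (- \<sigma>) x * f x) l"
		"\<And>x. x > 0 \<Longrightarrow> cmod (pw (- \<sigma>) x * f x - l) \<le>
			norm (L2 (grad \<sigma> f)) / sqrt (2 * (- \<sigma>) + 1) * x powr (- \<sigma> + 1/2)" by blast
	have e: "2 * (- \<sigma>) + 1 = 1 - 2 * \<sigma>" "- \<sigma> + 1/2 = 1/2 - \<sigma>" by auto
	show ?thesis using l unfolding e by blast
qed

lemma grad_dom_trace_bound:
	assumes f: "f \<in> grad_dom \<sigma>" and s: "\<sigma> < 1/2"
		and a: "lim0 (\<lambda>x. pw (- \<sigma>) x * f x) a" and x: "x > 0"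
	shows "cmod (pw (- \<sigma>) x * f x - a) \<le> norm (L2 (grad \<sigma> f)) / sqrt (1 - 2 * \<sigma>) * x powr (1/2 - \<sigma>)"
	using grad_dom_trace[OF f s] tendsto_unique[OF _ _ a] x by (metis trivial_limit_at_right_real)

text \<open>
	At distance \<open>x\<close> from \<open>0\<close> the boundary value differs from \<open>x powr (- \<sigma>) * f x\<close> by at most the energy times
	\<open>x powr (1/2 - \<sigma>)\<close>. Averaging over \<open>[\<delta>/2, \<delta>]\<close> with small \<open>\<delta>\<close> makes the energy term small.
\<close>

lemma trace_le_energy:
	assumes s: "\<sigma> < 1/2" and e: "\<epsilon> > 0"
	shows "\<exists>C\<ge>0. \<forall>f a. f \<in> grad_dom \<sigma> \<longrightarrow> lim0 (\<lambda>x. pw (- \<sigma>) x * f x) a \<longrightarrow>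
		(cmod a)\<^sup>2 \<le> \<epsilon> * (norm (L2 (grad \<sigma> f)))\<^sup>2 + C * (norm (L2 f))\<^sup>2"
proof -
	define k where "k = 1 - 2 * \<sigma>"
	have k: "k > 0" using s by (simp add: k_def)
	\<comment> \<open>Chosen so that the energy enters with the factor \<open>(2 / k) \<delta> powr k = \<epsilon>\<close>.\<close>
	define \<delta> where "\<delta> = (\<epsilon> * k / 2) powr (1 / k)"
	have d: "\<delta> > 0" using e k by (simp add: \<delta>_def)
	have dk: "2 / k * \<delta> powr k = \<epsilon>" using e k by (simp add: \<delta>_def powr_powr)
	define M where "M = (\<delta>/2) powr (- 2 * \<sigma>) + \<delta> powr (- 2 * \<sigma>)"
	have M: "M \<ge> 0" by (simp add: M_def)
	have xM: "x powr (- 2 * \<sigma>) \<le> M" if "x \<in> {\<delta>/2..\<delta>}" for x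
	proof (cases "\<sigma> \<ge> 0")
		case True
		have "x powr (- 2 * \<sigma>) \<le> (\<delta>/2) powr (- 2 * \<sigma>)" by (rule powr_mono2') (use that True d in auto)
		then show ?thesis by (simp add: M_def add_increasing2)
	next
		case False
		have "x powr (- 2 * \<sigma>) \<le> \<delta> powr (- 2 * \<sigma>)" by (rule powr_mono2) (use that False d in auto)
		then show ?thesis by (simp add: M_def add_increasing)
	qed
	have main: "(cmod a)\<^sup>2 \<le> \<epsilon> * (norm (L2 (grad \<sigma> f)))\<^sup>2 + 4 * M / \<delta> * (norm (L2 f))\<^sup>2"
		if f: "f \<in> grad_dom \<sigma>" and a: "lim0 (\<lambda>x. pw (- \<sigma>) x * f x) a" for f a
	proof -
		note D = grad_domD[OF f]
		define N where "N = (norm (L2 (grad \<sigma> f)))\<^sup>2"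
		have fi: "(\<lambda>x. (cmod (f x))\<^sup>2) integrable_on {\<delta>/2..\<delta>}"
			by (rule integrable_half_line_subinterval(2)[OF sq_integrableD(2)[OF D(1)]]) (use d in simp)
		have pw: "(cmod a)\<^sup>2 \<le> 2 * M * (cmod (f x))\<^sup>2 + \<epsilon> * N" if x: "x \<in> {\<delta>/2..\<delta>}" for x
		proof -
			have x0: "x > 0" using x d by simp
			have "(cmod a)\<^sup>2 = (cmod (pw (- \<sigma>) x * f x + - (pw (- \<sigma>) x * f x - a)))\<^sup>2" by simp
			also have "\<dots> \<le> 2 * (cmod (pw (- \<sigma>) x * f x))\<^sup>2 + 2 * (cmod (- (pw (- \<sigma>) x * f x - a)))\<^sup>2"
				by (rule cmod_sq_add_le)
			also have "(cmod (pw (- \<sigma>) x * f x))\<^sup>2 = x powr (- 2 * \<sigma>) * (cmod (f x))\<^sup>2"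
				by (simp add: norm_mult power_mult_distrib power2_eq_square powr_add[symmetric])
			also have "\<dots> \<le> M * (cmod (f x))\<^sup>2" by (rule mult_right_mono[OF xM[OF x]]) simp
			also have "(cmod (- (pw (- \<sigma>) x * f x - a)))\<^sup>2 \<le> (norm (L2 (grad \<sigma> f)) / sqrt (1 - 2 * \<sigma>) * x powr (1/2 - \<sigma>))\<^sup>2"
				unfolding norm_minus_cancel by (rule power_mono[OF grad_dom_trace_bound[OF f s a x0]]) simp
			also have "\<dots> = N / k * x powr k"
				using k by (simp add: N_def k_def power_mult_distrib power_divide power2_eq_square[of "x powr _"] powr_add[symmetric])
			also have "\<dots> \<le> N / k * \<delta> powr k"
				by (intro mult_left_mono powr_mono2) (use x x0 k in \<open>auto simp: N_def\<close>)
			finally have "(cmod a)\<^sup>2 \<le> 2 * (M * (cmod (f x))\<^sup>2) + 2 * (N / k * \<delta> powr k)" by simp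
			also have "2 * (N / k * \<delta> powr k) = \<epsilon> * N" unfolding dk[symmetric] by simp
			finally show ?thesis by simp
		qed
		have "\<delta> / 2 * (cmod a)\<^sup>2 = integral {\<delta>/2..\<delta>} (\<lambda>x. (cmod a)\<^sup>2)" using d by simp
		also have "\<dots> \<le> integral {\<delta>/2..\<delta>} (\<lambda>x. 2 * M * (cmod (f x))\<^sup>2 + \<epsilon> * N)"
		proof (rule integral_le[OF _ _ pw])
			show "(\<lambda>x. 2 * M * (cmod (f x))\<^sup>2 + \<epsilon> * N) integrable_on {\<delta>/2..\<delta>}"
				by (intro integrable_add integrable_on_mult_right fi) auto
		qed auto
		also have "\<dots> = 2 * M * integral {\<delta>/2..\<delta>} (\<lambda>x. (cmod (f x))\<^sup>2) + \<epsilon> * N * (\<delta> / 2)"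
		proof -
			have "integral {\<delta>/2..\<delta>} (\<lambda>x. 2 * M * (cmod (f x))\<^sup>2 + \<epsilon> * N) =
					integral {\<delta>/2..\<delta>} (\<lambda>x. 2 * M * (cmod (f x))\<^sup>2) + integral {\<delta>/2..\<delta>} (\<lambda>x. \<epsilon> * N)"
				by (rule Henstock_Kurzweil_Integration.integral_add) (intro integrable_on_mult_right fi, auto)
			then show ?thesis using d by simp
		qed
		also have "integral {\<delta>/2..\<delta>} (\<lambda>x. (cmod (f x))\<^sup>2) \<le> (norm (L2 f))\<^sup>2"
			by (rule integral_sq_le[OF D(1)]) (use d in simp)
		finally have "\<delta> / 2 * (cmod a)\<^sup>2 \<le> 2 * M * (norm (L2 f))\<^sup>2 + \<epsilon> * N * (\<delta> / 2)" using M by (simp add: mult_left_mono)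
		then show ?thesis using d by (simp add: N_def field_simps)
	qed
	show ?thesis by (intro exI[of _ "4 * M / \<delta>"] conjI allI impI main) (use M d in auto)
qed

text \<open>
	Without boundary value, \<open>f = O(x powr (1/2))\<close> and Hardy's inequality applies for \<open>\<sigma> < 1/2\<close>. With a nonzero one,
	\<open>f/x\<close> grows like \<open>x powr (\<sigma> - 1)\<close>.
\<close>

lemma hardy_dom_iff_trace:
	assumes f: "f \<in> grad_dom \<sigma>" and s: "\<sigma> < 1/2"
		and a: "lim0 (\<lambda>x. pw (- \<sigma>) x * f x) a"
	shows "f \<in> hardy_dom \<longleftrightarrow> a = 0"
proof
	note D = grad_domD[OF f]
	assume a0: "a = 0"
	define K where "K = norm (L2 (grad \<sigma> f)) / sqrt (1 - 2 * \<sigma>)"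
	have "(cmod (f x))\<^sup>2 \<le> K\<^sup>2 * x" if x: "x > 0" for x
	proof -
		have e: "1/2 - \<sigma> = - \<sigma> + 1/2" by simp
		have "cmod (f x - pw (- (- \<sigma>)) x * 0) \<le> K * x powr (1/2)"
			by (rule cmod_le_of_powr_mult[OF x]) (use grad_dom_trace_bound[OF f s a x] in \<open>simp add: a0 K_def\<close>)
		then show ?thesis using power_mono[of "cmod (f x)" "K * x powr (1/2)" 2] cmod_powr_half[OF x] by simp
	qed
	then have "sq_integrable (\<lambda>x. f x / cpx x)"
		by (intro Hardy[OF D(1,2,3)]) (use s in auto)
	then show "f \<in> hardy_dom" using f hardy_dom_iff[of f \<sigma>] by blast
next
	assume h: "f \<in> hardy_dom"
	show "a = 0"
	proof (rule ccontr)
		assume a0: "a \<noteq> 0"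
		obtain d where d: "d > 0" "\<And>x. 0 < x \<Longrightarrow> x < d \<Longrightarrow> cmod a / 2 \<le> cmod (pw (- \<sigma>) x * f x)"
			using tendsto_abs_lower[OF a a0] by blast
		have "\<not> sq_integrable (\<lambda>x. f x / cpx x)"
		proof (rule not_sq_integrable_powr[of "cmod a / 2" d "\<sigma> - 1"])
			fix x :: real assume x: "0 < x" "x < d"
			have "x powr (\<sigma> - 1) = x powr \<sigma> / x" using x powr_diff[of x \<sigma> 1] by simp
			then have "cmod a / 2 * x powr (\<sigma> - 1) = x powr \<sigma> * (cmod a / 2) / x" by simp
			also have "\<dots> \<le> x powr \<sigma> * cmod (pw (- \<sigma>) x * f x) / x"
				by (intro divide_right_mono mult_left_mono d(2) x) (use x in auto)
			also have "\<dots> = cmod (f x / cpx x)" using x by (simp add: norm_mult norm_divide powr_minus field_simps)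
			finally show "cmod a / 2 * x powr (\<sigma> - 1) \<le> cmod (f x / cpx x)" .
		qed (use a0 d s in auto)
		then show False using h by (simp add: hardy_dom_def)
	qed
qed

text \<open>
	The boundary term in Green's formula disappears against functions that vanish near \<open>0\<close>.
\<close>

lemma max_fun_in_adjoint:
	assumes nu: "0 < \<nu>" "\<nu> < 1" and f: "f \<in> bessel_max_fun \<nu>"
	shows "f \<in> grad_dom (1/2 - \<nu>)" "(L2 f, L2 (bessel_expr \<nu> f)) \<in> op_adjoint (bessel_min \<nu>)"
proof -
	define s where "s = 1/2 - \<nu>"
	have s: "s\<^sup>2 - s = \<nu>\<^sup>2 - 1/4" "s > -1/2" "s < 1/2" using nu by (auto simp: s_def power2_eq_square algebra_simps)
	obtain l where l: "lim0 (\<lambda>x. pw s x * grad s f x) l"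
		using max_fun_boundary_limit[OF f s(1,2)] by blast
	have fg: "f \<in> grad_dom s" by (rule max_fun_in_grad_dom[OF f s(1,2) l]) (use s in simp)
	then show "f \<in> grad_dom (1/2 - \<nu>)" by (simp add: s_def)
	have "l2_inner (L2 (bessel_expr \<nu> v)) (L2 f) = l2_inner (L2 v) (L2 (bessel_expr \<nu> f))"
		if v: "v \<in> bessel_max_fun \<nu>" "v \<in> compact_funs" for v
	proof -
		obtain a where a: "a > 0" "\<And>x. 0 < x \<Longrightarrow> x < a \<Longrightarrow> v x = 0 \<and> deriv_on {0<..} v x = 0"
			by (rule compact_fun_zero_near_0[OF v(2)]) blast
		have vg: "v \<in> grad_dom s" by (rule compact_fun_grad_dom[OF v s(1,2)])
		have "l2_inner (L2 (bessel_expr \<nu> f)) (L2 v) = l2_inner (L2 (grad s f)) (L2 (grad s v)) + 0"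
			by (rule Green_formula[OF f s(1) fg vg], rule tendsto_zero_near_0[OF a(1)]) (simp add: a(2))
		moreover have "l2_inner (L2 (bessel_expr \<nu> v)) (L2 f) = l2_inner (L2 (grad s v)) (L2 (grad s f))"
			by (rule compact_fun_Green[OF v s(1,2) fg])
		ultimately show ?thesis
			using l2_inner_commute[of "L2 v" "L2 (bessel_expr \<nu> f)"] l2_inner_commute[of "L2 (grad s v)" "L2 (grad s f)"] by simp
	qed
	then show "(L2 f, L2 (bessel_expr \<nu> f)) \<in> op_adjoint (bessel_min \<nu>)"
		unfolding op_adjoint_bessel_min by (auto simp: op_adjoint_def bessel_core_def max_restrict_def)
qed

definition boundary_funs :: "real \<Rightarrow> real option \<Rightarrow> (real \<Rightarrow> complex) set"
	where "boundary_funs \<nu> h = {f. lim0 (\<lambda>x. lagrange_bracket f (boundary_fun \<nu> h) x) 0}"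

lemma bessel_ext_eq:
	assumes nu: "0 < \<nu>" "\<nu> < 1"
	shows "bessel_ext \<nu> h = max_restrict \<nu> (boundary_funs \<nu> h)"
proof
	show "max_restrict \<nu> (boundary_funs \<nu> h) \<subseteq> bessel_ext \<nu> h"
		using max_fun_in_adjoint(2)[OF nu] by (auto simp: max_restrict_def boundary_funs_def bessel_ext_def op_restrict_def)
	show "bessel_ext \<nu> h \<subseteq> max_restrict \<nu> (boundary_funs \<nu> h)"
	proof
		fix p assume "p \<in> bessel_ext \<nu> h"
		then obtain f w where p: "p = (L2 f, w)" "(L2 f, w) \<in> op_adjoint (bessel_min \<nu>)" "f \<in> bessel_max_fun \<nu>" "f \<in> boundary_funs \<nu> h"
			by (auto simp: boundary_funs_def bessel_ext_def op_restrict_def)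
		have "w = L2 (bessel_expr \<nu> f)" by (rule bessel_adjoint_single_valued[OF p(2) max_fun_in_adjoint(2)[OF nu p(3)]])
		then show "p \<in> max_restrict \<nu> (boundary_funs \<nu> h)" using p by (auto simp: max_restrict_def)
	qed
qed

lemma lagrange_bracket_of_real:
	assumes x: "x > 0" and b: "(b has_real_derivative d) (at x)" and g: "g = (\<lambda>x. cpx (b x))"
	shows "lagrange_bracket f g x = f x * cpx d - deriv_on {0<..} f x * cpx (b x)"
proof -
	have "(g has_vector_derivative cpx d) (at x)"
		unfolding g by (rule has_vector_derivative_of_real[OF b])
	then have "deriv_on {0<..} g x = cpx d" by (rule deriv_on_eqI[OF x])
	then show ?thesis by (simp add: lagrange_bracket_def g)
qed

text \<open>
	Each power in the boundary function pairs with \<open>f\<close> through the factor \<open>grad\<close> that annihilates it.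
\<close>

lemma lagrange_bracket_Some:
	assumes x: "x > 0"
	shows "lagrange_bracket f (boundary_fun \<nu> (Some r)) x =
		- (pw (1/2 - \<nu>) x * grad (1/2 - \<nu>) f x)
		- cpx (2 * \<nu> * r) * (pw (1/2 + \<nu>) x * grad (1/2 + \<nu>) f x)"
proof -
	define s t where "s = 1/2 - \<nu>" and "t = 1/2 + \<nu>"
	have d: "((\<lambda>x. x powr s + 2 * \<nu> * r * x powr t) has_real_derivative
			(s * x powr (s - 1) + 2 * \<nu> * r * (t * x powr (t - 1)))) (at x)"
		using x by (intro DERIV_add DERIV_cmult has_real_derivative_powr)
	have e: "x powr (s - 1) = x powr s / x" "x powr (t - 1) = x powr t / x" using x by (simp_all add: powr_diff)
	have "lagrange_bracket f (boundary_fun \<nu> (Some r)) x =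
			f x * cpx (s * (x powr s / x) + 2 * \<nu> * r * (t * (x powr t / x))) - deriv_on {0<..} f x * cpx (x powr s + 2 * \<nu> * r * x powr t)"
		by (rule lagrange_bracket_of_real[OF x d[unfolded e]]) (simp add: boundary_fun_def[abs_def] s_def t_def)
	also have "\<dots> = - (pw s x * grad s f x) - cpx (2 * \<nu> * r) * (pw t x * grad t f x)"
		by (simp add: grad_def algebra_simps)
	finally show ?thesis by (simp only: s_def t_def)
qed

lemma lagrange_bracket_None:
	assumes x: "x > 0"
	shows "lagrange_bracket f (boundary_fun \<nu> None) x = - (pw (1/2 + \<nu>) x * grad (1/2 + \<nu>) f x)"
proof -
	define t where "t = 1/2 + \<nu>"
	have d: "((\<lambda>x. x powr t) has_real_derivative t * x powr (t - 1)) (at x)"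
		using x by (rule has_real_derivative_powr)
	have e: "x powr (t - 1) = x powr t / x" using x by (simp add: powr_diff)
	have "lagrange_bracket f (boundary_fun \<nu> None) x =
			f x * cpx (t * (x powr t / x)) - deriv_on {0<..} f x * pw t x"
		by (rule lagrange_bracket_of_real[OF x d[unfolded e]]) (simp add: boundary_fun_def[abs_def] t_def)
	also have "\<dots> = - (pw t x * grad t f x)"
		by (simp add: grad_def algebra_simps)
	finally show ?thesis by (simp only: t_def)
qed

lemma tendsto_transform_pos:
	assumes "(f \<longlongrightarrow> l) (at_right (0::real))" "\<And>x. x > 0 \<Longrightarrow> g x = f x"
	shows "lim0 g l"
proof (rule tendsto_cong[THEN iffD1, OF _ assms(1)])
	show "\<forall>\<^sub>F x in at_right 0. f x = g x" unfolding eventually_at_right_field using assms(2) by (intro exI[of _ 1]) auto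
qed

text \<open>
	Its boundary condition says that \<open>x powr s * grad s f\<close> vanishes at \<open>0\<close>, which means \<open>grad s f \<in> L\<^sup>2\<close>.
\<close>

lemma bessel_ext_None:
	assumes nu: "0 < \<nu>" "\<nu> < 1"
	shows "bessel_ext \<nu> None = finite_energy_op \<nu>" "form_dom (bessel_ext \<nu> None) = H10"
proof -
	define s where "s = 1/2 + \<nu>"
	have s: "s\<^sup>2 - s = \<nu>\<^sup>2 - 1/4" "s > 1/2" using nu by (auto simp: s_def power2_eq_square algebra_simps)
	have "f \<in> boundary_funs \<nu> None \<longleftrightarrow> f \<in> grad_dom s" if f: "f \<in> bessel_max_fun \<nu>" for f
	proof -
		let ?p = "\<lambda>x. pw s x * grad s f x"
		have "f \<in> boundary_funs \<nu> None \<longleftrightarrow> lim0 (?p) 0"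
		proof
			assume "f \<in> boundary_funs \<nu> None"
			then have "lim0 (\<lambda>x. - lagrange_bracket f (boundary_fun \<nu> None) x) (- 0)"
				unfolding boundary_funs_def mem_Collect_eq by (rule tendsto_minus)
			then have "lim0 (?p) (- 0)" by (rule tendsto_transform_pos) (simp add: lagrange_bracket_None s_def)
			then show "lim0 (?p) 0" by simp
		next
			assume "lim0 (?p) 0"
			then have "lim0 (\<lambda>x. - ?p x) (- 0)" by (rule tendsto_minus)
			then have "lim0 (\<lambda>x. lagrange_bracket f (boundary_fun \<nu> None) x) (- 0)"
				by (rule tendsto_transform_pos) (simp add: lagrange_bracket_None s_def)
			then show "f \<in> boundary_funs \<nu> None" by (simp add: boundary_funs_def)
		qed
		also have "\<dots> \<longleftrightarrow> f \<in> grad_dom s"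
			using max_fun_in_grad_dom[OF f s(1)] grad_dom_boundary_zero(1)[OF f s(1)] s(2) by auto
		finally show ?thesis .
	qed
	then show e: "bessel_ext \<nu> None = finite_energy_op \<nu>"
		unfolding bessel_ext_eq[OF nu] finite_energy_op_def s_def by (auto simp: max_restrict_def)
	show "form_dom (bessel_ext \<nu> None) = H10"
		unfolding e using nu
		by (simp add: factored_by_form_dom[OF factored_by_finite_energy_op] Domain_grad_op H10_eq grad_dom_eq_hardy_dom)
qed

text \<open>
	The two factors satisfy \<open>grad s f = grad s' f - 2 \<nu> f/x\<close>, so the limit of \<open>x powr s * grad s f\<close> is
	\<open>- 2 \<nu>\<close> times the boundary value \<open>a\<close>.
\<close>

lemma max_fun_boundary_identity:
	assumes nu: "0 < \<nu>" and a: "lim0 (\<lambda>x. pw (- (1/2 - \<nu>)) x * f x) a"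
		and L: "lim0 (\<lambda>x. pw (1/2 - \<nu>) x * grad (1/2 - \<nu>) f x) L"
	shows "lim0 (\<lambda>x. lagrange_bracket f (boundary_fun \<nu> (Some r)) x) (- L + cpx (4 * \<nu>\<^sup>2 * r) * a)"
proof -
	have z: "lim0 (\<lambda>x. pw (2 * \<nu>) x) 0"
		by (rule tendsto_zero_powr_bound[of _ 1 "2 * \<nu>"]) (use nu in auto)
	have lim: "lim0 (\<lambda>x. - (pw (1/2 - \<nu>) x * grad (1/2 - \<nu>) f x) - cpx (2 * \<nu> * r) *
			(pw (2 * \<nu>) x * (pw (1/2 - \<nu>) x * grad (1/2 - \<nu>) f x) -
			 cpx (2 * \<nu>) * (pw (- (1/2 - \<nu>)) x * f x))) (- L - cpx (2 * \<nu> * r) * (0 * L - cpx (2 * \<nu>) * a))"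
		by (intro tendsto_intros z a L)
	have v: "- L - cpx (2 * \<nu> * r) * (0 * L - cpx (2 * \<nu>) * a) = - L + cpx (4 * \<nu>\<^sup>2 * r) * a"
		by (simp add: power2_eq_square)
	have b: "lagrange_bracket f (boundary_fun \<nu> (Some r)) x =
			- (pw (1/2 - \<nu>) x * grad (1/2 - \<nu>) f x) - cpx (2 * \<nu> * r) *
			(pw (2 * \<nu>) x * (pw (1/2 - \<nu>) x * grad (1/2 - \<nu>) f x) -
			 cpx (2 * \<nu>) * (pw (- (1/2 - \<nu>)) x * f x))" if x: "x > 0" for x
	proof -
		have e1: "x powr (1/2 + \<nu>) = x powr (2 * \<nu>) * x powr (1/2 - \<nu>)"
			unfolding powr_add[symmetric] by (rule arg_cong[of _ _ "(powr) x"]) simp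
		have e: "- (1/2 - \<nu>) = (1/2 + \<nu>) - 1" by simp
		have e2: "x powr (- (1/2 - \<nu>)) = x powr (1/2 + \<nu>) / x" unfolding e powr_diff using x by simp
		have g: "grad (1/2 + \<nu>) f x = grad (1/2 - \<nu>) f x - cpx (2 * \<nu> / x) * f x"
			by (simp add: grad_def algebra_simps add_divide_distrib diff_divide_distrib)
		have "pw (1/2 + \<nu>) x * grad (1/2 + \<nu>) f x =
			pw (2 * \<nu>) x * (pw (1/2 - \<nu>) x * grad (1/2 - \<nu>) f x) -
			 cpx (2 * \<nu>) * (pw (- (1/2 - \<nu>)) x * f x)"
			unfolding g e2 by (simp add: right_diff_distrib e1)
		then show ?thesis unfolding lagrange_bracket_Some[OF x] by simp
	qed
	show ?thesis by (rule tendsto_transform_pos[OF lim[unfolded v] b])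
qed

lemma linear_bessel_ext:
	assumes nu: "0 < \<nu>" "\<nu> < 1"
	shows "linear_op (bessel_ext \<nu> h)"
	unfolding bessel_ext_eq[OF nu]
proof (rule linear_max_restrict)
	have "deriv_on {0<..} (\<lambda>x. 0) x = 0" if "x > 0" for x
		by (rule deriv_on_eqI[OF that has_vector_derivative_const])
	then show "(\<lambda>x. 0) \<in> boundary_funs \<nu> h"
		unfolding boundary_funs_def mem_Collect_eq
		by (intro tendsto_transform_pos[OF tendsto_const]) (simp add: lagrange_bracket_def)
next
	fix f g assume f: "f \<in> bessel_max_fun \<nu>" "f \<in> boundary_funs \<nu> h" and g: "g \<in> bessel_max_fun \<nu>" "g \<in> boundary_funs \<nu> h"
	let ?b = "boundary_fun \<nu> h"
	have "lim0 (\<lambda>x. lagrange_bracket f ?b x + lagrange_bracket g ?b x) (0 + 0)"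
		using f(2) g(2) by (intro tendsto_add) (simp_all add: boundary_funs_def)
	then have "lim0 (\<lambda>x. lagrange_bracket (\<lambda>x. f x + g x) ?b x) (0 + 0)"
	proof (rule tendsto_transform_pos)
		fix x :: real assume "x > 0"
		then show "lagrange_bracket (\<lambda>x. f x + g x) ?b x = lagrange_bracket f ?b x + lagrange_bracket g ?b x"
			by (simp add: lagrange_bracket_def max_fun_add(3)[OF f(1) g(1)] algebra_simps)
	qed
	then show "(\<lambda>x. f x + g x) \<in> boundary_funs \<nu> h" by (simp add: boundary_funs_def)
next
	fix c f assume f: "f \<in> bessel_max_fun \<nu>" "f \<in> boundary_funs \<nu> h"
	let ?b = "boundary_fun \<nu> h"
	have "lim0 (\<lambda>x. c * lagrange_bracket f ?b x) (c * 0)"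
		using f(2) by (intro tendsto_mult_left) (simp add: boundary_funs_def)
	then have "lim0 (\<lambda>x. lagrange_bracket (\<lambda>x. c * f x) ?b x) (c * 0)"
	proof (rule tendsto_transform_pos)
		fix x :: real assume "x > 0"
		then show "lagrange_bracket (\<lambda>x. c * f x) ?b x = c * lagrange_bracket f ?b x"
			by (simp add: lagrange_bracket_def max_fun_scale(3)[OF f(1)] algebra_simps)
	qed
	then show "(\<lambda>x. c * f x) \<in> boundary_funs \<nu> h" by (simp add: boundary_funs_def)
qed

text \<open>
	Green's formula with the smaller root: the boundary term is \<open>L cnj a\<close>, and the boundary condition says
	\<open>L = 4 \<nu>\<^sup>2 r a\<close>. By \<open>trace_le_energy\<close> it is at most half of the energy up to a multiple of the squared norm.
\<close>

lemma bessel_ext_form_dom_subset: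
	assumes nu: "0 < \<nu>" "\<nu> < 1"
	shows "form_dom (bessel_ext \<nu> (Some r)) \<subseteq> L2 ` grad_dom (1/2 - \<nu>)"
proof
	define s where "s = 1/2 - \<nu>"
	have s: "s\<^sup>2 - s = \<nu>\<^sup>2 - 1/4" "s > -1/2" "s < 1/2" using nu by (auto simp: s_def power2_eq_square algebra_simps)
	\<comment> \<open>With this choice the boundary term takes at most half of the energy.\<close>
	define \<epsilon> where "\<epsilon> = 1 / (8 * \<nu>\<^sup>2 * \<bar>r\<bar> + 1)"
	have e: "\<epsilon> > 0" "4 * \<nu>\<^sup>2 * \<bar>r\<bar> * \<epsilon> \<le> 1/2" by (auto simp: \<epsilon>_def field_simps add_pos_nonneg add_nonneg_pos)
	obtain C where C: "C \<ge> 0" "\<And>f a. f \<in> grad_dom s \<Longrightarrow> lim0 (\<lambda>x. pw (- s) x * f x) a \<Longrightarrow>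
		(cmod a)\<^sup>2 \<le> \<epsilon> * (norm (L2 (grad s f)))\<^sup>2 + C * (norm (L2 f))\<^sup>2"
		using trace_le_energy[OF s(3) e(1)] by blast
	have dom: "Domain (bessel_ext \<nu> (Some r)) \<subseteq> Domain (grad_op s)"
		using max_fun_in_adjoint(1)[OF nu] by (auto simp: bessel_ext_eq[OF nu] max_restrict_def Domain_grad_op s_def)
	have lower: "1/2 * (norm g)\<^sup>2 \<le> cmod (l2_inner y x) + 4 * \<nu>\<^sup>2 * \<bar>r\<bar> * C * (norm x)\<^sup>2"
		if xy: "(x, y) \<in> bessel_ext \<nu> (Some r)" and xg: "(x, g) \<in> grad_op s" for x y g
	proof -
		obtain f where f: "x = L2 f" "y = L2 (bessel_expr \<nu> f)" "f \<in> bessel_max_fun \<nu>" "f \<in> boundary_funs \<nu> (Some r)"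
			using xy by (auto simp: bessel_ext_eq[OF nu] max_restrict_def)
		have fg: "f \<in> grad_dom s" using max_fun_in_adjoint(1)[OF nu f(3)] by (simp add: s_def)
		have g: "g = L2 (grad s f)"
			by (rule grad_op_memD(2)[OF grad_domD(1)[OF fg] grad_domD(4)[OF fg]]) (use xg f in simp)
		obtain a where a: "lim0 (\<lambda>x. pw (- s) x * f x) a"
			using grad_dom_trace[OF fg s(3)] by blast
		obtain L where L: "lim0 (\<lambda>x. pw s x * grad s f x) L"
			using max_fun_boundary_limit[OF f(3) s(1,2)] by blast
		have "lim0 (\<lambda>x. lagrange_bracket f (boundary_fun \<nu> (Some r)) x) (- L + cpx (4 * \<nu>\<^sup>2 * r) * a)"
			by (rule max_fun_boundary_identity[OF nu(1) a[unfolded s_def] L[unfolded s_def]])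
		from tendsto_unique[OF trivial_limit_at_right_real this, of 0] f(4)
		have "- L + cpx (4 * \<nu>\<^sup>2 * r) * a = 0" by (simp only: boundary_funs_def mem_Collect_eq)
		then have La: "L = cpx (4 * \<nu>\<^sup>2 * r) * a" by (simp add: neg_eq_iff_add_eq_0)
		have "lim0 (\<lambda>x. (pw s x * grad s f x) * cnj (pw (- s) x * f x)) (L * cnj a)"
			by (intro tendsto_intros L a)
		then have "lim0 (\<lambda>x. grad s f x * cnj (f x)) (L * cnj a)"
		proof (rule tendsto_transform_pos)
			fix x :: real assume "x > 0"
			then show "grad s f x * cnj (f x) = pw s x * grad s f x * cnj (pw (- s) x * f x)"
				by (simp add: powr_minus field_simps)
		qed
		from Green_formula[OF f(3) s(1) fg fg this]
		have G: "l2_inner y x = cpx ((norm g)\<^sup>2) + L * cnj a" by (simp add: f g l2_inner_self)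
		have Ln: "cmod (L * cnj a) = 4 * \<nu>\<^sup>2 * \<bar>r\<bar> * (cmod a)\<^sup>2" by (simp add: La norm_mult norm_power power2_eq_square abs_mult)
		have "(norm g)\<^sup>2 = cmod (cpx ((norm g)\<^sup>2))" unfolding norm_of_real by simp
		also have "\<dots> = cmod (l2_inner y x - L * cnj a)" by (rule arg_cong[of _ _ cmod]) (simp add: G)
		also have "\<dots> \<le> cmod (l2_inner y x) + cmod (L * cnj a)" by (rule norm_triangle_ineq4)
		also have "cmod (L * cnj a) \<le> 4 * \<nu>\<^sup>2 * \<bar>r\<bar> * (\<epsilon> * (norm g)\<^sup>2 + C * (norm x)\<^sup>2)"
			unfolding Ln f(1) g by (rule mult_left_mono[OF C(2)[OF fg a]]) simp
		also have "\<dots> = (4 * \<nu>\<^sup>2 * \<bar>r\<bar> * \<epsilon>) * (norm g)\<^sup>2 + 4 * \<nu>\<^sup>2 * \<bar>r\<bar> * C * (norm x)\<^sup>2" by (simp add: algebra_simps)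
		also have "(4 * \<nu>\<^sup>2 * \<bar>r\<bar> * \<epsilon>) * (norm g)\<^sup>2 \<le> 1/2 * (norm g)\<^sup>2" by (rule mult_right_mono[OF e(2)]) simp
		finally show ?thesis by simp
	qed
	fix u assume "u \<in> form_dom (bessel_ext \<nu> (Some r))"
	then obtain X where X: "form_convergent (bessel_ext \<nu> (Some r)) X u" by (auto simp: form_dom_def)
	obtain g where "(u, g) \<in> grad_op s"
		by (rule form_convergent_imp[OF linear_bessel_ext[OF nu] linear_grad_op closed_grad_op dom _ lower X]) auto
	then show "u \<in> L2 ` grad_dom (1/2 - \<nu>)" by (auto simp: Domain_grad_op[symmetric] s_def)
qed

lemma form_convergent_mono:
	assumes S: "linear_op S" and T: "linear_op T" "T \<subseteq> S" and X: "form_convergent T X u"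
	shows "form_convergent S X u"
proof -
	have d: "X n \<in> Domain T" for n using X by (simp add: form_convergent_def)
	have "op_apply T (X m - X n) = op_apply S (X m - X n)" for m n
		using linear_op_apply[OF S] linear_op_apply_diff_mem[OF T(1) d d] T(2) by (metis subsetD)
	moreover have "X n \<in> Domain S" for n using d[of n] T(2) by blast
	ultimately show ?thesis using X by (simp add: form_convergent_def)
qed

lemma form_convergent_shift:
	assumes S: "linear_op S" and d: "d \<in> Domain S" and X: "form_convergent S X u"
	shows "form_convergent S (\<lambda>n. X n + d) (u + d)"
proof -
	have "X n + d \<in> Domain S" for n
	proof -
		have "X n \<in> Domain S" using X by (simp add: form_convergent_def)
		then obtain y where "(X n, y) \<in> S" by blast
		moreover obtain z where "(d, z) \<in> S" using d by auto
		ultimately show ?thesis using linear_opD(2)[OF S] by blast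
	qed
	then show ?thesis using X by (auto simp: form_convergent_def intro: tendsto_add)
qed

lemma exp_neg_sq_tendsto: "lim0 (\<lambda>x::real. cpx (exp (- x\<^sup>2))) 1"
proof -
	have "lim0 (\<lambda>x::real. cpx (exp (- x\<^sup>2))) (cpx (exp (- 0\<^sup>2)))"
		by (intro tendsto_intros)
	then show ?thesis by simp
qed

text \<open>
	The combination \<open>x powr s' + 2 \<nu> r x powr s\<close> of the boundary function itself, with a Gaussian factor.
\<close>

lemma bessel_ext_domain_element:
	assumes nu: "0 < \<nu>" "\<nu> < 1"
	obtains f where "f \<in> bessel_max_fun \<nu>" "f \<in> boundary_funs \<nu> (Some r)"
		"lim0 (\<lambda>x. pw (- (1/2 - \<nu>)) x * f x) 1"
proof -
	define s where "s = 1/2 - \<nu>"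
	define t where "t = 1/2 + \<nu>"
	have s: "s\<^sup>2 - s = \<nu>\<^sup>2 - 1/4" "t\<^sup>2 - t = \<nu>\<^sup>2 - 1/4" by (auto simp: s_def t_def power2_eq_square algebra_simps)
	have sb: "-1/2 < s" "s < 3/2" "-1/2 < t" "t < 3/2" using nu by (auto simp: s_def t_def)
	note gs = gauss_powr_max_fun[OF sb(1,2) s(1)] and gt = gauss_powr_max_fun[OF sb(3,4) s(2)]
	define c where "c = cpx (2 * \<nu> * r)"
	define f where "f x = gauss_powr s x + c * gauss_powr t x" for x
	have fm: "f \<in> bessel_max_fun \<nu>" unfolding f_def by (rule max_fun_add(1)[OF gs(1) max_fun_scale(1)[OF gt(1)]])
	have z: "lim0 (\<lambda>x::real. pw q x) 0" if "q > 0" for q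
		by (rule tendsto_zero_powr_bound[of _ 1 q]) (use that in auto)
	have trace: "lim0 (\<lambda>x. pw (- s) x * f x) 1"
	proof -
		have "lim0 (\<lambda>x. cpx (exp (- x\<^sup>2)) * (1 + c * pw (2 * \<nu>) x)) (1 * (1 + c * 0))"
			by (intro tendsto_intros exp_neg_sq_tendsto z) (use nu in simp)
		then have "lim0 (\<lambda>x. cpx (exp (- x\<^sup>2)) * (1 + c * pw (2 * \<nu>) x)) 1" by simp
		then show ?thesis
		proof (rule tendsto_transform_pos)
			fix x :: real assume x: "x > 0"
			have 1: "x powr (- s) * x powr s = 1" "x powr (- s) * x powr t = x powr (2 * \<nu>)"
				using x by (simp_all add: powr_add[symmetric] s_def t_def)
			have "pw (- s) x * f x = cpx (exp (- x\<^sup>2)) *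
					(cpx (x powr (- s) * x powr s) + c * cpx (x powr (- s) * x powr t))"
				by (simp add: f_def gauss_powr_def algebra_simps)
			then show "pw (- s) x * f x = cpx (exp (- x\<^sup>2)) * (1 + c * pw (2 * \<nu>) x)"
				by (simp only: 1 of_real_1)
		qed
	qed
	have "lim0 (\<lambda>x. pw s x * grad s f x) (cpx (4 * \<nu>\<^sup>2 * r))"
	proof -
		have "lim0 (\<lambda>x. cpx (exp (- x\<^sup>2)) * (- 2 * pw (2 - 2 * \<nu>) x + c * (cpx (2 * \<nu>) - 2 * pw 2 x))) (1 * (- 2 * 0 + c * (cpx (2 * \<nu>) - 2 * 0)))"
			by (intro tendsto_intros exp_neg_sq_tendsto z) (use nu in simp_all)
		moreover have "1 * (- 2 * 0 + c * (cpx (2 * \<nu>) - 2 * 0)) = cpx (4 * \<nu>\<^sup>2 * r)"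
			by (simp add: c_def power2_eq_square)
		ultimately have "lim0 (\<lambda>x. cpx (exp (- x\<^sup>2)) * (- 2 * pw (2 - 2 * \<nu>) x + c * (cpx (2 * \<nu>) - 2 * pw 2 x))) (cpx (4 * \<nu>\<^sup>2 * r))" by (simp only:)
		then show ?thesis
		proof (rule tendsto_transform_pos)
			fix x :: real assume x: "x > 0"
			have d: "deriv_on {0<..} f x = cpx s * gauss_powr (s - 1) x - 2 * gauss_powr (s + 1) x
					+ c * (cpx t * gauss_powr (t - 1) x - 2 * gauss_powr (t + 1) x)"
				unfolding f_def max_fun_add(3)[OF gs(1) max_fun_scale(1)[OF gt(1)] x] max_fun_scale(3)[OF gt(1) x] gs(2)[OF x] gt(2)[OF x] by simp
			have q: "gauss_powr q x / cpx x = gauss_powr (q - 1) x" for q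
				using x by (simp add: gauss_powr_def powr_diff)
			have "grad s f x = deriv_on {0<..} f x - cpx s * (gauss_powr s x / cpx x) - c * (cpx s * (gauss_powr t x / cpx x))"
				by (simp add: grad_def f_def algebra_simps add_divide_distrib)
			also have "\<dots> = - 2 * gauss_powr (s + 1) x + c * (cpx (2 * \<nu>) * gauss_powr (t - 1) x - 2 * gauss_powr (t + 1) x)"
				unfolding d q by (simp add: algebra_simps s_def t_def)
			finally have g: "grad s f x = \<dots>" .
			have m: "pw s x * gauss_powr q x = cpx (exp (- x\<^sup>2)) * pw (s + q) x" for q
				by (simp add: gauss_powr_def powr_add)
			have e: "s + (s + 1) = 2 - 2 * \<nu>" "s + (t - 1) = 0" "s + (t + 1) = 2" by (auto simp: s_def t_def)
			have "pw s x * grad s f x = - 2 * (pw s x * gauss_powr (s + 1) x)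
				 + c * (cpx (2 * \<nu>) * (pw s x * gauss_powr (t - 1) x) - 2 * (pw s x * gauss_powr (t + 1) x))"
				unfolding g by (simp add: algebra_simps)
			also have "\<dots> = cpx (exp (- x\<^sup>2)) * (- 2 * pw (2 - 2 * \<nu>) x + c * (cpx (2 * \<nu>) - 2 * pw 2 x))"
				unfolding m e using x by (simp add: algebra_simps)
			finally show "pw s x * grad s f x =
				cpx (exp (- x\<^sup>2)) * (- 2 * pw (2 - 2 * \<nu>) x + c * (cpx (2 * \<nu>) - 2 * pw 2 x))" .
		qed
	qed
	from max_fun_boundary_identity[OF nu(1) trace[unfolded s_def] this[unfolded s_def], of r]
	have "f \<in> boundary_funs \<nu> (Some r)" by (simp add: boundary_funs_def)
	with fm trace show ?thesis by (intro that) (simp_all add: s_def)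
qed

lemma bessel_core_subset_ext:
	assumes nu: "0 < \<nu>" "\<nu> < 1"
	shows "bessel_core \<nu> \<subseteq> bessel_ext \<nu> h"
proof -
	have "f \<in> boundary_funs \<nu> h" if f: "f \<in> compact_funs" for f
	proof -
		obtain a where a: "a > 0" "\<And>x. 0 < x \<Longrightarrow> x < a \<Longrightarrow> f x = 0 \<and> deriv_on {0<..} f x = 0"
			by (rule compact_fun_zero_near_0[OF f]) blast
		show ?thesis unfolding boundary_funs_def mem_Collect_eq
			by (rule tendsto_zero_near_0[OF a(1)]) (simp add: lagrange_bracket_def a(2))
	qed
	then show ?thesis by (auto simp: bessel_core_def bessel_ext_eq[OF nu] max_restrict_def)
qed

context cutoff
begin

lemma powr_cut_trace: "lim0 (\<lambda>x. pw (- p) x * powr_cut p x) 1"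
proof (rule tendsto_eventually)
	show "\<forall>\<^sub>F x in at_right 0. pw (- p) x * powr_cut p x = 1"
		unfolding eventually_at_right_field
		by (intro exI[of _ "1/2"]) (auto simp: powr_cut_def one powr_minus)
qed

text \<open>
	The difference of the cut off power and an element of the operator domain with the same boundary value is in
	\<open>H\<^sub>0\<^sup>1\<close>, hence a form limit of elements of the core; adding a fixed element of the domain to a form
	convergent sequence does not change its differences.
\<close>

theorem bessel_ext_form_dom:
	assumes nu: "0 < \<nu>" "\<nu> < 1"
	shows "is_direct_sum (form_dom (bessel_ext \<nu> (Some r))) H10 (l2.span {L2 (powr_cut (1/2 - \<nu>))})"
proof -
	define s where "s = 1/2 - \<nu>"
	have s: "s > -1/2" "s < 1/2" using nu by (auto simp: s_def)
	let ?T = "bessel_ext \<nu> (Some r)"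
	have cg: "powr_cut s \<in> grad_dom s" by (rule powr_cut_grad_dom[OF s(1)])
	have cs: "sq_integrable (powr_cut s)" by (rule grad_domD(1)[OF cg])
	have hs: "sq_integrable h" if "h \<in> hardy_dom" for h using that by (auto simp: hardy_dom_def dest: grad_domD(1))
	note tr = powr_cut_trace[of s]
	have int: "u = 0" if u: "u \<in> H10" "u \<in> range (\<lambda>k. k *\<^sub>C L2 (powr_cut s))" for u
	proof -
		obtain h where h: "h \<in> hardy_dom" "u = L2 h" using u(1) by (auto simp: H10_eq)
		obtain k where k: "u = k *\<^sub>C L2 (powr_cut s)" using u(2) by auto
		have kg: "(\<lambda>x. k * powr_cut s x) \<in> grad_dom s" by (rule grad_dom_scale(1)[OF cg])
		have "AE x in half_line. h x = k * powr_cut s x"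
			using h(2) k unfolding L2_scale[OF cs] by (intro L2_eq_iff[OF hs[OF h(1)] sq_integrable_scale[OF cs], THEN iffD1]) simp
		then have "AE x in half_line. h x / cpx x = k * powr_cut s x / cpx x" by eventually_elim simp
		from sq_integrable_cong_AE[OF _ this] have "sq_integrable (\<lambda>x. k * powr_cut s x / cpx x)"
			using h(1) by (simp add: hardy_dom_def)
		then have "(\<lambda>x. k * powr_cut s x) \<in> hardy_dom" using kg hardy_dom_iff[of _ s] by blast
		moreover have "lim0 (\<lambda>x. pw (- s) x * (k * powr_cut s x)) k"
			using tendsto_mult_left[OF tr, of k] by (simp add: mult_ac)
		ultimately have "k = 0" using hardy_dom_iff_trace[OF kg s(2)] by blast
		then show ?thesis using k by simp
	qed
	have "form_dom ?T \<subseteq> sum_space H10 (range (\<lambda>k. k *\<^sub>C L2 (powr_cut s)))"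
	proof
		fix u assume "u \<in> form_dom ?T"
		then obtain f where f: "f \<in> grad_dom s" "u = L2 f" using bessel_ext_form_dom_subset[OF nu] by (auto simp: s_def)
		obtain a where a: "lim0 (\<lambda>x. pw (- s) x * f x) a"
			using grad_dom_trace[OF f(1) s(2)] by blast
		define h where "h x = f x + (- a) * powr_cut s x" for x
		have hg: "h \<in> grad_dom s" unfolding h_def by (rule grad_dom_add(1)[OF f(1) grad_dom_scale(1)[OF cg]])
		have "lim0 (\<lambda>x. pw (- s) x * f x + (- a) * (pw (- s) x * powr_cut s x)) (a + (- a) * 1)"
			by (intro tendsto_intros a tr)
		then have "lim0 (\<lambda>x. pw (- s) x * h x) 0" by (simp add: h_def algebra_simps)
		then have hh: "h \<in> hardy_dom" using hardy_dom_iff_trace[OF hg s(2)] by blast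
		have "u = L2 (\<lambda>x. h x + a * powr_cut s x)" unfolding f(2) by (rule arg_cong[of _ _ L2]) (simp add: h_def)
		also have "\<dots> = L2 h + a *\<^sub>C L2 (powr_cut s)"
			by (simp add: L2_scale[OF cs] L2_add[OF hs[OF hh] sq_integrable_scale[OF cs]])
		finally show "u \<in> sum_space H10 (range (\<lambda>k. k *\<^sub>C L2 (powr_cut s)))" using hh by (auto simp: sum_space_def H10_eq)
	qed
	moreover have "sum_space H10 (range (\<lambda>k. k *\<^sub>C L2 (powr_cut s))) \<subseteq> form_dom ?T"
	proof
		fix u assume "u \<in> sum_space H10 (range (\<lambda>k. k *\<^sub>C L2 (powr_cut s)))"
		then obtain h k where h: "h \<in> hardy_dom" and u: "u = L2 h + k *\<^sub>C L2 (powr_cut s)" by (auto simp: sum_space_def H10_eq)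
		obtain f where f: "f \<in> bessel_max_fun \<nu>" "f \<in> boundary_funs \<nu> (Some r)"
			"lim0 (\<lambda>x. pw (- s) x * f x) 1"
			unfolding s_def by (rule bessel_ext_domain_element[OF nu])
		have fg: "f \<in> grad_dom s" using max_fun_in_adjoint(1)[OF nu f(1)] by (simp add: s_def)
		have fs: "sq_integrable f" by (rule grad_domD(1)[OF fg])
		define h' where "h' x = h x + k * (powr_cut s x + (- 1) * f x)" for x
		have hg: "h \<in> grad_dom s" using h hardy_dom_iff[of h s] by blast
		have h'g: "h' \<in> grad_dom s" unfolding h'_def
			by (intro grad_dom_add(1) grad_dom_scale(1) hg cg fg)
		have h0: "lim0 (\<lambda>x. pw (- s) x * h x) 0"
			using grad_dom_trace[OF hg s(2)] hardy_dom_iff_trace[OF hg s(2)] h by blast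
		have "lim0 (\<lambda>x. pw (- s) x * h x + k * (pw (- s) x * powr_cut s x + (- 1) * (pw (- s) x * f x))) (0 + k * (1 + (- 1) * 1))"
			by (intro tendsto_intros h0 tr f)
		then have "lim0 (\<lambda>x. pw (- s) x * h' x) 0" by (simp add: h'_def algebra_simps)
		then have h': "h' \<in> hardy_dom" using hardy_dom_iff_trace[OF h'g s(2)] by blast
		have "L2 h' \<in> form_dom (bessel_core \<nu>)"
			using h' nu by (simp add: factored_by_form_dom[OF factored_by_core] Domain_grad_op grad_dom_eq_hardy_dom)
		then obtain X where "form_convergent (bessel_core \<nu>) X (L2 h')" by (auto simp: form_dom_def)
		then have "form_convergent ?T X (L2 h')"
			by (rule form_convergent_mono[OF linear_bessel_ext[OF nu] linear_bessel_core bessel_core_subset_ext[OF nu]])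
		moreover have "L2 (\<lambda>x. k * f x) \<in> Domain ?T"
		proof -
			have "(L2 f, L2 (bessel_expr \<nu> f)) \<in> ?T" using f by (auto simp: bessel_ext_eq[OF nu] max_restrict_def)
			from linear_opD(3)[OF linear_bessel_ext[OF nu] this, of k] show ?thesis by (auto simp: L2_scale[OF fs])
		qed
		ultimately have "form_convergent ?T (\<lambda>n. X n + L2 (\<lambda>x. k * f x)) (L2 h' + L2 (\<lambda>x. k * f x))"
			by (intro form_convergent_shift[OF linear_bessel_ext[OF nu]])
		moreover have "L2 h' + L2 (\<lambda>x. k * f x) = u"
			unfolding u L2_scale[OF cs] L2_add[OF hs[OF h'] sq_integrable_scale[OF fs]] L2_add[OF hs[OF h] sq_integrable_scale[OF cs]]
			by (rule arg_cong[of _ _ L2]) (simp add: h'_def fun_eq_iff algebra_simps)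
		ultimately show "u \<in> form_dom ?T" by (auto simp: form_dom_def)
	qed
	moreover have "0 \<in> range (\<lambda>k. k *\<^sub>C L2 (powr_cut s))" by (intro range_eqI[of _ _ 0]) simp
	moreover have "0 \<in> H10" using sq_integrable_zero grad_dom_zero L2_zero unfolding H10_eq hardy_dom_def
		by (intro image_eqI[of _ _ "\<lambda>x. 0"]) auto
	ultimately show ?thesis
		unfolding is_direct_sum_def l2.span_singleton s_def[symmetric] using int by blast
qed

end

section \<open>Logarithmic elements of the form domain in order zero\<close>

lemma DERIV_neg_ln_powr:
	assumes x: "0 < x" "x < 1"
	shows "((\<lambda>x. (- ln x) powr q) has_real_derivative q * (- ln x) powr (q - 1) * (- (1 / x))) (at x)"
proof (rule DERIV_chain2[where g="\<lambda>x. - ln x" and f="\<lambda>z. z powr q"])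
	show "((\<lambda>z. z powr q) has_real_derivative q * (- ln x) powr (q - 1)) (at (- ln x))"
		by (rule has_real_derivative_powr) (use x in simp)
	show "((\<lambda>x. - ln x) has_real_derivative - (1 / x)) (at x)"
		using DERIV_minus[OF DERIV_ln_divide[OF x(1)]] .
qed

context cutoff
begin

definition log_cut :: "real \<Rightarrow> real \<Rightarrow> complex"
	where "log_cut \<alpha> x = cpx (x powr (1/2) * \<bar>ln x\<bar> powr (- \<alpha>)) * \<xi> x"

text \<open>
	The derivative of \<open>\<bar>ln x\<bar> powr (- \<alpha>) * \<xi>\<close>. The singular point \<open>x = 1\<close> of the logarithm lies outside the support of \<open>\<xi>\<close>.
\<close>

definition log_slope :: "real \<Rightarrow> real \<Rightarrow> complex"
	where "log_slope \<alpha> x = (if x < 1 then cpx (\<bar>ln x\<bar> powr (- \<alpha>)) * \<xi>' x +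
		cpx (\<alpha> * \<bar>ln x\<bar> powr (- \<alpha> - 1) / x) * \<xi> x else 0)"

lemma primitive_log_cut:
	"primitive (log_cut \<alpha>) (\<lambda>x. pw (1/2) x * log_slope \<alpha> x + cpx (1/2 / x) * log_cut \<alpha> x)"
proof -
	define \<eta> where "\<eta> x = cpx (\<bar>ln x\<bar> powr (- \<alpha>)) * \<xi> x" for x
	have far: "\<eta> x = 0" "log_slope \<alpha> x = 0" if "x > 3/4" for x
		using that by (simp_all add: \<eta>_def log_slope_def zero \<xi>'_far)
	have "primitive \<eta> (log_slope \<alpha>)"
	proof (rule primitive_of_has_derivative)
		fix x :: real assume x: "x > 0"
		show "(\<eta> has_vector_derivative log_slope \<alpha> x) (at x)"
		proof (cases "x < 1")
			case True
			have l: "- ln x > 0" using True x by simp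
			have "((\<lambda>x. (- ln x) powr (- \<alpha>)) has_real_derivative - \<alpha> * (- ln x) powr (- \<alpha> - 1) * (- (1 / x))) (at x)"
				by (rule DERIV_neg_ln_powr[OF x True])
			then have "((\<lambda>x. (- ln x) powr (- \<alpha>)) has_real_derivative \<alpha> * \<bar>ln x\<bar> powr (- \<alpha> - 1) / x) (at x)"
				using l by simp
			then have "((\<lambda>x. \<bar>ln x\<bar> powr (- \<alpha>)) has_real_derivative \<alpha> * \<bar>ln x\<bar> powr (- \<alpha> - 1) / x) (at x)"
				by (rule has_field_derivative_transform_within_open[of _ _ _ "{0<..<1}"]) (use x True in auto)
			from has_vector_derivative_mult[OF has_vector_derivative_of_real[OF this] has_derivative[OF x]]
			show ?thesis using True by (simp add: \<eta>_def[abs_def] log_slope_def)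
		next
			case False
			have "(\<eta> has_vector_derivative 0) (at x)"
				by (rule has_vector_derivative_transform_within_open[OF has_vector_derivative_const[of 0], of "{3/4<..}"])
					 (use far False in auto)
			then show ?thesis using False far(2)[of x] by simp
		qed
	next
		have "continuous_on ({0<..<1} \<union> {3/4<..}) (log_slope \<alpha>)"
		proof (rule continuous_on_open_Un)
			have "continuous_on {0<..} \<xi>" by (rule primitive_continuous_on[OF primitive_\<xi>])
			then have c: "continuous_on {0<..<1} \<xi>" "continuous_on {0<..<1} \<xi>'"
				by (auto intro: continuous_on_subset continuous_on_subset[OF \<xi>'_continuous])
			have "continuous_on {0<..<1} (\<lambda>x. cpx (\<bar>ln x\<bar> powr (- \<alpha>)) * \<xi>' x +
					cpx (\<alpha> * \<bar>ln x\<bar> powr (- \<alpha> - 1) / x) * \<xi> x)"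
				by (intro continuous_intros c) auto
			then show "continuous_on {0<..<1} (log_slope \<alpha>)"
				by (rule continuous_on_cong[THEN iffD1, OF refl, rotated]) (simp add: log_slope_def)
			show "continuous_on {3/4<..} (log_slope \<alpha>)"
				by (rule continuous_on_cong[THEN iffD1, OF refl _ continuous_on_const[of _ 0]]) (simp add: far)
		qed auto
		moreover have "{0<..<1} \<union> {3/4<..} = {0::real<..}" by auto
		ultimately show "continuous_on {0<..} (log_slope \<alpha>)" by simp
	qed
	then have "primitive \<eta> (\<lambda>x. log_slope \<alpha> x + cpx (0 / x) * \<eta> x)" by simp
	from primitive_powr_mult[OF this, of "1/2"]
	show ?thesis by (simp add: log_cut_def[abs_def] \<eta>_def mult.assoc)
qed

text \<open>
	\<open>(- ln x) powr (- 2 \<alpha> - 1) / (2 \<alpha> + 1)\<close> is a bounded primitive of the square.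
\<close>

lemma log_weight_sq_integrable:
	assumes a: "\<alpha> > 0"
	shows "sq_integrable (\<lambda>x. cpx (if x < 3/4 then x powr (-1/2) * \<bar>ln x\<bar> powr (- \<alpha> - 1) else 0))"
proof (rule sq_integrable_piecewise)
	show "continuous_on {0<..3/4} (\<lambda>x. x powr (-1/2) * \<bar>ln x\<bar> powr (- \<alpha> - 1))"
		by (intro continuous_intros) auto
	show "integral {b..3/4} (\<lambda>x. (x powr (-1/2) * \<bar>ln x\<bar> powr (- \<alpha> - 1))\<^sup>2) \<le> (- ln (3/4)) powr (- 2 * \<alpha> - 1) / (2 * \<alpha> + 1)"
		if b: "0 < b" "b \<le> 3/4" for b
	proof -
		define G where "G x = (- ln x) powr (- 2 * \<alpha> - 1) / (2 * \<alpha> + 1)" for x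
		have "((\<lambda>x. (x powr (-1/2) * \<bar>ln x\<bar> powr (- \<alpha> - 1))\<^sup>2) has_integral (G (3/4) - G b)) {b..3/4}"
		proof (rule fundamental_theorem_of_calculus[OF b(2)])
			fix x assume "x \<in> {b..3/4}"
			then have x: "x > 0" "x < 1" using b by auto
			have l: "- ln x > 0" using x by simp
			have q: "(x powr (-1/2) * \<bar>ln x\<bar> powr (- \<alpha> - 1))\<^sup>2 = (- ln x) powr (- 2 * \<alpha> - 1 - 1) * (1 / x)"
			proof -
				have "(x powr (-1/2))\<^sup>2 = 1 / x" using x powr_minus_divide[of x 1] by (simp add: power2_eq_square powr_add[symmetric])
				moreover have "(\<bar>ln x\<bar> powr (- \<alpha> - 1))\<^sup>2 = (- ln x) powr (- 2 * \<alpha> - 1 - 1)"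
					using l unfolding power2_eq_square powr_add[symmetric] by (intro arg_cong2[of _ _ _ _ "(powr)"]) auto
				ultimately show ?thesis by (simp add: power_mult_distrib)
			qed
			have "((\<lambda>x. (- ln x) powr (- 2 * \<alpha> - 1)) has_real_derivative (- 2 * \<alpha> - 1) * (- ln x) powr (- 2 * \<alpha> - 1 - 1) * (- (1 / x))) (at x)"
				by (rule DERIV_neg_ln_powr[OF x])
			from DERIV_cdivide[OF this, of "2 * \<alpha> + 1"]
			have "(G has_real_derivative (- 2 * \<alpha> - 1) * (- ln x) powr (- 2 * \<alpha> - 1 - 1) * (- (1 / x)) / (2 * \<alpha> + 1)) (at x)"
				by (simp add: G_def[abs_def])
			moreover have "(- 2 * \<alpha> - 1) * (- ln x) powr (- 2 * \<alpha> - 1 - 1) * (- (1 / x)) / (2 * \<alpha> + 1) = (x powr (-1/2) * \<bar>ln x\<bar> powr (- \<alpha> - 1))\<^sup>2"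
			proof -
				have "(- 2 * \<alpha> - 1) * P * (- Q) / (2 * \<alpha> + 1) = P * Q" for P Q :: real
				proof -
					have "(- 2 * \<alpha> - 1) * P * (- Q) = (P * Q) * (2 * \<alpha> + 1)" by (simp add: algebra_simps)
					then show ?thesis using a by simp
				qed
				then show ?thesis unfolding q .
			qed
			ultimately show "(G has_vector_derivative (x powr (-1/2) * \<bar>ln x\<bar> powr (- \<alpha> - 1))\<^sup>2) (at x within {b..3/4})"
				by (simp add: has_real_derivative_iff_has_vector_derivative[symmetric] has_field_derivative_at_within)
		qed
		then have "integral {b..3/4} (\<lambda>x. (x powr (-1/2) * \<bar>ln x\<bar> powr (- \<alpha> - 1))\<^sup>2) = G (3/4) - G b" by (rule integral_unique)
		moreover have "G b \<ge> 0" using a by (simp add: G_def)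
		ultimately show ?thesis by (simp add: G_def)
	qed
qed auto

lemma log_cut_grad_dom:
	assumes a: "\<alpha> > 0"
	shows "log_cut \<alpha> \<in> grad_dom (1/2)"
proof -
	obtain M where M: "M \<ge> 0" "\<And>x. x > 0 \<Longrightarrow> cmod (\<xi> x) \<le> M" "\<And>x. x > 0 \<Longrightarrow> cmod (\<xi>' x) \<le> M" by (rule bounded) blast
	define K where "K = (- ln (3/4)) powr (- \<alpha>) * M"
	have l: "\<bar>ln x\<bar> powr (- \<alpha>) \<le> (- ln (3/4)) powr (- \<alpha>)" if "0 < x" "x \<le> 3/4" for x
	proof (rule powr_mono2')
		show "- ln (3/4) \<le> \<bar>ln x\<bar>" using that ln_le_cancel_iff[of x "3/4"] by simp
	qed (use a in auto)
	have K: "K \<ge> 0" using M by (simp add: K_def)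
	have near: "x powr (1/2) * \<bar>ln x\<bar> powr (- \<alpha>) * cmod y \<le> K * x powr (1/2)" if "0 < x" "x \<le> 3/4" "cmod y \<le> M" for x y
	proof -
		have "\<bar>ln x\<bar> powr (- \<alpha>) * cmod y \<le> K" unfolding K_def by (rule mult_mono[OF l[OF that(1,2)] that(3)]) auto
		then have "x powr (1/2) * (\<bar>ln x\<bar> powr (- \<alpha>) * cmod y) \<le> x powr (1/2) * K" by (rule mult_left_mono) simp
		then show ?thesis by (simp add: mult_ac)
	qed
	have s1: "sq_integrable (log_cut \<alpha>)"
	proof (rule sq_integrable_le_weight[OF primitive_measurable[OF primitive_log_cut], where p="1/2" and K=K])
		fix x :: real assume x: "0 < x" "x < 1"
		show "cmod (log_cut \<alpha> x) \<le> K * x powr (1/2)"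
		proof (cases "x \<le> 3/4")
			case True
			then show ?thesis using near[OF x(1) True M(2)[OF x(1)]] by (simp add: log_cut_def norm_mult)
		qed (use K in \<open>simp add: log_cut_def zero\<close>)
	qed (use K in \<open>auto simp: log_cut_def zero\<close>)
	define v1 where "v1 x = cpx (x powr (1/2) * \<bar>ln x\<bar> powr (- \<alpha>)) * \<xi>' x" for x
	define v2 where "v2 x = cpx (x powr (1/2) * (\<alpha> * \<bar>ln x\<bar> powr (- \<alpha> - 1) / x)) * \<xi> x" for x
	have z_eq: "pw (1/2) x * log_slope \<alpha> x = v1 x + v2 x" if "x > 0" for x
		using \<xi>'_far[of x] zero[of x] by (simp add: log_slope_def v1_def v2_def algebra_simps)
	have \<xi>m: "\<xi> \<in> borel_measurable half_line" by (rule primitive_measurable[OF primitive_\<xi>])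
	have rm: "(\<lambda>x. cpx (h x)) \<in> borel_measurable half_line" if "h \<in> borel_measurable borel" for h :: "real \<Rightarrow> real"
	proof -
		have [measurable]: "h \<in> borel_measurable half_line"
			by (intro measurable_restrict_space1 measurable_completion) (use that in simp)
		show ?thesis by measurable
	qed
	have "sq_integrable v1"
	proof (rule sq_integrable_le_weight[of _ "1/2" K])
		show "v1 \<in> borel_measurable half_line"
			unfolding v1_def by (intro borel_measurable_times \<xi>'_measurable rm) measurable
		fix x :: real assume x: "0 < x" "x < 1"
		show "cmod (v1 x) \<le> K * x powr (1/2)"
		proof (cases "x \<le> 3/4")
			case True
			then show ?thesis using near[OF x(1) True M(3)[OF x(1)]] by (simp add: v1_def norm_mult)
		qed (use K in \<open>simp add: v1_def \<xi>'_far\<close>)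
	qed (use K in \<open>auto simp: v1_def \<xi>'_far\<close>)
	moreover have "sq_integrable v2"
	proof (rule sq_integrable_dominated[OF _ sq_integrable_scale[OF log_weight_sq_integrable[OF a], of "cpx (\<alpha> * M)"]])
		show "v2 \<in> borel_measurable half_line"
			unfolding v2_def by (intro borel_measurable_times \<xi>m rm) measurable
		fix x :: real assume x: "x > 0"
		show "cmod (v2 x) \<le> cmod (cpx (\<alpha> * M) * cpx (if x < 3/4 then x powr (-1/2) * \<bar>ln x\<bar> powr (- \<alpha> - 1) else 0))"
		proof (cases "x < 3/4")
			case True
			have e: "x powr (-1/2) = x powr (1/2) / x" using x powr_diff[of x "1/2" 1] by simp
			define P where "P = \<alpha> * (x powr (-1/2) * \<bar>ln x\<bar> powr (- \<alpha> - 1))"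
			have P: "P \<ge> 0" using a by (simp add: P_def)
			have "v2 x = cpx P * \<xi> x" unfolding v2_def P_def e by simp
			then have "cmod (v2 x) = P * cmod (\<xi> x)" using P by (simp add: norm_mult)
			also have "\<dots> \<le> P * M" by (rule mult_left_mono[OF M(2)[OF x] P])
			also have "\<dots> = cmod (cpx (P * M))" using P M by (simp add: norm_mult)
			also have "P * M = \<alpha> * M * (x powr (-1/2) * \<bar>ln x\<bar> powr (- \<alpha> - 1))" by (simp add: P_def)
			finally show ?thesis using True by (simp only: of_real_mult[symmetric] if_True)
		qed (simp add: v2_def zero)
	qed
	ultimately have "sq_integrable (\<lambda>x. v1 x + v2 x)" by (rule sq_integrable_add)
	then have "sq_integrable (\<lambda>x. pw (1/2) x * log_slope \<alpha> x)"
		by (rule sq_integrable_cong_AE[OF _ AE_half_lineI]) (simp add: z_eq)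
	then show ?thesis by (rule grad_domI(1)[OF s1 _ primitive_log_cut])
qed

lemma log_cut_sum:
	assumes A: "finite A" "A \<subseteq> {0<..}"
	shows "(\<lambda>x. \<Sum>\<alpha>\<in>A. c \<alpha> * log_cut \<alpha> x) \<in> grad_dom (1/2)"
		"(\<Sum>\<alpha>\<in>A. c \<alpha> *\<^sub>C L2 (log_cut \<alpha>)) = L2 (\<lambda>x. \<Sum>\<alpha>\<in>A. c \<alpha> * log_cut \<alpha> x)"
proof -
	have "(\<lambda>x. \<Sum>\<alpha>\<in>A. c \<alpha> * log_cut \<alpha> x) \<in> grad_dom (1/2) \<and>
		(\<Sum>\<alpha>\<in>A. c \<alpha> *\<^sub>C L2 (log_cut \<alpha>)) = L2 (\<lambda>x. \<Sum>\<alpha>\<in>A. c \<alpha> * log_cut \<alpha> x)"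
		using A
	proof (induction A rule: finite_induct)
		case empty
		then show ?case by (simp add: grad_dom_zero L2_zero)
	next
		case (insert \<alpha> A)
		have g: "log_cut \<alpha> \<in> grad_dom (1/2)" by (rule log_cut_grad_dom) (use insert in simp)
		have IH: "(\<lambda>x. \<Sum>\<alpha>\<in>A. c \<alpha> * log_cut \<alpha> x) \<in> grad_dom (1/2)"
			"(\<Sum>\<alpha>\<in>A. c \<alpha> *\<^sub>C L2 (log_cut \<alpha>)) = L2 (\<lambda>x. \<Sum>\<alpha>\<in>A. c \<alpha> * log_cut \<alpha> x)"
			using insert by auto
		have "L2 (\<lambda>x. c \<alpha> * log_cut \<alpha> x) + L2 (\<lambda>x. \<Sum>\<alpha>\<in>A. c \<alpha> * log_cut \<alpha> x) =
				L2 (\<lambda>x. c \<alpha> * log_cut \<alpha> x + (\<Sum>\<alpha>\<in>A. c \<alpha> * log_cut \<alpha> x))"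
			by (rule L2_add[OF sq_integrable_scale[OF grad_domD(1)[OF g]] grad_domD(1)[OF IH(1)]])
		then show ?case
			using grad_dom_add(1)[OF grad_dom_scale(1)[OF g] IH(1), of "c \<alpha>"] insert(1,2)
			by (simp add: IH(2) L2_scale[OF grad_domD(1)[OF g]])
	qed
	then show "(\<lambda>x. \<Sum>\<alpha>\<in>A. c \<alpha> * log_cut \<alpha> x) \<in> grad_dom (1/2)"
		"(\<Sum>\<alpha>\<in>A. c \<alpha> *\<^sub>C L2 (log_cut \<alpha>)) = L2 (\<lambda>x. \<Sum>\<alpha>\<in>A. c \<alpha> * log_cut \<alpha> x)" by auto
qed

text \<open>
	Let \<open>m\<close> be the smallest exponent that occurs. Near \<open>0\<close> the square of the combination divided by \<open>x\<close> is at
	least a multiple of \<open>\<bar>ln x\<bar> powr (- 2 m) / x\<close>, and \<open>2 m \<le> 1\<close> makes this nonintegrable, whereas \<open>f/x\<close> is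
	square integrable for \<open>f\<close> in \<open>H\<^sub>0\<^sup>1\<close>.
\<close>

lemma log_cut_independent:
	assumes A: "finite A" "A \<subseteq> {0<..1/2}" and H: "(\<Sum>\<alpha>\<in>A. c \<alpha> *\<^sub>C L2 (log_cut \<alpha>)) \<in> H10"
	shows "\<forall>\<alpha>\<in>A. c \<alpha> = 0"
proof (rule ccontr)
	assume "\<not> (\<forall>\<alpha>\<in>A. c \<alpha> = 0)"
	define B where "B = {\<alpha> \<in> A. c \<alpha> \<noteq> 0}"
	have B: "finite B" "B \<noteq> {}" "B \<subseteq> {0<..1/2}" using A \<open>\<not> _\<close> by (auto simp: B_def)
	define m where "m = Min B"
	have m: "m \<in> B" "\<And>\<alpha>. \<alpha> \<in> B \<Longrightarrow> m \<le> \<alpha>" using B by (auto simp: m_def)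
	define F where "F x = (\<Sum>\<alpha>\<in>B. c \<alpha> * log_cut \<alpha> x)" for x
	have Bs: "B \<subseteq> {0<..}" using B by auto
	have Fg: "F \<in> grad_dom (1/2)" unfolding F_def by (rule log_cut_sum(1)[OF B(1) Bs])
	have "(\<Sum>\<alpha>\<in>A. c \<alpha> *\<^sub>C L2 (log_cut \<alpha>)) = (\<Sum>\<alpha>\<in>B. c \<alpha> *\<^sub>C L2 (log_cut \<alpha>))"
		by (rule sum.mono_neutral_right[OF A(1)]) (auto simp: B_def)
	also have "\<dots> = L2 F" unfolding F_def by (rule log_cut_sum(2)[OF B(1) Bs])
	finally have "L2 F \<in> H10" using H by simp
	then obtain h where h: "h \<in> hardy_dom" "L2 F = L2 h" by (auto simp: H10_eq)
	have hs: "sq_integrable h" "sq_integrable (\<lambda>x. h x / cpx x)"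
		using h(1) by (auto simp: hardy_dom_def dest: grad_domD(1))
	have "AE x in half_line. h x = F x"
		using h(2) by (intro L2_eq_iff[OF hs(1) grad_domD(1)[OF Fg], THEN iffD1]) simp
	then have "AE x in half_line. h x / cpx x = F x / cpx x" by eventually_elim simp
	from sq_integrable_cong_AE[OF hs(2) this] have Fq: "sq_integrable (\<lambda>x. F x / cpx x)" .
	define b where "b x = (\<Sum>\<alpha>\<in>B. c \<alpha> * cpx ((- ln x) powr (- (\<alpha> - m))))" for x
	have "lim0 b (\<Sum>\<alpha>\<in>B. c \<alpha> * (if \<alpha> = m then 1 else 0))"
		unfolding b_def
	proof (intro tendsto_sum tendsto_mult_left)
		fix \<alpha> assume \<alpha>: "\<alpha> \<in> B"
		have top: "filterlim (\<lambda>x::real. - ln x) at_top (at_right 0)"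
			by (rule filterlim_compose[OF filterlim_uminus_at_top_at_bot ln_at_0])
		show "lim0 (\<lambda>x. cpx ((- ln x) powr (- (\<alpha> - m)))) (if \<alpha> = m then 1 else 0)"
		proof (cases "\<alpha> = m")
			case True
			have "\<forall>\<^sub>F x in at_right 0. cpx ((- ln x) powr (- (\<alpha> - m))) = 1"
				unfolding eventually_at_right_field True by (intro exI[of _ 1]) auto
			then show ?thesis using True by (simp add: tendsto_eventually)
		next
			case False
			then have "- (\<alpha> - m) < 0" using m(2)[OF \<alpha>] by simp
			from tendsto_of_real[OF tendsto_neg_powr[OF this top], where 'a=complex] show ?thesis using False by simp
		qed
	qed
	moreover have "(\<Sum>\<alpha>\<in>B. c \<alpha> * (if \<alpha> = m then 1 else 0)) = c m" using m(1) B(1) by (simp add: sum.delta' if_distrib cong: if_cong)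
	ultimately have bl: "lim0 b (c m)" by simp
	have cm: "c m \<noteq> 0" using m(1) by (simp add: B_def)
	obtain d where d: "d > 0" "\<And>x. 0 < x \<Longrightarrow> x < d \<Longrightarrow> cmod (c m) / 2 \<le> cmod (b x)"
		using tendsto_abs_lower[OF bl cm] by blast
	have "\<not> sq_integrable (\<lambda>x. F x / cpx x)"
	proof (rule not_sq_integrable_log[of "(cmod (c m))\<^sup>2 / 4" "min d (min (1/2) (exp (- 1)))"])
		fix x :: real assume "0 < x" "x < min d (min (1/2) (exp (- 1)))"
		then have x: "0 < x" "x < d" "x < 1/2" "x < exp (- 1)" by auto
		have l: "- ln x \<ge> 1" using x(1,4) ln_less_cancel_iff[of x "exp (- 1)"] by simp
		have al: "\<bar>ln x\<bar> = - ln x" using l by simp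
		define P where "P = x powr (1/2) * (- ln x) powr (- m) / x"
		have "F x / cpx x = cpx P * b x"
		proof -
			have "c \<alpha> * log_cut \<alpha> x / cpx x = cpx P * (c \<alpha> * cpx ((- ln x) powr (- (\<alpha> - m))))" for \<alpha>
			proof -
				have "(- ln x) powr (- \<alpha>) = (- ln x) powr (- m) * (- ln x) powr (- (\<alpha> - m))"
					unfolding powr_add[symmetric] by (rule arg_cong[of _ _ "(powr) (- ln x)"]) simp
				then show ?thesis by (simp add: log_cut_def P_def al one[OF x(1,3)])
			qed
			then show ?thesis by (simp add: F_def b_def sum_divide_distrib sum_distrib_left)
		qed
		then have e: "(cmod (F x / cpx x))\<^sup>2 = P\<^sup>2 * (cmod (b x))\<^sup>2"
			by (simp add: norm_mult power_mult_distrib)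
		have P2: "P\<^sup>2 = (- ln x) powr (- 2 * m) / x"
		proof -
			have "(x powr (1/2))\<^sup>2 = x" using x by (simp add: power2_eq_square powr_add[symmetric])
			moreover have "((- ln x) powr (- m))\<^sup>2 = (- ln x) powr (- 2 * m)" by (simp add: power2_eq_square powr_add[symmetric])
			ultimately have "P\<^sup>2 = x * (- ln x) powr (- 2 * m) / x\<^sup>2" by (simp add: P_def power_mult_distrib power_divide)
			then show ?thesis using x by (simp add: power2_eq_square)
		qed
		have "1 / \<bar>ln x\<bar> = (- ln x) powr (- 1)" using l powr_minus_divide[of "- ln x" 1] by (simp add: al)
		also have "\<dots> \<le> (- ln x) powr (- 2 * m)"
			by (rule powr_mono[OF _ l]) (use m(1) B(3) in auto)
		finally have q: "1 / \<bar>ln x\<bar> / x \<le> P\<^sup>2" unfolding P2 by (rule divide_right_mono) (use x in simp)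
		have "(cmod (c m) / 2)\<^sup>2 \<le> (cmod (b x))\<^sup>2" by (rule power_mono[OF d(2)[OF x(1,2)]]) simp
		then have "(1 / \<bar>ln x\<bar> / x) * (cmod (c m) / 2)\<^sup>2 \<le> P\<^sup>2 * (cmod (b x))\<^sup>2" using q by (intro mult_mono) auto
		then show "(cmod (c m))\<^sup>2 / 4 / (x * \<bar>ln x\<bar>) \<le> (cmod (F x / cpx x))\<^sup>2"
			unfolding e by (simp add: power_divide mult_ac)
	qed (use cm d in auto)
	then show False using Fq by simp
qed

lemma zero_H10: "0 \<in> H10"
	using sq_integrable_zero grad_dom_zero L2_zero unfolding H10_eq hardy_dom_def
	by (intro image_eqI[of _ _ "\<lambda>x. 0"]) auto

lemma inj_on_log_cut: "inj_on (\<lambda>\<alpha>. L2 (log_cut \<alpha>)) {0<..1/2}"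
proof (rule inj_onI, rule ccontr)
	fix \<alpha> \<beta> :: real assume ab: "\<alpha> \<in> {0<..1/2}" "\<beta> \<in> {0<..1/2}" "L2 (log_cut \<alpha>) = L2 (log_cut \<beta>)" "\<alpha> \<noteq> \<beta>"
	have "(\<Sum>\<gamma>\<in>{\<alpha>, \<beta>}. (if \<gamma> = \<alpha> then 1 else - 1) *\<^sub>C L2 (log_cut \<gamma>)) = 0"
		using ab(3,4) by simp
	then have "\<forall>\<gamma>\<in>{\<alpha>, \<beta>}. (if \<gamma> = \<alpha> then 1 else - 1 :: complex) = 0"
		using zero_H10 ab(1,2) by (intro log_cut_independent) auto
	then show False by auto
qed

lemma span_log_cut:
	assumes "u \<in> l2.span {L2 (log_cut \<alpha>) | \<alpha>. 0 < \<alpha> \<and> \<alpha> \<le> 1/2}"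
	obtains A c where "finite A" "A \<subseteq> {0<..1/2}" "u = (\<Sum>\<alpha>\<in>A. c \<alpha> *\<^sub>C L2 (log_cut \<alpha>))"
proof -
	have "{L2 (log_cut \<alpha>) | \<alpha>. 0 < \<alpha> \<and> \<alpha> \<le> 1/2} = (\<lambda>\<alpha>. L2 (log_cut \<alpha>)) ` {0<..1/2}" by auto
	then obtain t r where t: "finite t" "t \<subseteq> (\<lambda>\<alpha>. L2 (log_cut \<alpha>)) ` {0<..1/2}" "u = (\<Sum>a\<in>t. r a *\<^sub>C a)"
		using assms unfolding l2.span_explicit by auto
	from finite_subset_image[OF t(1,2)] obtain A where A: "A \<subseteq> {0<..1/2}" "finite A" "t = (\<lambda>\<alpha>. L2 (log_cut \<alpha>)) ` A" by blast
	have "u = (\<Sum>\<alpha>\<in>A. r (L2 (log_cut \<alpha>)) *\<^sub>C L2 (log_cut \<alpha>))"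
		unfolding t(3) A(3) using sum.reindex[OF inj_on_subset[OF inj_on_log_cut A(1)]] by simp
	with A show ?thesis by (intro that[of A "\<lambda>\<alpha>. r (L2 (log_cut \<alpha>))"])
qed

theorem friedrichs_form_dom_zero_order:
	defines "W \<equiv> l2.span {L2 (log_cut \<alpha>) | \<alpha>. 0 < \<alpha> \<and> \<alpha> \<le> 1/2}"
	shows "H10 \<inter> W = {0}" "sum_space H10 W \<subseteq> form_dom (friedrichs (bessel_min 0))"
		"quotient_dim (form_dom (friedrichs (bessel_min 0))) H10 = \<infinity>"
proof -
	have dom: "form_dom (friedrichs (bessel_min 0)) = L2 ` grad_dom (1/2)" using form_dom_friedrichs[of 0] by simp
	have "u = 0" if "u \<in> H10" "u \<in> W" for u
	proof -
		obtain A c where A: "finite A" "A \<subseteq> {0<..1/2}" "u = (\<Sum>\<alpha>\<in>A. c \<alpha> *\<^sub>C L2 (log_cut \<alpha>))"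
			using span_log_cut[OF \<open>u \<in> W\<close>[unfolded W_def]] by blast
		have "\<forall>\<alpha>\<in>A. c \<alpha> = 0" by (rule log_cut_independent[OF A(1,2)]) (use A(3) that(1) in simp)
		then show ?thesis using A(3) by simp
	qed
	moreover have "0 \<in> W" unfolding W_def by (rule l2.span_zero)
	ultimately show "H10 \<inter> W = {0}" using zero_H10 by auto
	show "sum_space H10 W \<subseteq> form_dom (friedrichs (bessel_min 0))"
	proof
		fix u assume "u \<in> sum_space H10 W"
		then obtain h w where u: "u = L2 h + w" "h \<in> hardy_dom" "w \<in> W" by (auto simp: sum_space_def H10_eq)
		obtain A c where A: "finite A" "A \<subseteq> {0<..1/2}" "w = (\<Sum>\<alpha>\<in>A. c \<alpha> *\<^sub>C L2 (log_cut \<alpha>))"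
			using span_log_cut[OF u(3)[unfolded W_def]] by blast
		have A': "A \<subseteq> {0<..}" using A(2) by auto
		have hg: "h \<in> grad_dom (1/2)" using u(2) hardy_dom_iff[of h "1/2"] by blast
		note S = log_cut_sum[OF A(1) A', of c]
		have "u = L2 (\<lambda>x. h x + (\<Sum>\<alpha>\<in>A. c \<alpha> * log_cut \<alpha> x))"
			unfolding u(1) A(3) S(2) by (rule L2_add[OF grad_domD(1)[OF hg] grad_domD(1)[OF S(1)]])
		then show "u \<in> form_dom (friedrichs (bessel_min 0))"
			unfolding dom using grad_dom_add(1)[OF hg S(1)] by blast
	qed
	show "quotient_dim (form_dom (friedrichs (bessel_min 0))) H10 = \<infinity>" (is "?d = \<infinity>")
	proof (rule ccontr)
		assume "?d \<noteq> \<infinity>"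
		then obtain n where n: "?d = enat n" by auto
		have "infinite {0<..1/2::real}" by (simp add: infinite_Ioc)
		from infinite_arbitrarily_large[OF this, of "Suc n"]
		obtain A where A: "finite A" "card A = Suc n" "A \<subseteq> {0<..1/2::real}" by blast
		define B where "B = (\<lambda>\<alpha>. L2 (log_cut \<alpha>)) ` A"
		have inj: "inj_on (\<lambda>\<alpha>. L2 (log_cut \<alpha>)) A" by (rule inj_on_subset[OF inj_on_log_cut A(3)])
		have "finite B" "card B = Suc n" using A card_image[OF inj] by (simp_all add: B_def)
		moreover have "B \<subseteq> form_dom (friedrichs (bessel_min 0))"
			unfolding dom B_def using A(3) by (auto intro!: imageI log_cut_grad_dom)
		moreover have "independent_mod H10 B"
			unfolding independent_mod_def
		proof (intro allI impI)
			fix c assume "(\<Sum>b\<in>B. c b *\<^sub>C b) \<in> H10"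
			then have "(\<Sum>\<alpha>\<in>A. c (L2 (log_cut \<alpha>)) *\<^sub>C L2 (log_cut \<alpha>)) \<in> H10"
				unfolding B_def by (simp add: sum.reindex[OF inj])
			from log_cut_independent[OF A(1,3) this] show "\<forall>b\<in>B. c b = 0" by (simp add: B_def)
		qed
		ultimately have "enat (card B) \<le> ?d" unfolding quotient_dim_def by (intro SUP_upper) simp
		then show False using n \<open>card B = Suc n\<close> by simp
	qed
qed

end

section \<open>The closed forms of the Bessel operators\<close>

theorem theorem5p10:
	fixes \<nu> :: real and \<xi> :: "real \<Rightarrow> complex"
	assumes "0 \<le> \<nu>" and "\<nu> < 1"
		and "\<xi> \<in> C1_0"
		and "\<forall>x\<in>{0<..<1/2}. \<xi> x = 1"
		and "\<forall>x\<ge>3/4. \<xi> x = 0"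
	shows
		"(0 < \<nu> \<longrightarrow>
				form_dom (friedrichs (bessel_min \<nu>)) = H10 \<and>
				(\<forall>f\<in>H10_fun.
					integrable half_line (\<lambda>x. (cmod (f x))\<^sup>2 / x\<^sup>2) \<and>
					op_form (friedrichs (bessel_min \<nu>)) (L2 f) (L2 f) = complex_of_real (
						(LINT x|half_line. (cmod (deriv_on {0..} f x))\<^sup>2) +
						(\<nu>\<^sup>2 - 1/4) * (LINT x|half_line. (cmod (f x))\<^sup>2 / x\<^sup>2)))) \<and>
		 (\<nu> = 0 \<longrightarrow>
				(\<forall>u\<in>form_dom (friedrichs (bessel_min 0)). \<exists>f.
					sq_integrable f \<and> u = L2 f \<and> loc_abs_continuous_on {0<..} f \<and>
					integrable half_line (\<lambda>x. (cmod (deriv_on {0<..} f x - f x / complex_of_real (2 * x)))\<^sup>2) \<and>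
					op_form (friedrichs (bessel_min 0)) u u = complex_of_real (
						LINT x|half_line. (cmod (deriv_on {0<..} f x - f x / complex_of_real (2 * x)))\<^sup>2)) \<and>
				(let W = l2.span {L2 (\<lambda>x. complex_of_real (x powr (1/2) * \<bar>ln x\<bar> powr (-\<alpha>)) * \<xi> x) | \<alpha>.
							0 < \<alpha> \<and> \<alpha> \<le> 1/2}
				 in H10 \<inter> W = {0} \<and> sum_space H10 W \<subseteq> form_dom (friedrichs (bessel_min 0))) \<and>
				quotient_dim (form_dom (friedrichs (bessel_min 0))) H10 = \<infinity>) \<and>
		 friedrichs (bessel_min \<nu>) =
			 op_restrict (op_adjoint (bessel_min \<nu>)) (Domain (friedrichs (bessel_min \<nu>))) \<and>
		 (\<xi> \<in> H2_fun \<longrightarrow>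
			 is_direct_sum (Domain (friedrichs (bessel_min \<nu>)))
				 H20 (l2.span {L2 (\<lambda>x. complex_of_real (x powr (1/2 + \<nu>)) * \<xi> x)})) \<and>
		 (0 < \<nu> \<longrightarrow>
			 (\<forall>h. is_direct_sum (form_dom (bessel_ext \<nu> (Some h)))
					H10 (l2.span {L2 (\<lambda>x. complex_of_real (x powr (1/2 - \<nu>)) * \<xi> x)})) \<and>
			 form_dom (bessel_ext \<nu> None) = H10)"
proof -
	interpret cutoff \<xi> using assms(3-5) by unfold_locales auto
	show ?thesis
	proof (intro conjI impI ballI allI)
		show "form_dom (friedrichs (bessel_min \<nu>)) = H10" if "0 < \<nu>"
			by (rule friedrichs_form_positive_order(1)[OF that assms(2)])
		show "integrable half_line (\<lambda>x. (cmod (f x))\<^sup>2 / x\<^sup>2)" if "0 < \<nu>" "f \<in> H10_fun" for f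
			by (rule friedrichs_form_positive_order(2)[OF that(1) assms(2) that(2)])
		show "op_form (friedrichs (bessel_min \<nu>)) (L2 f) (L2 f) = cpx (
						(LINT x|half_line. (cmod (deriv_on {0..} f x))\<^sup>2) +
						(\<nu>\<^sup>2 - 1/4) * (LINT x|half_line. (cmod (f x))\<^sup>2 / x\<^sup>2))" if "0 < \<nu>" "f \<in> H10_fun" for f
			by (rule friedrichs_form_positive_order(3)[OF that(1) assms(2) that(2)])
		show "\<exists>f. sq_integrable f \<and> u = L2 f \<and> loc_abs_continuous_on {0<..} f \<and>
					integrable half_line (\<lambda>x. (cmod (deriv_on {0<..} f x - f x / cpx (2 * x)))\<^sup>2) \<and>
					op_form (friedrichs (bessel_min 0)) u u = cpx (
						LINT x|half_line. (cmod (deriv_on {0<..} f x - f x / cpx (2 * x)))\<^sup>2)"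
			if "u \<in> form_dom (friedrichs (bessel_min 0))" for u
			by (rule friedrichs_form_zero_order[OF that])
		show "let W = l2.span {L2 (\<lambda>x. cpx (x powr (1/2) * \<bar>ln x\<bar> powr (-\<alpha>)) * \<xi> x) | \<alpha>.
							0 < \<alpha> \<and> \<alpha> \<le> 1/2}
				 in H10 \<inter> W = {0} \<and> sum_space H10 W \<subseteq> form_dom (friedrichs (bessel_min 0))"
			unfolding Let_def
			by (intro conjI friedrichs_form_dom_zero_order(1,2)[unfolded log_cut_def[abs_def]])
		show "quotient_dim (form_dom (friedrichs (bessel_min 0))) H10 = \<infinity>"
			by (rule friedrichs_form_dom_zero_order(3))
		show "friedrichs (bessel_min \<nu>) = op_restrict (op_adjoint (bessel_min \<nu>)) (Domain (friedrichs (bessel_min \<nu>)))"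
			unfolding friedrichs_eq[OF assms(1)] by (rule finite_energy_op_restrict[OF assms(1)])
		show "is_direct_sum (Domain (friedrichs (bessel_min \<nu>)))
				 H20 (l2.span {L2 (\<lambda>x. pw (1/2 + \<nu>) x * \<xi> x)})" if "\<xi> \<in> H2_fun"
			using friedrichs_domain[OF that assms(1,2)] by (simp add: powr_cut_def[abs_def])
		show "is_direct_sum (form_dom (bessel_ext \<nu> (Some h)))
					H10 (l2.span {L2 (\<lambda>x. pw (1/2 - \<nu>) x * \<xi> x)})" if "0 < \<nu>" for h
			using bessel_ext_form_dom[OF that assms(2), of h] by (simp add: powr_cut_def[abs_def])
		show "form_dom (bessel_ext \<nu> None) = H10" if "0 < \<nu>"
			by (rule bessel_ext_None(2)[OF that assms(2)])
	qed
qed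

end
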